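(* Let $m\in\mathbb{N}$, $a=-2$, $\nu>0$ and $\omega_0\in\dot H^m$. Let $m_*\in\mathbb{N}$ be such that $m_*>m$ and assume $B_{m_*}<\infty$. Then there exists an invariant measure $\mu$ on $\dot H^m$ for the transition semigroup $(P_t)_{t\ge 0}$ associated with the stochastic equation $$\omega_t+a u\omega_x-u_x\omega-\nu\omega_{xx}=\xi_t,\qquad u_x=\mathcal{H}(\omega).$$ Moreover, $\mu$ is supported by $\dot H^{m+1}$, in the sense that $$\int_{\dot H^m}\|y\|_{\dot H^{m+1}}^2\,\mu(dy)<\infty .$$
   Context: Notation: $\mathbb{N}=\{1,2,\dots\}$, $\mathbb{S}^1=\mathbb{R}/2\pi\mathbb{Z}$, $\mathbb{Z}^*=\mathbb{Z}\setminus\{0\}$. $H$ is the real Hilbert space of $u\in L^2(\mathbb{S}^1)$ with $\int_0^{2\pi}u\,dx=0$, with inner product $\langle u,v\rangle_H=\int_0^{2\pi}uv\,dx$ and orthonormal basis $e_k(x)=\pi^{-1/2}\cos(kx)$ for $k\ge1$, $e_k(x)=\pi^{-1/2}\sin(-kx)$ for $k\le-1$; $u_k=\langle u,e_k\rangle_H$. For $m\in\mathbb{N}$, $\dot H^m=\{u\in H:\|u\|_{\dot H^m}^2:=\sum_{k\in\mathbb{Z}^*}|k|^{2m}u_k^2<\infty\}$; the norm is $+\infty$ outside $\dot H^m$. $X_T^m=C([0,T];\dot H^m)$ with the sup norm, and $X_\infty^m=C([0,\infty);\dot H^m)$. Hilbert transform: with complex Fourier coefficients $\hat u(k)=\frac1{2\pi}\int_0^{2\pi}u(x)e^{-ikx}dx$,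 $\widehat{\mathcal{H}(u)}(k)=-i\,\mathrm{sgn}(k)\hat u(k)$, $\mathrm{sgn}(0)=0$. In the equation, $u$ is the mean-zero function with $u_x=\mathcal{H}(\omega)$, i.e. $u=-(-\partial_x^2)^{-1/2}\omega$. Noise: $(\Omega,\mathcal{F},\mathbb{P},(\mathcal{F}_t)_{t\ge0})$ is a filtered probability space, $\{\beta_k\}_{k\in\mathbb{Z}^*}$ are independent real Brownian motions adapted to $(\mathcal{F}_t)$ whose increments after time $s$ are independent of $\mathcal{F}_s$ for every $s\ge 0$; $\{b_k\}_{k\in\mathbb{Z}^*}$ is a fixed real sequence, $\xi(t,x)=\sum_{k\in\mathbb{Z}^*}b_k\beta_k(t)e_k(x)$, and $B_m=\sum_{k\in\mathbb{Z}^*}|k|^{2m}b_k^2$. Solution: $\omega\in X_T^m$ is a solution on $[0,T]$ with initial value $\omega_0\in\dot H^m$ if, $\mathbb{P}$-a.s., for all $t\in[0,T]$, in $\dot H^m$, $$\omega(t)=e^{\nu t\partial_x^2}\omega_0+\int_0^te^{\nu(t-s)\partial_x^2}\{-a(u\omega)_x(s)+(1+a)(u_x\omega)(s)\}ds+\int_0^te^{\nu(t-s)\partial_x^2}d\xi(s),$$ where $e^{\nu t\partial_x^2}$ is the heat semigroup. For $a=-2$ and $B_{m_*}<\infty$ for some integer $m_*>m$, there is for each $y\in\dot H^m$ a unique adapted global solution $\omega(\cdot;y)\in X_\infty^m$ with $\omega(0)=y$. Transition semigroup: $P_tf(y)=\mathbb{E}[f(\omega(t;y))]$ for bounded Borel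 $f:\dot H^m\to\mathbb{R}$ and $y\in\dot H^m$. An invariant measure on $\dot H^m$ is a Borel probability measure $\mu$ on $\dot H^m$ with $\int P_tf\,d\mu=\int f\,d\mu$ for all $t\ge0$ and all bounded Borel $f$. *)

theory Defs
  imports "HOL-Probability.Probability"
begin

section \<open>The real Hilbert space of square integrable functions on the circle\<close>

text \<open>
  The circle is represented by the fundamental domain \<open>[0, 2\<pi>]\<close>; values of a representative outside
  this interval play no role.
\<close>

definition circle_measure :: "real measure" where
  "circle_measure = restrict_space lborel {0..2 * pi}"

definition square_integrable :: "(real \<Rightarrow> real) \<Rightarrow> bool" where
  "square_integrable f \<longleftrightarrow>
     f \<in> borel_measurable circle_measure \<and> integrable circle_measure (\<lambda>x. (f x)\<^sup>2)"

definition l2_rel :: "(real \<Rightarrow> real) \<Rightarrow> (real \<Rightarrow> real) \<Rightarrow> bool" where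
  "l2_rel f g \<longleftrightarrow>
     square_integrable f \<and> square_integrable g \<and> (AE x in circle_measure. f x = g x)"

lemma finite_measure_circle: "finite_measure circle_measure"
  unfolding circle_measure_def
  by (intro finite_measure_restrict_space finite_measureI)
     (auto simp: emeasure_restrict_space space_restrict_space intro: finite_measureI)

lemma square_integrable_0: "square_integrable (\<lambda>x. 0)"
  by (simp add: square_integrable_def)

lemma square_integrable_mult:
  assumes "square_integrable f" "square_integrable g"
  shows "integrable circle_measure (\<lambda>x. f x * g x)"
proof (rule Bochner_Integration.integrable_bound)
  show "integrable circle_measure (\<lambda>x. (f x)\<^sup>2 + (g x)\<^sup>2)"
    using assms by (auto simp: square_integrable_def)
  show "(\<lambda>x. f x * g x) \<in> borel_measurable circle_measure"
    using assms by (auto simp: square_integrable_def)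
  have "\<bar>a * b\<bar> \<le> a\<^sup>2 + b\<^sup>2" for a b :: real
  proof -
    have "0 \<le> (\<bar>a\<bar> - \<bar>b\<bar>)\<^sup>2" by simp
    then have "2 * (\<bar>a\<bar> * \<bar>b\<bar>) \<le> a\<^sup>2 + b\<^sup>2"
      by (simp add: power2_diff)
    moreover have "0 \<le> \<bar>a\<bar> * \<bar>b\<bar>" by simp
    ultimately show ?thesis unfolding abs_mult by linarith
  qed
  then show "AE x in circle_measure. norm (f x * g x) \<le> norm ((f x)\<^sup>2 + (g x)\<^sup>2)"
    by (intro AE_I2) (auto simp: abs_mult[symmetric])
qed

lemma square_integrable_add:
  assumes "square_integrable f" "square_integrable g"
  shows "square_integrable (\<lambda>x. f x + g x)"
  using assms square_integrable_mult[OF assms]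
  by (auto simp: square_integrable_def power2_sum mult.assoc)

lemma square_integrable_scale:
  assumes "square_integrable f"
  shows "square_integrable (\<lambda>x. c * f x)"
  using assms by (auto simp: square_integrable_def power_mult_distrib)

lemma square_integrable_bounded:
  assumes "f \<in> borel_measurable borel" "\<And>x. \<bar>f x\<bar> \<le> C"
  shows "square_integrable f"
proof -
  interpret finite_measure circle_measure by (rule finite_measure_circle)
  have m: "f \<in> borel_measurable circle_measure"
    using assms(1) by (auto simp: circle_measure_def intro: measurable_restrict_space1)
  have "integrable circle_measure (\<lambda>x. (f x)\<^sup>2)"
  proof (rule integrable_const_bound[where B = "C\<^sup>2"])
    have "(f x)\<^sup>2 \<le> C\<^sup>2" for x
      using power_mono[OF assms(2)[of x], of 2] by simp
    then show "AE x in circle_measure. norm ((f x)\<^sup>2) \<le> C\<^sup>2"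
      by simp
  qed (use m in auto)
  with m show ?thesis by (simp add: square_integrable_def)
qed

quotient_type l2_circle = "real \<Rightarrow> real" / partial: l2_rel
proof (rule part_equivpI)
  show "\<exists>f. l2_rel f f"
    using square_integrable_0 by (intro exI[of _ "\<lambda>x. 0"]) (simp add: l2_rel_def)
  show "symp l2_rel"
    by (rule sympI) (auto simp: l2_rel_def)
  show "transp l2_rel"
    by (rule transpI) (auto simp: l2_rel_def)
qed

instantiation l2_circle :: real_inner
begin

lift_definition zero_l2_circle :: l2_circle is "\<lambda>x. 0"
  by (simp add: l2_rel_def square_integrable_0)

lift_definition plus_l2_circle :: "l2_circle \<Rightarrow> l2_circle \<Rightarrow> l2_circle" is "\<lambda>f g x. f x + g x"
  by (auto simp: l2_rel_def square_integrable_add)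

lift_definition scaleR_l2_circle :: "real \<Rightarrow> l2_circle \<Rightarrow> l2_circle" is "\<lambda>c f x. c * f x"
  by (auto simp: l2_rel_def square_integrable_scale)

definition uminus_l2_circle :: "l2_circle \<Rightarrow> l2_circle" where
  "uminus_l2_circle u = (-1) *\<^sub>R u"

definition minus_l2_circle :: "l2_circle \<Rightarrow> l2_circle \<Rightarrow> l2_circle" where
  "minus_l2_circle u v = u + (- v)"

lift_definition inner_l2_circle :: "l2_circle \<Rightarrow> l2_circle \<Rightarrow> real" is
  "\<lambda>f g. \<integral>x. f x * g x \<partial>circle_measure"
  unfolding l2_rel_def
  by (intro integral_cong_AE) (auto simp: square_integrable_def)

definition norm_l2_circle :: "l2_circle \<Rightarrow> real" where
  "norm_l2_circle u = sqrt (inner u u)"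

definition sgn_l2_circle :: "l2_circle \<Rightarrow> l2_circle" where
  "sgn_l2_circle u = inverse (norm u) *\<^sub>R u"

definition dist_l2_circle :: "l2_circle \<Rightarrow> l2_circle \<Rightarrow> real" where
  "dist_l2_circle u v = norm (u - v)"

definition uniformity_l2_circle :: "(l2_circle \<times> l2_circle) filter" where
  "uniformity_l2_circle = (INF e\<in>{0<..}. principal {(u, v). dist u v < e})"

definition open_l2_circle :: "l2_circle set \<Rightarrow> bool" where
  "open_l2_circle U \<longleftrightarrow> (\<forall>u\<in>U. eventually (\<lambda>(u', v). u' = u \<longrightarrow> v \<in> U) uniformity)"

instance
proof
  fix u v w :: l2_circle and c d :: real
  show "u + v + w = u + (v + w)"
    by transfer (auto simp: l2_rel_def square_integrable_add add.assoc)
  show "u + v = v + u"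
    by transfer (auto simp: l2_rel_def square_integrable_add add.commute)
  show "0 + u = u"
    by transfer (auto simp: l2_rel_def)
  show "- u + u = 0"
    unfolding uminus_l2_circle_def
    by transfer (auto simp: l2_rel_def square_integrable_0)
  show "u - v = u + - v"
    by (simp add: minus_l2_circle_def)
  show "c *\<^sub>R (u + v) = c *\<^sub>R u + c *\<^sub>R v"
    by transfer (auto simp: l2_rel_def square_integrable_add square_integrable_scale distrib_left)
  show "(c + d) *\<^sub>R u = c *\<^sub>R u + d *\<^sub>R u"
    by transfer (auto simp: l2_rel_def distrib_right
        intro: square_integrable_scale square_integrable_add)
  show "c *\<^sub>R d *\<^sub>R u = (c * d) *\<^sub>R u"
    by transfer (auto simp: l2_rel_def mult.assoc intro: square_integrable_scale)
  show "1 *\<^sub>R u = u"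
    by transfer (auto simp: l2_rel_def)
  show "inner u v = inner v u"
    by transfer (simp add: mult.commute)
  show "inner (u + v) w = inner u w + inner v w"
    by transfer (auto simp: l2_rel_def distrib_right square_integrable_mult)
  show "inner (c *\<^sub>R u) v = c * inner u v"
    by transfer (auto simp: mult.assoc)
  show "0 \<le> inner u u"
    by transfer simp
  show "inner u u = 0 \<longleftrightarrow> u = 0"
    by transfer
      (auto simp: l2_rel_def square_integrable_0 square_integrable_def power2_eq_square
        integral_nonneg_eq_0_iff_AE)
  show "norm u = sqrt (inner u u)"
    by (rule norm_l2_circle_def)
  show "sgn u = inverse (norm u) *\<^sub>R u"
    by (rule sgn_l2_circle_def)
  show "dist u v = norm (u - v)"
    by (rule dist_l2_circle_def)
  show "uniformity = (INF e\<in>{0<..}. principal {(u, v). dist (u::l2_circle) v < e})"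
    by (rule uniformity_l2_circle_def)
  show "open U \<longleftrightarrow> (\<forall>u\<in>U. eventually (\<lambda>(u', v). u' = u \<longrightarrow> v \<in> U) uniformity)"
    for U :: "l2_circle set"
    by (rule open_l2_circle_def)
qed

end

lift_definition circle_integral :: "l2_circle \<Rightarrow> real" is "\<lambda>f. \<integral>x. f x \<partial>circle_measure"
  unfolding l2_rel_def
  by (intro integral_cong_AE) (auto simp: square_integrable_def)

text \<open>
  The product of two classes is only meaningful here if it is again square integrable; otherwise it
  is set to zero.
\<close>

lift_definition l2_times :: "l2_circle \<Rightarrow> l2_circle \<Rightarrow> l2_circle" is
  "\<lambda>f g x. if square_integrable (\<lambda>x. f x * g x) then f x * g x else 0"
proof -
  fix f f' g g'
  assume A: "l2_rel f f'" "l2_rel g g'"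
  then have m: "f \<in> borel_measurable circle_measure" "f' \<in> borel_measurable circle_measure"
    "g \<in> borel_measurable circle_measure" "g' \<in> borel_measurable circle_measure"
    by (auto simp: l2_rel_def square_integrable_def)
  have ae: "AE x in circle_measure. f x * g x = f' x * g' x"
    using A by (auto simp: l2_rel_def)
  have "integrable circle_measure (\<lambda>x. (f x * g x)\<^sup>2) \<longleftrightarrow>
        integrable circle_measure (\<lambda>x. (f' x * g' x)\<^sup>2)"
    by (rule integrable_cong_AE) (use m ae in auto)
  then have "square_integrable (\<lambda>x. f x * g x) \<longleftrightarrow> square_integrable (\<lambda>x. f' x * g' x)"
    using m by (auto simp: square_integrable_def)
  then show "l2_rel (\<lambda>x. if square_integrable (\<lambda>x. f x * g x) then f x * g x else 0)
      (\<lambda>x. if square_integrable (\<lambda>x. f' x * g' x) then f' x * g' x else 0)"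
    using ae by (auto simp: l2_rel_def square_integrable_0)
qed

section \<open>Homogeneous Sobolev spaces\<close>

abbreviation nonzero_ints :: "int set" where
  "nonzero_ints \<equiv> UNIV - {0}"

definition mean_zero :: "l2_circle set" where
  "mean_zero = {u. circle_integral u = 0}"

lift_definition basis_fun :: "int \<Rightarrow> l2_circle" is
  "\<lambda>k x. (if k \<ge> 1 then cos (of_int k * x) else sin (- (of_int k * x))) / sqrt pi"
  subgoal for k
    by (auto simp: l2_rel_def divide_right_mono
        intro!: square_integrable_bounded[where C = "1 / sqrt pi"])
  done

definition sobolev_norm_sq :: "nat \<Rightarrow> l2_circle \<Rightarrow> ennreal" where
  "sobolev_norm_sq m u =
     (\<Sum>\<^sub>\<infinity>k\<in>nonzero_ints. ennreal (\<bar>of_int k\<bar> ^ (2 * m) * (inner u (basis_fun k))\<^sup>2))"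

definition hom_sobolev :: "nat \<Rightarrow> l2_circle set" where
  "hom_sobolev m = {u \<in> mean_zero. sobolev_norm_sq m u < \<infinity>}"

definition sobolev_topology :: "nat \<Rightarrow> l2_circle topology" where
  "sobolev_topology m =
     Metric_space.mtopology (hom_sobolev m) (\<lambda>u v. sqrt (enn2real (sobolev_norm_sq m (u - v))))"

definition sobolev_borel :: "nat \<Rightarrow> l2_circle measure" where
  "sobolev_borel m = sigma (hom_sobolev m) {U. openin (sobolev_topology m) U}"

section \<open>Fourier multipliers and the drift\<close>

lift_definition fourier_coeff :: "l2_circle \<Rightarrow> int \<Rightarrow> complex" is
  "\<lambda>f k. (\<integral>x. complex_of_real (f x) * exp (- (\<i> * of_int k * complex_of_real x)) \<partial>circle_measure)
     / (2 * pi)"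
proof (intro ext)
  fix f g :: "real \<Rightarrow> real" and k :: int
  assume A: "l2_rel f g"
  have e: "(\<lambda>x. exp (- (\<i> * of_int k * complex_of_real x))) \<in> borel_measurable circle_measure"
  proof -
    have "(\<lambda>x. exp (- (\<i> * of_int k * complex_of_real x))) \<in> borel_measurable borel"
      by (rule borel_measurable_continuous_onI) (intro continuous_intros)
    then show ?thesis
      unfolding circle_measure_def by (intro measurable_restrict_space1) simp
  qed
  have "(\<integral>x. complex_of_real (f x) * exp (- (\<i> * of_int k * complex_of_real x)) \<partial>circle_measure)
      = (\<integral>x. complex_of_real (g x) * exp (- (\<i> * of_int k * complex_of_real x)) \<partial>circle_measure)"
    by (rule integral_cong_AE) (use A e in \<open>auto simp: l2_rel_def square_integrable_def\<close>)
  then show "(\<integral>x. complex_of_real (f x) * exp (- (\<i> * of_int k * complex_of_real x)) \<partial>circle_measure)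
        / (2 * pi)
      = (\<integral>x. complex_of_real (g x) * exp (- (\<i> * of_int k * complex_of_real x)) \<partial>circle_measure)
        / (2 * pi)"
    by simp
qed

text \<open>
  The description denotes the unique element with the given Fourier coefficients whenever such an
  element exists in the space of real square integrable functions, and is unspecified otherwise.
\<close>

definition fourier_multiplier :: "(int \<Rightarrow> complex) \<Rightarrow> l2_circle \<Rightarrow> l2_circle" where
  "fourier_multiplier \<sigma> u = (THE v. \<forall>k. fourier_coeff v k = \<sigma> k * fourier_coeff u k)"

definition hilbert_transform :: "l2_circle \<Rightarrow> l2_circle" where
  "hilbert_transform = fourier_multiplier (\<lambda>k. - \<i> * of_int (sgn k))"

definition ddx :: "l2_circle \<Rightarrow> l2_circle" where
  "ddx = fourier_multiplier (\<lambda>k. \<i> * of_int k)"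

text \<open>\<open>heat r\<close> is the operator \<open>exp (r \<partial>\<^sub>x\<^sup>2)\<close>, for \<open>r \<ge> 0\<close>.\<close>

definition heat :: "real \<Rightarrow> l2_circle \<Rightarrow> l2_circle" where
  "heat r = fourier_multiplier (\<lambda>k. complex_of_real (exp (- r * (of_int k)\<^sup>2)))"

text \<open>
  The mean-zero \<open>u\<close> with \<open>u\<^sub>x = H(w)\<close>. The derivative is written through Fourier coefficients, so
  that the equation entails that \<open>u\<close> is weakly differentiable in \<open>L\<^sup>2\<close>.
\<close>

definition velocity :: "l2_circle \<Rightarrow> l2_circle" where
  "velocity w = (THE u. u \<in> mean_zero \<and>
     (\<forall>k. \<i> * of_int k * fourier_coeff u k = fourier_coeff (hilbert_transform w) k))"

definition drift :: "real \<Rightarrow> l2_circle \<Rightarrow> l2_circle" where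
  "drift a w = (- a) *\<^sub>R ddx (l2_times (velocity w) w)
     + (1 + a) *\<^sub>R l2_times (ddx (velocity w)) w"

section \<open>The noise\<close>

definition brownian_motion :: "'w measure \<Rightarrow> (real \<Rightarrow> 'w \<Rightarrow> real) \<Rightarrow> bool" where
  "brownian_motion M B \<longleftrightarrow>
     (\<forall>t\<ge>0. B t \<in> borel_measurable M) \<and>
     (AE \<omega> in M. B 0 \<omega> = 0) \<and>
     (\<forall>s t. 0 \<le> s \<and> s < t \<longrightarrow>
        distributed M lborel (\<lambda>\<omega>. B t \<omega> - B s \<omega>) (normal_density 0 (sqrt (t - s)))) \<and>
     (\<forall>\<tau>::nat \<Rightarrow> real. \<tau> 0 \<ge> 0 \<and> mono \<tau> \<longrightarrow>
        prob_space.indep_vars M (\<lambda>_. borel) (\<lambda>i \<omega>. B (\<tau> (Suc i)) \<omega> - B (\<tau> i) \<omega>) UNIV) \<and>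
     (AE \<omega> in M. continuous_on {0..} (\<lambda>t. B t \<omega>))"

definition filtered_prob_space :: "'w measure \<Rightarrow> (real \<Rightarrow> 'w measure) \<Rightarrow> bool" where
  "filtered_prob_space M F \<longleftrightarrow>
     prob_space M \<and> (\<forall>t\<ge>0. subalgebra M (F t)) \<and>
     (\<forall>s t. 0 \<le> s \<and> s \<le> t \<longrightarrow> subalgebra (F t) (F s))"

text \<open>
  The processes are independent as random elements of the path space, and the increments
  after time \<open>s\<close> of all of them are jointly independent of \<open>F s\<close>.
\<close>

definition brownian_family ::
    "'w measure \<Rightarrow> (real \<Rightarrow> 'w measure) \<Rightarrow> (int \<Rightarrow> real \<Rightarrow> 'w \<Rightarrow> real) \<Rightarrow> bool" where
  "brownian_family M F \<beta> \<longleftrightarrow>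
     (\<forall>k\<in>nonzero_ints. brownian_motion M (\<beta> k) \<and> (\<forall>t\<ge>0. \<beta> k t \<in> borel_measurable (F t))) \<and>
     prob_space.indep_vars M (\<lambda>_. PiM {0..} (\<lambda>_. borel)) (\<lambda>k \<omega>. \<lambda>t\<in>{0..}. \<beta> k t \<omega>) nonzero_ints \<and>
     (\<forall>s\<ge>0. prob_space.indep_set M (sets (F s))
        (sets (vimage_algebra (space M)
          (\<lambda>\<omega>. \<lambda>(k, t)\<in>nonzero_ints \<times> {s..}. \<beta> k t \<omega> - \<beta> k s \<omega>)
          (PiM (nonzero_ints \<times> {s..}) (\<lambda>_. borel)))))"

definition noise_strength :: "nat \<Rightarrow> (int \<Rightarrow> real) \<Rightarrow> ennreal" where
  "noise_strength m b = (\<Sum>\<^sub>\<infinity>k\<in>nonzero_ints. ennreal (\<bar>of_int k\<bar> ^ (2 * m) * (b k)\<^sup>2))"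

definition noise ::
    "(int \<Rightarrow> real) \<Rightarrow> (int \<Rightarrow> real \<Rightarrow> 'w \<Rightarrow> real) \<Rightarrow> real \<Rightarrow> 'w \<Rightarrow> l2_circle" where
  "noise b \<beta> t \<omega> = (\<Sum>\<^sub>\<infinity>k\<in>nonzero_ints. (b k * \<beta> k t \<omega>) *\<^sub>R basis_fun k)"

text \<open>
  \<open>has_wiener_integral M \<xi> \<Phi> t I\<close> states that \<open>I\<close> is the stochastic integral of the deterministic
  operator-valued \<open>\<Phi>\<close> against \<open>d\<xi>\<close> over \<open>[0, t]\<close>: the limit in \<open>L\<^sup>2(\<Omega>; L\<^sup>2)\<close> of the left-endpoint
  sums over partitions whose mesh tends to zero. This determines \<open>I\<close> up to null sets. The limit
  exists for the strongly continuous bounded integrands used below.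
\<close>

definition has_wiener_integral ::
    "'w measure \<Rightarrow> (real \<Rightarrow> 'w \<Rightarrow> l2_circle) \<Rightarrow> (real \<Rightarrow> l2_circle \<Rightarrow> l2_circle) \<Rightarrow> real
       \<Rightarrow> ('w \<Rightarrow> l2_circle) \<Rightarrow> bool" where
  "has_wiener_integral M \<xi> \<Phi> t I \<longleftrightarrow>
     I \<in> borel_measurable M \<and>
     (\<forall>\<epsilon>>0. \<exists>\<delta>>0. \<forall>n (\<tau>::nat \<Rightarrow> real).
        \<tau> 0 = 0 \<and> \<tau> n = t \<and> (\<forall>i<n. \<tau> i \<le> \<tau> (Suc i) \<and> \<tau> (Suc i) - \<tau> i < \<delta>) \<longrightarrow>
        (\<integral>\<^sup>+\<omega>. ennreal ((norm ((\<Sum>i<n. \<Phi> (\<tau> i) (\<xi> (\<tau> (Suc i)) \<omega> - \<xi> (\<tau> i) \<omega>)) - I \<omega>))\<^sup>2) \<partial>M)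
          < ennreal \<epsilon>)"

section \<open>Solutions, transition semigroup, invariant measures\<close>

text \<open>
  For each \<open>t\<close> the stochastic convolution is only determined up to a null set; \<open>Z\<close> is a version for
  which the equation holds for all \<open>t\<close> at once outside a single null set. As all other terms are then
  continuous in time, so is \<open>Z\<close>, and \<open>Z\<close> is unique up to indistinguishability.
\<close>

definition solution_on ::
    "'w measure \<Rightarrow> real \<Rightarrow> real \<Rightarrow> (real \<Rightarrow> 'w \<Rightarrow> l2_circle) \<Rightarrow> nat \<Rightarrow> real \<Rightarrow> l2_circle
       \<Rightarrow> (real \<Rightarrow> 'w \<Rightarrow> l2_circle) \<Rightarrow> bool" where
  "solution_on M a \<nu> \<xi> m T y w \<longleftrightarrow>
     (AE \<omega> in M. continuous_map (top_of_set {0..T}) (sobolev_topology m) (\<lambda>t. w t \<omega>)) \<and>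
     (\<exists>Z. (\<forall>t\<in>{0..T}. has_wiener_integral M \<xi> (\<lambda>s. heat (\<nu> * (t - s))) t (Z t)) \<and>
        (AE \<omega> in M. \<forall>t\<in>{0..T}.
           (\<lambda>s. heat (\<nu> * (t - s)) (drift a (w s \<omega>))) integrable_on {0..t} \<and>
           w t \<omega> = heat (\<nu> * t) y
             + integral {0..t} (\<lambda>s. heat (\<nu> * (t - s)) (drift a (w s \<omega>))) + Z t \<omega>))"

definition adapted_global_solution ::
    "'w measure \<Rightarrow> (real \<Rightarrow> 'w measure) \<Rightarrow> real \<Rightarrow> real \<Rightarrow> (real \<Rightarrow> 'w \<Rightarrow> l2_circle) \<Rightarrow> nat
       \<Rightarrow> l2_circle \<Rightarrow> (real \<Rightarrow> 'w \<Rightarrow> l2_circle) \<Rightarrow> bool" where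
  "adapted_global_solution M F a \<nu> \<xi> m y w \<longleftrightarrow>
     (\<forall>t\<ge>0. w t \<in> F t \<rightarrow>\<^sub>M sobolev_borel m) \<and> (\<forall>T>0. solution_on M a \<nu> \<xi> m T y w)"

definition transition_semigroup ::
    "'w measure \<Rightarrow> (l2_circle \<Rightarrow> real \<Rightarrow> 'w \<Rightarrow> l2_circle) \<Rightarrow> real \<Rightarrow> (l2_circle \<Rightarrow> real)
       \<Rightarrow> l2_circle \<Rightarrow> real" where
  "transition_semigroup M W t f y = (\<integral>\<omega>. f (W y t \<omega>) \<partial>M)"

text \<open>
  Integrability of \<open>P t f\<close> is demanded explicitly because the library integral of a non-integrable
  function is zero.
\<close>

definition invariant_measure ::
    "nat \<Rightarrow> (real \<Rightarrow> (l2_circle \<Rightarrow> real) \<Rightarrow> l2_circle \<Rightarrow> real) \<Rightarrow> l2_circle measure \<Rightarrow> bool" where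
  "invariant_measure m P \<mu> \<longleftrightarrow>
     prob_space \<mu> \<and> sets \<mu> = sets (sobolev_borel m) \<and>
     (\<forall>t\<ge>0. \<forall>f\<in>borel_measurable (sobolev_borel m). bounded (f ` hom_sobolev m) \<longrightarrow>
        integrable \<mu> (P t f) \<and> (\<integral>y. P t f y \<partial>\<mu>) = (\<integral>y. f y \<partial>\<mu>))"

end

theory Submission
  imports Defs
begin

text \<open>
  For \<open>a = -2\<close> the nonlinearity is skew in \<open>L\<^sup>2\<close>, so the \<open>L\<^sup>2\<close> norm is only dissipated, and its
  powers control the \<open>H\<^bsup>m+1\<^esup>\<close> energy. As the noise is additive, every solution satisfies, coordinate by
  coordinate and path by path, an integral equation driven by the Brownian coordinates, and a
  Gronwall argument in \<open>L\<^sup>2\<close> shows that it is the limit of explicit Euler steps for Galerkin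
  truncations. No stochastic calculus is needed: the Euler scheme is a Markov chain with Gaussian
  increments, a discrete Lyapunov estimate for \<open>|x|\<^sup>2\<close> in \<open>H\<^bsup>m+1\<^esup>\<close> plus a multiple of
  \<open>|x|\<^bsup>2(m+3)\<^esup>\<close> in \<open>L\<^sup>2\<close> bounds the second moment in \<open>H\<^bsup>m+1\<^esup>\<close> of the solution started at \<open>0\<close>
  uniformly in time, and the Markov property passes to the limit. The Gronwall argument also shows
  that the semigroup preserves continuity with respect to the \<open>L\<^sup>2\<close> norm. An invariant
  measure is then a limit of Krylov--Bogoliubov averages. Compactness is obtained by coding all
  Fourier coordinates into one real number and applying the theorems of Helly and Skorohod on the
  line. The \<open>L\<^sup>2\<close>-continuous test functions suffice, because the coordinates generate the Borel sets
  of \<open>H\<^sup>m\<close>.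
\<close>


section \<open>Fourier series of square integrable functions\<close>

text \<open>The solutions are given one starting point at a time, each with its own null set and
  without joint measurability in the starting point and the sample. So \<open>P t f\<close> is not
  known in advance to be measurable, and the Markov property cannot be read off a flow. Both are
  recovered through the scheme: its one-step operator acts on finitely many coordinates, its
  iterates converge to \<open>P t f\<close> at each point of H^m, and its stability gives continuity
  of \<open>P t f\<close>. The H^s energy of the quadratic drift is controlled by dissipation only
  up to the power s + 2 of the squared L^2 norm; with s = m + 1 this fixes the second term of the
  Lyapunov function. Explicit steps of a quadratic field may run away, hence the cut-off in
  \<open>Gn\<close>; along a fixed path it is inactive for large n, because the scheme stays near
  the path. Skewness is a property of the L^2 pairing, so stability uniform in the truncation is
  available in L^2. This is why the test functions are continuous in L^2 although the semigroup acts
  on H^m.\<close>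

lemma space_circle [simp]: "space circle_measure = {0..2 * pi}"
  by (simp add: circle_measure_def space_restrict_space)

lemma borel_measurable_circle [measurable (raw)]:
  "f \<in> borel_measurable borel \<Longrightarrow> f \<in> borel_measurable circle_measure"
  unfolding circle_measure_def by (intro measurable_restrict_space1) simp

interpretation circle: finite_measure circle_measure
  by (rule finite_measure_circle)

lemma integrable_circle_bounded:
  fixes f :: "real \<Rightarrow> 'a :: {banach, second_countable_topology}"
  assumes "f \<in> borel_measurable circle_measure" "\<And>x. norm (f x) \<le> C"
  shows "integrable circle_measure f"
  by (rule circle.integrable_const_bound[where B = C]) (use assms in auto)

section \<open>Integrals of trigonometric functions over a period\<close>

lemma integral_circle_FTC:
  fixes f F :: "real \<Rightarrow> real"
  assumes "\<And>x. (F has_real_derivative f x) (at x)" "continuous_on UNIV f"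
  shows "(\<integral>x. f x \<partial>circle_measure) = F (2 * pi) - F 0"
proof -
  have "(\<integral>x. f x \<partial>circle_measure) = (\<integral>x. indicator {0..2*pi} x *\<^sub>R f x \<partial>lborel)"
    unfolding circle_measure_def by (subst integral_restrict_space) auto
  also have "\<dots> = F (2 * pi) - F 0"
  proof (rule integral_FTC_atLeastAtMost)
    show "(F has_vector_derivative f x) (at x within {0..2 * pi})" for x
      using assms(1)[of x]
      by (simp add: has_real_derivative_iff_has_vector_derivative has_vector_derivative_at_within)
    show "continuous_on {0..2 * pi} f"
      using assms(2) by (rule continuous_on_subset) auto
  qed simp
  finally show ?thesis .
qed

lemma integral_circle_cos: "(\<integral>x. cos (of_int k * x) \<partial>circle_measure) = (if k = 0 then 2 * pi else 0)"
proof (cases "k = 0")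
  case True
  then show ?thesis using integral_circle_FTC[of "\<lambda>x. x" "\<lambda>x. 1"] by simp
next
  case False
  have "(\<integral>x. cos (of_int k * x) \<partial>circle_measure)
      = sin (of_int k * (2 * pi)) / of_int k - sin (of_int k * 0) / of_int k"
    by (rule integral_circle_FTC)
      (use False in \<open>auto intro!: derivative_eq_intros continuous_intros\<close>)
  also have "sin (of_int k * (2 * pi)) = 0"
    using sin_integer_2pi[of "of_int k"] by (simp add: mult_ac)
  finally show ?thesis using False by simp
qed

lemma integral_circle_sin: "(\<integral>x. sin (of_int k * x) \<partial>circle_measure) = 0"
proof (cases "k = 0")
  case False
  have "(\<integral>x. sin (of_int k * x) \<partial>circle_measure)
      = - cos (of_int k * (2 * pi)) / of_int k - (- cos (of_int k * 0) / of_int k)"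
    by (rule integral_circle_FTC)
      (use False in \<open>auto intro!: derivative_eq_intros continuous_intros\<close>)
  also have "cos (of_int k * (2 * pi)) = 1"
    using cos_integer_2pi[of "of_int k"] by (simp add: mult_ac)
  finally show ?thesis using False by simp
qed simp

section \<open>Classes and their representatives\<close>

abbreviation L2 :: "(real \<Rightarrow> real) \<Rightarrow> l2_circle" where "L2 \<equiv> abs_l2_circle"

lemma l2_rel_refl [simp]: "l2_rel f f \<longleftrightarrow> square_integrable f"
  by (auto simp: l2_rel_def)

lemma L2_cases [cases type: l2_circle]:
  obtains f where "square_integrable f" "u = L2 f"
proof -
  have Q: "Quotient3 l2_rel abs_l2_circle rep_l2_circle"
    by (rule Quotient3_l2_circle)
  show thesis
    using Quotient3_rep_reflp[OF Q, of u] Quotient3_abs_rep[OF Q, of u]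
    by (intro that[of "rep_l2_circle u"]) auto
qed

lemma L2_eq_iff:
  assumes "square_integrable f" "square_integrable g"
  shows "L2 f = L2 g \<longleftrightarrow> (AE x in circle_measure. f x = g x)"
  using assms Quotient3_rel[OF Quotient3_l2_circle, of f g] by (auto simp: l2_rel_def)

lemma square_integrable_measurable [measurable_dest]:
  "square_integrable f \<Longrightarrow> f \<in> borel_measurable circle_measure"
  by (simp add: square_integrable_def)

lemma square_integrable_integrable:
  assumes "square_integrable f" shows "integrable circle_measure f"
  using square_integrable_mult[OF assms, of "\<lambda>_. 1"] square_integrable_bounded[of "\<lambda>_. 1" 1] by simp

lemma L2_add: "square_integrable f \<Longrightarrow> square_integrable g \<Longrightarrow> L2 f + L2 g = L2 (\<lambda>x. f x + g x)"
  by (rule plus_l2_circle.abs_eq) auto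

lemma L2_scale: "square_integrable f \<Longrightarrow> c *\<^sub>R L2 f = L2 (\<lambda>x. c * f x)"
  by (rule scaleR_l2_circle.abs_eq) auto

lemma L2_zero: "0 = L2 (\<lambda>x. 0)"
  by (rule zero_l2_circle.abs_eq)

lemma square_integrable_diff:
  "square_integrable f \<Longrightarrow> square_integrable g \<Longrightarrow> square_integrable (\<lambda>x. f x - g x)"
  using square_integrable_add[of f "\<lambda>x. (-1) * g x"] square_integrable_scale[of g "-1"] by simp

lemma L2_diff: "square_integrable f \<Longrightarrow> square_integrable g \<Longrightarrow> L2 f - L2 g = L2 (\<lambda>x. f x - g x)"
  using L2_add[of f "\<lambda>x. (-1) * g x"] L2_scale[of g "-1"] square_integrable_scale[of g "-1"]
  by (simp add: diff_conv_add_uminus del: add_uminus_conv_diff)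

lemma L2_inner: "square_integrable f \<Longrightarrow> square_integrable g \<Longrightarrow>
    inner (L2 f) (L2 g) = (\<integral>x. f x * g x \<partial>circle_measure)"
  by (rule inner_l2_circle.abs_eq) auto

lemma L2_norm: "square_integrable f \<Longrightarrow> (norm (L2 f))\<^sup>2 = (\<integral>x. (f x)\<^sup>2 \<partial>circle_measure)"
  by (simp add: power2_norm_eq_inner L2_inner flip: power2_eq_square)

lemma square_integrable_cos [simp]: "square_integrable (\<lambda>x. cos (c * x))"
  and square_integrable_sin [simp]: "square_integrable (\<lambda>x. sin (c * x))"
  and square_integrable_const [simp]: "square_integrable (\<lambda>x. d)"
  by (intro square_integrable_bounded[where C = 1] square_integrable_bounded[where C = "\<bar>d\<bar>"]; simp)+

definition bfun :: "int \<Rightarrow> real \<Rightarrow> real" where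
  "bfun k x = (if k \<ge> 1 then cos (of_int k * x) else sin (- (of_int k * x))) / sqrt pi"

lemma bfun_bound: "\<bar>bfun k x\<bar> \<le> 1 / sqrt pi"
  by (auto simp: bfun_def divide_right_mono)

lemma bfun_measurable [measurable]: "bfun k \<in> borel_measurable borel"
  unfolding bfun_def by simp

lemma square_integrable_bfun [simp]: "square_integrable (bfun k)"
  by (rule square_integrable_bounded[OF bfun_measurable bfun_bound])

lemma basis_fun_L2: "basis_fun k = L2 (bfun k)"
  unfolding basis_fun.abs_eq bfun_def ..

lemma int_circle_cos_cos: "(\<integral>x. cos (of_int k * x) * cos (of_int l * x) \<partial>circle_measure)
    = (if k - l = 0 then pi else 0) + (if k + l = 0 then pi else 0)"
proof -
  have "(\<integral>x. cos (of_int k * x) * cos (of_int l * x) \<partial>circle_measure)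
     = (\<integral>x. cos (of_int (k - l) * x) / 2 + cos (of_int (k + l) * x) / 2 \<partial>circle_measure)"
    by (intro Bochner_Integration.integral_cong)
       (auto simp: cos_add cos_diff left_diff_distrib distrib_right field_simps)
  also have "\<dots> = (\<integral>x. cos (of_int (k - l) * x) \<partial>circle_measure) / 2
      + (\<integral>x. cos (of_int (k + l) * x) \<partial>circle_measure) / 2"
    by (subst Bochner_Integration.integral_add)
       (auto intro!: integrable_circle_bounded[where C = 1] integrable_divide_zero)
  finally show ?thesis unfolding integral_circle_cos by auto
qed

lemma int_circle_sin_sin: "(\<integral>x. sin (of_int k * x) * sin (of_int l * x) \<partial>circle_measure)
    = (if k - l = 0 then pi else 0) - (if k + l = 0 then pi else 0)"
proof -
  have "(\<integral>x. sin (of_int k * x) * sin (of_int l * x) \<partial>circle_measure)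
     = (\<integral>x. cos (of_int (k - l) * x) / 2 - cos (of_int (k + l) * x) / 2 \<partial>circle_measure)"
    by (intro Bochner_Integration.integral_cong)
       (auto simp: cos_add cos_diff left_diff_distrib distrib_right field_simps)
  also have "\<dots> = (\<integral>x. cos (of_int (k - l) * x) \<partial>circle_measure) / 2
      - (\<integral>x. cos (of_int (k + l) * x) \<partial>circle_measure) / 2"
    by (subst Bochner_Integration.integral_diff)
       (auto intro!: integrable_circle_bounded[where C = 1] integrable_divide_zero)
  finally show ?thesis unfolding integral_circle_cos by auto
qed

lemma int_circle_sin_cos: "(\<integral>x. sin (of_int k * x) * cos (of_int l * x) \<partial>circle_measure) = 0"
proof -
  have "(\<integral>x. sin (of_int k * x) * cos (of_int l * x) \<partial>circle_measure)
     = (\<integral>x. sin (of_int (k - l) * x) / 2 + sin (of_int (k + l) * x) / 2 \<partial>circle_measure)"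
    by (intro Bochner_Integration.integral_cong)
       (auto simp: sin_add sin_diff left_diff_distrib distrib_right field_simps)
  also have "\<dots> = (\<integral>x. sin (of_int (k - l) * x) \<partial>circle_measure) / 2
      + (\<integral>x. sin (of_int (k + l) * x) \<partial>circle_measure) / 2"
    by (subst Bochner_Integration.integral_add)
       (auto intro!: integrable_circle_bounded[where C = 1] integrable_divide_zero)
  finally show ?thesis unfolding integral_circle_sin by auto
qed

lemma bfun_alt: "bfun k x = (if k \<ge> 1 then cos (of_int k * x) else - sin (of_int k * x)) / sqrt pi"
  by (simp add: bfun_def)

lemma inner_basis_fun:
  assumes "k \<noteq> 0" "l \<noteq> 0"
  shows "inner (basis_fun k) (basis_fun l) = (if k = l then 1 else 0)"
proof -
  let ?f = "\<lambda>k x. if k \<ge> 1 then cos (real_of_int k * x) else - sin (of_int k * x)"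
  have "inner (basis_fun k) (basis_fun l) = (\<integral>x. (?f k x * ?f l x) / pi \<partial>circle_measure)"
    by (auto simp: basis_fun_L2 L2_inner bfun_alt intro!: Bochner_Integration.integral_cong)
  also have "\<dots> = (\<integral>x. (?f k x * ?f l x) \<partial>circle_measure) / pi" by simp
  also have "\<dots> = (if k = l then 1 else 0)"
    using assms int_circle_cos_cos[of k l] int_circle_sin_sin[of k l] int_circle_sin_cos[of k l]
      int_circle_sin_cos[of l k]
    by (cases "k \<ge> 1"; cases "l \<ge> 1") (auto simp: mult.commute[of "cos _" "sin _"])
  finally show ?thesis .
qed

lemma circle_integral_L2: "square_integrable f \<Longrightarrow> circle_integral (L2 f) = (\<integral>x. f x \<partial>circle_measure)"
  by (rule circle_integral.abs_eq) auto

lemma circle_integral_inner: "circle_integral u = inner u (L2 (\<lambda>_. 1))"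
  by (cases u) (simp add: circle_integral_L2 L2_inner)

lemma circle_integral_basis_fun: "k \<noteq> 0 \<Longrightarrow> circle_integral (basis_fun k) = 0"
  by (cases "k \<ge> 1") (auto simp: basis_fun_L2 circle_integral_L2 bfun_alt integral_circle_cos integral_circle_sin)

section \<open>Completeness of L^2\<close>

lemma L1_le_norm:
  assumes "square_integrable g"
  shows "(\<integral>x. \<bar>g x\<bar> \<partial>circle_measure) \<le> norm (L2 g) * norm (L2 (\<lambda>_. 1))"
proof -
  have sq: "square_integrable (\<lambda>x. \<bar>g x\<bar>)"
    using assms by (auto simp: square_integrable_def)
  have "(\<integral>x. \<bar>g x\<bar> \<partial>circle_measure) = inner (L2 (\<lambda>x. \<bar>g x\<bar>)) (L2 (\<lambda>_. 1))"
    using sq by (simp add: L2_inner)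
  also have "\<dots> \<le> norm (L2 (\<lambda>x. \<bar>g x\<bar>)) * norm (L2 (\<lambda>_. 1))"
    by (rule norm_cauchy_schwarz)
  also have "norm (L2 (\<lambda>x. \<bar>g x\<bar>)) = norm (L2 g)"
    using L2_norm[OF sq] L2_norm[OF assms] by - (rule power2_eq_imp_eq, auto)
  finally show ?thesis .
qed

lemma ennreal_norm_L2:
  "square_integrable g \<Longrightarrow> (\<integral>\<^sup>+x. ennreal ((g x)\<^sup>2) \<partial>circle_measure) = ennreal ((norm (L2 g))\<^sup>2)"
  by (subst nn_integral_eq_integral) (auto simp: L2_norm square_integrable_def)

text \<open>Riesz-Fischer: on a finite measure the L^1 norm is dominated by the L^2 norm, so a
  subsequence with geometrically small steps is absolutely summable at almost every point, and
  Fatou's lemma shows that its pointwise limit is the L^2 limit. Completeness is what lets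
  \<open>synth\<close> converge.\<close>

instance l2_circle :: banach
proof
  fix X :: "nat \<Rightarrow> l2_circle"
  assume X: "Cauchy X"
  have "\<exists>r::nat \<Rightarrow> nat. \<forall>i. True \<and> (\<forall>m\<ge>r i. dist (X m) (X (r i)) < (1/2) ^ i) \<and> r (Suc i) > r i" 
  proof -
    have ex: "\<exists>N>K. \<forall>m\<ge>N. dist (X m) (X N) < (1/2) ^ i" for i K :: nat
    proof -
      from X obtain N where N: "\<And>m n. m \<ge> N \<Longrightarrow> n \<ge> N \<Longrightarrow> dist (X m) (X n) < (1/2) ^ i"
        unfolding Cauchy_def by (metis half_gt_zero_iff zero_less_one zero_less_power)
      show ?thesis
        by (rule exI[of _ "max N (Suc K)"]) (auto intro!: N)
    qed
    have "\<exists>r::nat \<Rightarrow> nat. \<forall>i. (\<forall>m\<ge>r i. dist (X m) (X (r i)) < (1/2) ^ i) \<and> r i < r (Suc i)"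
    proof (rule dependent_nat_choice)
      show "\<exists>x. \<forall>m\<ge>x. dist (X m) (X x) < (1 / 2) ^ 0" using ex[of 0 0] by blast
      show "\<exists>y. (\<forall>m\<ge>y. dist (X m) (X y) < (1 / 2) ^ Suc i) \<and> x < y" for x i
        using ex[of x "Suc i"] by blast
    qed
    then show ?thesis by simp
  qed
  then obtain r :: "nat \<Rightarrow> nat"
    where r: "\<And>i m. m \<ge> r i \<Longrightarrow> dist (X m) (X (r i)) < (1/2) ^ i" and "\<And>i. r (Suc i) > r i"
    by blast
  then have mono: "strict_mono r" by (simp add: strict_mono_Suc_iff)
  have "\<exists>f. \<forall>i. square_integrable (f i) \<and> X (r i) = L2 (f i)"
    by (intro choice allI) (metis L2_cases)
  then obtain f where sq: "\<And>i. square_integrable (f i)" and f: "\<And>i. X (r i) = L2 (f i)"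
    by blast
  note [measurable] = square_integrable_measurable[OF sq]
  define C where "C = norm (L2 (\<lambda>_. 1))"
  have L1: "(\<integral>x. \<bar>f (Suc i) x - f i x\<bar> \<partial>circle_measure) \<le> (1/2)^i * C" for i
  proof -
    have "(\<integral>x. \<bar>f (Suc i) x - f i x\<bar> \<partial>circle_measure) \<le> norm (L2 (\<lambda>x. f (Suc i) x - f i x)) * C"
      unfolding C_def by (intro L1_le_norm square_integrable_diff sq)
    also have "norm (L2 (\<lambda>x. f (Suc i) x - f i x)) \<le> (1/2) ^ i"
      using r[of i "r (Suc i)"] strict_mono_less_eq[OF mono, of i "Suc i"]
      by (simp add: f dist_norm L2_diff sq)
    finally show ?thesis by (simp add: C_def mult_right_mono)
  qed
  have "(\<integral>\<^sup>+x. (\<Sum>i. ennreal \<bar>f (Suc i) x - f i x\<bar>) \<partial>circle_measure)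
      = (\<Sum>i. \<integral>\<^sup>+x. ennreal \<bar>f (Suc i) x - f i x\<bar> \<partial>circle_measure)"
    by (rule nn_integral_suminf) simp
  also have "\<dots> \<le> (\<Sum>i. ennreal ((1/2)^i * C))"
  proof (rule suminf_le)
    fix i
    have "(\<integral>\<^sup>+x. ennreal \<bar>f (Suc i) x - f i x\<bar> \<partial>circle_measure)
        = ennreal (\<integral>x. \<bar>f (Suc i) x - f i x\<bar> \<partial>circle_measure)"
      by (rule nn_integral_eq_integral)
         (auto intro!: square_integrable_integrable square_integrable_diff sq integrable_abs)
    then show "(\<integral>\<^sup>+x. ennreal \<bar>f (Suc i) x - f i x\<bar> \<partial>circle_measure) \<le> ennreal ((1/2)^i * C)"
      using L1[of i] by (simp add: ennreal_leI)
  qed auto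
  also have "\<dots> = ennreal (\<Sum>i. (1/2)^i * C)"
    by (rule suminf_ennreal2) (auto simp: C_def intro!: summable_mult2 summable_geometric)
  finally have "(\<integral>\<^sup>+x. (\<Sum>i. ennreal \<bar>f (Suc i) x - f i x\<bar>) \<partial>circle_measure) \<noteq> \<infinity>"
    by (auto simp: top_unique)
  then have "AE x in circle_measure. (\<Sum>i. ennreal \<bar>f (Suc i) x - f i x\<bar>) \<noteq> \<infinity>"
    by (intro nn_integral_PInf_AE) auto
  then have "AE x in circle_measure. convergent (\<lambda>i. f i x)"
  proof eventually_elim
    case (elim x)
    have "summable (\<lambda>i. \<bar>f (Suc i) x - f i x\<bar>)"
      by (rule summable_suminf_not_top) (use elim in auto)
    then have "summable (\<lambda>i. f (Suc i) x - f i x)"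
      by (rule summable_rabs_cancel)
    then have "convergent (\<lambda>n. f 0 x + (\<Sum>i<n. f (Suc i) x - f i x))"
      by (simp add: summable_iff_convergent convergent_add_const_iff)
    moreover have "f 0 x + (\<Sum>i<n. f (Suc i) x - f i x) = f n x" for n
      using sum_lessThan_telescope[of "\<lambda>i. f i x" n] by simp
    ultimately show ?case by simp
  qed
  then have lim: "AE x in circle_measure. (\<lambda>i. f i x) \<longlonglongrightarrow> lim (\<lambda>i. f i x)"
    by eventually_elim (simp add: convergent_LIMSEQ_iff)
  define g where "g x = lim (\<lambda>i. f i x)" for x
  have [measurable]: "g \<in> borel_measurable circle_measure"
    unfolding g_def by measurable
  \<comment> \<open>Fatou transfers the Cauchy bound to the limit before \<open>g\<close> is known
    to be square integrable; that follows afterwards by adding \<open>f 0\<close> to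
    \<open>g - f 0\<close>.\<close>
  have bd: "(\<integral>\<^sup>+x. ennreal ((g x - f i x)\<^sup>2) \<partial>circle_measure) \<le> ennreal (((1/2)^i)\<^sup>2)" for i
  proof -
    have "(\<integral>\<^sup>+x. ennreal ((g x - f i x)\<^sup>2) \<partial>circle_measure)
        = (\<integral>\<^sup>+x. liminf (\<lambda>j. ennreal ((f j x - f i x)\<^sup>2)) \<partial>circle_measure)"
    proof (rule nn_integral_cong_AE, use lim in eventually_elim)
      case (elim x)
      have "(\<lambda>j. ennreal ((f j x - f i x)\<^sup>2)) \<longlonglongrightarrow> ennreal ((g x - f i x)\<^sup>2)"
        using elim unfolding g_def[symmetric] by (intro tendsto_intros)
      then show ?case by (rule lim_imp_Liminf[OF sequentially_bot, symmetric])
    qed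
    also have "\<dots> \<le> liminf (\<lambda>j. \<integral>\<^sup>+x. ennreal ((f j x - f i x)\<^sup>2) \<partial>circle_measure)"
      by (rule nn_integral_liminf) measurable
    also have "\<dots> \<le> ennreal (((1/2)^i)\<^sup>2)"
    proof (rule Liminf_le)
      show "\<forall>\<^sub>F j in sequentially. (\<integral>\<^sup>+x. ennreal ((f j x - f i x)\<^sup>2) \<partial>circle_measure) \<le> ennreal (((1/2)^i)\<^sup>2)"
        using eventually_ge_at_top[of i]
      proof eventually_elim
        case (elim j)
        have "(\<integral>\<^sup>+x. ennreal ((f j x - f i x)\<^sup>2) \<partial>circle_measure) = ennreal ((norm (X (r j) - X (r i)))\<^sup>2)"
          by (simp add: f L2_diff sq ennreal_norm_L2 square_integrable_diff)
        also have "\<dots> \<le> ennreal (((1/2)^i)\<^sup>2)"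
          using r[of i "r j"] elim strict_mono_less_eq[OF mono, of i j]
          by (intro ennreal_leI power_mono) (auto simp: dist_norm)
        finally show ?case .
      qed
    qed simp
    finally show ?thesis .
  qed
  have sqd: "square_integrable (\<lambda>x. g x - f i x)" for i
    using order_le_less_trans[OF bd[of i] ennreal_less_top]
    by (auto simp: square_integrable_def integrable_iff_bounded)
  have sqg: "square_integrable g" using square_integrable_add[OF sqd[of 0] sq[of 0]] by (simp only: diff_add_cancel)
  have "norm (X (r i) - L2 g) \<le> (1/2)^i" for i
  proof -
    have "ennreal ((norm (L2 (\<lambda>x. g x - f i x)))\<^sup>2) \<le> ennreal (((1/2)^i)\<^sup>2)"
      unfolding ennreal_norm_L2[OF sqd, symmetric] by (rule bd)
    then have "(norm (L2 (\<lambda>x. g x - f i x)))\<^sup>2 \<le> ((1/2)^i)\<^sup>2"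
      by (subst (asm) ennreal_le_iff) auto
    then have "norm (L2 (\<lambda>x. g x - f i x)) \<le> (1/2)^i"
      by (rule power2_le_imp_le) simp
    also have "norm (L2 (\<lambda>x. g x - f i x)) = norm (X (r i) - L2 g)"
      unfolding f L2_diff[OF sqg sq, symmetric] by (rule norm_minus_commute)
    finally show ?thesis .
  qed
  moreover have "(\<lambda>i. (1/2 :: real)^i) \<longlonglongrightarrow> 0"
    by (rule LIMSEQ_realpow_zero) auto
  ultimately have "(\<lambda>i. X (r i) - L2 g) \<longlonglongrightarrow> 0"
    by (intro Lim_null_comparison[of "\<lambda>i. X (r i) - L2 g" "\<lambda>i. (1/2)^i"]) auto
  then have "(\<lambda>i. X (r i)) \<longlonglongrightarrow> L2 g"
    by (rule LIM_zero_cancel)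
  then show "convergent X"
    by (intro convergentI[OF Cauchy_converges_subseq[OF X mono, of "L2 g"]]) (simp only: comp_def)
qed

section \<open>Completeness of the trigonometric system\<close>

definition trig_annihilates :: "(real \<Rightarrow> real) \<Rightarrow> (real \<Rightarrow> real) \<Rightarrow> bool" where
  "trig_annihilates f \<phi> \<longleftrightarrow> \<phi> \<in> borel_measurable borel \<and> (\<exists>C. \<forall>x. \<bar>\<phi> x\<bar> \<le> C) \<and>
     (\<forall>k::int. (\<integral>x. f x * \<phi> x * cos (of_int k * x) \<partial>circle_measure) = 0 \<and>
        (\<integral>x. f x * \<phi> x * sin (of_int k * x) \<partial>circle_measure) = 0)"

lemma integrable_mult_bounded:
  assumes "integrable M (f :: 'a \<Rightarrow> real)" "g \<in> borel_measurable M" "\<And>x. \<bar>g x\<bar> \<le> C"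
  shows "integrable M (\<lambda>x. f x * g x)"
proof (rule Bochner_Integration.integrable_bound)
  show "integrable M (\<lambda>x. C * f x)" using assms(1) by simp
  have "\<bar>f x * g x\<bar> \<le> \<bar>C * f x\<bar>" for x
    using mult_left_mono[OF assms(3)[of x], of "\<bar>f x\<bar>"] abs_ge_self[of C]
      mult_left_mono[of C "\<bar>C\<bar>" "\<bar>f x\<bar>"] by (simp add: abs_mult mult.commute)
  then show "AE x in M. norm (f x * g x) \<le> norm (C * f x)" by simp
qed (use assms in auto)

text \<open>The product formulas shift a frequency by one, so the multipliers \<open>\<phi>\<close>
  for which all trigonometric integrals of \<open>f\<close> times \<open>\<phi>\<close> vanish are
  closed under multiplication by cos and sin. Carrying \<open>\<phi>\<close> along makes the whole
  algebra generated by cos and sin accessible.\<close>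

lemma trig_annihilates_cos_sin:
  assumes f: "integrable circle_measure f" and \<phi>: "trig_annihilates f \<phi>"
  shows "trig_annihilates f (\<lambda>x. \<phi> x * cos x)" "trig_annihilates f (\<lambda>x. \<phi> x * sin x)"
proof -
  from \<phi> obtain C where C: "\<And>x. \<bar>\<phi> x\<bar> \<le> C" and [measurable]: "\<phi> \<in> borel_measurable borel"
    by (auto simp: trig_annihilates_def)
  have C0: "C \<ge> 0" using C[of 0] by linarith
  have int: "integrable circle_measure (\<lambda>x. f x * \<phi> x * g x)"
    if "g \<in> borel_measurable borel" "\<And>x. \<bar>g x\<bar> \<le> 1" for g
    by (rule integrable_mult_bounded[where C = 1] integrable_mult_bounded[where C = C] f C that
        borel_measurable_circle \<open>\<phi> \<in> borel_measurable borel\<close>)+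
  note I = int[of "\<lambda>x. cos (c * x)" for c] int[of "\<lambda>x. sin (c * x)" for c]
  have cc: "f x * (\<phi> x * cos x) * cos (of_int k * x) =
      (f x * \<phi> x * cos (of_int (k + 1) * x) + f x * \<phi> x * cos (of_int (k - 1) * x)) / 2"
    and sc: "f x * (\<phi> x * cos x) * sin (of_int k * x) =
      (f x * \<phi> x * sin (of_int (k + 1) * x) + f x * \<phi> x * sin (of_int (k - 1) * x)) / 2"
    and cs: "f x * (\<phi> x * sin x) * cos (of_int k * x) =
      (f x * \<phi> x * sin (of_int (k + 1) * x) - f x * \<phi> x * sin (of_int (k - 1) * x)) / 2"
    and ss: "f x * (\<phi> x * sin x) * sin (of_int k * x) =
      (f x * \<phi> x * cos (of_int (k - 1) * x) - f x * \<phi> x * cos (of_int (k + 1) * x)) / 2"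
    for x and k :: int
    by (simp_all add: cos_add cos_diff sin_add sin_diff distrib_right left_diff_distrib)
       (simp_all add: algebra_simps)
  have b: "\<bar>\<phi> x * cos x\<bar> \<le> C" "\<bar>\<phi> x * sin x\<bar> \<le> C" for x
    using mult_mono[OF C[of x] abs_cos_le_one[of x]] mult_mono[OF C[of x] abs_sin_le_one[of x]] C0
    by (auto simp: abs_mult)
  note Z = \<phi>[unfolded trig_annihilates_def, THEN conjunct2, THEN conjunct2, rule_format]
  show "trig_annihilates f (\<lambda>x. \<phi> x * cos x)"
    unfolding trig_annihilates_def cc sc using b Z by (auto simp: I simp del: of_int_add of_int_diff)
  show "trig_annihilates f (\<lambda>x. \<phi> x * sin x)"
    unfolding trig_annihilates_def cs ss using b Z by (auto simp: I simp del: of_int_add of_int_diff)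
qed

text \<open>Stone-Weierstrass on the unit circle of the complex plane: continuity there already
  includes periodicity, and \<open>Re\<close> and \<open>Im\<close> separate the points.\<close>

lemma trig_annihilates_1_imp_continuous:
  fixes g :: "complex \<Rightarrow> real"
  assumes f: "integrable circle_measure f" and 1: "trig_annihilates f (\<lambda>_. 1)"
    and g: "continuous_on (sphere 0 1) g"
  shows "(\<integral>x. f x * g (cis x) \<partial>circle_measure) = 0"
proof -
  have cis_S: "cis x \<in> sphere 0 1" for x by simp
  have cis_cont: "continuous_on UNIV cis"
    by (intro continuous_intros)
  \<comment> \<open>Membership in \<open>P\<close> is phrased as preservation of all annihilating
    multipliers, so that closure under products is mere composition.\<close>
  define P :: "(complex \<Rightarrow> real) \<Rightarrow> bool"
    where "P h \<longleftrightarrow> continuous_on (sphere 0 1) h \<and>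
       (\<forall>\<phi>. trig_annihilates f \<phi> \<longrightarrow> trig_annihilates f (\<lambda>x. \<phi> x * h (cis x)))" for h
  have meas: "(\<lambda>x. h (cis x)) \<in> borel_measurable borel" if "continuous_on (sphere 0 1) h" for h :: "complex \<Rightarrow> real"
    by (intro borel_measurable_continuous_onI continuous_on_compose2[OF that cis_cont]) auto
  have bdd: "\<exists>C. \<forall>x. \<bar>h (cis x)\<bar> \<le> C" if "continuous_on (sphere 0 1) h" for h :: "complex \<Rightarrow> real"
  proof -
    have "bounded (h ` sphere 0 1)"
      by (intro compact_imp_bounded compact_continuous_image that) auto
    then show ?thesis unfolding bounded_iff by (metis cis_S imageI real_norm_def)
  qed
  have Re: "P Re" and Im: "P Im"
    using trig_annihilates_cos_sin[OF f] by (auto simp: P_def intro!: continuous_intros)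
  have int: "integrable circle_measure (\<lambda>x. f x * \<phi> x * c x)"
    if "trig_annihilates f \<phi>" "c \<in> borel_measurable borel" "\<And>x. \<bar>c x\<bar> \<le> B" for \<phi> c B
  proof -
    from that(1) obtain D where "\<And>x. \<bar>\<phi> x\<bar> \<le> D" "\<phi> \<in> borel_measurable borel"
      unfolding trig_annihilates_def by blast
    then show ?thesis
      using that by (intro integrable_mult_bounded[where C = B] integrable_mult_bounded[where C = D] f) auto
  qed
  have const: "P (\<lambda>_. c)" for c
    unfolding P_def
  proof (intro conjI allI impI)
    fix \<phi> assume A: "trig_annihilates f \<phi>"
    then obtain D where D: "\<And>x. \<bar>\<phi> x\<bar> \<le> D" by (auto simp: trig_annihilates_def)
    have eq: "f x * (\<phi> x * c) * h = c * (f x * \<phi> x * h)" for x h by simp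
    have "\<bar>\<phi> x * c\<bar> \<le> D * \<bar>c\<bar>" for x
      using D[of x] by (simp add: abs_mult mult_right_mono)
    then show "trig_annihilates f (\<lambda>x. \<phi> x * c)"
      using A unfolding trig_annihilates_def eq by auto
  qed auto
  have add: "P (\<lambda>x. h x + k x)" if "P h" "P k" for h k
    unfolding P_def
  proof (intro conjI allI impI)
    fix \<phi> assume A: "trig_annihilates f \<phi>"
    have 1: "trig_annihilates f (\<lambda>x. \<phi> x * h (cis x))" and 2: "trig_annihilates f (\<lambda>x. \<phi> x * k (cis x))"
      using that A by (auto simp: P_def)
    obtain D E where "\<And>x. \<bar>\<phi> x * h (cis x)\<bar> \<le> D" "\<And>x. \<bar>\<phi> x * k (cis x)\<bar> \<le> E"
      using 1 2 by (auto simp: trig_annihilates_def)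
    then have "\<bar>\<phi> x * (h (cis x) + k (cis x))\<bar> \<le> D + E" for x
      unfolding distrib_left by (meson abs_triangle_ineq add_mono order_trans)
    moreover have eq: "f x * (\<phi> x * (h (cis x) + k (cis x))) * c =
       f x * (\<phi> x * h (cis x)) * c + f x * (\<phi> x * k (cis x)) * c" for x c
      by (simp add: algebra_simps)
    moreover note i = int[OF 1, of "\<lambda>x. cos (c * x)" 1 for c] int[OF 1, of "\<lambda>x. sin (c * x)" 1 for c]
      int[OF 2, of "\<lambda>x. cos (c * x)" 1 for c] int[OF 2, of "\<lambda>x. sin (c * x)" 1 for c]
    note m1 = 1[unfolded trig_annihilates_def] and m2 = 2[unfolded trig_annihilates_def]
    have "(\<lambda>x. \<phi> x * (h (cis x) + k (cis x))) \<in> borel_measurable borel"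
      unfolding distrib_left by (intro borel_measurable_add conjunct1[OF m1] conjunct1[OF m2])
    moreover have "(\<integral>x. f x * (\<phi> x * (h (cis x) + k (cis x))) * cos (of_int l * x) \<partial>circle_measure) = 0" for l
      unfolding eq using m1[THEN conjunct2, THEN conjunct2, rule_format, of l] m2[THEN conjunct2, THEN conjunct2, rule_format, of l]
      by (subst Bochner_Integration.integral_add) (auto intro!: i)
    moreover have "(\<integral>x. f x * (\<phi> x * (h (cis x) + k (cis x))) * sin (of_int l * x) \<partial>circle_measure) = 0" for l
      unfolding eq using m1[THEN conjunct2, THEN conjunct2, rule_format, of l] m2[THEN conjunct2, THEN conjunct2, rule_format, of l]
      by (subst Bochner_Integration.integral_add) (auto intro!: i)
    ultimately show "trig_annihilates f (\<lambda>x. \<phi> x * (h (cis x) + k (cis x)))"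
      unfolding trig_annihilates_def by blast
  qed (use that in \<open>auto simp: P_def intro!: continuous_intros\<close>)
  have mult: "P (\<lambda>x. h x * k x)" if "P h" "P k" for h k
    using that unfolding P_def by (auto simp flip: mult.assoc intro!: continuous_intros)
  have approx: "\<exists>h. P h \<and> (\<forall>x\<in>sphere 0 1. \<bar>g x - h x\<bar> < e)" if "e > 0" for e
  proof (rule Stone_Weierstrass_HOL[where S = "sphere 0 1" and P = P])
    fix x y :: complex assume "x \<in> sphere 0 1 \<and> y \<in> sphere 0 1 \<and> x \<noteq> y"
    then show "\<exists>f. P f \<and> f x \<noteq> f y"
      using Re Im by (auto simp: complex_eq_iff)
  qed (use const add mult g that in \<open>auto simp: P_def\<close>)
  have "\<bar>\<integral>x. f x * g (cis x) \<partial>circle_measure\<bar> \<le> e * (\<integral>x. \<bar>f x\<bar> \<partial>circle_measure)" if e: "e > 0" for e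
  proof -
    obtain h where h: "P h" "\<And>x. x \<in> sphere 0 1 \<Longrightarrow> \<bar>g x - h x\<bar> < e"
      using approx[OF e] by blast
    have ch: "continuous_on (sphere 0 1) h" using h by (simp add: P_def)
    have "trig_annihilates f (\<lambda>x. h (cis x))"
      using h(1) 1 unfolding P_def by force
    then have "(\<integral>x. f x * h (cis x) \<partial>circle_measure) = 0"
      unfolding trig_annihilates_def by (elim conjE allE[of _ "0::int"]) simp
    moreover have ig: "integrable circle_measure (\<lambda>x. f x * k (cis x))" if "continuous_on (sphere 0 1) k" for k
      using bdd[OF that] meas[OF that] f by (auto intro!: integrable_mult_bounded)
    ultimately have "(\<integral>x. f x * g (cis x) \<partial>circle_measure) = (\<integral>x. f x * (g (cis x) - h (cis x)) \<partial>circle_measure)"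
      by (simp add: right_diff_distrib ig[OF g] ig[OF ch])
    also have "\<bar>\<dots>\<bar> \<le> (\<integral>x. \<bar>f x * (g (cis x) - h (cis x))\<bar> \<partial>circle_measure)"
      using integral_norm_bound[of circle_measure "\<lambda>x. f x * (g (cis x) - h (cis x))"] by simp
    also have "\<dots> \<le> (\<integral>x. e * \<bar>f x\<bar> \<partial>circle_measure)"
    proof (rule integral_mono)
      show "integrable circle_measure (\<lambda>x. \<bar>f x * (g (cis x) - h (cis x))\<bar>)"
        by (simp add: right_diff_distrib ig[OF g] ig[OF ch] integrable_abs)
      show "\<bar>f x * (g (cis x) - h (cis x))\<bar> \<le> e * \<bar>f x\<bar>" for x
        using mult_right_mono[OF less_imp_le[OF h(2)[of "cis x"]], of "\<bar>f x\<bar>"]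
        by (simp add: abs_mult mult.commute)
    qed (use f in auto)
    finally show ?thesis by simp
  qed
  note bound = this
  have "((\<lambda>e. e * (\<integral>x. \<bar>f x\<bar> \<partial>circle_measure)) \<longlongrightarrow> 0 * (\<integral>x. \<bar>f x\<bar> \<partial>circle_measure)) (at_right 0)"
    by (intro tendsto_intros)
  then have "\<bar>\<integral>x. f x * g (cis x) \<partial>circle_measure\<bar> \<le> 0"
    by (intro tendsto_lowerbound[of "\<lambda>e. e * (\<integral>x. \<bar>f x\<bar> \<partial>circle_measure)" _ "at_right 0"])
      (auto simp: eventually_at_filter intro!: always_eventually bound)
  then show ?thesis by simp
qed

text \<open>A Borel left inverse of \<open>cis\<close> on [0, 2 pi). The clamp keeps the argument of
  \<open>arccos\<close> in its domain for every complex number, so that part is continuous on the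
  whole plane.\<close>

definition circle_arg :: "complex \<Rightarrow> real" where
  "circle_arg z = (let c = arccos (max (-1) (min 1 (Re z))) in if Im z \<ge> 0 then c else 2 * pi - c)"

lemma circle_arg_measurable [measurable]: "circle_arg \<in> borel_measurable borel"
proof -
  have "continuous_on UNIV (\<lambda>z. arccos (max (-1) (min 1 (Re z))))"
    by (intro continuous_on_compose2[OF continuous_on_arccos'] continuous_intros) auto
  then have [measurable]: "(\<lambda>z. arccos (max (-1) (min 1 (Re z)))) \<in> borel_measurable borel"
    by (rule borel_measurable_continuous_onI)
  show ?thesis unfolding circle_arg_def Let_def by measurable
qed

lemma circle_arg_cis:
  assumes "0 \<le> x" "x < 2 * pi" shows "circle_arg (cis x) = x"
proof (cases "x \<le> pi")
  case True
  then show ?thesis using assms sin_ge_zero[of x] by (simp add: circle_arg_def arccos_cos)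
next
  case False
  then have "sin x < 0" using assms sin_lt_zero[of x] by simp
  moreover have "arccos (cos x) = 2 * pi - x"
    using arccos_cos[of "2 * pi - x"] assms False by (simp add: cos_diff)
  ultimately show ?thesis by (simp add: circle_arg_def)
qed

lemma AE_circle_lt: "AE x in circle_measure. 0 \<le> x \<and> x < 2 * pi"
proof -
  have "AE x in lborel. x \<noteq> 2 * pi" by (rule AE_lborel_singleton)
  then show ?thesis unfolding circle_measure_def
    by (subst AE_restrict_space_iff) auto
qed

text \<open>Indicators of closed sets are limits of continuous functions, and Dynkin's lemma leads
  on to all Borel sets of the circle; applied to the set where \<open>f\<close> is positive, this
  kills the positive part. A one-sided conclusion is enough because it can be applied to
  \<open>f\<close> and to its negative.\<close>

lemma trig_annihilates_1_imp_nonpos: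
  assumes f: "integrable circle_measure f" and 1: "trig_annihilates f (\<lambda>_. 1)"
  shows "AE x in circle_measure. f x \<le> 0"
proof -
  have int: "integrable circle_measure (\<lambda>x. f x * indicator A (cis x))" if "A \<in> sets borel" for A
    using that f by (intro integrable_mult_bounded[where C = 1] borel_measurable_circle)
      (auto intro!: measurable_compose[OF borel_measurable_continuous_onI[of cis]] continuous_intros
        simp: indicator_def)
  have closed: "(\<integral>x. f x * indicator K (cis x) \<partial>circle_measure) = 0" if K: "closed K" for K
  proof (cases "K = {}")
    case False
    let ?g = "\<lambda>n z. max 0 (1 - real n * infdist z K)"
    have "(\<lambda>n. \<integral>x. f x * ?g n (cis x) \<partial>circle_measure) \<longlonglongrightarrow> (\<integral>x. f x * indicator K (cis x) \<partial>circle_measure)"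
    proof (rule integral_dominated_convergence[where w = "\<lambda>x. \<bar>f x\<bar>"])
      show "AE x in circle_measure. (\<lambda>n. f x * ?g n (cis x)) \<longlonglongrightarrow> f x * indicator K (cis x)"
      proof (intro AE_I2 tendsto_mult tendsto_const)
        fix x
        show "(\<lambda>n. ?g n (cis x)) \<longlonglongrightarrow> indicator K (cis x)"
        proof (cases "cis x \<in> K")
          case True then show ?thesis by simp
        next
          case F: False
          then have pos: "infdist (cis x) K > 0"
            using in_closed_iff_infdist_zero[OF K False] infdist_nonneg[of "cis x" K] by force
          obtain N where N: "real N > 1 / infdist (cis x) K" using reals_Archimedean2 by blast
          have "\<forall>\<^sub>F n in sequentially. ?g n (cis x) = 0"
            using eventually_ge_at_top[of N]
          proof eventually_elim
            case (elim n)
            then have "real n > 1 / infdist (cis x) K" using N by linarith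
            then show ?case using pos by (simp add: field_simps)
          qed
          then show ?thesis using F by (simp add: tendsto_eventually)
        qed
      qed
      show "\<And>n. (\<lambda>x. f x * ?g n (cis x)) \<in> borel_measurable circle_measure"
        by (intro borel_measurable_times borel_measurable_integrable[OF f] borel_measurable_circle
            borel_measurable_continuous_onI continuous_intros)
      show "AE x in circle_measure. norm (f x * ?g n (cis x)) \<le> \<bar>f x\<bar>" for n
        by (auto simp: abs_mult infdist_nonneg intro!: AE_I2 mult_left_le)
    qed (use f int[of K] K in auto)
    moreover have "(\<integral>x. f x * ?g n (cis x) \<partial>circle_measure) = 0" for n
      by (rule trig_annihilates_1_imp_continuous[OF f 1]) (intro continuous_intros)
    ultimately show ?thesis by (simp add: LIMSEQ_const_iff)
  qed simp
  have all: "(\<integral>x. f x * indicator A (cis x) \<partial>circle_measure) = 0" if "A \<in> sets borel" for A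
  proof -
    have "Int_stable (Collect closed :: complex set set)" "Collect closed \<subseteq> Pow (UNIV :: complex set)"
      "A \<in> sigma_sets UNIV (Collect closed)"
      using that by (auto simp: Int_stable_def borel_eq_closed sets_measure_of_conv)
    then show ?thesis
    proof (induction A rule: sigma_sets_induct_disjoint)
      case (compl A)
      have "A \<in> sets borel" using compl by (simp add: borel_eq_closed sets_measure_of_conv)
      moreover have "f x * indicator (UNIV - A) (cis x) = f x * indicator UNIV (cis x) - f x * indicator A (cis x)" for x
        by (auto simp: indicator_def)
      ultimately show ?case
        using compl closed[of UNIV] int[of A] int[of UNIV] by simp
    next
      case (union A)
      have A: "A i \<in> sets borel" for i using union by (auto simp: borel_eq_closed sets_measure_of_conv)
      have "(\<lambda>n. \<integral>x. (\<Sum>i<n. f x * indicator (A i) (cis x)) \<partial>circle_measure)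
          \<longlonglongrightarrow> (\<integral>x. f x * indicator (\<Union>i. A i) (cis x) \<partial>circle_measure)"
      proof (rule integral_dominated_convergence[where w = "\<lambda>x. \<bar>f x\<bar>"])
        show "AE x in circle_measure. (\<lambda>n. \<Sum>i<n. f x * indicator (A i) (cis x)) \<longlonglongrightarrow> f x * indicator (\<Union>i. A i) (cis x)"
        proof (intro AE_I2)
          fix x
          have "(\<lambda>i. indicator (A i) (cis x) :: real) sums indicator (\<Union>i. A i) (cis x)"
            by (rule indicator_sums) (use union in \<open>auto simp: disjoint_family_on_def\<close>)
          from sums_mult[OF this, of "f x"]
          show "(\<lambda>n. \<Sum>i<n. f x * indicator (A i) (cis x)) \<longlonglongrightarrow> f x * indicator (\<Union>i. A i) (cis x)"
            unfolding sums_def .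
        qed
        show "AE x in circle_measure. norm (\<Sum>i<n. f x * indicator (A i) (cis x)) \<le> \<bar>f x\<bar>" for n
        proof (intro AE_I2)
          fix x
          have "(\<Sum>i<n. indicator (A i) (cis x) :: real) = indicator (\<Union>i<n. A i) (cis x)"
            by (rule indicator_UN_disjoint[symmetric])
              (use union in \<open>auto simp: disjoint_family_on_def\<close>)
          then have "(\<Sum>i<n. f x * indicator (A i) (cis x)) = f x * indicator (\<Union>i<n. A i) (cis x)"
            by (simp flip: sum_distrib_left)
          then show "norm (\<Sum>i<n. f x * indicator (A i) (cis x)) \<le> \<bar>f x\<bar>"
            by (simp only:) (simp add: abs_mult indicator_def)
        qed
        show "(\<lambda>x. f x * indicator (\<Union>i. A i) (cis x)) \<in> borel_measurable circle_measure"
          by (intro borel_measurable_integrable[OF int] sets.countable_UN) (use A in blast)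
        show "(\<lambda>x. \<Sum>i<n. f x * indicator (A i) (cis x)) \<in> borel_measurable circle_measure" for n
          by (intro borel_measurable_sum borel_measurable_integrable[OF int[OF A]])
        show "integrable circle_measure (\<lambda>x. \<bar>f x\<bar>)" using f by (rule integrable_abs)
      qed
      moreover have "(\<integral>x. (\<Sum>i<n. f x * indicator (A i) (cis x)) \<partial>circle_measure) = 0" for n
        by (subst Bochner_Integration.integral_sum[OF int[OF A]]) (simp add: union)
      ultimately show ?case by (simp add: LIMSEQ_const_iff)
    qed (auto simp: closed)
  qed
  \<comment> \<open>\<open>f\<close> is measurable on the restricted space only; its extension by
    zero is Borel on the line, which makes \<open>A\<close> a Borel set of the plane.\<close>
  define f' where "f' x = indicator {0..2*pi} x *\<^sub>R f x" for x
  have [measurable]: "f' \<in> borel_measurable borel"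
    using borel_measurable_integrable[OF f]
    unfolding f'_def circle_measure_def by (subst (asm) borel_measurable_restrict_space_iff) auto
  define A where "A = {z. f' (circle_arg z) > 0}"
  have A: "A \<in> sets borel" unfolding A_def by measurable
  have "(\<integral>x. max 0 (f x) \<partial>circle_measure) = (\<integral>x. f x * indicator A (cis x) \<partial>circle_measure)"
  proof (rule integral_cong_AE)
    show "AE x in circle_measure. max 0 (f x) = f x * indicator A (cis x)"
      using AE_circle_lt
      by eventually_elim (auto simp: A_def circle_arg_cis f'_def indicator_def)
  qed (intro borel_measurable_max borel_measurable_const borel_measurable_integrable[OF f] borel_measurable_integrable[OF int[OF A]])+
  with all[OF A] have "(\<integral>x. max 0 (f x) \<partial>circle_measure) = 0" by simp
  then have "AE x in circle_measure. max 0 (f x) = 0"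
    using integral_nonneg_eq_0_iff_AE[OF integrable_max[OF integrable_zero f]] by simp
  then show ?thesis by eventually_elim simp
qed

lemma trig_complete:
  assumes "circle_integral u = 0" and "\<And>k. k \<noteq> 0 \<Longrightarrow> inner u (basis_fun k) = 0"
  shows "u = 0"
proof (cases u)
  fix f assume sq: "square_integrable f" and u: "u = L2 f"
  have f: "integrable circle_measure f" by (rule square_integrable_integrable[OF sq])
  have *: "(\<integral>x. f x * bfun k x \<partial>circle_measure) = 0" if "k \<noteq> 0" for k
    using assms(2)[OF that] by (simp add: u basis_fun_L2 L2_inner sq)
  have c1: "(\<integral>x. f x * cos (of_int k * x) \<partial>circle_measure) = 0" if "k \<ge> 1" for k
    using *[of k] that by (simp add: bfun_alt)
  have s1: "(\<integral>x. f x * sin (of_int k * x) \<partial>circle_measure) = 0" if "k < 0" for k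
    using *[of k] that by (simp add: bfun_alt)
  have c: "(\<integral>x. f x * cos (of_int k * x) \<partial>circle_measure) = 0" for k
    using c1[of k] c1[of "-k"] assms(1) u sq
    by (cases "k \<ge> 1"; cases "k = 0") (auto simp: circle_integral_L2)
  have s: "(\<integral>x. f x * sin (of_int k * x) \<partial>circle_measure) = 0" for k
    using s1[of k] s1[of "-k"]
    by (cases "k < 0"; cases "k = 0") auto
  have "AE x in circle_measure. f x \<le> 0"
    by (rule trig_annihilates_1_imp_nonpos[OF f])
      (auto simp: trig_annihilates_def c s intro!: exI[of _ 1])
  moreover have "AE x in circle_measure. - f x \<le> 0"
    by (rule trig_annihilates_1_imp_nonpos)
      (auto simp: trig_annihilates_def c s f intro!: exI[of _ 1])
  ultimately have "AE x in circle_measure. f x = 0"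
    by eventually_elim simp
  then show ?thesis
    unfolding u L2_zero by (subst L2_eq_iff) (auto simp: sq)
qed

section \<open>Coordinates and orthonormal expansions\<close>

abbreviation coord :: "l2_circle \<Rightarrow> int \<Rightarrow> real" where
  "coord u k \<equiv> inner u (basis_fun k)"

text \<open>Symmetric under change of sign, so that the cosine and the sine of a frequency are kept
  or dropped together; this matters whenever real coordinates are exchanged for complex Fourier
  coefficients.\<close>

definition freqs :: "nat \<Rightarrow> int set" where
  "freqs n = {k. k \<noteq> 0 \<and> \<bar>k\<bar> \<le> int n}"

lemma finite_freqs [simp, intro]: "finite (freqs n)"
  by (rule finite_subset[of _ "{- int n..int n}"]) (auto simp: freqs_def)

lemma freqs_nonzero: "k \<in> freqs n \<Longrightarrow> k \<noteq> 0"
  by (simp add: freqs_def)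

lemma zero_notin_freqs [simp]: "0 \<notin> freqs n"
  by (simp add: freqs_def)

lemma freqs_subset: "freqs n \<subseteq> nonzero_ints"
  by (auto simp: freqs_def)

lemma freqs_mono: "m \<le> n \<Longrightarrow> freqs m \<subseteq> freqs n"
  by (auto simp: freqs_def)

lemma minus_mem_freqs [simp]: "- k \<in> freqs n \<longleftrightarrow> k \<in> freqs n"
  by (auto simp: freqs_def)

lemma finite_subset_freqs:
  assumes "finite X" "X \<subseteq> nonzero_ints"
  obtains n where "X \<subseteq> freqs n"
proof
  show "X \<subseteq> freqs (nat (Max (insert 0 (abs ` X))))"
  proof
    fix k assume k: "k \<in> X"
    then have "\<bar>k\<bar> \<le> Max (insert 0 (abs ` X))" using assms by (intro Max_ge) auto
    then show "k \<in> freqs (nat (Max (insert 0 (abs ` X))))" using assms k by (auto simp: freqs_def)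
  qed
qed

lemma filterlim_freqs: "filterlim freqs (finite_subsets_at_top nonzero_ints) sequentially"
  unfolding filterlim_finite_subsets_at_top
proof (intro allI impI)
  fix X :: "int set" assume X: "finite X \<and> X \<subseteq> nonzero_ints"
  then obtain n where n: "X \<subseteq> freqs n" using finite_subset_freqs by blast
  show "\<forall>\<^sub>F y in sequentially. finite (freqs y) \<and> X \<subseteq> freqs y \<and> freqs y \<subseteq> nonzero_ints"
    using eventually_ge_at_top[of n]
    by eventually_elim (use n freqs_mono freqs_subset in blast)
qed

lemma has_sum_imp_tendsto_freqs: "(f has_sum s) nonzero_ints \<Longrightarrow> (\<lambda>n. sum f (freqs n)) \<longlonglongrightarrow> s"
  unfolding has_sum_def by (rule filterlim_compose[OF _ filterlim_freqs])

lemma coord_sum: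
  assumes "finite F" "0 \<notin> F" "l \<noteq> 0"
  shows "coord (\<Sum>k\<in>F. c k *\<^sub>R basis_fun k) l = (if l \<in> F then c l else 0)"
proof -
  have "coord (\<Sum>k\<in>F. c k *\<^sub>R basis_fun k) l = (\<Sum>k\<in>F. if k = l then c k else 0)"
    unfolding inner_sum_left inner_scaleR_left
  proof (intro sum.cong refl)
    fix k assume "k \<in> F"
    then have "k \<noteq> 0" using assms by metis
    then show "c k * coord (basis_fun k) l = (if k = l then c k else 0)"
      using assms by (simp add: inner_basis_fun)
  qed
  then show ?thesis using assms by simp
qed

lemma norm_sum_basis:
  assumes "finite F" "0 \<notin> F"
  shows "(norm (\<Sum>k\<in>F. c k *\<^sub>R basis_fun k))\<^sup>2 = (\<Sum>k\<in>F. (c k)\<^sup>2)"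
proof -
  have "(norm (\<Sum>k\<in>F. c k *\<^sub>R basis_fun k))\<^sup>2 = (\<Sum>l\<in>F. c l * coord (\<Sum>k\<in>F. c k *\<^sub>R basis_fun k) l)"
    by (simp add: power2_norm_eq_inner inner_sum_right)
  also have "\<dots> = (\<Sum>k\<in>F. (c k)\<^sup>2)"
    using assms by (intro sum.cong refl) (subst coord_sum; auto simp: power2_eq_square)
  finally show ?thesis .
qed

definition l2seq :: "(int \<Rightarrow> real) \<Rightarrow> bool" where
  "l2seq c \<longleftrightarrow> (\<lambda>k. (c k)\<^sup>2) summable_on nonzero_ints"

definition synth :: "(int \<Rightarrow> real) \<Rightarrow> l2_circle" where
  "synth c = (\<Sum>\<^sub>\<infinity>k\<in>nonzero_ints. c k *\<^sub>R basis_fun k)"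

lemma l2seqI:
  assumes "\<And>n. (\<Sum>k\<in>freqs n. (c k)\<^sup>2) \<le> B"
  shows "l2seq c"
  unfolding l2seq_def
proof (rule nonneg_bdd_above_summable_on)
  show "bdd_above (sum (\<lambda>k. (c k)\<^sup>2) ` {F. F \<subseteq> nonzero_ints \<and> finite F})"
  proof (rule bdd_aboveI2[of _ _ B])
    fix F assume F: "F \<in> {F. F \<subseteq> nonzero_ints \<and> finite F}"
    then obtain n where n: "F \<subseteq> freqs n" using finite_subset_freqs by blast
    have "(\<Sum>k\<in>F. (c k)\<^sup>2) \<le> (\<Sum>k\<in>freqs n. (c k)\<^sup>2)"
      by (rule sum_mono2) (use n in auto)
    also note assms
    finally show "(\<Sum>k\<in>F. (c k)\<^sup>2) \<le> B" .
  qed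
qed simp

text \<open>Pythagoras turns the tail of the convergent sum of squares into a Cauchy bound for the
  partial sums over all finite supersets of \<open>freqs n\<close>; with completeness this gives
  unordered convergence.\<close>

lemma has_sum_synth:
  assumes c: "l2seq c"
  shows "((\<lambda>k. c k *\<^sub>R basis_fun k) has_sum synth c) nonzero_ints"
proof -
  let ?S = "\<lambda>F. \<Sum>k\<in>F. c k *\<^sub>R basis_fun k"
  let ?q = "\<lambda>F. \<Sum>k\<in>F. (c k)\<^sup>2"
  define s where "s = (\<Sum>\<^sub>\<infinity>k\<in>nonzero_ints. (c k)\<^sup>2)"
  have s: "((\<lambda>k. (c k)\<^sup>2) has_sum s) nonzero_ints"
    using c unfolding l2seq_def s_def by (rule has_sum_infsum)
  have lim: "(\<lambda>n. ?q (freqs n)) \<longlonglongrightarrow> s" by (rule has_sum_imp_tendsto_freqs[OF s])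
  have le: "?q F \<le> s" if "finite F" "F \<subseteq> nonzero_ints" for F
    by (rule finite_sum_le_has_sum[OF s that]) simp
  have dist: "(norm (?S F - ?S (freqs n)))\<^sup>2 \<le> s - ?q (freqs n)"
    if "finite F" "F \<subseteq> nonzero_ints" "freqs n \<subseteq> F" for F n
  proof -
    have "?S F - ?S (freqs n) = ?S (F - freqs n)" using that by (simp add: sum_diff)
    then have "(norm (?S F - ?S (freqs n)))\<^sup>2 = ?q (F - freqs n)"
      using that norm_sum_basis[of "F - freqs n" c] by auto
    also have "\<dots> = ?q F - ?q (freqs n)" using that by (simp add: sum_diff)
    finally show ?thesis using le[OF that(1,2)] by simp
  qed
  have ex: "\<exists>n. s - ?q (freqs n) < e\<^sup>2" if "e > 0" for e :: real
  proof -
    have "\<forall>\<^sub>F n in sequentially. ?q (freqs n) > s - e\<^sup>2"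
      by (rule order_tendstoD[OF lim]) (use that in auto)
    from eventually_happens'[OF sequentially_bot this] show ?thesis by (auto simp: algebra_simps)
  qed
  have ex2: "\<exists>n. \<forall>F. finite F \<longrightarrow> F \<subseteq> nonzero_ints \<longrightarrow> freqs n \<subseteq> F \<longrightarrow> norm (?S F - ?S (freqs n)) < e"
    if e: "e > 0" for e :: real
  proof -
    obtain n where n: "s - ?q (freqs n) < e\<^sup>2" using ex[OF e] by blast
    show ?thesis
    proof (intro exI allI impI)
      fix F assume "finite F" "F \<subseteq> nonzero_ints" "freqs n \<subseteq> F"
      from dist[OF this] n have "(norm (?S F - ?S (freqs n)))\<^sup>2 < e\<^sup>2" by simp
      then show "norm (?S F - ?S (freqs n)) < e" using e by (intro power2_less_imp_less[of _ e]) auto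
    qed
  qed
  have "Cauchy (\<lambda>n. ?S (freqs n))"
  proof (rule metric_CauchyI)
    fix e :: real assume "e > 0"
    then obtain n where n: "\<And>F. finite F \<Longrightarrow> F \<subseteq> nonzero_ints \<Longrightarrow> freqs n \<subseteq> F \<Longrightarrow> norm (?S F - ?S (freqs n)) < e/2"
      using ex2[of "e/2"] by auto
    show "\<exists>M. \<forall>m\<ge>M. \<forall>k\<ge>M. dist (?S (freqs m)) (?S (freqs k)) < e"
    proof (intro exI[of _ n] allI impI)
      fix m k assume "n \<le> m" "n \<le> k"
      then show "dist (?S (freqs m)) (?S (freqs k)) < e"
        unfolding dist_norm
        by (intro norm_triangle_half_l[OF n[OF finite_freqs freqs_subset freqs_mono] n[OF finite_freqs freqs_subset freqs_mono]])
    qed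
  qed
  then obtain v where v: "(\<lambda>n. ?S (freqs n)) \<longlonglongrightarrow> v"
    using Cauchy_convergent convergent_def by blast
  have "((\<lambda>k. c k *\<^sub>R basis_fun k) has_sum v) nonzero_ints"
    unfolding has_sum_def tendsto_iff
  proof (intro allI impI)
    fix e :: real assume e: "e > 0"
    then obtain n where n: "\<And>F. finite F \<Longrightarrow> F \<subseteq> nonzero_ints \<Longrightarrow> freqs n \<subseteq> F \<Longrightarrow> norm (?S F - ?S (freqs n)) < e/2"
      using ex2[of "e/2"] by auto
    have "norm (v - ?S (freqs n)) \<le> e/2"
    proof (rule tendsto_upperbound)
      show "(\<lambda>m. norm (?S (freqs m) - ?S (freqs n))) \<longlonglongrightarrow> norm (v - ?S (freqs n))"
        by (intro tendsto_intros v)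
      show "\<forall>\<^sub>F i in sequentially. norm (?S (freqs i) - ?S (freqs n)) \<le> e / 2"
        using eventually_ge_at_top[of n]
        by eventually_elim (intro less_imp_le[OF n[OF finite_freqs freqs_subset freqs_mono]])
    qed simp
    note v' = this
    show "\<forall>\<^sub>F F in finite_subsets_at_top nonzero_ints. dist (?S F) v < e"
      unfolding eventually_finite_subsets_at_top
    proof (intro exI[of _ "freqs n"] conjI allI impI)
      fix F assume F: "finite F \<and> freqs n \<subseteq> F \<and> F \<subseteq> nonzero_ints"
      have "dist (?S F) v \<le> norm (?S F - ?S (freqs n)) + norm (v - ?S (freqs n))"
        using norm_triangle_ineq4[of "?S F - ?S (freqs n)" "v - ?S (freqs n)"] by (simp add: dist_norm)
      also have "\<dots> < e/2 + e/2" using F n[of F] v' by (intro add_less_le_mono) auto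
      finally show "dist (?S F) v < e" by simp
    qed (auto simp: freqs_subset)
  qed
  then show ?thesis unfolding synth_def using infsumI by fastforce
qed

lemma coord_synth:
  assumes "l2seq c" "l \<noteq> 0" shows "coord (synth c) l = c l"
proof -
  have "(\<lambda>n. coord (\<Sum>k\<in>freqs n. c k *\<^sub>R basis_fun k) l) \<longlonglongrightarrow> coord (synth c) l"
    by (intro tendsto_intros has_sum_imp_tendsto_freqs has_sum_synth assms)
  moreover have "\<forall>\<^sub>F n in sequentially. coord (\<Sum>k\<in>freqs n. c k *\<^sub>R basis_fun k) l = c l"
    using eventually_ge_at_top[of "nat \<bar>l\<bar>"]
  proof eventually_elim
    case (elim n)
    then have "l \<in> freqs n" using assms by (auto simp: freqs_def)
    then show ?case using assms by (subst coord_sum) auto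
  qed
  ultimately show ?thesis
    using LIMSEQ_unique[OF _ tendsto_eventually] by blast
qed

lemma circle_integral_tendsto: "X \<longlonglongrightarrow> u \<Longrightarrow> (\<lambda>n. circle_integral (X n)) \<longlonglongrightarrow> circle_integral u"
  unfolding circle_integral_inner by (intro tendsto_intros)

lemma circle_integral_add [simp]: "circle_integral (u + v) = circle_integral u + circle_integral v"
  and circle_integral_diff [simp]: "circle_integral (u - v) = circle_integral u - circle_integral v"
  and circle_integral_scale [simp]: "circle_integral (c *\<^sub>R u) = c * circle_integral u"
  and circle_integral_sum: "circle_integral (\<Sum>i\<in>A. g i) = (\<Sum>i\<in>A. circle_integral (g i))"
  and circle_integral_zero [simp]: "circle_integral 0 = 0"
  unfolding circle_integral_inner by (simp_all add: inner_add_left inner_diff_left inner_sum_left)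

lemma mean_zero_sum: "0 \<notin> F \<Longrightarrow> (\<Sum>k\<in>F. c k *\<^sub>R basis_fun k) \<in> mean_zero"
  unfolding mean_zero_def circle_integral_sum mem_Collect_eq
  by (intro sum.neutral ballI) (metis circle_integral_scale circle_integral_basis_fun mult_zero_right)

lemma mean_zero_closed: "X \<longlonglongrightarrow> u \<Longrightarrow> (\<And>n. X n \<in> mean_zero) \<Longrightarrow> u \<in> mean_zero"
  using circle_integral_tendsto[of X u] by (simp add: mean_zero_def LIMSEQ_const_iff)

lemma mean_zero_synth: "l2seq c \<Longrightarrow> synth c \<in> mean_zero"
  using has_sum_imp_tendsto_freqs[OF has_sum_synth, of c]
  by (rule mean_zero_closed) (auto intro: mean_zero_sum)

lemma has_sum_norm_synth:
  assumes "l2seq c"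
  shows "((\<lambda>k. (c k)\<^sup>2) has_sum (norm (synth c))\<^sup>2) nonzero_ints"
proof -
  obtain s where s: "((\<lambda>k. (c k)\<^sup>2) has_sum s) nonzero_ints"
    using assms by (auto simp: l2seq_def summable_on_def)
  have "(\<lambda>n. (norm (\<Sum>k\<in>freqs n. c k *\<^sub>R basis_fun k))\<^sup>2) \<longlonglongrightarrow> (norm (synth c))\<^sup>2"
    by (intro tendsto_intros has_sum_imp_tendsto_freqs has_sum_synth assms)
  then have "(\<lambda>n. \<Sum>k\<in>freqs n. (c k)\<^sup>2) \<longlonglongrightarrow> (norm (synth c))\<^sup>2"
    by (simp add: norm_sum_basis)
  with has_sum_imp_tendsto_freqs[OF s] have "s = (norm (synth c))\<^sup>2" by (rule LIMSEQ_unique)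
  with s show ?thesis by simp
qed

text \<open>Completeness of the system in its working form: identities between operators on
  mean-zero elements are checked coordinate by coordinate.\<close>

lemma coord_eqI:
  assumes "u \<in> mean_zero" "v \<in> mean_zero" "\<And>k. k \<noteq> 0 \<Longrightarrow> coord u k = coord v k"
  shows "u = v"
  using trig_complete[of "u - v"] assms by (simp add: mean_zero_def inner_diff_left)

definition proj :: "nat \<Rightarrow> l2_circle \<Rightarrow> l2_circle" where
  "proj n u = (\<Sum>k\<in>freqs n. coord u k *\<^sub>R basis_fun k)"

lemma coord_proj: "l \<noteq> 0 \<Longrightarrow> coord (proj n u) l = (if l \<in> freqs n then coord u l else 0)"
  unfolding proj_def by (rule coord_sum) auto

lemma bessel: "(\<Sum>k\<in>freqs n. (coord u k)\<^sup>2) \<le> (norm u)\<^sup>2"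
proof -
  let ?p = "proj n u" and ?s = "\<Sum>k\<in>freqs n. (coord u k)\<^sup>2"
  have 1: "inner ?p u = ?s"
    unfolding proj_def by (simp add: inner_sum_left power2_eq_square inner_commute[of "basis_fun _"])
  have 2: "inner ?p ?p = ?s"
    using norm_sum_basis[of "freqs n" "coord u", folded proj_def] by (simp add: power2_norm_eq_inner)
  have "0 \<le> inner (u - ?p) (u - ?p)" by simp
  also have "\<dots> = (norm u)\<^sup>2 - ?s"
    using 1 2 by (simp add: inner_diff_left inner_diff_right inner_commute[of u ?p] power2_norm_eq_inner)
  finally show ?thesis by simp
qed

lemma l2seq_coord: "l2seq (coord u)"
  by (rule l2seqI[OF bessel])

lemma synth_coord: "u \<in> mean_zero \<Longrightarrow> synth (coord u) = u"
  by (rule coord_eqI) (auto simp: mean_zero_synth coord_synth l2seq_coord)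

lemma proj_tendsto: "u \<in> mean_zero \<Longrightarrow> (\<lambda>n. proj n u) \<longlonglongrightarrow> u"
  using has_sum_imp_tendsto_freqs[OF has_sum_synth[OF l2seq_coord[of u]]]
  by (simp add: synth_coord flip: proj_def)

lemma parseval: "u \<in> mean_zero \<Longrightarrow> ((\<lambda>k. (coord u k)\<^sup>2) has_sum (norm u)\<^sup>2) nonzero_ints"
  using has_sum_norm_synth[OF l2seq_coord[of u]] by (simp add: synth_coord)

lemma l2seq_cmult_bound:
  assumes "l2seq c" "\<And>k. k \<noteq> 0 \<Longrightarrow> \<bar>d k\<bar> \<le> C * \<bar>c k\<bar>"
  shows "l2seq d"
proof -
  obtain s where s: "((\<lambda>k. (c k)\<^sup>2) has_sum s) nonzero_ints"
    using assms(1) by (auto simp: l2seq_def summable_on_def)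
  show ?thesis
  proof (rule l2seqI)
    fix n
    have "(\<Sum>k\<in>freqs n. (d k)\<^sup>2) \<le> (\<Sum>k\<in>freqs n. C\<^sup>2 * (c k)\<^sup>2)"
    proof (rule sum_mono)
      fix k assume "k \<in> freqs n"
      then have "\<bar>d k\<bar> \<le> \<bar>C * c k\<bar>" using assms(2)[of k] abs_ge_self[of C]
        mult_right_mono[of C "\<bar>C\<bar>" "\<bar>c k\<bar>"] by (force simp: abs_mult)
      then show "(d k)\<^sup>2 \<le> C\<^sup>2 * (c k)\<^sup>2" by (simp add: abs_le_square_iff power_mult_distrib)
    qed
    also have "\<dots> = C\<^sup>2 * (\<Sum>k\<in>freqs n. (c k)\<^sup>2)" by (simp add: sum_distrib_left)
    also have "\<dots> \<le> C\<^sup>2 * s"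
      by (intro mult_left_mono finite_sum_le_has_sum[OF s]) (auto simp: freqs_subset)
    finally show "(\<Sum>k\<in>freqs n. (d k)\<^sup>2) \<le> C\<^sup>2 * s" .
  qed
qed

lemma bij_uminus_nonzero: "bij_betw uminus nonzero_ints nonzero_ints"
  by (rule bij_betwI[of _ _ _ uminus]) auto

lemma l2seq_uminus: "l2seq c \<Longrightarrow> l2seq (\<lambda>k. c (- k))"
  unfolding l2seq_def
  using summable_on_reindex_bij_betw[OF bij_uminus_nonzero, of "\<lambda>k. (c k)\<^sup>2"] by simp

section \<open>Fourier multipliers\<close>

lemma fourier_coeff_L2:
  assumes f: "square_integrable f"
  shows "fourier_coeff (L2 f) k = Complex (\<integral>x. f x * cos (of_int k * x) \<partial>circle_measure)
     (- (\<integral>x. f x * sin (of_int k * x) \<partial>circle_measure)) / (2 * pi)"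
proof -
  have i: "integrable circle_measure (\<lambda>x. f x * cos (of_int k * x))"
    "integrable circle_measure (\<lambda>x. f x * sin (of_int k * x))"
    by (intro square_integrable_mult f square_integrable_cos square_integrable_sin)+
  have "complex_of_real (f x) * exp (- (\<i> * of_int k * complex_of_real x))
      = complex_of_real (f x * cos (of_int k * x)) - \<i> * complex_of_real (f x * sin (of_int k * x))" for x
  proof -
    have "- (\<i> * of_int k * complex_of_real x) = \<i> * complex_of_real (- (of_int k * x))" by simp
    then have "exp (- (\<i> * of_int k * complex_of_real x)) = cis (- (of_int k * x))"
      by (simp only: cis_conv_exp)
    then show ?thesis by (simp add: complex_eq_iff)
  qed
  then have "(\<integral>x. complex_of_real (f x) * exp (- (\<i> * of_int k * complex_of_real x)) \<partial>circle_measure)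
    = (\<integral>x. complex_of_real (f x * cos (of_int k * x)) \<partial>circle_measure)
      - \<i> * (\<integral>x. complex_of_real (f x * sin (of_int k * x)) \<partial>circle_measure)"
    using i by (simp del: of_real_mult)
  also have "\<dots> = Complex (\<integral>x. f x * cos (of_int k * x) \<partial>circle_measure)
     (- (\<integral>x. f x * sin (of_int k * x) \<partial>circle_measure))"
    unfolding integral_complex_of_real by (simp add: complex_eq_iff)
  finally show ?thesis
    using f by (simp add: fourier_coeff.abs_eq)
qed

text \<open>For k >= 1 the basis elements of index k and - k are the cosine and the sine of the same
  frequency, so one complex coefficient carries both coordinates. Negative frequencies follow by
  conjugation, and frequency 0 is the mean.\<close>

lemma fourier_coeff_pos:
  assumes "k \<ge> 1"
  shows "fourier_coeff u k = (sqrt pi / (2 * pi)) *\<^sub>R Complex (coord u k) (- coord u (- k))"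
proof (cases u)
  fix f assume f: "square_integrable f" and u: "u = L2 f"
  have "coord u k = (\<integral>x. f x * cos (of_int k * x) \<partial>circle_measure) / sqrt pi"
    "coord u (- k) = (\<integral>x. f x * sin (of_int k * x) \<partial>circle_measure) / sqrt pi"
    using assms f by (auto simp: u basis_fun_L2 L2_inner bfun_alt)
  then show ?thesis
    using f by (simp add: u fourier_coeff_L2 complex_eq_iff Re_divide_of_real Im_divide_of_real del: of_real_mult)
qed

lemma fourier_coeff_uminus: "fourier_coeff u (- k) = cnj (fourier_coeff u k)"
  by (cases u) (simp add: fourier_coeff_L2 complex_eq_iff)

lemma fourier_coeff_0: "fourier_coeff u 0 = circle_integral u / (2 * pi)"
  by (cases u) (simp add: fourier_coeff_L2 circle_integral_L2 complex_eq_iff)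

lemma fourier_coeff_add: "fourier_coeff (u + v) k = fourier_coeff u k + fourier_coeff v k"
  and fourier_coeff_scale: "fourier_coeff (c *\<^sub>R u) k = c *\<^sub>R fourier_coeff u k"
proof -
  have pos: "fourier_coeff (u + v) k = fourier_coeff u k + fourier_coeff v k \<and>
    fourier_coeff (c *\<^sub>R u) k = c *\<^sub>R fourier_coeff u k" if "k \<ge> 1" for k
    using that by (simp add: fourier_coeff_pos inner_add_left complex_eq_iff algebra_simps)
  consider "k \<ge> 1" | "k = 0" | "- k \<ge> 1" by linarith
  then have "fourier_coeff (u + v) k = fourier_coeff u k + fourier_coeff v k \<and>
    fourier_coeff (c *\<^sub>R u) k = c *\<^sub>R fourier_coeff u k"
  proof cases
    case 2 then show ?thesis by (simp add: fourier_coeff_0 add_divide_distrib scaleR_conv_of_real)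
  next
    case 3 then show ?thesis using pos[of "-k"] fourier_coeff_uminus[of _ "-k"] by simp
  qed (use pos in auto)
  then show "fourier_coeff (u + v) k = fourier_coeff u k + fourier_coeff v k"
    "fourier_coeff (c *\<^sub>R u) k = c *\<^sub>R fourier_coeff u k" by auto
qed

lemma fourier_coeff_eqI:
  assumes "\<And>k. fourier_coeff u k = fourier_coeff v k"
  shows "u = v"
proof -
  have c: "coord u k = coord v k" "coord u (-k) = coord v (-k)" if "k \<ge> 1" for k
    using assms[of k] that by (auto simp: fourier_coeff_pos)
  have "coord u k = coord v k" if "k \<noteq> 0" for k
    using c(1)[of k] c(2)[of "-k"] that by (cases "k \<ge> 1") auto
  moreover have "circle_integral u = circle_integral v"
    using assms[of 0] unfolding fourier_coeff_0 by simp
  ultimately have "u - v = 0"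
    by (intro trig_complete) (auto simp: inner_diff_left)
  then show ?thesis by simp
qed

text \<open>The description has a value once a candidate exists; uniqueness is completeness of the
  trigonometric system. The operators below are computed by exhibiting a candidate, built with
  \<open>synth\<close>.\<close>

lemma fourier_multiplierI:
  assumes "\<And>k. fourier_coeff v k = \<sigma> k * fourier_coeff u k"
  shows "fourier_multiplier \<sigma> u = v"
  unfolding fourier_multiplier_def
  by (rule the_equality) (use assms in \<open>auto intro: fourier_coeff_eqI\<close>)

text \<open>The condition on conjugates says that the multiplier maps real functions to real
  functions; it reduces the claim to positive frequencies and the mean.\<close>

lemma multiplier_coordI:
  assumes "\<And>k. k \<ge> 1 \<Longrightarrow> Complex (coord v k) (- coord v (- k)) = \<sigma> k * Complex (coord u k) (- coord u (- k))"
    and "complex_of_real (circle_integral v) = \<sigma> 0 * circle_integral u" and "\<And>k. \<sigma> (- k) = cnj (\<sigma> k)"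
  shows "fourier_coeff v k = \<sigma> k * fourier_coeff u k"
proof -
  have pos: "fourier_coeff v k = \<sigma> k * fourier_coeff u k" if "k \<ge> 1" for k
    using assms(1)[OF that] that by (simp add: fourier_coeff_pos)
  consider "k \<ge> 1" | "k = 0" | "- k \<ge> 1" by linarith
  then show ?thesis
  proof cases
    case 2 then show ?thesis using assms(2) by (simp add: fourier_coeff_0)
  next
    case 3 then show ?thesis using pos[of "-k"] fourier_coeff_uminus[of _ "-k"] assms(3)[of "-k"] by simp
  qed (use pos in auto)
qed

lemma mean_zero_iff: "u \<in> mean_zero \<longleftrightarrow> circle_integral u = 0"
  by (simp add: mean_zero_def)

text \<open>Differentiation exchanges sine and cosine, hence the index \<open>- k\<close>. The
  hypothesis says that the derivative is again in L^2; otherwise the description behind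
  \<open>ddx\<close> is unspecified.\<close>

lemma
  assumes "l2seq (\<lambda>k. of_int k * coord u k)"
  shows ddx_eq: "ddx u = synth (\<lambda>k. of_int k * coord u (- k))"
    and fourier_coeff_ddx: "fourier_coeff (ddx u) k = \<i> * of_int k * fourier_coeff u k"
    and coord_ddx: "l \<noteq> 0 \<Longrightarrow> coord (ddx u) l = of_int l * coord u (- l)"
    and mean_zero_ddx: "ddx u \<in> mean_zero"
proof -
  let ?v = "synth (\<lambda>k. of_int k * coord u (- k))"
  have l: "l2seq (\<lambda>k. of_int k * coord u (- k))"
    using l2seq_uminus[OF assms] by (rule l2seq_cmult_bound[where C = 1]) auto
  have m: "?v \<in> mean_zero" by (rule mean_zero_synth[OF l])
  have c: "fourier_coeff ?v k = \<i> * of_int k * fourier_coeff u k" for k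
    by (rule multiplier_coordI) (use m in \<open>auto simp: coord_synth[OF l] complex_eq_iff mean_zero_iff\<close>)
  show eq: "ddx u = ?v" unfolding ddx_def by (rule fourier_multiplierI[OF c])
  show "fourier_coeff (ddx u) k = \<i> * of_int k * fourier_coeff u k" unfolding eq by (rule c)
  show "l \<noteq> 0 \<Longrightarrow> coord (ddx u) l = of_int l * coord u (- l)" unfolding eq by (simp add: coord_synth[OF l])
  show "ddx u \<in> mean_zero" unfolding eq by (rule m)
qed

lemma
  shows fourier_coeff_hilbert: "fourier_coeff (hilbert_transform u) k = - \<i> * of_int (sgn k) * fourier_coeff u k"
    and coord_hilbert: "l \<noteq> 0 \<Longrightarrow> coord (hilbert_transform u) l = - sgn (of_int l) * coord u (- l)"
    and mean_zero_hilbert: "hilbert_transform u \<in> mean_zero"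
proof -
  define v where "v = synth (\<lambda>k. - sgn (of_int k) * coord u (- k))"
  have l: "l2seq (\<lambda>k. - sgn (of_int k) * coord u (- k))"
    using l2seq_uminus[OF l2seq_coord] by (rule l2seq_cmult_bound[where C = 1]) (auto simp: abs_mult sgn_if)
  have m: "v \<in> mean_zero" unfolding v_def by (rule mean_zero_synth[OF l])
  have cv: "coord v k = - sgn (of_int k) * coord u (- k)" if "k \<noteq> 0" for k
    using that unfolding v_def by (rule coord_synth[OF l])
  have c: "fourier_coeff v k = - \<i> * of_int (sgn k) * fourier_coeff u k" for k
    by (rule multiplier_coordI) (use m in \<open>auto simp: cv complex_eq_iff mean_zero_iff\<close>)
  have eq: "hilbert_transform u = v"
    unfolding hilbert_transform_def by (rule fourier_multiplierI[OF c])
  show "fourier_coeff (hilbert_transform u) k = - \<i> * of_int (sgn k) * fourier_coeff u k"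
    unfolding eq by (rule c)
  show "l \<noteq> 0 \<Longrightarrow> coord (hilbert_transform u) l = - sgn (of_int l) * coord u (- l)"
    unfolding eq by (simp add: cv)
  show "hilbert_transform u \<in> mean_zero" unfolding eq by (rule m)
qed

text \<open>Comparing i k u_k with - i sgn(k) w_k gives u_k = - w_k/|k|, while frequency 0 carries
  no information and is fixed by the mean. The gain of one derivative makes the velocity of an L^2
  function bounded.\<close>

lemma
  shows coord_velocity: "l \<noteq> 0 \<Longrightarrow> coord (velocity u) l = - coord u l / \<bar>of_int l\<bar>"
    and mean_zero_velocity: "velocity u \<in> mean_zero"
    and fourier_coeff_velocity: "k \<noteq> 0 \<Longrightarrow> fourier_coeff (velocity u) k = - fourier_coeff u k / of_int \<bar>k\<bar>"
proof -
  define v where "v = synth (\<lambda>k. - coord u k / \<bar>of_int k\<bar>)"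
  have l: "l2seq (\<lambda>k. - coord u k / \<bar>of_int k\<bar>)"
  proof (rule l2seq_cmult_bound[OF l2seq_coord[of u], where C = 1])
    fix k :: int assume "k \<noteq> 0"
    then have "1 \<le> real_of_int \<bar>k\<bar>" by linarith
    then show "\<bar>- coord u k / \<bar>of_int k\<bar>\<bar> \<le> 1 * \<bar>coord u k\<bar>"
      by (simp add: divide_le_eq mult_left_le_one_le mult_le_cancel_left1)
  qed
  have m: "v \<in> mean_zero" unfolding v_def by (rule mean_zero_synth[OF l])
  have cv: "coord v k = - coord u k / \<bar>of_int k\<bar>" if "k \<noteq> 0" for k
    using that unfolding v_def by (rule coord_synth[OF l])
  have c: "fourier_coeff v k = (if k = 0 then 0 else complex_of_real (- 1 / of_int \<bar>k\<bar>)) * fourier_coeff u k" for k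
    by (rule multiplier_coordI) (use m in \<open>auto simp: cv complex_eq_iff mean_zero_iff Re_divide_of_real\<close>)
  have "velocity u = v" unfolding velocity_def
  proof (rule the_equality)
    show "v \<in> mean_zero \<and> (\<forall>k. \<i> * of_int k * fourier_coeff v k = fourier_coeff (hilbert_transform u) k)"
      using m by (auto simp: c fourier_coeff_hilbert sgn_if abs_if)
    fix y assume y: "y \<in> mean_zero \<and> (\<forall>k. \<i> * of_int k * fourier_coeff y k = fourier_coeff (hilbert_transform u) k)"
    have "fourier_coeff y k = fourier_coeff v k" for k
    proof (cases "k = 0")
      case True then show ?thesis using y m by (simp add: fourier_coeff_0 mean_zero_iff)
    next
      case False
      have "\<i> * of_int k * fourier_coeff y k = \<i> * of_int k * fourier_coeff v k"
        using y False by (auto simp: c fourier_coeff_hilbert sgn_if abs_if)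
      then show ?thesis using False by simp
    qed
    then show "y = v" by (rule fourier_coeff_eqI)
  qed
  then have eq: "velocity u = v" .
  show "l \<noteq> 0 \<Longrightarrow> coord (velocity u) l = - coord u l / \<bar>of_int l\<bar>" unfolding eq by (simp add: cv)
  show "velocity u \<in> mean_zero" unfolding eq by (rule m)
  show "k \<noteq> 0 \<Longrightarrow> fourier_coeff (velocity u) k = - fourier_coeff u k / of_int \<bar>k\<bar>"
    unfolding eq c by (simp flip: of_int_abs)
qed

lemma ddx_velocity: "ddx (velocity u) = hilbert_transform u"
proof (rule coord_eqI)
  have l: "l2seq (\<lambda>k. of_int k * coord (velocity u) k)"
    by (rule l2seq_cmult_bound[OF l2seq_coord[of u], where C = 1])
      (auto simp: coord_velocity abs_mult)
  show "ddx (velocity u) \<in> mean_zero" by (rule mean_zero_ddx[OF l])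
  show "hilbert_transform u \<in> mean_zero" by (rule mean_zero_hilbert)
  show "coord (ddx (velocity u)) k = coord (hilbert_transform u) k" if "k \<noteq> 0" for k
    using that by (simp add: coord_ddx[OF l] coord_hilbert coord_velocity sgn_if abs_if)
qed

lemma coord_heat:
  assumes "r \<ge> 0" "l \<noteq> 0"
  shows "coord (heat r u) l = exp (- r * (of_int l)\<^sup>2) * coord u l"
proof -
  define c where "c k = exp (- r * (real_of_int k)\<^sup>2) * coord u k" for k
  \<comment> \<open>\<open>u\<close> need not have mean zero, and the mean is invisible to
    \<open>coord\<close>; it is put back as a constant, on which the heat symbol equals 1.\<close>
  define v where "v = synth c + (circle_integral u / (2 * pi)) *\<^sub>R L2 (\<lambda>_. 1)"
  have l: "l2seq c"
  proof (rule l2seq_cmult_bound[OF l2seq_coord[of u], where C = 1])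
    fix k :: int
    have "exp (- r * (real_of_int k)\<^sup>2) \<le> 1" using assms by simp
    then show "\<bar>c k\<bar> \<le> 1 * \<bar>coord u k\<bar>" by (simp add: abs_mult mult_left_le_one_le c_def)
  qed
  have cv: "coord (synth c) k = c k" if "k \<noteq> 0" for k
    using that by (rule coord_synth[OF l])
  have m: "circle_integral (synth c) = 0" using mean_zero_synth[OF l] by (simp add: mean_zero_iff)
  have one: "coord (L2 (\<lambda>_. 1)) k = 0" if "k \<noteq> 0" for k
    using circle_integral_basis_fun[OF that] by (simp add: circle_integral_inner inner_commute)
  have "circle_integral (L2 (\<lambda>_. 1)) = 2 * pi"
    using integral_circle_cos[of 0] by (simp add: circle_integral_L2)
  then have fc: "fourier_coeff v k = complex_of_real (exp (- r * (of_int k)\<^sup>2)) * fourier_coeff u k" for k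
    by (intro multiplier_coordI)
       (auto simp: v_def cv inner_add_left one m complex_eq_iff c_def)
  have "heat r u = v" unfolding heat_def by (rule fourier_multiplierI[OF fc])
  then show ?thesis using assms by (simp add: v_def inner_add_left one cv c_def)
qed

section \<open>Sobolev norms\<close>

definition hsum :: "nat \<Rightarrow> nat \<Rightarrow> l2_circle \<Rightarrow> real" where
  "hsum m n u = (\<Sum>k\<in>freqs n. \<bar>of_int k\<bar> ^ (2 * m) * (coord u k)\<^sup>2)"

text \<open>The operator (- d^2/dx^2)^(m/2), which carries H^m isometrically into L^2. Topological
  statements about H^m thereby become statements about an L^2 norm.\<close>

definition Lam :: "nat \<Rightarrow> l2_circle \<Rightarrow> l2_circle" where
  "Lam m u = synth (\<lambda>k. \<bar>of_int k\<bar> ^ m * coord u k)"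

lemma hsum_alt: "hsum m n u = (\<Sum>k\<in>freqs n. (\<bar>of_int k\<bar> ^ m * coord u k)\<^sup>2)"
  unfolding hsum_def by (simp add: power_mult_distrib mult.commute[of 2] flip: power_mult)

lemma hsum_nonneg [simp]: "0 \<le> hsum m n u"
  unfolding hsum_def by (intro sum_nonneg) auto

lemma sobolev_tendsto: "(\<lambda>n. ennreal (hsum m n u)) \<longlonglongrightarrow> sobolev_norm_sq m u"
proof -
  have "(\<lambda>k. ennreal (\<bar>of_int k\<bar> ^ (2 * m) * (coord u k)\<^sup>2)) summable_on nonzero_ints"
    by (rule nonneg_summable_on_complete) simp
  from has_sum_imp_tendsto_freqs[OF has_sum_infsum[OF this]] show ?thesis
    unfolding sobolev_norm_sq_def hsum_def by (subst (asm) sum_ennreal) auto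
qed

lemma hsum_mono: "n \<le> n' \<Longrightarrow> hsum m n u \<le> hsum m n' u"
  unfolding hsum_def by (rule sum_mono2) (auto dest: freqs_mono)

lemma sobolev_eq_SUP: "sobolev_norm_sq m u = (SUP n. ennreal (hsum m n u))"
  by (rule LIMSEQ_unique[OF sobolev_tendsto LIMSEQ_SUP]) (auto simp: mono_def intro!: ennreal_leI hsum_mono)

lemma hsum_le_sobolev: "ennreal (hsum m n u) \<le> sobolev_norm_sq m u"
  unfolding sobolev_eq_SUP by (rule SUP_upper) simp

lemma hom_sobolev_iff: "u \<in> hom_sobolev m \<longleftrightarrow> u \<in> mean_zero \<and> l2seq (\<lambda>k. \<bar>of_int k\<bar> ^ m * coord u k)"
proof (intro iffI conjI)
  assume u: "u \<in> hom_sobolev m"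
  then have fin: "sobolev_norm_sq m u < top" by (simp add: hom_sobolev_def)
  show "l2seq (\<lambda>k. \<bar>of_int k\<bar> ^ m * coord u k)"
  proof (rule l2seqI[where B = "enn2real (sobolev_norm_sq m u)"])
    fix n
    show "(\<Sum>k\<in>freqs n. (\<bar>real_of_int k\<bar> ^ m * coord u k)\<^sup>2) \<le> enn2real (sobolev_norm_sq m u)"
      using enn2real_mono[OF hsum_le_sobolev[of m n u] fin] by (simp flip: hsum_alt)
  qed
next
  assume u: "u \<in> mean_zero \<and> l2seq (\<lambda>k. \<bar>of_int k\<bar> ^ m * coord u k)"
  have "(\<lambda>n. hsum m n u) \<longlonglongrightarrow> (norm (Lam m u))\<^sup>2"
    unfolding hsum_alt Lam_def by (intro has_sum_imp_tendsto_freqs has_sum_norm_synth) (use u in auto)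
  then have "(\<lambda>n. ennreal (hsum m n u)) \<longlonglongrightarrow> ennreal ((norm (Lam m u))\<^sup>2)"
    by (intro tendsto_ennrealI)
  then have "sobolev_norm_sq m u = ennreal ((norm (Lam m u))\<^sup>2)"
    by (rule LIMSEQ_unique[OF sobolev_tendsto])
  then show "u \<in> hom_sobolev m" using u by (simp add: hom_sobolev_def)
qed (auto simp: hom_sobolev_def)

lemma hom_sobolev_mean_zero: "u \<in> hom_sobolev m \<Longrightarrow> u \<in> mean_zero"
  by (simp add: hom_sobolev_iff)

lemma hsum_tendsto: "u \<in> hom_sobolev m \<Longrightarrow> (\<lambda>n. hsum m n u) \<longlonglongrightarrow> (norm (Lam m u))\<^sup>2"
  unfolding hsum_alt Lam_def by (intro has_sum_imp_tendsto_freqs has_sum_norm_synth) (auto simp: hom_sobolev_iff)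

lemma sobolev_norm_Lam: "u \<in> hom_sobolev m \<Longrightarrow> sobolev_norm_sq m u = ennreal ((norm (Lam m u))\<^sup>2)"
  by (rule LIMSEQ_unique[OF sobolev_tendsto tendsto_ennrealI[OF hsum_tendsto]])

lemma coord_Lam: "u \<in> hom_sobolev m \<Longrightarrow> k \<noteq> 0 \<Longrightarrow> coord (Lam m u) k = \<bar>of_int k\<bar> ^ m * coord u k"
  unfolding Lam_def by (rule coord_synth) (auto simp: hom_sobolev_iff)

lemma mean_zero_Lam: "u \<in> hom_sobolev m \<Longrightarrow> Lam m u \<in> mean_zero"
  unfolding Lam_def by (rule mean_zero_synth) (auto simp: hom_sobolev_iff)

lemma hom_sobolev_by_coord:
  assumes "u \<in> mean_zero" "v \<in> mean_zero" "\<And>k. k \<noteq> 0 \<Longrightarrow> coord v k = \<bar>of_int k\<bar> ^ m * coord u k"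
  shows "u \<in> hom_sobolev m" "Lam m u = v"
proof -
  have "l2seq (\<lambda>k. \<bar>of_int k\<bar> ^ m * coord u k)"
    using l2seq_coord[of v] by (rule l2seq_cmult_bound[where C = 1]) (simp add: assms)
  then show u: "u \<in> hom_sobolev m" using assms by (simp add: hom_sobolev_iff)
  show "Lam m u = v" by (rule coord_eqI) (auto simp: assms mean_zero_Lam coord_Lam u)
qed

lemma
  assumes "u \<in> hom_sobolev m" "v \<in> hom_sobolev m"
  shows hom_sobolev_add: "u + v \<in> hom_sobolev m" and Lam_add: "Lam m (u + v) = Lam m u + Lam m v"
    and hom_sobolev_diff: "u - v \<in> hom_sobolev m" and Lam_diff: "Lam m (u - v) = Lam m u - Lam m v"
  using assms
    hom_sobolev_by_coord[of "u + v" "Lam m u + Lam m v" m]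
    hom_sobolev_by_coord[of "u - v" "Lam m u - Lam m v" m]
    hom_sobolev_mean_zero[OF assms(1)] hom_sobolev_mean_zero[OF assms(2)]
    mean_zero_Lam[OF assms(1)] mean_zero_Lam[OF assms(2)]
  by (auto simp: coord_Lam inner_add_left inner_diff_left mean_zero_iff algebra_simps)

lemma hom_sobolev_zero: "0 \<in> hom_sobolev m"
  by (rule hom_sobolev_by_coord[of _ 0]) (auto simp: mean_zero_iff)

lemma hom_sobolev_sum: "finite F \<Longrightarrow> 0 \<notin> F \<Longrightarrow> (\<Sum>k\<in>F. c k *\<^sub>R basis_fun k) \<in> hom_sobolev m"
  by (rule hom_sobolev_by_coord[of _ "\<Sum>k\<in>F. (\<bar>of_int k\<bar> ^ m * c k) *\<^sub>R basis_fun k"])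
     (auto simp: mean_zero_sum coord_sum)

lemma hom_sobolev_proj: "proj n u \<in> hom_sobolev m"
  unfolding proj_def by (rule hom_sobolev_sum) auto

lemma mean_zero_proj: "proj n u \<in> mean_zero"
  unfolding proj_def by (rule mean_zero_sum) auto

lemma Lam_proj: "u \<in> hom_sobolev m \<Longrightarrow> Lam m (proj n u) = proj n (Lam m u)"
  by (rule hom_sobolev_by_coord) (auto simp: mean_zero_proj coord_proj coord_Lam)

lemma norm_mono_coord:
  assumes "u \<in> mean_zero" "v \<in> mean_zero" "\<And>k. k \<noteq> 0 \<Longrightarrow> \<bar>coord u k\<bar> \<le> \<bar>coord v k\<bar>"
  shows "norm u \<le> norm v"
proof -
  have "(norm u)\<^sup>2 \<le> (norm v)\<^sup>2"
    by (rule has_sum_mono[OF parseval parseval]) (use assms in \<open>auto simp: abs_le_square_iff\<close>)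
  then show ?thesis by (rule power2_le_imp_le) simp
qed

lemma nonzero_int_ge_1: "k \<noteq> 0 \<Longrightarrow> 1 \<le> \<bar>real_of_int k\<bar>"
  by linarith

lemma
  assumes "u \<in> hom_sobolev n" "m \<le> n"
  shows hom_sobolev_mono: "u \<in> hom_sobolev m"
    and norm_Lam_mono: "norm (Lam m u) \<le> norm (Lam n u)"
proof -
  have le: "\<bar>\<bar>real_of_int k\<bar> ^ m * coord u k\<bar> \<le> \<bar>\<bar>of_int k\<bar> ^ n * coord u k\<bar>" if "k \<noteq> 0" for k
    using power_increasing[OF assms(2) nonzero_int_ge_1[OF that]] by (simp add: abs_mult mult_right_mono)
  show u: "u \<in> hom_sobolev m"
    using assms le unfolding hom_sobolev_iff by (auto intro: l2seq_cmult_bound[where C = 1])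
  show "norm (Lam m u) \<le> norm (Lam n u)"
    by (rule norm_mono_coord) (use u assms le in \<open>auto simp: mean_zero_Lam coord_Lam\<close>)
qed

lemma Lam_0: "u \<in> mean_zero \<Longrightarrow> Lam 0 u = u"
  by (simp add: Lam_def synth_coord)

lemma norm_le_Lam: "u \<in> hom_sobolev m \<Longrightarrow> norm u \<le> norm (Lam m u)"
  using norm_Lam_mono[of u m 0] hom_sobolev_mean_zero[of u m] by (simp add: Lam_0)

abbreviation sob_dist :: "nat \<Rightarrow> l2_circle \<Rightarrow> l2_circle \<Rightarrow> real" where
  "sob_dist m u v \<equiv> sqrt (enn2real (sobolev_norm_sq m (u - v)))"

lemma sob_dist_eq:
  "u \<in> hom_sobolev m \<Longrightarrow> v \<in> hom_sobolev m \<Longrightarrow> sob_dist m u v = norm (Lam m u - Lam m v)"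
  by (simp add: sobolev_norm_Lam hom_sobolev_diff Lam_diff)

lemma norm_diff_le_sob_dist:
  "u \<in> hom_sobolev m \<Longrightarrow> v \<in> hom_sobolev m \<Longrightarrow> norm (u - v) \<le> norm (Lam m u - Lam m v)"
  using norm_le_Lam[OF hom_sobolev_diff, of u m v] by (simp add: Lam_diff)

lemma sobolev_norm_sq_uminus: "sobolev_norm_sq m (u - v) = sobolev_norm_sq m (v - u)"
  unfolding sobolev_eq_SUP hsum_def inner_diff_left by (simp add: power2_commute)

interpretation sob: Metric_space "hom_sobolev m" "sob_dist m" for m
proof
  fix u v w assume "u \<in> hom_sobolev m" "v \<in> hom_sobolev m" "w \<in> hom_sobolev m"
  then show "sob_dist m u w \<le> sob_dist m u v + sob_dist m v w"
    using norm_triangle_ineq[of "Lam m u - Lam m v" "Lam m v - Lam m w"]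
    by (simp add: sob_dist_eq)
next
  fix u v assume uv: "u \<in> hom_sobolev m" "v \<in> hom_sobolev m"
  then have "sob_dist m u v = 0 \<Longrightarrow> u = v"
    using norm_diff_le_sob_dist[OF uv] unfolding sob_dist_eq[OF uv] by simp
  then show "(sob_dist m u v = 0) = (u = v)"
    using sob_dist_eq[OF uv] by auto
qed (auto simp: sobolev_norm_sq_uminus)

text \<open>The passage from the abstract topology of H^m to norms of \<open>Lam\<close>, in which
  all later path estimates are written.\<close>

lemma continuous_map_sobolev:
  fixes S :: "real set"
  assumes "continuous_map (top_of_set S) (sobolev_topology m) w"
  shows "\<And>t. t \<in> S \<Longrightarrow> w t \<in> hom_sobolev m" "continuous_on S (\<lambda>t. Lam m (w t))"
proof -
  show m: "w t \<in> hom_sobolev m" if "t \<in> S" for t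
    using continuous_map_image_subset_topspace[OF assms] that
    unfolding sobolev_topology_def sob.topspace_mtopology by auto
  show "continuous_on S (\<lambda>t. Lam m (w t))"
    unfolding continuous_on_iff
  proof (intro ballI allI impI)
    fix x and e :: real assume x: "x \<in> S" and e: "0 < e"
    then obtain U where U: "openin (top_of_set S) U" "x \<in> U" "\<And>y. y \<in> U \<Longrightarrow> w y \<in> sob.mball m (w x) e"
      using assms unfolding sobolev_topology_def sob.continuous_map_to_metric by force
    then obtain d where d: "d > 0" "\<And>y. y \<in> S \<Longrightarrow> dist y x < d \<Longrightarrow> y \<in> U"
      unfolding openin_euclidean_subtopology_iff by metis
    have "dist (Lam m (w y)) (Lam m (w x)) < e" if "y \<in> S" "dist y x < d" for y
      using U(3)[OF d(2)[OF that]] sob_dist_eq[OF m[OF x] m[OF that(1)]]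
      by (simp add: sob.mball_def dist_norm norm_minus_commute)
    then show "\<exists>d>0. \<forall>x'\<in>S. dist x' x < d \<longrightarrow> dist (Lam m (w x')) (Lam m (w x)) < e"
      using d by blast
  qed
qed

lemma l2seq_H1: "u \<in> hom_sobolev 1 \<Longrightarrow> l2seq (\<lambda>k. of_int k * coord u k)"
  unfolding hom_sobolev_iff by (auto intro: l2seq_cmult_bound[where C = 1] simp: abs_mult)

text \<open>\<open>ddx\<close> and \<open>hilbert_transform\<close> exchange the cosine and the sine
  of a frequency; by Parseval such an exchange does not affect the norm.\<close>

lemma norm_reflect:
  assumes "u \<in> mean_zero" "v \<in> mean_zero" "\<And>k. k \<noteq> 0 \<Longrightarrow> \<bar>coord u k\<bar> = \<bar>coord v (- k)\<bar>"
  shows "norm u = norm v"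
proof -
  have "((\<lambda>k. (coord v (- k))\<^sup>2) has_sum (norm v)\<^sup>2) nonzero_ints"
    using has_sum_reindex_bij_betw[OF bij_uminus_nonzero, of "\<lambda>k. (coord v k)\<^sup>2"] parseval[OF assms(2)] by simp
  moreover have "(coord u k)\<^sup>2 = (coord v (- k))\<^sup>2" if "k \<in> nonzero_ints" for k
    using assms(3)[of k] that by (metis DiffE power2_abs singletonI)
  ultimately have "((\<lambda>k. (coord u k)\<^sup>2) has_sum (norm v)\<^sup>2) nonzero_ints"
    using has_sum_cong[of nonzero_ints "\<lambda>k. (coord u k)\<^sup>2" "\<lambda>k. (coord v (- k))\<^sup>2"] by blast
  with parseval[OF assms(1)] have "(norm u)\<^sup>2 = (norm v)\<^sup>2" by (rule has_sum_unique)
  then show ?thesis by simp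
qed

lemma norm_ddx: "u \<in> hom_sobolev 1 \<Longrightarrow> norm (ddx u) = norm (Lam 1 u)"
  using l2seq_H1[of u]
  by (intro norm_reflect) (auto simp: mean_zero_ddx mean_zero_Lam coord_ddx coord_Lam abs_mult)

lemma norm_hilbert: "u \<in> mean_zero \<Longrightarrow> norm (hilbert_transform u) = norm u"
  by (rule norm_reflect) (auto simp: mean_zero_hilbert coord_hilbert abs_mult sgn_if)

lemma
  assumes "u \<in> mean_zero"
  shows velocity_H1: "velocity u \<in> hom_sobolev 1" and Lam_velocity: "norm (Lam 1 (velocity u)) = norm u"
proof -
  have *: "(- u) \<in> mean_zero" using assms circle_integral_scale[of "-1" u] by (simp add: mean_zero_iff)
  note hom_sobolev_by_coord[OF mean_zero_velocity *, of 1]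
  then show "velocity u \<in> hom_sobolev 1" "norm (Lam 1 (velocity u)) = norm u"
    by (auto simp: coord_velocity)
qed

section \<open>The embedding of H^1 into the bounded functions\<close>

lemma freqs_Suc: "freqs (Suc n) = insert (int (Suc n)) (insert (- int (Suc n)) (freqs n))"
  by (auto simp: freqs_def)

lemma freqs_0 [simp]: "freqs 0 = {}"
  by (auto simp: freqs_def)

lemma sum_inverse_squares: "(\<Sum>k\<in>freqs n. 1 / (real_of_int k)\<^sup>2) \<le> 4"
proof -
  \<comment> \<open>The remainder closes the induction, because 1/(j + 1)^2 is at most 1/j - 1/(j +
    1). The bound 4 is the square of the embedding constant 2.\<close>
  have "(\<Sum>k\<in>freqs (Suc n). 1 / (real_of_int k)\<^sup>2) \<le> 4 - 2 / real (Suc n)" for n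
  proof (induction n)
    case 0
    have "freqs (Suc 0) = {1, -1}" by (auto simp: freqs_def)
    then show ?case by simp
  next
    case (Suc n)
    have "(\<Sum>k\<in>freqs (Suc (Suc n)). 1 / (real_of_int k)\<^sup>2)
       = 2 / (real (Suc (Suc n)))\<^sup>2 + (\<Sum>k\<in>freqs (Suc n). 1 / (real_of_int k)\<^sup>2)"
    proof -
      have *: "int (Suc (Suc n)) \<notin> insert (- int (Suc (Suc n))) (freqs (Suc n))"
        "- int (Suc (Suc n)) \<notin> freqs (Suc n)" by (auto simp: freqs_def)
      show ?thesis
        using * by (subst freqs_Suc) (simp add: power2_commute[of "-1"] power2_eq_square algebra_simps)
    qed
    also have "\<dots> \<le> 2 / (real (Suc (Suc n)))\<^sup>2 + (4 - 2 / real (Suc n))" using Suc by simp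
    also have "2 / (real (Suc (Suc n)))\<^sup>2 \<le> 2 / (real (Suc n) * real (Suc (Suc n)))"
      unfolding power2_eq_square by (intro divide_left_mono mult_right_mono) auto
    also have "\<dots> = 2 / real (Suc n) - 2 / real (Suc (Suc n))" by (simp add: field_simps)
    finally show ?case by simp
  qed
  note * = this
  show ?thesis
  proof (cases n)
    case (Suc n')
    have "0 \<le> 2 / real (Suc n')" by simp
    with *[of n'] show ?thesis unfolding Suc by linarith
  qed simp
qed

lemma proj_L2: "proj n u = L2 (\<lambda>x. \<Sum>k\<in>freqs n. coord u k * bfun k x)"
  and square_integrable_proj: "square_integrable (\<lambda>x. \<Sum>k\<in>freqs n. coord u k * bfun k x)"
proof -
  have "(\<Sum>k\<in>F. coord u k *\<^sub>R basis_fun k) = L2 (\<lambda>x. \<Sum>k\<in>F. coord u k * bfun k x)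
      \<and> square_integrable (\<lambda>x. \<Sum>k\<in>F. coord u k * bfun k x)" if "finite F" for F
    using that
  proof induction
    case (insert k F)
    then show ?case
      using L2_add[of "\<lambda>x. coord u k * bfun k x" "\<lambda>x. \<Sum>k\<in>F. coord u k * bfun k x"]
        square_integrable_scale[OF square_integrable_bfun]
        square_integrable_add[of "\<lambda>x. coord u k * bfun k x" "\<lambda>x. \<Sum>k\<in>F. coord u k * bfun k x"]
      by (simp add: basis_fun_L2 L2_scale)
  qed (simp add: L2_zero square_integrable_0)
  then show "proj n u = L2 (\<lambda>x. \<Sum>k\<in>freqs n. coord u k * bfun k x)"
    "square_integrable (\<lambda>x. \<Sum>k\<in>freqs n. coord u k * bfun k x)" unfolding proj_def by auto
qed

text \<open>Cauchy-Schwarz with the weights k and 1/k. The bound does not depend on n, so it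
  survives the passage to the limit in \<open>sup_H1\<close>.\<close>

lemma sup_proj: "u \<in> hom_sobolev 1 \<Longrightarrow> \<bar>\<Sum>k\<in>freqs n. coord u k * bfun k x\<bar> \<le> 2 * norm (Lam 1 u)"
proof -
  assume u: "u \<in> hom_sobolev 1"
  let ?a = "\<lambda>k. of_int k * coord u k" and ?b = "\<lambda>k. bfun k x / of_int k"
  have eq: "(\<Sum>k\<in>freqs n. coord u k * bfun k x) = (\<Sum>k\<in>freqs n. ?a k * ?b k)"
    by (intro sum.cong) (auto dest: freqs_nonzero)
  have "\<bar>\<Sum>k\<in>freqs n. ?a k * ?b k\<bar> \<le> (\<Sum>k\<in>freqs n. \<bar>?a k\<bar> * \<bar>?b k\<bar>)"
    using sum_abs[of "\<lambda>k. ?a k * ?b k" "freqs n"] unfolding abs_mult .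
  also have "\<dots> \<le> L2_set ?a (freqs n) * L2_set ?b (freqs n)"
    by (rule L2_set_mult_ineq)
  also have "\<dots> \<le> norm (Lam 1 u) * 2"
  proof (rule mult_mono)
    have "(\<Sum>k\<in>freqs n. (of_int k * coord u k)\<^sup>2) = (\<Sum>k\<in>freqs n. (coord (Lam 1 u) k)\<^sup>2)"
    proof (intro sum.cong refl)
      fix k assume "k \<in> freqs n"
      then show "(of_int k * coord u k)\<^sup>2 = (coord (Lam 1 u) k)\<^sup>2"
        using coord_Lam[OF u freqs_nonzero] by (simp add: power_mult_distrib)
    qed
    also have "\<dots> \<le> (norm (Lam 1 u))\<^sup>2" by (rule bessel)
    finally show "L2_set (\<lambda>k. of_int k * coord u k) (freqs n) \<le> norm (Lam 1 u)"
      unfolding L2_set_def by (rule real_le_lsqrt[rotated 1]) simp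
    have "(\<Sum>k\<in>freqs n. (bfun k x / of_int k)\<^sup>2) \<le> (\<Sum>k\<in>freqs n. 1 / (real_of_int k)\<^sup>2)"
    proof (rule sum_mono)
      fix k assume "k \<in> freqs n"
      have "\<bar>bfun k x\<bar> \<le> 1 / 1"
        using order_trans[OF bfun_bound[of k x], of 1] pi_gt3 by (simp add: real_le_rsqrt)
      then have "(bfun k x)\<^sup>2 \<le> 1" by (simp add: abs_square_le_1)
      then show "(bfun k x / of_int k)\<^sup>2 \<le> 1 / (real_of_int k)\<^sup>2"
        by (simp add: power_divide divide_right_mono)
    qed
    also have "\<dots> \<le> 2\<^sup>2" using sum_inverse_squares by simp
    finally show "L2_set (\<lambda>k. bfun k x / of_int k) (freqs n) \<le> 2"
      unfolding L2_set_def by (rule real_le_lsqrt[rotated 1]) simp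
  qed auto
  finally show ?thesis unfolding eq by (simp only: mult.commute)
qed

lemma L2_tendsto_AE_subseq:
  assumes "\<And>n. square_integrable (f n)" "square_integrable g" "(\<lambda>n. L2 (f n)) \<longlonglongrightarrow> L2 g"
  obtains r :: "nat \<Rightarrow> nat" where "strict_mono r" "AE x in circle_measure. (\<lambda>n. f (r n) x) \<longlonglongrightarrow> g x"
proof -
  have sq: "square_integrable (\<lambda>x. f n x - g x)" for n by (intro square_integrable_diff assms)
  have "(\<lambda>n. (norm (L2 (f n) - L2 g))\<^sup>2) \<longlonglongrightarrow> 0\<^sup>2"
    by (intro tendsto_power tendsto_norm_zero LIM_zero assms)
  then have "(\<lambda>n. \<integral>x. norm ((f n x - g x)\<^sup>2) \<partial>circle_measure) \<longlonglongrightarrow> 0"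
    by (simp add: L2_diff assms L2_norm sq)
  with tendsto_L1_AE_subseq[of circle_measure "\<lambda>n x. (f n x - g x)\<^sup>2"] sq
  obtain r :: "nat \<Rightarrow> nat" where r: "strict_mono r" "AE x in circle_measure. (\<lambda>n. (f (r n) x - g x)\<^sup>2) \<longlonglongrightarrow> 0"
    by (auto simp: square_integrable_def)
  from r(2) have "AE x in circle_measure. (\<lambda>n. f (r n) x) \<longlonglongrightarrow> g x"
  proof eventually_elim
    case (elim x)
    then have "(\<lambda>n. sqrt ((f (r n) x - g x)\<^sup>2)) \<longlonglongrightarrow> sqrt 0" by (rule tendsto_real_sqrt)
    then have "(\<lambda>n. f (r n) x - g x) \<longlonglongrightarrow> 0" by (simp add: tendsto_rabs_zero_iff)
    then show ?case by (rule LIM_zero_cancel)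
  qed
  with r(1) show ?thesis by (rule that)
qed

lemma sup_H1:
  assumes f: "square_integrable f" and u: "L2 f \<in> hom_sobolev 1"
  shows "AE x in circle_measure. \<bar>f x\<bar> \<le> 2 * norm (Lam 1 (L2 f))"
proof -
  have "(\<lambda>n. L2 (\<lambda>x. \<Sum>k\<in>freqs n. coord (L2 f) k * bfun k x)) \<longlonglongrightarrow> L2 f"
    using proj_tendsto[OF hom_sobolev_mean_zero[OF u]] by (simp add: proj_L2)
  then obtain r where "strict_mono (r :: nat \<Rightarrow> nat)"
    "AE x in circle_measure. (\<lambda>n. \<Sum>k\<in>freqs (r n). coord (L2 f) k * bfun k x) \<longlonglongrightarrow> f x"
    by (rule L2_tendsto_AE_subseq[OF square_integrable_proj f])
  from this(2) show ?thesis
  proof eventually_elim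
    case (elim x)
    show ?case
      by (rule tendsto_upperbound[OF tendsto_rabs[OF elim] always_eventually sequentially_bot])
        (intro allI sup_proj[OF u])
  qed
qed

section \<open>The drift\<close>

text \<open>The order \<open>1\<close> of the Sobolev space is to stay a literal.\<close>

declare One_nat_def [simp del]

lemma l2_times_L2:
  assumes "square_integrable f" "square_integrable g" "square_integrable (\<lambda>x. f x * g x)"
  shows "l2_times (L2 f) (L2 g) = L2 (\<lambda>x. f x * g x)"
  using assms by (simp add: l2_times.abs_eq)

text \<open>An essential bound. \<open>l2_times\<close> replaces a product outside L^2 by zero and
  so need not be additive; a bounded factor keeps the products in L^2 and restores
  additivity.\<close>

definition sup_le :: "l2_circle \<Rightarrow> real \<Rightarrow> bool" where
  "sup_le u C \<longleftrightarrow> (\<exists>f. square_integrable f \<and> u = L2 f \<and> (AE x in circle_measure. \<bar>f x\<bar> \<le> C))"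

lemma square_integrable_mult_bounded:
  assumes f: "square_integrable f" and g: "square_integrable g" and b: "AE x in circle_measure. \<bar>f x\<bar> \<le> C"
  shows "square_integrable (\<lambda>x. f x * g x)"
    and "(\<integral>x. (f x * g x)\<^sup>2 \<partial>circle_measure) \<le> (\<integral>x. C\<^sup>2 * (g x)\<^sup>2 \<partial>circle_measure)"
proof -
  have [measurable]: "f \<in> borel_measurable circle_measure" "g \<in> borel_measurable circle_measure"
    using f g by (auto simp: square_integrable_def)
  have ae: "AE x in circle_measure. (f x * g x)\<^sup>2 \<le> C\<^sup>2 * (g x)\<^sup>2"
    using b
  proof eventually_elim
    case (elim x)
    then have "(f x)\<^sup>2 \<le> C\<^sup>2" using power_mono[of "\<bar>f x\<bar>" C 2] by simp
    then show ?case by (simp add: power_mult_distrib mult_right_mono)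
  qed
  have int: "integrable circle_measure (\<lambda>x. C\<^sup>2 * (g x)\<^sup>2)"
    using g by (simp add: square_integrable_def)
  have int2: "integrable circle_measure (\<lambda>x. (f x * g x)\<^sup>2)"
    by (rule Bochner_Integration.integrable_bound[OF int]) (use ae in auto)
  then show "square_integrable (\<lambda>x. f x * g x)" by (simp add: square_integrable_def)
  show "(\<integral>x. (f x * g x)\<^sup>2 \<partial>circle_measure) \<le> (\<integral>x. C\<^sup>2 * (g x)\<^sup>2 \<partial>circle_measure)"
    by (rule integral_mono_AE[OF int2 int ae])
qed

lemma l2_times_commute: "l2_times u v = l2_times v u"
proof -
  obtain f where f: "square_integrable f" "u = L2 f" by (rule L2_cases)
  obtain g where g: "square_integrable g" "v = L2 g" by (rule L2_cases)
  define h where "h = (\<lambda>x. f x * g x)"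
  have h: "h = (\<lambda>x. g x * f x)" by (simp add: h_def mult.commute)
  have "l2_times u v = L2 (\<lambda>x. if square_integrable h then h x else 0)"
    using f g by (simp add: l2_times.abs_eq h_def cong: if_cong)
  also have "\<dots> = l2_times v u" using f g by (simp add: l2_times.abs_eq h cong: if_cong)
  finally show ?thesis .
qed

lemma norm_l2_times:
  assumes "sup_le u C" "C \<ge> 0" shows "norm (l2_times u v) \<le> C * norm v"
proof -
  obtain f where f: "square_integrable f" "u = L2 f" "AE x in circle_measure. \<bar>f x\<bar> \<le> C"
    using assms unfolding sup_le_def by - (elim exE conjE, rule that)
  obtain g where g: "square_integrable g" "v = L2 g" by (rule L2_cases)
  note fg = square_integrable_mult_bounded[OF f(1) g(1) f(3)]
  have "(norm (l2_times u v))\<^sup>2 \<le> (C * norm v)\<^sup>2"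
    using fg(2) by (simp add: f g l2_times_L2 fg L2_norm power_mult_distrib)
  then show ?thesis by (rule power2_le_imp_le) (use assms in simp)
qed

lemma l2_times_add_right:
  assumes "sup_le u C" shows "l2_times u (v + w) = l2_times u v + l2_times u w"
proof -
  obtain f where f: "square_integrable f" "u = L2 f" "AE x in circle_measure. \<bar>f x\<bar> \<le> C"
    using assms unfolding sup_le_def by - (elim exE conjE, rule that)
  obtain g where g: "square_integrable g" "v = L2 g" by (rule L2_cases)
  obtain h where h: "square_integrable h" "w = L2 h" by (rule L2_cases)
  note fg = square_integrable_mult_bounded(1)[OF f(1) g(1) f(3)]
  note fh = square_integrable_mult_bounded(1)[OF f(1) h(1) f(3)]
  show ?thesis
    using square_integrable_add[OF fg fh]
    by (simp add: f g h l2_times_L2 fg fh L2_add square_integrable_add distrib_left)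
qed

lemma l2_times_diff_right:
  "sup_le u C \<Longrightarrow> l2_times u (v - w) = l2_times u v - l2_times u w"
  using l2_times_add_right[of u C "v - w" w] by simp

lemma l2_times_add_left:
  assumes "sup_le u C" "sup_le v D" shows "l2_times (u + v) w = l2_times u w + l2_times v w"
proof -
  obtain f where f: "square_integrable f" "u = L2 f" "AE x in circle_measure. \<bar>f x\<bar> \<le> C"
    using assms unfolding sup_le_def by - (elim exE conjE, rule that)
  obtain g where g: "square_integrable g" "v = L2 g" "AE x in circle_measure. \<bar>g x\<bar> \<le> D"
    using assms unfolding sup_le_def by - (elim exE conjE, rule that)
  obtain h where h: "square_integrable h" "w = L2 h" by (rule L2_cases)
  note fh = square_integrable_mult_bounded(1)[OF f(1) h(1) f(3)]
  note gh = square_integrable_mult_bounded(1)[OF g(1) h(1) g(3)]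
  show ?thesis
    using square_integrable_add[OF fh gh]
    by (simp add: f g h l2_times_L2 fh gh L2_add square_integrable_add distrib_right)
qed

lemma sup_le_H1: "u \<in> hom_sobolev 1 \<Longrightarrow> sup_le u (2 * norm (Lam 1 u))"
  using sup_H1 by (cases u) (auto simp: sup_le_def)

lemma sup_le_velocity: "w \<in> mean_zero \<Longrightarrow> sup_le (velocity w) (2 * norm w)"
  using sup_le_H1[OF velocity_H1, of w] by (simp add: Lam_velocity)

lemma l2_times_diff_left_H1:
  assumes "u \<in> hom_sobolev 1" "v \<in> hom_sobolev 1"
  shows "l2_times (u - v) w = l2_times u w - l2_times v w"
  using l2_times_add_left[OF sup_le_H1[OF hom_sobolev_diff[OF assms]] sup_le_H1[OF assms(2)], of w] by simp

lemma velocity_diff: "velocity (u - v) = velocity u - velocity v"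
  by (rule coord_eqI; use mean_zero_velocity in \<open>auto simp: coord_velocity inner_diff_left mean_zero_iff
    diff_divide_distrib\<close>)+

lemma hilbert_diff: "hilbert_transform (u - v) = hilbert_transform u - hilbert_transform v"
  by (rule coord_eqI; use mean_zero_hilbert in \<open>auto simp: coord_hilbert inner_diff_left mean_zero_iff
    algebra_simps\<close>)+

lemma coord_ddx_H1: "u \<in> hom_sobolev 1 \<Longrightarrow> l \<noteq> 0 \<Longrightarrow> coord (ddx u) l = of_int l * coord u (- l)"
  and mean_zero_ddx_H1: "u \<in> hom_sobolev 1 \<Longrightarrow> ddx u \<in> mean_zero"
  by (simp_all add: coord_ddx mean_zero_ddx l2seq_H1)

lemma ddx_diff: "u \<in> hom_sobolev 1 \<Longrightarrow> v \<in> hom_sobolev 1 \<Longrightarrow> ddx (u - v) = ddx u - ddx v"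
  using mean_zero_ddx_H1 hom_sobolev_diff[of u 1 v]
  by (intro coord_eqI; simp add: coord_ddx_H1 inner_diff_left mean_zero_iff algebra_simps)+

text \<open>
  With \<open>u = velocity w\<close>, the drift for \<open>a = -2\<close> is \<open>2 u w\<^sub>x + u\<^sub>x w = Bil w w\<close>.
  This value of \<open>a\<close> is special because \<open>Bil w\<close> is skew.
\<close>

definition Bil :: "l2_circle \<Rightarrow> l2_circle \<Rightarrow> l2_circle" where
  "Bil w v = 2 *\<^sub>R l2_times (velocity w) (ddx v) + l2_times (hilbert_transform w) v"

text \<open>In each product one factor is bounded, by \<open>sup_le_velocity\<close> or
  \<open>sup_le_H1\<close>, and the other one is measured in L^2. Both embedding constants are 2,
  which makes 2 * 2 + 2 = 6.\<close>

lemma norm_Bil: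
  assumes w: "w \<in> mean_zero" and v: "v \<in> hom_sobolev 1"
  shows "norm (Bil w v) \<le> 6 * norm w * norm (Lam 1 v)"
proof -
  have "norm (Bil w v) \<le> 2 * norm (l2_times (velocity w) (ddx v)) + norm (l2_times v (hilbert_transform w))"
    unfolding Bil_def using norm_triangle_ineq[of "2 *\<^sub>R l2_times (velocity w) (ddx v)"]
    by (simp add: l2_times_commute)
  also have "norm (l2_times (velocity w) (ddx v)) \<le> 2 * norm w * norm (ddx v)"
    by (rule norm_l2_times[OF sup_le_velocity[OF w]]) simp
  also have "norm (l2_times v (hilbert_transform w)) \<le> 2 * norm (Lam 1 v) * norm (hilbert_transform w)"
    by (rule norm_l2_times[OF sup_le_H1[OF v]]) simp
  finally show ?thesis by (simp add: norm_ddx v norm_hilbert w mult_ac)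
qed

lemma Bil_diff_left:
  assumes w: "w \<in> mean_zero" "w' \<in> mean_zero" and v: "v \<in> hom_sobolev 1"
  shows "Bil (w - w') v = Bil w v - Bil w' v"
  unfolding Bil_def velocity_diff hilbert_diff
  using l2_times_diff_left_H1[OF velocity_H1[OF w(1)] velocity_H1[OF w(2)], of "ddx v"]
    l2_times_diff_right[OF sup_le_H1[OF v], of "hilbert_transform w" "hilbert_transform w'"]
  by (simp add: l2_times_commute[of _ v] scaleR_diff_right)

lemma Bil_diff_right:
  assumes w: "w \<in> mean_zero" and v: "v \<in> hom_sobolev 1" "v' \<in> hom_sobolev 1"
  shows "Bil w (v - v') = Bil w v - Bil w v'"
  unfolding Bil_def ddx_diff[OF v]
  using l2_times_diff_right[OF sup_le_velocity[OF w], of "ddx v" "ddx v'"]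
    l2_times_diff_left_H1[OF v, of "hilbert_transform w"]
  by (simp add: l2_times_commute[of "hilbert_transform w"] scaleR_diff_right)

section \<open>The bilinear term in Fourier coefficients\<close>

lemma sum_freqs_sym:
  fixes f g :: "int \<Rightarrow> 'a :: real_vector"
  assumes "\<And>k. k \<ge> 1 \<Longrightarrow> f k + f (- k) = g k + g (- k)"
  shows "sum f (freqs n) = sum g (freqs n)"
proof (induction n)
  case (Suc n)
  have *: "int (Suc n) \<notin> insert (- int (Suc n)) (freqs n)" "- int (Suc n) \<notin> freqs n"
    by (auto simp: freqs_def)
  have "sum f (freqs (Suc n)) = (f (int (Suc n)) + f (- int (Suc n))) + sum f (freqs n)" for f :: "int \<Rightarrow> 'a"
    unfolding freqs_Suc using * by (simp add: add.assoc)
  then show ?case using assms[of "int (Suc n)"] Suc by simp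
qed simp

text \<open>Parseval with a weight. Evenness of the weight lets the frequencies k and - k be paired,
  and a pair contributes twice the same real part.\<close>

lemma sum_coord_fourier:
  assumes "\<And>k. g (- k) = g k"
  shows "(\<Sum>k\<in>freqs n. g k * coord u k * coord v k)
    = 2 * pi * (\<Sum>k\<in>freqs n. g k * Re (fourier_coeff u k * cnj (fourier_coeff v k)))"
  unfolding sum_distrib_left
proof (rule sum_freqs_sym)
  fix k :: int assume k: "k \<ge> 1"
  have "Re (fourier_coeff u k * cnj (fourier_coeff v k))
    = (coord u k * coord v k + coord u (- k) * coord v (- k)) / (4 * pi)"
    using k by (simp add: fourier_coeff_pos field_simps power2_eq_square)
  moreover have "Re (fourier_coeff u (- k) * cnj (fourier_coeff v (- k))) = Re (fourier_coeff u k * cnj (fourier_coeff v k))"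
    by (simp add: fourier_coeff_uminus)
  ultimately show "g k * coord u k * coord v k + g (- k) * coord u (- k) * coord v (- k)
    = 2 * pi * (g k * Re (fourier_coeff u k * cnj (fourier_coeff v k)))
      + 2 * pi * (g (- k) * Re (fourier_coeff u (- k) * cnj (fourier_coeff v (- k))))"
    unfolding assms by (simp only:) (simp add: field_simps)
qed

lemma proj_fourier:
  "complex_of_real (\<Sum>k\<in>freqs n. coord u k * bfun k x) = (\<Sum>p\<in>freqs n. fourier_coeff u p * cis (of_int p * x))"
  unfolding of_real_sum
proof (rule sum_freqs_sym)
  fix k :: int assume k: "k \<ge> 1"
  have "fourier_coeff u k * cis (of_int k * x) + fourier_coeff u (- k) * cis (of_int (- k) * x)
     = fourier_coeff u k * cis (of_int k * x) + cnj (fourier_coeff u k * cis (of_int k * x))"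
    by (simp add: fourier_coeff_uminus cis_cnj)
  also have "\<dots> = of_real (2 * Re (fourier_coeff u k * cis (of_int k * x)))"
    by (simp add: complex_eq_iff)
  also have "2 * Re (fourier_coeff u k * cis (of_int k * x)) = coord u k * bfun k x + coord u (- k) * bfun (- k) x"
  proof -
    have gen: "2 * Re (c *\<^sub>R Complex a (- b) * cis t) = (2 * c) * (a * cos t + b * sin t)" for a b c t
      by (simp add: algebra_simps)
    have sp: "2 * (sqrt pi / (2 * pi)) = 1 / sqrt pi" by (simp add: field_simps)
    show ?thesis unfolding fourier_coeff_pos[OF k] gen sp
      using k by (simp add: bfun_def add_divide_distrib)
  qed
  finally show "complex_of_real (coord u k * bfun k x) + complex_of_real (coord u (- k) * bfun (- k) x)
    = fourier_coeff u k * cis (of_int k * x) + fourier_coeff u (- k) * cis (of_int (- k) * x)" by simp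
qed

lemma fourier_coeff_abs:
  "square_integrable f \<Longrightarrow> fourier_coeff (L2 f) k = (\<integral>x. complex_of_real (f x) * cis (- (of_int k * x)) \<partial>circle_measure) / (2 * pi)"
proof -
  assume f: "square_integrable f"
  have "exp (- (\<i> * of_int k * complex_of_real x)) = cis (- (of_int k * x))" for x
    by (simp add: cis_conv_exp mult.assoc)
  then show ?thesis using f by (simp add: fourier_coeff.abs_eq)
qed

lemma cis_borel: "(\<lambda>x. cis (c * x)) \<in> borel_measurable borel"
  by (intro borel_measurable_continuous_onI continuous_intros)

lemma integrable_L2_cis:
  "square_integrable f \<Longrightarrow> integrable circle_measure (\<lambda>x. complex_of_real (f x) * cis (c * x))"
proof -
  assume f: "square_integrable f"
  have "integrable circle_measure (\<lambda>x. complex_of_real (f x))"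
    using square_integrable_integrable[OF f] by simp
  then show ?thesis
    by (rule Bochner_Integration.integrable_bound)
      (use f cis_borel in \<open>auto simp: norm_mult\<close>)
qed

text \<open>With one factor truncated the convolution is a finite sum, so its convergence is never
  an issue; limits in the truncation are taken afterwards.\<close>

lemma fourier_coeff_times_proj:
  "fourier_coeff (l2_times (proj n u) v) k = (\<Sum>p\<in>freqs n. fourier_coeff u p * fourier_coeff v (k - p))"
proof -
  obtain g where g: "square_integrable g" "v = L2 g" by (rule L2_cases)
  let ?f = "\<lambda>x. \<Sum>k\<in>freqs n. coord u k * bfun k x"
  have "\<bar>?f x\<bar> \<le> (\<Sum>k\<in>freqs n. \<bar>coord u k\<bar> * (1 / sqrt pi))" for x
    by (rule order_trans[OF sum_abs]) (auto intro!: sum_mono mult_left_mono bfun_bound simp: abs_mult simp del: times_divide_eq_right)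
  then have sq: "square_integrable (\<lambda>x. ?f x * g x)"
    by (intro square_integrable_mult_bounded(1)[OF square_integrable_proj g(1)] AE_I2)
  have "fourier_coeff (l2_times (proj n u) v) k
     = (\<integral>x. complex_of_real (?f x * g x) * cis (- (of_int k * x)) \<partial>circle_measure) / (2 * pi)"
    unfolding g proj_L2 l2_times_L2[OF square_integrable_proj g(1) sq] by (rule fourier_coeff_abs[OF sq])
  also have "(\<lambda>x. complex_of_real (?f x * g x) * cis (- (of_int k * x)))
     = (\<lambda>x. \<Sum>p\<in>freqs n. fourier_coeff u p * (complex_of_real (g x) * cis (- (of_int (k - p)) * x)))"
  proof
    fix x
    have c: "cis (real_of_int p * x) * cis (- (of_int k * x)) = cis (- (of_int (k - p)) * x)" for p
      by (simp add: cis_mult algebra_simps)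
    have "complex_of_real (?f x * g x) * cis (- (of_int k * x))
       = (\<Sum>p\<in>freqs n. fourier_coeff u p * cis (of_int p * x)) * (complex_of_real (g x) * cis (- (of_int k * x)))"
      unfolding of_real_mult proj_fourier by simp
    also have "\<dots> = (\<Sum>p\<in>freqs n. fourier_coeff u p * (complex_of_real (g x) * (cis (real_of_int p * x) * cis (- (of_int k * x)))))"
      unfolding sum_distrib_right by (intro sum.cong refl) (simp add: mult_ac)
    finally show "complex_of_real (?f x * g x) * cis (- (of_int k * x))
       = (\<Sum>p\<in>freqs n. fourier_coeff u p * (complex_of_real (g x) * cis (- (of_int (k - p)) * x)))"
      unfolding c .
  qed
  also have "(\<integral>x. (\<Sum>p\<in>freqs n. fourier_coeff u p * (complex_of_real (g x) * cis (- (of_int (k - p)) * x))) \<partial>circle_measure)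
    = (\<Sum>p\<in>freqs n. fourier_coeff u p * (\<integral>x. complex_of_real (g x) * cis (- (of_int (k - p)) * x) \<partial>circle_measure))"
    by (subst Bochner_Integration.integral_sum; (intro integrable_mult_right integrable_L2_cis[OF g(1)])?) simp
  finally show ?thesis
    unfolding g(2) fourier_coeff_abs[OF g(1)] mult_minus_left
    by (simp only: sum_divide_distrib times_divide_eq_right)
qed

lemma fourier_coeff_tendsto:
  assumes "X \<longlonglongrightarrow> u" shows "(\<lambda>n. fourier_coeff (X n) k) \<longlonglongrightarrow> fourier_coeff u k"
proof -
  have pos: "(\<lambda>n. fourier_coeff (X n) k) \<longlonglongrightarrow> fourier_coeff u k" if "k \<ge> 1" for k
    unfolding fourier_coeff_pos[OF that] using assms
    by (intro tendsto_intros)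
  consider "k \<ge> 1" | "k = 0" | "- k \<ge> 1" by linarith
  then show ?thesis
  proof cases
    case 2 then show ?thesis unfolding 2 fourier_coeff_0
      by (intro tendsto_intros circle_integral_tendsto assms) auto
  next
    case 3
    then show ?thesis using tendsto_cnj[OF pos[of "-k"]] by (simp flip: fourier_coeff_uminus)
  qed (use pos in auto)
qed

lemma tendsto_l2_times:
  assumes "\<And>n. sup_le (u n - u') (C n)" "\<And>n. C n \<ge> 0" "C \<longlonglongrightarrow> 0" "sup_le u' D"
  shows "(\<lambda>n. l2_times (u n) v) \<longlonglongrightarrow> l2_times u' v"
proof -
  have "(\<lambda>n. l2_times (u n - u') v) \<longlonglongrightarrow> 0"
  proof (rule Lim_null_comparison)
    show "\<forall>\<^sub>F n in sequentially. norm (l2_times (u n - u') v) \<le> C n * norm v"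
      by (intro always_eventually allI norm_l2_times assms)
    show "(\<lambda>n. C n * norm v) \<longlonglongrightarrow> 0" using tendsto_mult_right[OF assms(3), of "norm v"] by simp
  qed
  moreover have "l2_times (u n) v = l2_times (u n - u') v + l2_times u' v" for n
    using l2_times_add_left[OF assms(1)[of n] assms(4), of v] by simp
  ultimately show ?thesis using tendsto_add[OF _ tendsto_const, of "\<lambda>n. l2_times (u n - u') v" 0 _ "l2_times u' v"] by simp
qed

lemma Lam_proj_tendsto:
  assumes "u \<in> hom_sobolev m" shows "(\<lambda>n. norm (Lam m (proj n u - u))) \<longlonglongrightarrow> 0"
  unfolding Lam_diff[OF hom_sobolev_proj assms] Lam_proj[OF assms]
  by (intro tendsto_norm_zero LIM_zero proj_tendsto mean_zero_Lam assms)

text \<open>For a truncated first factor the rule is the identity k = p + (k - p) inside a finite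
  convolution. The limit is taken with uniform convergence of the truncations, which the H^1
  embedding provides.\<close>

lemma product_rule:
  assumes u: "u \<in> hom_sobolev 1" and w: "w \<in> hom_sobolev 1"
  shows "ddx (l2_times u w) = l2_times (ddx u) w + l2_times u (ddx w)"
  unfolding ddx_def[THEN fun_cong, of "l2_times u w"]
proof (rule fourier_multiplierI)
  fix k
  have pu: "proj n u \<in> hom_sobolev 1" for n by (rule hom_sobolev_proj)
  have ddxp: "ddx (proj n u) = proj n (ddx u)" for n
    by (rule coord_eqI) (auto simp: mean_zero_ddx[OF l2seq_H1[OF pu]] mean_zero_proj coord_proj
        coord_ddx[OF l2seq_H1[OF pu]] coord_ddx[OF l2seq_H1[OF u]])
  have fin: "fourier_coeff (l2_times (ddx (proj n u)) w + l2_times (proj n u) (ddx w)) k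
    = \<i> * of_int k * fourier_coeff (l2_times (proj n u) w) k" for n
    unfolding ddxp fourier_coeff_add fourier_coeff_times_proj
      fourier_coeff_ddx[OF l2seq_H1[OF u]] fourier_coeff_ddx[OF l2seq_H1[OF w]]
    unfolding sum_distrib_left sum.distrib[symmetric]
    by (intro sum.cong refl) (simp add: algebra_simps)
  have 1: "(\<lambda>n. l2_times (proj n u) v) \<longlonglongrightarrow> l2_times u v" for v
    by (rule tendsto_l2_times[OF sup_le_H1[OF hom_sobolev_diff[OF pu u]] _ _ sup_le_H1[OF u]])
       (use tendsto_mult_right_zero[OF Lam_proj_tendsto[OF u], of 2] in auto)
  have 2: "(\<lambda>n. l2_times (ddx (proj n u)) w) \<longlonglongrightarrow> l2_times (ddx u) w"
  proof -
    have "(\<lambda>n. l2_times w (ddx (proj n u) - ddx u)) \<longlonglongrightarrow> 0"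
    proof (rule Lim_null_comparison)
      show "\<forall>\<^sub>F n in sequentially. norm (l2_times w (ddx (proj n u) - ddx u)) \<le> (2 * norm (Lam 1 w)) * norm (ddx (proj n u) - ddx u)"
        by (intro always_eventually allI norm_l2_times sup_le_H1 w) simp
      have "(\<lambda>n. ddx (proj n u)) \<longlonglongrightarrow> ddx u" unfolding ddxp
        by (rule proj_tendsto[OF mean_zero_ddx[OF l2seq_H1[OF u]]])
      then show "(\<lambda>n. (2 * norm (Lam 1 w)) * norm (ddx (proj n u) - ddx u)) \<longlonglongrightarrow> 0"
        by (intro tendsto_mult_right_zero tendsto_norm_zero LIM_zero)
    qed
    then show ?thesis
      unfolding l2_times_diff_right[OF sup_le_H1[OF w]] unfolding l2_times_commute[of w] by (rule LIM_zero_cancel)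
  qed
  have "(\<lambda>n. \<i> * of_int k * fourier_coeff (l2_times (proj n u) w) k) \<longlonglongrightarrow> \<i> * of_int k * fourier_coeff (l2_times u w) k"
    by (intro tendsto_mult tendsto_const fourier_coeff_tendsto 1)
  moreover have "(\<lambda>n. \<i> * of_int k * fourier_coeff (l2_times (proj n u) w) k) \<longlonglongrightarrow>
      fourier_coeff (l2_times (ddx u) w + l2_times u (ddx w)) k"
    unfolding fin[symmetric] by (intro fourier_coeff_tendsto tendsto_add 1 2)
  ultimately show "fourier_coeff (l2_times (ddx u) w + l2_times u (ddx w)) k = \<i> * of_int k * fourier_coeff (l2_times u w) k"
    using LIMSEQ_unique by blast
qed

lemma drift_eq_Bil:
  assumes w: "w \<in> hom_sobolev 1"
  shows "drift (-2) w = Bil w w"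
proof -
  have "velocity w \<in> hom_sobolev 1" using w hom_sobolev_mean_zero velocity_H1 by blast
  then show ?thesis
    unfolding drift_def Bil_def product_rule[OF _ w] ddx_velocity
    by (simp add: product_rule[OF _ w] ddx_velocity scaleR_add_right)
      (simp add: scaleR_2)
qed

text \<open>The transport term contributes 2 (k - p)/|p| and the stretching term sgn p = p/|p|;
  together they make (2 k - p)/|p|.\<close>

lemma fourier_coeff_Bil:
  assumes "w \<in> mean_zero" and v: "v \<in> hom_sobolev 1"
  shows "fourier_coeff (Bil (proj n w) v) k
    = - \<i> * (\<Sum>p\<in>freqs n. of_int (2 * k - p) / of_int \<bar>p\<bar> * fourier_coeff w p * fourier_coeff v (k - p))"
proof -
  have vp: "velocity (proj n w) = proj n (velocity w)"
    by (rule coord_eqI) (auto simp: mean_zero_velocity mean_zero_proj coord_proj coord_velocity)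
  have hp: "hilbert_transform (proj n w) = proj n (hilbert_transform w)"
    by (rule coord_eqI) (auto simp: mean_zero_hilbert mean_zero_proj coord_proj coord_hilbert)
  have p: "(of_int p :: complex) / of_int \<bar>p\<bar> = of_int (sgn p)" if "p \<noteq> 0" for p
    using that by (auto simp: abs_if sgn_if)
  show ?thesis
    unfolding Bil_def vp hp fourier_coeff_add fourier_coeff_scale fourier_coeff_times_proj
      fourier_coeff_ddx[OF l2seq_H1[OF v]] fourier_coeff_hilbert
    unfolding sum_distrib_left scaleR_sum_right sum.distrib[symmetric]
  proof (intro sum.cong refl)
    fix p assume "p \<in> freqs n"
    then have p0: "p \<noteq> 0" by (rule freqs_nonzero)
    have "of_int (2 * k - p) / (of_int \<bar>p\<bar> :: complex) = 2 * of_int (k - p) / of_int \<bar>p\<bar> + of_int (sgn p)"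
      unfolding p[OF p0, symmetric] using p0 by (simp add: add_divide_distrib[symmetric] del: of_int_abs)
    moreover have "2 *\<^sub>R (- W / q * (\<i> * K * V)) + - \<i> * r * W * V = - \<i> * ((2 * K / q + r) * W * V)"
      for W q K V r :: complex
      by (simp add: scaleR_conv_of_real algebra_simps)
    ultimately show "2 *\<^sub>R (fourier_coeff (velocity w) p * (\<i> * of_int (k - p) * fourier_coeff v (k - p))) +
         - \<i> * of_int (sgn p) * fourier_coeff w p * fourier_coeff v (k - p) =
         - \<i> * (of_int (2 * k - p) / of_int \<bar>p\<bar> * fourier_coeff w p * fourier_coeff v (k - p))"
      unfolding fourier_coeff_velocity[OF p0] by simp
  qed
qed

lemma fourier_coeff_proj: "fourier_coeff (proj n u) k = (if k \<in> freqs n then fourier_coeff u k else 0)"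
proof -
  have pos: "fourier_coeff (proj n u) k = (if k \<in> freqs n then fourier_coeff u k else 0)" if "k \<ge> 1" for k
    using that by (auto simp: fourier_coeff_pos coord_proj complex_eq_iff)
  consider "k \<ge> 1" | "k = 0" | "- k \<ge> 1" by linarith
  then show ?thesis
  proof cases
    case 2 then show ?thesis using mean_zero_proj[of n u] by (simp add: fourier_coeff_0 mean_zero_iff)
  next
    case 3 then show ?thesis using pos[of "-k"] fourier_coeff_uminus[of _ "-k"] by (auto split: if_splits)
  qed (use pos in auto)
qed

lemma coord_proj_in [simp]: "k \<in> freqs n \<Longrightarrow> coord (proj n u) k = coord u k"
  by (simp add: coord_proj freqs_nonzero)

lemma inner_proj_right: "inner y (proj n x) = (\<Sum>k\<in>freqs n. coord y k * coord x k)"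
  unfolding proj_def inner_sum_right by (simp add: mult.commute)

text \<open>Formally the pairing is the integral of the derivative of u x^2, where u is the
  velocity. In Fourier coefficients, the substitution (k, p) -> (k - p, - p) fixes 2 k - p and |p|
  and conjugates the product of coefficients; so the double sum is real and the factor - i removes
  it from the real part.\<close>

lemma Bil_skew_proj:
  assumes w: "w \<in> mean_zero"
  shows "inner (Bil (proj n w) (proj n x)) (proj n x) = 0"
proof -
  let ?x = "fourier_coeff (proj n x)" and ?w = "fourier_coeff w"
  have x0: "?x q = 0" if "q \<notin> freqs n" for q using that by (simp add: fourier_coeff_proj)
  define t where "t = (\<lambda>(k, p). of_int (2 * k - p) / of_int \<bar>p\<bar> * ?w p * ?x (k - p) * cnj (?x k))"
  let ?S = "sum t (freqs n \<times> freqs n)"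
  have coeff: "fourier_coeff (Bil (proj n w) (proj n x)) k * cnj (?x k) = - \<i> * (\<Sum>p\<in>freqs n. t (k, p))" for k
    unfolding fourier_coeff_Bil[OF w hom_sobolev_proj] by (simp add: t_def sum_distrib_right)
  have "inner (Bil (proj n w) (proj n x)) (proj n x)
      = (\<Sum>k\<in>freqs n. 1 * coord (Bil (proj n w) (proj n x)) k * coord (proj n x) k)"
    unfolding inner_proj_right by (intro sum.cong refl) simp
  also have "\<dots> = 2 * pi * (\<Sum>k\<in>freqs n. 1 * Re (fourier_coeff (Bil (proj n w) (proj n x)) k * cnj (?x k)))"
    by (rule sum_coord_fourier) simp
  also have "\<dots> = 2 * pi * Re (- \<i> * ?S)"
  proof -
    have S: "?S = (\<Sum>k\<in>freqs n. \<Sum>p\<in>freqs n. t (k, p))"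
      by (simp add: sum.cartesian_product)
    show ?thesis unfolding coeff S sum_distrib_left Re_sum by simp
  qed
  also have "cnj ?S = ?S"
    unfolding cnj_sum
  \<comment> \<open>Pairs with \<open>k - p\<close> outside the truncation leave the index square
    under the substitution; their terms vanish because \<open>x\<close> is truncated.\<close>
  proof (rule sum.reindex_bij_witness_not_neutral[where i = "\<lambda>(k, p). (k - p, - p)" and j = "\<lambda>(k, p). (k - p, - p)"
      and S' = "{z \<in> freqs n \<times> freqs n. fst z - snd z \<notin> freqs n}" and T' = "{z \<in> freqs n \<times> freqs n. fst z - snd z \<notin> freqs n}"])
    show "t (case z of (k, p) \<Rightarrow> (k - p, - p)) = cnj (t z)" for z
      by (cases z) (simp add: t_def fourier_coeff_uminus)
  qed (auto simp: t_def x0)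
  then have "Im ?S = 0" by (metis cnj.simps(2) equal_neg_zero)
  then have "Re (- \<i> * ?S) = 0" by simp
  finally show ?thesis by simp
qed

section \<open>The Sobolev estimate of the bilinear term\<close>

lemma sum_weighted_fourier_sq:
  "(\<Sum>k\<in>freqs n. (\<bar>of_int k\<bar> ^ j * cmod (fourier_coeff x k))\<^sup>2) = hsum j n x / (2 * pi)"
proof -
  have "hsum j n x = (\<Sum>k\<in>freqs n. \<bar>of_int k\<bar> ^ (2 * j) * coord x k * coord x k)"
    unfolding hsum_def by (simp add: power2_eq_square mult.assoc)
  also have "\<dots> = 2 * pi * (\<Sum>k\<in>freqs n. \<bar>of_int k\<bar> ^ (2 * j) * Re (fourier_coeff x k * cnj (fourier_coeff x k)))"
    by (rule sum_coord_fourier) simp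
  also have "(\<Sum>k\<in>freqs n. \<bar>of_int k\<bar> ^ (2 * j) * Re (fourier_coeff x k * cnj (fourier_coeff x k)))
     = (\<Sum>k\<in>freqs n. (\<bar>of_int k\<bar> ^ j * cmod (fourier_coeff x k))\<^sup>2)"
    by (intro sum.cong refl)
      (simp add: cmod_power2 power_mult_distrib mult.commute[of 2] flip: power_mult power2_eq_square)
  finally show ?thesis by simp
qed

text \<open>For fixed p, Cauchy-Schwarz in k pairs two square summable factors; translating
  \<open>H\<close> does not increase its norm over the truncation, since \<open>H\<close> is
  supported there. The third factor enters through its sum.\<close>

lemma trilinear:
  fixes F G H :: "int \<Rightarrow> real"
  assumes pos: "\<And>k. 0 \<le> F k" "\<And>k. 0 \<le> G k" "\<And>k. 0 \<le> H k"
    and supp: "\<And>k. k \<notin> freqs n \<Longrightarrow> H k = 0"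
  shows "(\<Sum>k\<in>freqs n. \<Sum>p\<in>freqs n. F k * G p * H (k - p)) \<le> L2_set F (freqs n) * (\<Sum>p\<in>freqs n. G p) * L2_set H (freqs n)"
proof -
  have "(\<Sum>k\<in>freqs n. \<Sum>p\<in>freqs n. F k * G p * H (k - p)) = (\<Sum>p\<in>freqs n. G p * (\<Sum>k\<in>freqs n. F k * H (k - p)))"
    by (subst sum.swap) (simp add: sum_distrib_left mult_ac)
  also have "\<dots> \<le> (\<Sum>p\<in>freqs n. G p * (L2_set F (freqs n) * L2_set H (freqs n)))"
  proof (intro sum_mono mult_left_mono pos)
    fix p
    have "(\<Sum>k\<in>freqs n. F k * H (k - p)) \<le> L2_set F (freqs n) * L2_set (\<lambda>k. H (k - p)) (freqs n)"
      using L2_set_mult_ineq[of F "\<lambda>k. H (k - p)" "freqs n"] by (simp add: pos)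
    also have "L2_set (\<lambda>k. H (k - p)) (freqs n) \<le> L2_set H (freqs n)"
      unfolding L2_set_def
    proof (rule real_sqrt_le_mono)
      have "(\<Sum>k\<in>freqs n. (H (k - p))\<^sup>2) = (\<Sum>q\<in>(\<lambda>k. k - p) ` freqs n. (H q)\<^sup>2)"
        by (subst sum.reindex) (auto simp: inj_on_def)
      also have "\<dots> = (\<Sum>q\<in>(\<lambda>k. k - p) ` freqs n \<inter> freqs n. (H q)\<^sup>2)"
        by (rule sum.mono_neutral_right) (auto simp: supp)
      also have "\<dots> \<le> (\<Sum>q\<in>freqs n. (H q)\<^sup>2)" by (rule sum_mono2) auto
      finally show "(\<Sum>k\<in>freqs n. (H (k - p))\<^sup>2) \<le> (\<Sum>q\<in>freqs n. (H q)\<^sup>2)" .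
    qed
    finally show "(\<Sum>k\<in>freqs n. F k * H (k - p)) \<le> L2_set F (freqs n) * L2_set H (freqs n)"
      by (simp add: mult_left_mono)
  qed
  also have "\<dots> = L2_set F (freqs n) * (\<Sum>p\<in>freqs n. G p) * L2_set H (freqs n)"
    by (simp add: sum_distrib_left[symmetric] sum_distrib_right[symmetric] mult_ac)
  finally show ?thesis .
qed

text \<open>The substitution p -> k - p; terms that leave the truncation are zero.\<close>

lemma trilinear_swap:
  fixes F G H :: "int \<Rightarrow> real"
  assumes supp: "\<And>k. k \<notin> freqs n \<Longrightarrow> H k = 0" "\<And>k. k \<notin> freqs n \<Longrightarrow> G k = 0"
  shows "(\<Sum>k\<in>freqs n. \<Sum>p\<in>freqs n. F k * G p * H (k - p)) = (\<Sum>k\<in>freqs n. \<Sum>p\<in>freqs n. F k * H p * G (k - p))"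
proof (rule sum.cong[OF refl])
  fix k
  show "(\<Sum>p\<in>freqs n. F k * G p * H (k - p)) = (\<Sum>p\<in>freqs n. F k * H p * G (k - p))"
    by (rule sum.reindex_bij_witness_not_neutral[where i = "\<lambda>p. k - p" and j = "\<lambda>p. k - p"
        and S' = "{p \<in> freqs n. k - p \<notin> freqs n}" and T' = "{p \<in> freqs n. k - p \<notin> freqs n}"])
      (auto simp: supp)
qed

text \<open>With q = k - p this is the symbol that remains after s + 1 of the 2 s derivatives have
  gone to the tested factor. The larger of |p| and |q| receives s derivatives, and the smaller one
  receives an inverse power that makes its coefficients summable.\<close>

lemma frequency_weight:
  assumes "s \<ge> 1" "p \<noteq> 0" "q \<noteq> (0::int)"
  shows "\<bar>real_of_int (p + q)\<bar> ^ (s - 1) * (\<bar>real_of_int (p + 2 * q)\<bar> / \<bar>of_int p\<bar>)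
     \<le> 3 * 2 ^ (s - 1) * (\<bar>of_int q\<bar> ^ s / \<bar>of_int p\<bar> + \<bar>of_int p\<bar> ^ s / \<bar>of_int q\<bar>)"
proof -
  define P Q where "P = \<bar>real_of_int p\<bar>" and "Q = \<bar>real_of_int q\<bar>"
  have PQ: "P \<ge> 1" "Q \<ge> 1" using assms unfolding P_def Q_def by linarith+
  define M where "M = max P Q"
  have 1: "\<bar>real_of_int (p + q)\<bar> \<le> 2 * M" and 2: "\<bar>real_of_int (p + 2 * q)\<bar> \<le> 3 * M"
    unfolding M_def P_def Q_def by auto
  \<comment> \<open>Where |p| dominates, 1/|p| is traded for the larger 1/|q|.\<close>
  have key: "M ^ s / P \<le> Q ^ s / P + P ^ s / Q"
  proof (cases "P \<le> Q")
    case True then show ?thesis using PQ by (simp add: M_def)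
  next
    case False
    then have "P ^ s / P \<le> P ^ s / Q" using PQ by (intro divide_left_mono) auto
    moreover have "0 \<le> Q ^ s / P" using PQ by simp
    ultimately show ?thesis using False by (simp add: M_def)
  qed
  have s: "M ^ s = M ^ (s - 1) * M" using assms(1) by (cases s) auto
  have "\<bar>real_of_int (p + q)\<bar> ^ (s - 1) * (\<bar>real_of_int (p + 2 * q)\<bar> / P) \<le> (2 * M) ^ (s - 1) * (3 * M / P)"
    by (intro mult_mono power_mono divide_right_mono 1 2) (use PQ in \<open>auto simp: M_def\<close>)
  also have "\<dots> = 3 * 2 ^ (s - 1) * (M ^ s / P)"
    by (simp add: s power_mult_distrib)
  also have "\<dots> \<le> 3 * 2 ^ (s - 1) * (Q ^ s / P + P ^ s / Q)"
    by (intro mult_left_mono key) simp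
  finally show ?thesis unfolding P_def Q_def by simp
qed

text \<open>The third norm is only that of L^2: coefficients divided by |k| have a sum at most twice
  their square norm, by \<open>sum_inverse_squares\<close>. This is why powers of the L^2 norm
  control the energy. The constant is the same for all truncations.\<close>

lemma Bil_sobolev_estimate:
  assumes s: "s \<ge> 1"
  obtains C where "C \<ge> 0" "\<And>n x. x \<in> mean_zero \<Longrightarrow>
    \<bar>\<Sum>k\<in>freqs n. \<bar>of_int k\<bar> ^ (2 * s) * coord x k * coord (Bil (proj n x) (proj n x)) k\<bar>
      \<le> C * sqrt (hsum (s + 1) n x) * sqrt (hsum s n x) * sqrt (hsum 0 n x)"
proof
  \<comment> \<open>2 pi comes from \<open>sum_coord_fourier\<close>, 3 * 2^(s - 1) from
    \<open>frequency_weight\<close>, one factor 2 from summing \<open>G\<close> and another from the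
    two symmetric sums. The three square roots convert Fourier coefficients into
    coordinates.\<close>
  let ?C = "24 * pi * 2 ^ (s - 1) / (sqrt (2 * pi)) ^ 3"
  show "?C \<ge> 0" by simp
  fix n x assume x: "x \<in> mean_zero"
  let ?B = "Bil (proj n x) (proj n x)" and ?I = "freqs n"
  define A where "A k = cmod (fourier_coeff (proj n x) k)" for k
  have A0: "A k \<ge> 0" for k by (simp add: A_def)
  have Aout: "A k = 0" if "k \<notin> ?I" for k using that by (simp add: A_def fourier_coeff_proj)
  have Ain: "A k = cmod (fourier_coeff x k)" if "k \<in> ?I" for k using that by (simp add: A_def fourier_coeff_proj)
  define F where "F k = \<bar>real_of_int k\<bar> ^ (s + 1) * A k" for k
  define H where "H k = \<bar>real_of_int k\<bar> ^ s * A k" for k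
  define G where "G k = A k / \<bar>real_of_int k\<bar>" for k
  have pos: "F k \<ge> 0" "G k \<ge> 0" "H k \<ge> 0" for k by (auto simp: F_def G_def H_def A0)
  have LF: "L2_set F ?I = sqrt (hsum (s + 1) n x) / sqrt (2 * pi)"
    unfolding L2_set_def using sum_weighted_fourier_sq[of "s + 1" x n]
    by (simp add: F_def Ain real_sqrt_divide cong: sum.cong)
  have LH: "L2_set H ?I = sqrt (hsum s n x) / sqrt (2 * pi)"
    unfolding L2_set_def using sum_weighted_fourier_sq[of s x n]
    by (simp add: H_def Ain real_sqrt_divide cong: sum.cong)
  have LA: "L2_set A ?I = sqrt (hsum 0 n x) / sqrt (2 * pi)"
    unfolding L2_set_def using sum_weighted_fourier_sq[of 0 x n]
    by (simp add: Ain real_sqrt_divide cong: sum.cong)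
  have G: "(\<Sum>p\<in>?I. G p) \<le> 2 * L2_set A ?I"
  proof -
    have "(\<Sum>p\<in>?I. \<bar>A p\<bar> * \<bar>1 / real_of_int p\<bar>) \<le> L2_set A ?I * L2_set (\<lambda>p. 1 / real_of_int p) ?I"
      by (rule L2_set_mult_ineq)
    also have "\<dots> \<le> L2_set A ?I * 2"
    proof (intro mult_left_mono L2_set_nonneg)
      show "L2_set (\<lambda>p. 1 / real_of_int p) ?I \<le> 2"
      unfolding L2_set_def
      by (rule real_le_lsqrt) (use sum_inverse_squares[of n] in \<open>auto simp: power_divide sum_nonneg\<close>)
    qed
    finally show ?thesis by (simp add: G_def A0 mult.commute)
  qed
  have coeff: "cmod (fourier_coeff ?B k) \<le> (\<Sum>p\<in>?I. \<bar>of_int (2 * k - p)\<bar> / \<bar>of_int p\<bar> * A p * A (k - p))" for k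
    unfolding fourier_coeff_Bil[OF x hom_sobolev_proj] norm_mult
    using norm_sum[of "\<lambda>p. of_int (2 * k - p) / of_int \<bar>p\<bar> * fourier_coeff x p * fourier_coeff (proj n x) (k - p)" ?I]
    by (simp add: norm_mult norm_divide Ain del: of_int_diff flip: A_def of_int_abs cong: sum.cong)
  have "(\<Sum>k\<in>?I. \<bar>of_int k\<bar> ^ (2 * s) * coord x k * coord ?B k)
     = 2 * pi * (\<Sum>k\<in>?I. \<bar>of_int k\<bar> ^ (2 * s) * Re (fourier_coeff x k * cnj (fourier_coeff ?B k)))"
    by (rule sum_coord_fourier) simp
  also have "\<bar>\<dots>\<bar> \<le> 2 * pi * (\<Sum>k\<in>?I. \<bar>\<bar>of_int k\<bar> ^ (2 * s) * Re (fourier_coeff x k * cnj (fourier_coeff ?B k))\<bar>)"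
    unfolding abs_mult[of "2 * pi"] by (intro order_trans[OF mult_left_mono[OF sum_abs]]) auto
  also have "(\<Sum>k\<in>?I. \<bar>\<bar>of_int k\<bar> ^ (2 * s) * Re (fourier_coeff x k * cnj (fourier_coeff ?B k))\<bar>)
     \<le> (\<Sum>k\<in>?I. \<Sum>p\<in>?I. 3 * 2 ^ (s - 1) * (F k * G p * H (k - p) + F k * H p * G (k - p)))"
  proof (rule sum_mono)
    fix k assume k: "k \<in> ?I"
    have "\<bar>\<bar>of_int k\<bar> ^ (2 * s) * Re (fourier_coeff x k * cnj (fourier_coeff ?B k))\<bar>
       \<le> \<bar>of_int k\<bar> ^ (2 * s) * (A k * cmod (fourier_coeff ?B k))"
      using abs_Re_le_cmod[of "fourier_coeff x k * cnj (fourier_coeff ?B k)"]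
      by (simp add: abs_mult norm_mult Ain[OF k] mult_left_mono)
    also have "\<dots> \<le> \<bar>of_int k\<bar> ^ (2 * s) * (A k * (\<Sum>p\<in>?I. \<bar>of_int (2 * k - p)\<bar> / \<bar>of_int p\<bar> * A p * A (k - p)))"
      by (intro mult_left_mono coeff A0) simp
    also have "\<dots> = (\<Sum>p\<in>?I. F k * A p * A (k - p) * (\<bar>of_int k\<bar> ^ (s - 1) * (\<bar>of_int (2 * k - p)\<bar> / \<bar>of_int p\<bar>)))"
    proof -
      have "s + 1 + (s - 1) = 2 * s" using s by simp
      then have "\<bar>real_of_int k\<bar> ^ (2 * s) = \<bar>of_int k\<bar> ^ (s + 1) * \<bar>of_int k\<bar> ^ (s - 1)"
        by (metis power_add)
      then show ?thesis unfolding F_def by (simp add: sum_distrib_left mult_ac)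
    qed
    also have "\<dots> \<le> (\<Sum>p\<in>?I. 3 * 2 ^ (s - 1) * (F k * G p * H (k - p) + F k * H p * G (k - p)))"
    proof (rule sum_mono)
      fix p assume p: "p \<in> ?I"
      show "F k * A p * A (k - p) * (\<bar>of_int k\<bar> ^ (s - 1) * (\<bar>of_int (2 * k - p)\<bar> / \<bar>of_int p\<bar>))
         \<le> 3 * 2 ^ (s - 1) * (F k * G p * H (k - p) + F k * H p * G (k - p))"
      proof (cases "k - p \<in> ?I")
        case False
        then have "A (k - p) = 0" "H (k - p) = 0" "G (k - p) = 0" by (auto simp: Aout G_def H_def)
        then show ?thesis by simp
      next
        case True
        have pq: "p + (k - p) = k" "p + 2 * (k - p) = 2 * k - p" by auto
        have "F k * A p * A (k - p) * (\<bar>of_int k\<bar> ^ (s - 1) * (\<bar>of_int (2 * k - p)\<bar> / \<bar>of_int p\<bar>))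
          \<le> F k * A p * A (k - p) * (3 * 2 ^ (s - 1) * (\<bar>of_int (k - p)\<bar> ^ s / \<bar>of_int p\<bar> + \<bar>of_int p\<bar> ^ s / \<bar>of_int (k - p)\<bar>))"
          using frequency_weight[OF s freqs_nonzero[OF p] freqs_nonzero[OF True]] unfolding pq
          by (intro mult_left_mono mult_nonneg_nonneg pos A0)
        also have "\<dots> = 3 * 2 ^ (s - 1) * (F k * G p * H (k - p) + F k * H p * G (k - p))"
          unfolding G_def H_def by (simp add: algebra_simps del: of_int_diff)
        finally show ?thesis .
      qed
    qed
    finally show "\<bar>\<bar>of_int k\<bar> ^ (2 * s) * Re (fourier_coeff x k * cnj (fourier_coeff ?B k))\<bar> \<le> \<dots>" .
  qed
  also have "\<dots> = 3 * 2 ^ (s - 1) * ((\<Sum>k\<in>?I. \<Sum>p\<in>?I. F k * G p * H (k - p)) + (\<Sum>k\<in>?I. \<Sum>p\<in>?I. F k * H p * G (k - p)))"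
    by (simp add: sum_distrib_left[symmetric] sum.distrib)
  also have "(\<Sum>k\<in>?I. \<Sum>p\<in>?I. F k * H p * G (k - p)) = (\<Sum>k\<in>?I. \<Sum>p\<in>?I. F k * G p * H (k - p))"
    by (rule trilinear_swap) (auto simp: G_def H_def Aout)
  also have "(\<Sum>k\<in>?I. \<Sum>p\<in>?I. F k * G p * H (k - p)) \<le> L2_set F ?I * (\<Sum>p\<in>?I. G p) * L2_set H ?I"
    by (rule trilinear) (auto simp: pos, auto simp: H_def Aout)
  also have "\<dots> \<le> L2_set F ?I * (2 * L2_set A ?I) * L2_set H ?I"
    by (intro mult_left_mono mult_right_mono G L2_set_nonneg)
  finally have "\<bar>\<Sum>k\<in>?I. \<bar>of_int k\<bar> ^ (2 * s) * coord x k * coord ?B k\<bar>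
    \<le> 2 * pi * (3 * 2 ^ (s - 1) * (L2_set F ?I * (2 * L2_set A ?I) * L2_set H ?I + L2_set F ?I * (2 * L2_set A ?I) * L2_set H ?I))"
    by (simp add: mult_left_mono)
  also have "\<dots> = ?C * sqrt (hsum (s + 1) n x) * sqrt (hsum s n x) * sqrt (hsum 0 n x)"
    unfolding LF LH LA by (simp add: power3_eq_cube)
  finally show "\<bar>\<Sum>k\<in>?I. \<bar>of_int k\<bar> ^ (2 * s) * coord x k * coord ?B k\<bar>
     \<le> ?C * sqrt (hsum (s + 1) n x) * sqrt (hsum s n x) * sqrt (hsum 0 n x)" .
qed

section \<open>Explicit Galerkin schemes\<close>

text \<open>States of the truncated system are plain coordinate functions, of which only the values
  on \<open>freqs n\<close> count; this suits noise increments and product measures.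
  \<open>wsum s n X\<close> below is the squared H^s norm of the polynomial
  \<open>tp n X\<close>.\<close>

definition tp :: "nat \<Rightarrow> (int \<Rightarrow> real) \<Rightarrow> l2_circle" where
  "tp n X = (\<Sum>k\<in>freqs n. X k *\<^sub>R basis_fun k)"

definition Dn :: "nat \<Rightarrow> (int \<Rightarrow> real) \<Rightarrow> int \<Rightarrow> real" where
  "Dn n X k = coord (Bil (tp n X) (tp n X)) k"

definition wsum :: "nat \<Rightarrow> nat \<Rightarrow> (int \<Rightarrow> real) \<Rightarrow> real" where
  "wsum s n X = (\<Sum>k\<in>freqs n. \<bar>of_int k\<bar> ^ (2 * s) * (X k)\<^sup>2)"

lemma wsum_nonneg [simp]: "0 \<le> wsum s n X"
  unfolding wsum_def by (intro sum_nonneg) auto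

lemma wsum_0: "wsum 0 n X = (\<Sum>k\<in>freqs n. (X k)\<^sup>2)"
  by (simp add: wsum_def)

lemma coord_tp: "l \<noteq> 0 \<Longrightarrow> coord (tp n X) l = (if l \<in> freqs n then X l else 0)"
  unfolding tp_def by (rule coord_sum) auto

lemma coord_tp_in [simp]: "l \<in> freqs n \<Longrightarrow> coord (tp n X) l = X l"
  by (simp add: coord_tp freqs_nonzero)

lemma hom_sobolev_tp [simp]: "tp n X \<in> hom_sobolev m"
  unfolding tp_def by (rule hom_sobolev_sum) auto

lemma mean_zero_tp [simp]: "tp n X \<in> mean_zero"
  unfolding tp_def by (rule mean_zero_sum) auto

lemma proj_tp [simp]: "proj n (tp n X) = tp n X"
  by (rule coord_eqI) (auto simp: mean_zero_proj coord_proj coord_tp)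

lemma tp_coord: "tp n (coord u) = proj n u"
  by (simp add: tp_def proj_def)

lemma tp_add: "tp n (\<lambda>k. X k + Y k) = tp n X + tp n Y"
  and tp_diff: "tp n (\<lambda>k. X k - Y k) = tp n X - tp n Y"
  by (simp_all add: tp_def scaleR_add_left scaleR_diff_left sum.distrib sum_subtractf)

lemma hsum_tp [simp]: "hsum s n (tp n X) = wsum s n X"
  unfolding hsum_def wsum_def by (intro sum.cong) auto

lemma norm_Lam_tp: "(norm (Lam s (tp n X)))\<^sup>2 = wsum s n X"
proof -
  have "Lam s (tp n X) = (\<Sum>k\<in>freqs n. (\<bar>of_int k\<bar> ^ s * X k) *\<^sub>R basis_fun k)"
    by (rule hom_sobolev_by_coord(2)) (auto simp: mean_zero_sum coord_sum coord_tp)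
  then show ?thesis
    by (simp add: norm_sum_basis wsum_def power_mult_distrib mult.commute[of 2] flip: power_mult)
qed

lemma norm_tp: "(norm (tp n X))\<^sup>2 = wsum 0 n X"
  using norm_Lam_tp[of 0 n X] by (simp add: Lam_0)

lemma wsum_mono_s: "s \<le> s' \<Longrightarrow> wsum s n X \<le> wsum s' n X"
  unfolding wsum_def by (intro sum_mono mult_right_mono power_increasing) (auto dest: freqs_nonzero nonzero_int_ge_1)

lemma abs_freqs_le: "k \<in> freqs n \<Longrightarrow> \<bar>real_of_int k\<bar> \<le> real n"
  by (auto simp: freqs_def)

lemma wsum_le_pow: "wsum s n X \<le> real n ^ (2 * s) * wsum 0 n X"
  unfolding wsum_def sum_distrib_left
  by (intro sum_mono) (simp add: mult_right_mono power_mono abs_freqs_le)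

lemma inner_tp: "inner u (tp n X) = (\<Sum>k\<in>freqs n. X k * coord u k)"
  by (simp add: tp_def inner_sum_right)

lemma sum_sq_le_norm: "(\<Sum>k\<in>freqs n. (coord u k)\<^sup>2) \<le> (norm u)\<^sup>2"
  by (rule bessel)

lemma Bil_skew:
  assumes "w \<in> mean_zero" shows "inner (Bil (tp n W) (tp n X)) (tp n X) = 0"
  using Bil_skew_proj[OF mean_zero_tp, of n n W "tp n X"] by simp

lemma Dn_skew: "(\<Sum>k\<in>freqs n. X k * Dn n X k) = 0"
  using Bil_skew[OF mean_zero_tp, of n X X] by (simp add: inner_tp Dn_def)

lemma norm_drift_tp: "norm (Bil (tp n X) (tp n X)) \<le> 6 * real n * wsum 0 n X"
proof -
  have "(norm (Lam 1 (tp n X)))\<^sup>2 \<le> (real n * norm (tp n X))\<^sup>2"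
    unfolding power_mult_distrib norm_Lam_tp norm_tp using wsum_le_pow[of 1 n X] by simp
  then have "norm (Lam 1 (tp n X)) \<le> real n * norm (tp n X)"
    by (rule power2_le_imp_le) simp
  then have "norm (tp n X) * norm (Lam 1 (tp n X)) \<le> norm (tp n X) * (real n * norm (tp n X))"
    by (rule mult_left_mono) simp
  then show ?thesis
    using norm_Bil[of "tp n X" "tp n X"] by (simp add: norm_tp[symmetric] power2_eq_square mult_ac)
qed

lemma Dn_bound: "(\<Sum>k\<in>freqs n. (Dn n X k)\<^sup>2) \<le> (6 * real n * wsum 0 n X)\<^sup>2"
  unfolding Dn_def
  by (rule order_trans[OF sum_sq_le_norm]) (intro power_mono norm_drift_tp norm_ge_zero)

text \<open>The difference of the two quadratic terms splits into \<open>Bil (w + E) E\<close> and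
  \<open>Bil E w\<close>, up to \<open>tp\<close>, and skewness removes the first from the pairing
  with \<open>E\<close>. Hence the growth rate sees only the H^1 norm of the reference state,
  uniformly in the truncation and in the size of \<open>E\<close>.\<close>

lemma Dn_stability:
  "(\<Sum>k\<in>freqs n. E k * (Dn n (\<lambda>k. w k + E k) k - Dn n w k)) \<le> 6 * norm (Lam 1 (tp n w)) * wsum 0 n E"
proof -
  let ?w = "tp n w" and ?e = "tp n E"
  have "(\<Sum>k\<in>freqs n. E k * (Dn n (\<lambda>k. w k + E k) k - Dn n w k)) = inner (Bil (?w + ?e) (?w + ?e) - Bil ?w ?w) ?e"
    by (simp add: Dn_def tp_add inner_tp inner_diff_left)
  also have "Bil (?w + ?e) (?w + ?e) - Bil ?w ?w = Bil (?w + ?e) ?e + Bil ?e ?w"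
    using Bil_diff_right[of "?w + ?e" "?w + ?e" ?w] Bil_diff_left[of "?w + ?e" ?w ?w]
      mean_zero_tp[of n w] mean_zero_tp[of n E] hom_sobolev_add[of ?w 1 ?e]
    by (simp add: mean_zero_iff)
  also have "inner (Bil (?w + ?e) ?e + Bil ?e ?w) ?e = inner (Bil ?e ?w) ?e"
    using Bil_skew[OF mean_zero_tp, of n "\<lambda>k. w k + E k" E] by (simp add: tp_add inner_add_left)
  also have "\<dots> \<le> norm (Bil ?e ?w) * norm ?e" by (rule norm_cauchy_schwarz)
  also have "\<dots> \<le> (6 * norm ?e * norm (Lam 1 ?w)) * norm ?e"
    by (intro mult_right_mono norm_Bil) auto
  finally show ?thesis by (simp add: norm_tp[symmetric] power2_eq_square mult_ac)
qed

text \<open>Meant for points of an exact path and their truncations: there the H^1 distance is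
  small, so losing a derivative on the difference is harmless.\<close>

lemma drift_difference:
  assumes a: "a \<in> hom_sobolev 1" and b: "b \<in> hom_sobolev 1"
    and Ka: "norm (Lam 1 a) \<le> K" and Kb: "norm (Lam 1 b) \<le> K" 
  shows "norm (Bil a a - Bil b b) \<le> 12 * K * norm (Lam 1 (a - b))"
proof -
  note az = hom_sobolev_mean_zero[OF a] hom_sobolev_mean_zero[OF b] hom_sobolev_mean_zero[OF hom_sobolev_diff[OF a b]]
  have "Bil a a - Bil b b = Bil a (a - b) + Bil (a - b) b"
    by (simp add: Bil_diff_right[OF az(1) a b] Bil_diff_left[OF az(1,2) b])
  also have "norm \<dots> \<le> norm (Bil a (a - b)) + norm (Bil (a - b) b)" by (rule norm_triangle_ineq)
  also have "\<dots> \<le> 6 * norm a * norm (Lam 1 (a - b)) + 6 * norm (a - b) * norm (Lam 1 b)"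
    by (intro add_mono norm_Bil az hom_sobolev_diff a b)
  also have "\<dots> \<le> 6 * K * norm (Lam 1 (a - b)) + 6 * norm (Lam 1 (a - b)) * K"
  proof (intro add_mono mult_mono order_refl)
    show "norm a \<le> K" using norm_le_Lam[OF a] Ka by simp
    show "norm (a - b) \<le> norm (Lam 1 (a - b))" by (rule norm_le_Lam[OF hom_sobolev_diff[OF a b]])
  qed (use Ka Kb order_trans[OF norm_ge_zero Ka] in auto)
  finally show ?thesis by simp
qed

text \<open>Young's inequality spends half of the viscosity. What remains, c L b, is split by
  frequency: where c L is at most (\<nu>/2) k^2 the other half absorbs it, and elsewhere |k|^(2 s)
  is at most (2 c L/\<nu>)^s. This produces the power s + 2 of the squared L^2 norm.\<close>

lemma Dn_sobolev:
  assumes s: "s \<ge> 1" and nu: "\<nu> > 0"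
  obtains C where "C \<ge> 0" "\<And>n X. 2 * (\<Sum>k\<in>freqs n. \<bar>of_int k\<bar> ^ (2 * s) * X k * Dn n X k)
     \<le> \<nu> * wsum (s + 1) n X + C * wsum 0 n X ^ (s + 2)"
proof -
  obtain C where C: "C \<ge> 0" "\<And>n x. x \<in> mean_zero \<Longrightarrow>
    \<bar>\<Sum>k\<in>freqs n. \<bar>of_int k\<bar> ^ (2 * s) * coord x k * coord (Bil (proj n x) (proj n x)) k\<bar>
      \<le> C * sqrt (hsum (s + 1) n x) * sqrt (hsum s n x) * sqrt (hsum 0 n x)"
    using Bil_sobolev_estimate[OF s] by blast
  \<comment> \<open>From 2 x y <= (\<nu>/2) x^2 + (2/\<nu>) y^2 with x^2 = a and y^2 = C^2 b
    L.\<close>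
  define c where "c = 2 * C\<^sup>2 / \<nu>"
  have c0: "c \<ge> 0" using nu by (simp add: c_def)
  show thesis
  proof
    show "c * (2 * c / \<nu>) ^ s \<ge> 0" using c0 nu by simp
    fix n X
    define a b L where "a = wsum (s + 1) n X" and "b = wsum s n X" and "L = wsum 0 n X"
    have nn: "a \<ge> 0" "b \<ge> 0" "L \<ge> 0" by (auto simp: a_def b_def L_def)
    have "(\<Sum>k\<in>freqs n. \<bar>of_int k\<bar> ^ (2 * s) * X k * Dn n X k) \<le> C * sqrt a * sqrt b * sqrt L"
      using C(2)[where n = n and x = "tp n X", OF mean_zero_tp] by (simp add: a_def b_def L_def Dn_def)
    also have "2 * (C * sqrt a * sqrt b * sqrt L) \<le> \<nu> / 2 * a + c * L * b"
    proof -
      let ?x = "sqrt a" and ?y = "C * sqrt b * sqrt L"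
      have "0 \<le> (\<nu> / 2) * (?x - 2 / \<nu> * ?y)\<^sup>2" using nu by simp
      also have "\<dots> = \<nu> / 2 * ?x\<^sup>2 - 2 * ?x * ?y + 2 / \<nu> * ?y\<^sup>2"
        using nu by (simp add: power2_eq_square field_simps)
      finally show ?thesis using nn by (simp add: power_mult_distrib c_def mult_ac)
    qed
    also have "c * L * b \<le> \<nu> / 2 * a + c * (2 * c / \<nu>) ^ s * L ^ (s + 2)"
    proof -
      have k: "c * L * \<bar>real_of_int k\<bar> ^ (2 * s) \<le> \<nu> / 2 * \<bar>of_int k\<bar> ^ (2 * (s + 1)) + c * L * (2 * (c * L) / \<nu>) ^ s" for k
      proof (cases "c * L \<le> \<nu> / 2 * \<bar>real_of_int k\<bar> ^ 2")
        case True
        then have "c * L * \<bar>real_of_int k\<bar> ^ (2 * s) \<le> (\<nu> / 2 * \<bar>real_of_int k\<bar> ^ 2) * \<bar>real_of_int k\<bar> ^ (2 * s)"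
          by (rule mult_right_mono) simp
        also have "\<dots> = \<nu> / 2 * \<bar>of_int k\<bar> ^ (2 * (s + 1))"
          by (simp add: power_add mult_ac power2_eq_square)
        also have "\<dots> \<le> \<nu> / 2 * \<bar>of_int k\<bar> ^ (2 * (s + 1)) + c * L * (2 * (c * L) / \<nu>) ^ s"
          using c0 nn nu by simp
        finally show ?thesis .
      next
        case False
        then have "\<bar>real_of_int k\<bar> ^ 2 \<le> 2 * (c * L) / \<nu>" using nu by (simp add: field_simps)
        then have "(\<bar>real_of_int k\<bar> ^ 2) ^ s \<le> (2 * (c * L) / \<nu>) ^ s" by (rule power_mono) simp
        then have "c * L * \<bar>real_of_int k\<bar> ^ (2 * s) \<le> c * L * (2 * (c * L) / \<nu>) ^ s"
          unfolding power_mult[symmetric] using c0 nn by (intro mult_left_mono) auto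
        moreover have "0 \<le> \<nu> / 2 * \<bar>real_of_int k\<bar> ^ (2 * (s + 1))" using nu by simp
        ultimately show ?thesis by linarith
      qed
      have "c * L * b = (\<Sum>k\<in>freqs n. (c * L * \<bar>real_of_int k\<bar> ^ (2 * s)) * (X k)\<^sup>2)"
        unfolding b_def wsum_def by (simp add: sum_distrib_left mult_ac)
      also have "\<dots> \<le> (\<Sum>k\<in>freqs n. (\<nu> / 2 * \<bar>of_int k\<bar> ^ (2 * (s + 1)) + c * L * (2 * (c * L) / \<nu>) ^ s) * (X k)\<^sup>2)"
        by (intro sum_mono mult_right_mono k) simp
      also have "\<dots> = \<nu> / 2 * a + c * L * (2 * (c * L) / \<nu>) ^ s * L"
        unfolding a_def L_def wsum_0 unfolding wsum_def
        by (simp add: distrib_right sum.distrib sum_distrib_left mult.assoc)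
      also have "c * L * (2 * (c * L) / \<nu>) ^ s * L = c * (2 * c / \<nu>) ^ s * L ^ (s + 2)"
        by (simp add: power_mult_distrib power_divide power_add power2_eq_square mult_ac)
      finally show ?thesis .
    qed
    finally show "2 * (\<Sum>k\<in>freqs n. \<bar>of_int k\<bar> ^ (2 * s) * X k * Dn n X k)
     \<le> \<nu> * wsum (s + 1) n X + c * (2 * c / \<nu>) ^ s * wsum 0 n X ^ (s + 2)"
      by (simp add: a_def L_def)
  qed
qed

text \<open>Switching the quadratic term off outside a ball keeps all moments of the explicit scheme finite.\<close>

definition Gn :: "real \<Rightarrow> nat \<Rightarrow> (int \<Rightarrow> real) \<Rightarrow> int \<Rightarrow> real" where
  "Gn \<nu> n X k = - \<nu> * (of_int k)\<^sup>2 * X k + (if wsum 0 n X \<le> (real n)\<^sup>2 then Dn n X k else 0)"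

section \<open>A single explicit step\<close>

definition step :: "real \<Rightarrow> nat \<Rightarrow> real \<Rightarrow> (int \<Rightarrow> real) \<Rightarrow> (int \<Rightarrow> real) \<Rightarrow> int \<Rightarrow> real" where
  "step \<nu> n h X \<zeta> k = X k + h * Gn \<nu> n X k + \<zeta> k"

text \<open>On \<open>freqs n\<close> the second derivative is bounded by n^2, and the cut-off drift
  by 6 n * n^2; the square of a sum costs a factor 2, hence 2 * 36 = 72. These powers of n decide
  how fine the mesh has to be.\<close>

lemma Gn_sq_bound:
  "(\<Sum>k\<in>freqs n. \<bar>of_int k\<bar> ^ (2 * s) * (Gn \<nu> n X k)\<^sup>2) \<le> 2 * \<nu>\<^sup>2 * real n ^ 4 * wsum s n X + 72 * real n ^ (2 * s + 6)"
proof -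
  let ?D = "\<lambda>k. if wsum 0 n X \<le> (real n)\<^sup>2 then Dn n X k else 0"
  have "(\<Sum>k\<in>freqs n. \<bar>of_int k\<bar> ^ (2 * s) * (Gn \<nu> n X k)\<^sup>2)
     \<le> (\<Sum>k\<in>freqs n. 2 * \<nu>\<^sup>2 * real n ^ 4 * (\<bar>of_int k\<bar> ^ (2 * s) * (X k)\<^sup>2) + 2 * real n ^ (2 * s) * (?D k)\<^sup>2)"
  proof (rule sum_mono)
    fix k assume k: "k \<in> freqs n"
    have sq: "(x + y)\<^sup>2 \<le> 2 * x\<^sup>2 + 2 * y\<^sup>2" for x y :: real
      using sum_squares_bound[of x y] by (simp add: power2_sum)
    have kn: "\<bar>real_of_int k\<bar> \<le> real n" by (rule abs_freqs_le[OF k])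
    have "(real_of_int k)\<^sup>2 ^ 2 \<le> real n ^ 4"
      using power_mono[OF kn, of 4] by (simp flip: power_mult)
    then have "(- \<nu> * (of_int k)\<^sup>2 * X k)\<^sup>2 \<le> \<nu>\<^sup>2 * real n ^ 4 * (X k)\<^sup>2"
      by (simp add: power_mult_distrib mult_left_mono mult_right_mono)
    then have "(Gn \<nu> n X k)\<^sup>2 \<le> 2 * (\<nu>\<^sup>2 * real n ^ 4 * (X k)\<^sup>2) + 2 * (?D k)\<^sup>2"
      unfolding Gn_def using sq[of "- \<nu> * (of_int k)\<^sup>2 * X k" "?D k"] by linarith
    then have "\<bar>of_int k\<bar> ^ (2 * s) * (Gn \<nu> n X k)\<^sup>2 \<le> \<bar>of_int k\<bar> ^ (2 * s) * (2 * (\<nu>\<^sup>2 * real n ^ 4 * (X k)\<^sup>2) + 2 * (?D k)\<^sup>2)"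
      by (rule mult_left_mono) simp
    also have "\<dots> \<le> 2 * \<nu>\<^sup>2 * real n ^ 4 * (\<bar>of_int k\<bar> ^ (2 * s) * (X k)\<^sup>2) + 2 * real n ^ (2 * s) * (?D k)\<^sup>2"
      using mult_right_mono[OF power_mono[OF kn, of "2 * s"], of "2 * (?D k)\<^sup>2"] by (simp add: algebra_simps)
    finally show "\<bar>of_int k\<bar> ^ (2 * s) * (Gn \<nu> n X k)\<^sup>2 \<le> \<dots>" .
  qed
  also have "\<dots> = 2 * \<nu>\<^sup>2 * real n ^ 4 * wsum s n X + 2 * real n ^ (2 * s) * (\<Sum>k\<in>freqs n. (?D k)\<^sup>2)"
    by (simp add: sum.distrib sum_distrib_left wsum_def)
  also have "2 * real n ^ (2 * s) * (\<Sum>k\<in>freqs n. (?D k)\<^sup>2) \<le> 2 * real n ^ (2 * s) * (36 * real n ^ 6)"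
  proof (rule mult_left_mono)
    show "(\<Sum>k\<in>freqs n. (?D k)\<^sup>2) \<le> 36 * real n ^ 6"
    proof (cases "wsum 0 n X \<le> (real n)\<^sup>2")
      case True
      then have "6 * real n * wsum 0 n X \<le> 6 * real n * (real n)\<^sup>2" by (intro mult_left_mono) auto
      then have "(6 * real n * wsum 0 n X)\<^sup>2 \<le> (6 * real n * (real n)\<^sup>2)\<^sup>2" by (rule power_mono) simp
      also have "\<dots> = 36 * real n ^ 6" by (simp add: power_mult_distrib flip: power_mult power_Suc power_add power_Suc2)
      finally show ?thesis using order_trans[OF Dn_bound] True by simp
    qed simp
  qed simp
  finally show ?thesis by (simp add: power_add)
qed

lemma wsum_step_0:
  "wsum s n (\<lambda>k. X k + h * G k) = wsum s n X + 2 * h * (\<Sum>k\<in>freqs n. \<bar>of_int k\<bar> ^ (2 * s) * X k * G k)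
      + h\<^sup>2 * (\<Sum>k\<in>freqs n. \<bar>of_int k\<bar> ^ (2 * s) * (G k)\<^sup>2)"
  unfolding wsum_def sum_distrib_left sum.distrib[symmetric]
  by (intro sum.cong refl) (simp add: power2_eq_square algebra_simps)

lemma sum_X_Gn:
  "(\<Sum>k\<in>freqs n. \<bar>of_int k\<bar> ^ (2 * s) * X k * Gn \<nu> n X k) = - \<nu> * wsum (s + 1) n X
    + (if wsum 0 n X \<le> (real n)\<^sup>2 then (\<Sum>k\<in>freqs n. \<bar>of_int k\<bar> ^ (2 * s) * X k * Dn n X k) else 0)"
proof -
  let ?P = "wsum 0 n X \<le> (real n)\<^sup>2"
  have "\<bar>of_int k\<bar> ^ (2 * s) * X k * Gn \<nu> n X k = - \<nu> * (\<bar>of_int k\<bar> ^ (2 * (s + 1)) * (X k)\<^sup>2)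
      + (if ?P then \<bar>of_int k\<bar> ^ (2 * s) * X k * Dn n X k else 0)" for k
  proof -
    have "\<bar>real_of_int k\<bar> ^ (2 * (s + 1)) = \<bar>of_int k\<bar> ^ (2 * s) * (of_int k)\<^sup>2"
      by (simp add: power_add power2_eq_square)
    then show ?thesis by (simp add: Gn_def algebra_simps power2_eq_square)
  qed
  note eq = this
  show ?thesis
    unfolding eq sum.distrib wsum_def[of "s + 1"] sum_distrib_left[symmetric] by (cases ?P) simp_all
qed

text \<open>Rewrites the second-order term of a step as first-order terms times quantities that the
  mesh conditions bound by 1.\<close>

lemma absorb: "h\<^sup>2 * (2 * \<nu>\<^sup>2 * p * w + 72 * q) = (4 * h * \<nu> * p) * (h * \<nu> / 2 * w) + (72 * h * q) * (h :: real)"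
  by (simp add: power2_eq_square algebra_simps)

text \<open>The quadratic term drops out by skewness and the viscosity removes 2 \<nu> h. The
  second-order term gives back at most \<nu> h/2 and an additive h, so the rate \<nu>
  survives.\<close>

lemma step_L2_bound:
  assumes nu: "\<nu> > 0" and h: "h \<ge> 0" "4 * h * \<nu> * real n ^ 4 \<le> 1" "72 * h * real n ^ 6 \<le> 1"
  shows "wsum 0 n (\<lambda>k. X k + h * Gn \<nu> n X k) \<le> (1 - \<nu> * h) * wsum 0 n X + h"
proof -
  have 1: "2 * h * (\<Sum>k\<in>freqs n. \<bar>of_int k\<bar> ^ (2 * 0) * X k * Gn \<nu> n X k) \<le> - 2 * \<nu> * h * wsum 0 n X"
    using wsum_mono_s[of 0 "0 + 1" n X] nu h Dn_skew[of X n] unfolding sum_X_Gn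
    by (simp add: mult_left_mono)
  have "h\<^sup>2 * (\<Sum>k\<in>freqs n. \<bar>of_int k\<bar> ^ (2 * 0) * (Gn \<nu> n X k)\<^sup>2) \<le> h\<^sup>2 * (2 * \<nu>\<^sup>2 * real n ^ 4 * wsum 0 n X + 72 * real n ^ (2 * 0 + 6))"
    by (intro mult_left_mono Gn_sq_bound) simp
  also have "\<dots> = (4 * h * \<nu> * real n ^ 4) * (h * \<nu> / 2 * wsum 0 n X) + (72 * h * real n ^ 6) * h"
    using absorb[of h \<nu> "real n ^ 4" "wsum 0 n X" "real n ^ 6"] by (simp only: mult_zero_right add_0)
  also have "\<dots> \<le> 1 * (h * \<nu> / 2 * wsum 0 n X) + 1 * h"
    using nu h by (intro add_mono mult_right_mono) auto
  finally have 2: "h\<^sup>2 * (\<Sum>k\<in>freqs n. \<bar>of_int k\<bar> ^ (2 * 0) * (Gn \<nu> n X k)\<^sup>2) \<le> h * \<nu> / 2 * wsum 0 n X + h" by simp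
  define w where "w = \<nu> * h * wsum 0 n X"
  have w: "- 2 * \<nu> * h * wsum 0 n X = - 2 * w" "h * \<nu> / 2 * wsum 0 n X = w / 2" "(1 - \<nu> * h) * wsum 0 n X = wsum 0 n X - w"
    unfolding w_def by (simp_all only: left_diff_distrib mult_1_left mult.assoc mult.commute[of h \<nu>] mult_minus_left
      times_divide_eq_left times_divide_eq_right mult.left_commute[of h \<nu>])
  have "0 \<le> w" unfolding w_def using nu h by simp
  with 1 2 show ?thesis unfolding wsum_step_0 w by simp
qed

text \<open>Of the viscous rate 2 \<nu> the nonlinearity takes \<nu> through
  \<open>Dn_sobolev\<close> and the second-order term another \<nu>/2. The remaining dissipation of
  order s + 1 is weakened to order s.\<close>

lemma step_sobolev_bound:
  assumes s: "s \<ge> 1" and nu: "\<nu> > 0"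
  obtains C where "C \<ge> 0" "\<And>n h X. h \<ge> 0 \<Longrightarrow> 4 * h * \<nu> * real n ^ 4 \<le> 1 \<Longrightarrow> 72 * h * real n ^ (2 * s + 6) \<le> 1 \<Longrightarrow>
    wsum s n (\<lambda>k. X k + h * Gn \<nu> n X k) \<le> (1 - \<nu> / 2 * h) * wsum s n X + h * (1 + C * wsum 0 n X ^ (s + 2))"
proof -
  obtain C where C: "C \<ge> 0" "\<And>n X. 2 * (\<Sum>k\<in>freqs n. \<bar>of_int k\<bar> ^ (2 * s) * X k * Dn n X k)
     \<le> \<nu> * wsum (s + 1) n X + C * wsum 0 n X ^ (s + 2)"
    using Dn_sobolev[OF s nu] by blast
  show thesis
  proof
    fix n h X
    assume h: "(0::real) \<le> h" "4 * h * \<nu> * real n ^ 4 \<le> 1" "72 * h * real n ^ (2 * s + 6) \<le> 1"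
    have "2 * (\<Sum>k\<in>freqs n. \<bar>of_int k\<bar> ^ (2 * s) * X k * Gn \<nu> n X k) \<le> - \<nu> * wsum (s + 1) n X + C * wsum 0 n X ^ (s + 2)"
      using C(2)[where n = n and X = X] C(1) nu wsum_nonneg[of "s + 1" n X] wsum_nonneg[of 0 n X]
        mult_nonneg_nonneg[of \<nu> "wsum (s + 1) n X"] mult_nonneg_nonneg[OF C(1) zero_le_power[OF wsum_nonneg[of 0 n X], of "s + 2"]]
      unfolding sum_X_Gn by (simp del: wsum_nonneg)
    also have "\<dots> \<le> - \<nu> * wsum s n X + C * wsum 0 n X ^ (s + 2)"
      using wsum_mono_s[of s "s + 1" n X] nu by simp
    finally have "h * (2 * (\<Sum>k\<in>freqs n. \<bar>of_int k\<bar> ^ (2 * s) * X k * Gn \<nu> n X k)) \<le> h * (- \<nu> * wsum s n X + C * wsum 0 n X ^ (s + 2))"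
      using h(1) by (rule mult_left_mono)
    moreover have "h\<^sup>2 * (\<Sum>k\<in>freqs n. \<bar>of_int k\<bar> ^ (2 * s) * (Gn \<nu> n X k)\<^sup>2) \<le> h * \<nu> / 2 * wsum s n X + h"
    proof -
      have "h\<^sup>2 * (\<Sum>k\<in>freqs n. \<bar>of_int k\<bar> ^ (2 * s) * (Gn \<nu> n X k)\<^sup>2) \<le> h\<^sup>2 * (2 * \<nu>\<^sup>2 * real n ^ 4 * wsum s n X + 72 * real n ^ (2 * s + 6))"
        by (intro mult_left_mono Gn_sq_bound) simp
      also have "\<dots> = (4 * h * \<nu> * real n ^ 4) * (h * \<nu> / 2 * wsum s n X) + (72 * h * real n ^ (2 * s + 6)) * h"
        by (rule absorb)
      also have "\<dots> \<le> 1 * (h * \<nu> / 2 * wsum s n X) + 1 * h"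
        using nu h by (intro add_mono mult_right_mono) auto
      finally show ?thesis by simp
    qed
    ultimately show "wsum s n (\<lambda>k. X k + h * Gn \<nu> n X k) \<le> (1 - \<nu> / 2 * h) * wsum s n X + h * (1 + C * wsum 0 n X ^ (s + 2))"
      unfolding wsum_step_0 by (simp add: algebra_simps)
  qed (rule C(1))
qed

section \<open>Driven paths and stability of the scheme\<close>

primrec scheme :: "real \<Rightarrow> nat \<Rightarrow> real \<Rightarrow> (nat \<Rightarrow> int \<Rightarrow> real) \<Rightarrow> (int \<Rightarrow> real) \<Rightarrow> nat \<Rightarrow> int \<Rightarrow> real" where
  "scheme \<nu> n h \<zeta> X 0 = X"
| "scheme \<nu> n h \<zeta> X (Suc j) = step \<nu> n h (scheme \<nu> n h \<zeta> X j) (\<zeta> j)"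

definition vfield :: "real \<Rightarrow> l2_circle \<Rightarrow> int \<Rightarrow> real" where
  "vfield \<nu> u k = - \<nu> * (of_int k)\<^sup>2 * coord u k + coord (Bil u u) k"

text \<open>The pathwise notion of solution, free of probability. The driver \<open>z\<close> is
  arbitrary: the path and the scheme receive the same increments of it, so it cancels from their
  difference.\<close>

definition drift_path :: "real \<Rightarrow> real \<Rightarrow> (real \<Rightarrow> int \<Rightarrow> real) \<Rightarrow> (real \<Rightarrow> l2_circle) \<Rightarrow> bool" where
  "drift_path \<nu> T z x \<longleftrightarrow> (\<forall>t\<in>{0..T}. x t \<in> hom_sobolev 1) \<and> continuous_on {0..T} (\<lambda>t. Lam 1 (x t)) \<and>
     (\<forall>k\<in>nonzero_ints. \<forall>t\<in>{0..T}. coord (x t) k = coord (x 0) k + integral {0..t} (\<lambda>s. vfield \<nu> (x s) k) + z t k)"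

lemma norm_basis_fun: "k \<noteq> 0 \<Longrightarrow> norm (basis_fun k) = 1"
  using inner_basis_fun[of k k] by (simp add: norm_eq_sqrt_inner)

lemma coord_le_norm: "k \<noteq> 0 \<Longrightarrow> \<bar>coord u k\<bar> \<le> norm u"
  using Cauchy_Schwarz_ineq2[of u "basis_fun k"] by (simp add: norm_basis_fun)

lemma norm_proj_le: "norm (proj n u) \<le> norm u"
proof -
  have "(norm (proj n u))\<^sup>2 \<le> (norm u)\<^sup>2"
    using bessel[of u n] norm_sum_basis[of "freqs n" "coord u"] by (simp add: proj_def)
  then show ?thesis by (rule power2_le_imp_le) simp
qed

lemma proj_diff: "proj n (u - v) = proj n u - proj n v"
  by (simp add: proj_def inner_diff_left scaleR_diff_left sum_subtractf)

lemma norm_Lam_proj_le: "u \<in> hom_sobolev m \<Longrightarrow> norm (Lam m (proj n u)) \<le> norm (Lam m u)"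
  by (simp add: Lam_proj norm_proj_le)

context
  fixes \<nu> T :: real and z :: "real \<Rightarrow> int \<Rightarrow> real" and x :: "real \<Rightarrow> l2_circle"
  assumes path: "drift_path \<nu> T z x"
begin

lemma path_H1: "t \<in> {0..T} \<Longrightarrow> x t \<in> hom_sobolev 1"
  using path by (simp add: drift_path_def)

lemma path_mean_zero: "t \<in> {0..T} \<Longrightarrow> x t \<in> mean_zero"
  using path_H1 hom_sobolev_mean_zero by blast

lemma path_continuous: "continuous_on {0..T} (\<lambda>t. Lam 1 (x t))"
  using path by (simp add: drift_path_def)

lemma path_bound: obtains K where "K \<ge> 1" "\<And>t. t \<in> {0..T} \<Longrightarrow> norm (Lam 1 (x t)) \<le> K"
proof -
  have "bounded ((\<lambda>t. Lam 1 (x t)) ` {0..T})"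
    by (intro compact_imp_bounded compact_continuous_image path_continuous compact_Icc)
  then obtain B where "\<forall>t\<in>{0..T}. norm (Lam 1 (x t)) \<le> B" unfolding bounded_iff by auto
  then show thesis by (intro that[of "max 1 B"]) (auto simp: le_max_iff_disj)
qed

lemma path_coord_continuous: "k \<noteq> 0 \<Longrightarrow> continuous_on {0..T} (\<lambda>t. coord (x t) k)"
proof -
  assume k: "k \<noteq> 0"
  have "continuous_on {0..T} (\<lambda>t. coord (Lam 1 (x t)) k / \<bar>of_int k\<bar>)"
    by (intro continuous_intros path_continuous) (use k in auto)
  moreover have "coord (Lam 1 (x t)) k / \<bar>of_int k\<bar> = coord (x t) k" if "t \<in> {0..T}" for t
    using k by (simp add: coord_Lam[OF path_H1[OF that]])
  ultimately show ?thesis by (rule continuous_on_eq)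
qed

lemma path_Bil_continuous: "continuous_on {0..T} (\<lambda>t. Bil (x t) (x t))"
proof -
  obtain K where K: "\<And>t. t \<in> {0..T} \<Longrightarrow> norm (Lam 1 (x t)) \<le> K" using path_bound by metis
  show ?thesis unfolding continuous_on_def
  proof
    fix t assume t: "t \<in> {0..T}"
    have "((\<lambda>s. Bil (x s) (x s) - Bil (x t) (x t)) \<longlongrightarrow> 0) (at t within {0..T})"
    proof (rule Lim_null_comparison)
      show "\<forall>\<^sub>F s in at t within {0..T}. norm (Bil (x s) (x s) - Bil (x t) (x t)) \<le> 12 * K * norm (Lam 1 (x s) - Lam 1 (x t))"
        unfolding eventually_at_filter
      proof (intro always_eventually allI impI)
        fix s assume s: "s \<in> {0..T}"
        show "norm (Bil (x s) (x s) - Bil (x t) (x t)) \<le> 12 * K * norm (Lam 1 (x s) - Lam 1 (x t))"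
          using drift_difference[OF path_H1[OF s] path_H1[OF t] K[OF s] K[OF t]]
          by (simp add: Lam_diff[OF path_H1[OF s] path_H1[OF t]])
      qed
      have "((\<lambda>s. Lam 1 (x s)) \<longlongrightarrow> Lam 1 (x t)) (at t within {0..T})"
        using path_continuous t unfolding continuous_on_def by blast
      then show "((\<lambda>s. 12 * K * norm (Lam 1 (x s) - Lam 1 (x t))) \<longlongrightarrow> 0) (at t within {0..T})"
        by (intro tendsto_mult_right_zero tendsto_norm_zero LIM_zero)
    qed
    then show "((\<lambda>s. Bil (x s) (x s)) \<longlongrightarrow> Bil (x t) (x t)) (at t within {0..T})"
      by (rule LIM_zero_cancel)
  qed
qed

lemma path_vfield_continuous: "k \<noteq> 0 \<Longrightarrow> continuous_on {0..T} (\<lambda>t. vfield \<nu> (x t) k)"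
  unfolding vfield_def by (intro continuous_intros path_coord_continuous path_Bil_continuous)

lemma path_increment:
  assumes "k \<noteq> 0" "0 \<le> t" "t \<le> t'" "t' \<le> T"
  shows "coord (x t') k - coord (x t) k = integral {t..t'} (\<lambda>s. vfield \<nu> (x s) k) + (z t' k - z t k)"
proof -
  have "(\<lambda>s. vfield \<nu> (x s) k) integrable_on {0..t'}"
    by (intro integrable_continuous_interval continuous_on_subset[OF path_vfield_continuous]) (use assms in auto)
  then have "integral {0..t} (\<lambda>s. vfield \<nu> (x s) k) + integral {t..t'} (\<lambda>s. vfield \<nu> (x s) k) = integral {0..t'} (\<lambda>s. vfield \<nu> (x s) k)"
    by (intro Henstock_Kurzweil_Integration.integral_combine) (use assms in auto)
  moreover have "coord (x t) k = coord (x 0) k + integral {0..t} (\<lambda>s. vfield \<nu> (x s) k) + z t k"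
    "coord (x t') k = coord (x 0) k + integral {0..t'} (\<lambda>s. vfield \<nu> (x s) k) + z t' k"
    by (rule path[unfolded drift_path_def, THEN conjunct2, THEN conjunct2, rule_format]; use assms in simp)+
  ultimately show ?thesis by linarith
qed

lemma path_modulus:
  assumes "e > 0"
  obtains d where "d > 0" "\<And>s t. s \<in> {0..T} \<Longrightarrow> t \<in> {0..T} \<Longrightarrow> \<bar>s - t\<bar> < d \<Longrightarrow> norm (Lam 1 (x s - x t)) < e"
proof -
  have "uniformly_continuous_on {0..T} (\<lambda>t. Lam 1 (x t))"
    by (rule compact_uniformly_continuous[OF path_continuous compact_Icc])
  then obtain d where "d > 0" "\<forall>s\<in>{0..T}. \<forall>t\<in>{0..T}. dist t s < d \<longrightarrow> dist (Lam 1 (x t)) (Lam 1 (x s)) < e"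
    using assms unfolding uniformly_continuous_on_def by blast
  then show thesis
    by (intro that[of d]) (auto simp: dist_norm Lam_diff path_H1)
qed

text \<open>A continuous path stays in a compact subset of H^1, and truncations are contractions of
  H^1; therefore their pointwise convergence is uniform along the path.\<close>

lemma path_uniform_proj:
  assumes e: "e > 0"
  obtains N where "\<And>n t. n \<ge> N \<Longrightarrow> t \<in> {0..T} \<Longrightarrow> norm (Lam 1 (proj n (x t) - x t)) < e"
proof -
  obtain d where d: "d > 0" "\<And>s t. s \<in> {0..T} \<Longrightarrow> t \<in> {0..T} \<Longrightarrow> \<bar>s - t\<bar> < d \<Longrightarrow> norm (Lam 1 (x s - x t)) < e / 3"
    using path_modulus[of "e / 3"] e by auto
  have comp: "compact {0..T}" by (rule compact_Icc)
  have cov: "{0..T} \<subseteq> (\<Union>t\<in>{0..T}. ball t d)"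
    using d(1) by (meson UN_I centre_in_ball subsetI)
  obtain F where F: "F \<subseteq> {0..T}" "finite F" "{0..T} \<subseteq> (\<Union>t\<in>F. ball t d)"
    by (rule compactE_image[OF comp _ cov]) auto
  have "\<forall>t\<in>F. \<forall>\<^sub>F n in sequentially. norm (Lam 1 (proj n (x t) - x t)) < e / 3"
  proof
    fix t assume "t \<in> F"
    then have "(\<lambda>n. norm (Lam 1 (proj n (x t) - x t))) \<longlonglongrightarrow> 0"
      using F(1) by (intro Lam_proj_tendsto path_H1) auto
    then show "\<forall>\<^sub>F n in sequentially. norm (Lam 1 (proj n (x t) - x t)) < e / 3"
      by (rule order_tendstoD) (use e in simp)
  qed
  then have "\<forall>\<^sub>F n in sequentially. \<forall>t\<in>F. norm (Lam 1 (proj n (x t) - x t)) < e / 3"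
    using F(2) by (simp add: eventually_ball_finite)
  then obtain N where N: "\<And>n t. n \<ge> N \<Longrightarrow> t \<in> F \<Longrightarrow> norm (Lam 1 (proj n (x t) - x t)) < e / 3"
    unfolding eventually_sequentially by blast
  show thesis
  proof (rule that[of N])
    fix n t assume n: "n \<ge> N" and t: "t \<in> {0..T}"
    then obtain s where s: "s \<in> F" "\<bar>t - s\<bar> < d" using F(3) by (force simp: dist_real_def)
    have sT: "s \<in> {0..T}" using s F by auto
    note H = path_H1[OF sT] path_H1[OF t]
    have "Lam 1 (proj n (x t) - x t) = (proj n (Lam 1 (x t - x s)) - Lam 1 (x t - x s)) + Lam 1 (proj n (x s) - x s)"
      using H by (simp add: Lam_diff hom_sobolev_proj Lam_proj proj_diff)
    also have "norm \<dots> \<le> norm (proj n (Lam 1 (x t - x s))) + norm (Lam 1 (x t - x s)) + norm (Lam 1 (proj n (x s) - x s))"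
      by (intro order_trans[OF norm_triangle_ineq] add_right_mono norm_triangle_ineq4)
    also have "\<dots> < e / 3 + e / 3 + e / 3"
      using norm_proj_le[of n "Lam 1 (x t - x s)"] d(2)[OF t sT s(2)] N[OF n s(1)] by linarith
    finally show "norm (Lam 1 (proj n (x t) - x t)) < e" by simp
  qed
qed

text \<open>The new error is the old one plus an integral of drift differences, as the increments of
  \<open>z\<close> cancel. Its square grows at the rate 2 (6 K + 1): 6 K comes from
  \<open>Dn_stability\<close> and 1 from Young's inequality for the consistency error. The defect is
  governed by the oscillation \<open>d\<close> of the path during the step and the truncation error
  \<open>r\<close>, both in H^1, and by a term of second order in h.\<close>

lemma stability_step:
  assumes nu: "\<nu> > 0" and t: "0 \<le> t" "t + h \<le> T" and h: "h > 0"
    and K: "K \<ge> 1" "\<And>s. s \<in> {0..T} \<Longrightarrow> norm (Lam 1 (x s)) \<le> K"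
    and d: "d \<le> 1" "\<And>s. s \<in> {t..t + h} \<Longrightarrow> norm (Lam 1 (x s - x t)) \<le> d"
    and r: "norm (Lam 1 (proj n (x t) - x t)) \<le> r" 
    and n: "real n \<ge> K + 1" and e1: "wsum 0 n (\<lambda>k. X k - coord (x t) k) \<le> 1"
  shows "wsum 0 n (\<lambda>k. step \<nu> n h X (\<lambda>k. z (t + h) k - z t k) k - coord (x (t + h)) k)
    \<le> (1 + h * (2 * (6 * K + 1))) * wsum 0 n (\<lambda>k. X k - coord (x t) k)
      + h * (\<nu> * d\<^sup>2 / 2 + 72 * K\<^sup>2 * (r + d)\<^sup>2 + h * (2 * real n * (2 * \<nu> * (real n)\<^sup>2 + 12 * real n * (K + 1)\<^sup>2)\<^sup>2))"
proof -
  define e where "e k = X k - coord (x t) k" for k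
  have e_eq: "e = (\<lambda>k. X k - coord (x t) k)" by (simp add: e_def fun_eq_iff)
  define G where "G k s = Gn \<nu> n X k - vfield \<nu> (x s) k" for k s
  \<comment> \<open>A crude bound on the coordinates of the integrand that enters only with h^2; the
    choice of the mesh defeats its growth in n.\<close>
  define B where "B = 2 * \<nu> * (real n)\<^sup>2 + 12 * real n * (K + 1)\<^sup>2"
  define A where "A = \<nu> * d\<^sup>2 / 4 + (6 * K + 1) * wsum 0 n e + 36 * K\<^sup>2 * (r + d)\<^sup>2"
  have tT: "t \<in> {0..T}" and sT: "s \<in> {0..T}" if "s \<in> {t..t+h}" for s using that t h by auto
  have tT': "t \<in> {0..T}" using t h by auto
  have d0: "0 \<le> d" using order_trans[OF norm_ge_zero d(2)[of t]] h by simp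
  have q: "wsum 0 n e \<le> 1" using e1 unfolding e_eq .
  have tpX: "tp n X = tp n e + proj n (x t)"
    by (simp add: tp_coord[symmetric] tp_add[symmetric] e_def)
  have ne1: "norm (tp n e) \<le> 1"
    using q norm_tp[of n e] abs_square_le_1[of "norm (tp n e)"] by simp
  have nx: "norm (proj n (x t)) \<le> K"
    using norm_proj_le[of n "x t"] norm_le_Lam[OF path_H1[OF tT']] K(2)[OF tT'] by linarith
  have "norm (tp n X) \<le> K + 1"
    unfolding tpX using norm_triangle_ineq[of "tp n e" "proj n (x t)"] ne1 nx by linarith
  \<comment> \<open>An error of at most 1 keeps the scheme in the ball of radius K + 1 <= n, so the
    cut-off in \<open>Gn\<close> is inactive.\<close>
  then have X: "wsum 0 n X \<le> (K + 1)\<^sup>2"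
    unfolding norm_tp[symmetric] by (intro power_mono) auto
  also have "\<dots> \<le> (real n)\<^sup>2" by (intro power_mono n) (use K in simp)
  finally have trunc: "wsum 0 n X \<le> (real n)\<^sup>2" .
  then have Gn: "Gn \<nu> n X k = - \<nu> * (of_int k)\<^sup>2 * X k + Dn n X k" for k by (simp add: Gn_def)
  have Gcont: "continuous_on {t..t+h} (G k)" if "k \<noteq> 0" for k
    unfolding G_def by (intro continuous_intros continuous_on_subset[OF path_vfield_continuous] that)
      (use sT in auto)
  have Gint: "G k integrable_on {t..t+h}" if "k \<noteq> 0" for k
    by (intro integrable_continuous_interval Gcont that)
  define I where "I k = integral {t..t+h} (G k)" for k
  have next_e: "step \<nu> n h X (\<lambda>k. z (t + h) k - z t k) k - coord (x (t + h)) k = e k + I k" if k: "k \<in> freqs n" for k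
  proof -
    have k0: "k \<noteq> 0" by (rule freqs_nonzero[OF k])
    have "(\<lambda>s. vfield \<nu> (x s) k) integrable_on {t..t+h}"
      by (intro integrable_continuous_interval continuous_on_subset[OF path_vfield_continuous[OF k0]]) (use sT in auto)
    then have "I k = h * Gn \<nu> n X k - integral {t..t+h} (\<lambda>s. vfield \<nu> (x s) k)"
      unfolding I_def G_def using h by (subst Henstock_Kurzweil_Integration.integral_diff) auto
    then show ?thesis
      using path_increment[OF k0, of t "t + h"] t h by (simp add: step_def e_def)
  qed
  have xdiff: "\<bar>coord (x s) k - coord (x t) k\<bar> \<le> 1" if "s \<in> {t..t+h}" "k \<noteq> 0" for s k
    using coord_le_norm[OF that(2), of "x s - x t"] norm_le_Lam[OF hom_sobolev_diff[OF path_H1[OF sT[OF that(1)]] path_H1[OF tT']]]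
      d(1) d(2)[OF that(1)] by (simp add: inner_diff_left)
  have Gbound: "\<bar>G k s\<bar> \<le> B" if k: "k \<in> freqs n" and s: "s \<in> {t..t+h}" for k s
  proof -
    have k0: "k \<noteq> 0" by (rule freqs_nonzero[OF k])
    have "(e k)\<^sup>2 \<le> 1"
      using q member_le_sum[of k "freqs n" "\<lambda>k. (e k)\<^sup>2"] k unfolding wsum_0 by auto
    then have "\<bar>e k\<bar> \<le> 1" by (simp add: abs_square_le_1)
    then have "\<bar>X k - coord (x s) k\<bar> \<le> 2" using xdiff[OF s k0] unfolding e_def by linarith
    then have "(real_of_int k)\<^sup>2 * \<bar>X k - coord (x s) k\<bar> \<le> (real n)\<^sup>2 * 2"
      using power_mono[OF abs_freqs_le[OF k], of 2] by (intro mult_mono) auto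
    then have 1: "\<bar>- \<nu> * (of_int k)\<^sup>2 * (X k - coord (x s) k)\<bar> \<le> 2 * \<nu> * (real n)\<^sup>2"
      using nu by (simp add: abs_mult mult.assoc)
    have "\<bar>Dn n X k\<bar> \<le> norm (Bil (tp n X) (tp n X))"
      unfolding Dn_def by (rule coord_le_norm[OF k0])
    also have "\<dots> \<le> 6 * real n * wsum 0 n X" by (rule norm_drift_tp)
    also have "\<dots> \<le> 6 * real n * (K + 1)\<^sup>2" by (intro mult_left_mono X) simp
    finally have 2: "\<bar>Dn n X k\<bar> \<le> 6 * real n * (K + 1)\<^sup>2" .
    have "\<bar>coord (Bil (x s) (x s)) k\<bar> \<le> norm (Bil (x s) (x s))" by (rule coord_le_norm[OF k0])
    also have "\<dots> \<le> 6 * norm (x s) * norm (Lam 1 (x s))"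
      by (rule norm_Bil[OF path_mean_zero path_H1]) (use sT[OF s] in auto)
    also have "\<dots> \<le> 6 * (K + 1) * (K + 1)"
      using norm_le_Lam[OF path_H1[OF sT[OF s]]] K(1) K(2)[OF sT[OF s]] by (intro mult_mono) auto
    also have "\<dots> = 6 * 1 * (K + 1)\<^sup>2" by (simp add: power2_eq_square)
    also have "\<dots> \<le> 6 * real n * (K + 1)\<^sup>2"
      using n K(1) by (intro mult_right_mono mult_left_mono) auto
    finally have 3: "\<bar>coord (Bil (x s) (x s)) k\<bar> \<le> 6 * real n * (K + 1)\<^sup>2" .
    have "G k s = - \<nu> * (of_int k)\<^sup>2 * (X k - coord (x s) k) + Dn n X k - coord (Bil (x s) (x s)) k"
      unfolding G_def Gn vfield_def by (simp add: algebra_simps)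
    then show ?thesis unfolding B_def using 1 2 3 by linarith
  qed
  have A: "(\<Sum>k\<in>freqs n. e k * G k s) \<le> A" if s: "s \<in> {t..t+h}" for s
  proof -
    have H: "x s \<in> hom_sobolev 1" "x t \<in> hom_sobolev 1" using path_H1 sT[OF s] tT' by auto
    \<comment> \<open>The truncated nonlinearity at the truncated path is interposed: from the
      scheme to it by skewness, from it to the exact drift by consistency.\<close>
    define D0 where "D0 = Dn n (coord (x t))"
    have split: "e k * G k s = \<nu> * (of_int k)\<^sup>2 * (- (e k)\<^sup>2 + e k * (coord (x s) k - coord (x t) k))
        + e k * (Dn n X k - D0 k) + e k * (D0 k - coord (Bil (x s) (x s)) k)" for k
      unfolding G_def Gn vfield_def e_def by (simp add: algebra_simps power2_eq_square)
    \<comment> \<open>The weight k^2 is unbounded in n. The negative square supplied by the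
      viscosity absorbs the error, and only the H^1 oscillation of the path is left.\<close>
    have T1: "(\<Sum>k\<in>freqs n. \<nu> * (of_int k)\<^sup>2 * (- (e k)\<^sup>2 + e k * (coord (x s) k - coord (x t) k))) \<le> \<nu> * d\<^sup>2 / 4"
    proof -
      have young: "- a\<^sup>2 + a * b \<le> b\<^sup>2 / 4" for a b :: real
        using zero_le_power2[of "a - b / 2"] by (simp add: power2_eq_square field_simps)
      have "(\<Sum>k\<in>freqs n. \<nu> * (of_int k)\<^sup>2 * (- (e k)\<^sup>2 + e k * (coord (x s) k - coord (x t) k)))
        \<le> (\<Sum>k\<in>freqs n. \<nu> * (of_int k)\<^sup>2 * ((coord (x s) k - coord (x t) k)\<^sup>2 / 4))"
        by (intro sum_mono mult_left_mono young) (use nu in simp)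
      also have "\<dots> = \<nu> / 4 * (\<Sum>k\<in>freqs n. (coord (Lam 1 (x s - x t)) k)\<^sup>2)"
        unfolding sum_distrib_left
      proof (rule sum.cong[OF refl])
        fix k assume "k \<in> freqs n"
        then have "coord (Lam 1 (x s - x t)) k = \<bar>of_int k\<bar> * (coord (x s) k - coord (x t) k)"
          using coord_Lam[OF hom_sobolev_diff[OF H] freqs_nonzero] by (simp add: inner_diff_left)
        then show "\<nu> * (of_int k)\<^sup>2 * ((coord (x s) k - coord (x t) k)\<^sup>2 / 4) = \<nu> / 4 * (coord (Lam 1 (x s - x t)) k)\<^sup>2"
          by (simp add: power_mult_distrib)
      qed
      also have "\<dots> \<le> \<nu> / 4 * d\<^sup>2"
        using nu by (intro mult_left_mono order_trans[OF bessel] power_mono d(2) s) auto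
      finally show ?thesis by simp
    qed
    have T2: "(\<Sum>k\<in>freqs n. e k * (Dn n X k - D0 k)) \<le> 6 * K * wsum 0 n e"
    proof -
      have "(\<lambda>k. coord (x t) k + e k) = X" by (simp add: e_def fun_eq_iff)
      then have "(\<Sum>k\<in>freqs n. e k * (Dn n X k - D0 k)) \<le> 6 * norm (Lam 1 (tp n (coord (x t)))) * wsum 0 n e"
        using Dn_stability[where w = "coord (x t)" and E = e and n = n] unfolding D0_def by simp
      also have "\<dots> \<le> 6 * K * wsum 0 n e"
        unfolding tp_coord using norm_Lam_proj_le[OF H(2), of n] K(2)[OF tT']
        by (intro mult_right_mono mult_left_mono) auto
      finally show ?thesis .
    qed
    have T3: "(\<Sum>k\<in>freqs n. e k * (D0 k - coord (Bil (x s) (x s)) k)) \<le> wsum 0 n e + 36 * K\<^sup>2 * (r + d)\<^sup>2"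
    proof -
      let ?p = "proj n (x t)"
      have "(\<Sum>k\<in>freqs n. e k * (D0 k - coord (Bil (x s) (x s)) k)) = inner (Bil ?p ?p - Bil (x s) (x s)) (tp n e)"
        by (simp add: D0_def Dn_def tp_coord inner_tp inner_diff_left)
      also have "\<dots> \<le> norm (Bil ?p ?p - Bil (x s) (x s)) * norm (tp n e)" by (rule norm_cauchy_schwarz)
      also have "\<dots> \<le> (12 * K * (r + d)) * norm (tp n e)"
      proof (rule mult_right_mono)
        have "norm (Bil ?p ?p - Bil (x s) (x s)) \<le> 12 * K * norm (Lam 1 (?p - x s))"
          using norm_Lam_proj_le[OF H(2), of n] K(2)[OF tT'] K(2)[OF sT[OF s]]
          by (intro drift_difference hom_sobolev_proj H) auto
        also have "norm (Lam 1 (?p - x s)) \<le> r + d"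
        proof -
          have "Lam 1 (?p - x s) = Lam 1 (?p - x t) - Lam 1 (x s - x t)"
            by (simp add: Lam_diff hom_sobolev_proj H)
          then show ?thesis using norm_triangle_ineq4[of "Lam 1 (?p - x t)" "Lam 1 (x s - x t)"] r d(2)[OF s] by simp
        qed
        finally show "norm (Bil ?p ?p - Bil (x s) (x s)) \<le> 12 * K * (r + d)" using K(1) by (simp add: mult_left_mono)
      qed simp
      also have "\<dots> \<le> (norm (tp n e))\<^sup>2 + 36 * K\<^sup>2 * (r + d)\<^sup>2"
      proof -
        have "12 * c * y \<le> y\<^sup>2 + 36 * c\<^sup>2" for c y :: real
          using zero_le_power2[of "y - 6 * c"] by (simp add: power2_eq_square algebra_simps)
        from this[of "K * (r + d)" "norm (tp n e)"] show ?thesis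
          by (simp add: power_mult_distrib mult.assoc)
      qed
      finally show ?thesis by (simp add: norm_tp)
    qed
    show ?thesis unfolding split sum.distrib A_def using T1 T2 T3 by (simp add: distrib_right)
  qed
  have eI: "(\<Sum>k\<in>freqs n. e k * I k) \<le> h * A"
  proof -
    have "((\<lambda>s. \<Sum>k\<in>freqs n. e k * G k s) has_integral (\<Sum>k\<in>freqs n. e k * I k)) {t..t+h}"
      unfolding I_def by (intro has_integral_sum has_integral_mult_right integrable_integral Gint) (auto dest: freqs_nonzero)
    moreover have "((\<lambda>s. A) has_integral h * A) {t..t+h}"
      using has_integral_const_real[of A t "t + h"] h by simp
    ultimately show ?thesis by (rule has_integral_le) (rule A)
  qed
  have II: "(\<Sum>k\<in>freqs n. (I k)\<^sup>2) \<le> h\<^sup>2 * (2 * real n * B\<^sup>2)"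
  proof -
    have card: "card (freqs n) \<le> 2 * n"
    proof -
      have "freqs n = {- int n..- 1} \<union> {1..int n}" by (auto simp: freqs_def)
      then show ?thesis using card_Un_le[of "{- int n..- 1}" "{1..int n}"] by simp
    qed
    have "(I k)\<^sup>2 \<le> (B * h)\<^sup>2" if k: "k \<in> freqs n" for k
    proof -
      have "norm (I k) \<le> B * (t + h - t)"
        unfolding I_def
        by (rule integral_bound) (use h Gcont[OF freqs_nonzero[OF k]] Gbound[OF k] in auto)
      then have "\<bar>I k\<bar> \<le> \<bar>B * h\<bar>" by simp
      then show ?thesis by (simp only: abs_le_square_iff)
    qed
    then have "(\<Sum>k\<in>freqs n. (I k)\<^sup>2) \<le> real (card (freqs n)) * (B * h)\<^sup>2"
      by (rule sum_bounded_above)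
    also have "\<dots> \<le> real (2 * n) * (B * h)\<^sup>2" using card by (intro mult_right_mono) auto
    finally show ?thesis by (simp add: power_mult_distrib mult_ac)
  qed
  have "wsum 0 n (\<lambda>k. step \<nu> n h X (\<lambda>k. z (t + h) k - z t k) k - coord (x (t + h)) k) = (\<Sum>k\<in>freqs n. (e k + I k)\<^sup>2)"
    unfolding wsum_0 by (intro sum.cong refl) (simp add: next_e)
  also have "\<dots> = wsum 0 n e + 2 * (\<Sum>k\<in>freqs n. e k * I k) + (\<Sum>k\<in>freqs n. (I k)\<^sup>2)"
    unfolding wsum_0 by (simp add: power2_sum sum.distrib sum_distrib_left mult.assoc)
  also have "\<dots> \<le> wsum 0 n e + 2 * (h * A) + h\<^sup>2 * (2 * real n * B\<^sup>2)" using eI II by linarith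
  also have "\<dots> = (1 + h * (2 * (6 * K + 1))) * wsum 0 n e
      + h * (\<nu> * d\<^sup>2 / 2 + 72 * K\<^sup>2 * (r + d)\<^sup>2 + h * (2 * real n * B\<^sup>2))"
    unfolding A_def by (simp add: power2_eq_square algebra_simps)
  finally show ?thesis unfolding B_def e_eq .
qed

text \<open>A discrete Gronwall argument. The condition \<open>small\<close> drives the induction:
  it keeps the error at most 1 at every step, as \<open>stability_step\<close> demands.\<close>

lemma stability_iterate:
  assumes nu: "\<nu> > 0" and h: "h > 0" "real J * h \<le> T"
    and K: "K \<ge> 1" "\<And>s. s \<in> {0..T} \<Longrightarrow> norm (Lam 1 (x s)) \<le> K"
    and d: "d \<le> 1" "\<And>s t. s \<in> {0..T} \<Longrightarrow> t \<in> {0..T} \<Longrightarrow> \<bar>s - t\<bar> \<le> h \<Longrightarrow> norm (Lam 1 (x s - x t)) \<le> d"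
    and r: "\<And>t. t \<in> {0..T} \<Longrightarrow> norm (Lam 1 (proj n (x t) - x t)) \<le> r" 
    and n: "real n \<ge> K + 1"
    and eps: "\<epsilon> = \<nu> * d\<^sup>2 / 2 + 72 * K\<^sup>2 * (r + d)\<^sup>2 + h * (2 * real n * (2 * \<nu> * (real n)\<^sup>2 + 12 * real n * (K + 1)\<^sup>2)\<^sup>2)"
    and E: "wsum 0 n (\<lambda>k. X k - coord (x 0) k) \<le> E" and small: "exp (2 * (6 * K + 1) * T) * (E + T * \<epsilon>) \<le> 1"
  shows "wsum 0 n (\<lambda>k. scheme \<nu> n h (\<lambda>j k. z (real j * h + h) k - z (real j * h) k) X J k - coord (x (real J * h)) k)
     \<le> exp (2 * (6 * K + 1) * T) * (E + T * \<epsilon>)"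
proof -
  let ?c = "2 * (6 * K + 1)"
  let ?S = "scheme \<nu> n h (\<lambda>j k. z (real j * h + h) k - z (real j * h) k) X"
  have c: "?c \<ge> 0" using K by simp
  have E0: "E \<ge> 0" using E wsum_nonneg order_trans by blast
  have eps0: "\<epsilon> \<ge> 0" unfolding eps using nu h by simp
  have pw: "(1 + h * ?c) ^ j * (E + real j * h * \<epsilon>) \<le> exp (?c * T) * (E + T * \<epsilon>)" if "j \<le> J" for j
  proof -
    have jh: "real j * h \<le> T" using that h by (meson mult_right_mono of_nat_le_iff less_imp_le order_trans)
    have "(1 + h * ?c) ^ j \<le> exp (h * ?c) ^ j" using h c by (intro power_mono exp_ge_add_one_self) auto
    also have "\<dots> = exp (?c * (real j * h))" by (simp add: exp_of_nat_mult[symmetric] mult_ac)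
    also have "\<dots> \<le> exp (?c * T)" using mult_left_mono[OF jh c] by simp
    finally have 1: "(1 + h * ?c) ^ j \<le> exp (?c * T)" .
    have "real j * h * \<epsilon> \<le> T * \<epsilon>" using jh eps0 by (rule mult_right_mono)
    then show ?thesis using 1 E0 eps0 h by (intro mult_mono) auto
  qed
  have "wsum 0 n (\<lambda>k. ?S j k - coord (x (real j * h)) k) \<le> (1 + h * ?c) ^ j * (E + real j * h * \<epsilon>)" if "j \<le> J" for j
    using that
  proof (induction j)
    case 0
    then show ?case using E by simp
  next
    case (Suc j)
    have IH: "wsum 0 n (\<lambda>k. ?S j k - coord (x (real j * h)) k) \<le> (1 + h * ?c) ^ j * (E + real j * h * \<epsilon>)"
      using Suc by simp
    have j1: "real j * h + h \<le> T"
    proof -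
      have "real (Suc j) * h \<le> real J * h" using Suc h by (intro mult_right_mono) auto
      then show ?thesis using h by (simp add: algebra_simps)
    qed
    have j0: "0 \<le> real j * h" using h by simp
    have le1: "wsum 0 n (\<lambda>k. ?S j k - coord (x (real j * h)) k) \<le> 1"
      using IH pw[of j] Suc small by simp
    have "wsum 0 n (\<lambda>k. ?S (Suc j) k - coord (x (real j * h + h)) k)
      \<le> (1 + h * ?c) * wsum 0 n (\<lambda>k. ?S j k - coord (x (real j * h)) k) + h * \<epsilon>"
      unfolding scheme.simps eps
    proof (rule stability_step[OF nu j0 j1 h(1) K d(1) _ _ n le1])
      show "norm (Lam 1 (x s - x (real j * h))) \<le> d" if "s \<in> {real j * h..real j * h + h}" for s
      proof (rule d(2))
        show "s \<in> {0..T}" "real j * h \<in> {0..T}" "\<bar>s - real j * h\<bar> \<le> h"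
          using that j0 j1 h(1) unfolding atLeastAtMost_iff by linarith+
      qed
      show "norm (Lam 1 (proj n (x (real j * h)) - x (real j * h))) \<le> r"
        using j0 j1 h(1) by (intro r) (unfold atLeastAtMost_iff, linarith)
    qed
    also have "\<dots> \<le> (1 + h * ?c) * ((1 + h * ?c) ^ j * (E + real j * h * \<epsilon>)) + h * \<epsilon>"
      using IH h c by (intro add_right_mono mult_left_mono) auto
    also have "h * \<epsilon> \<le> (1 + h * ?c) ^ Suc j * (h * \<epsilon>)"
    proof -
      have "1 \<le> (1 + h * ?c) ^ Suc j" using h c by (intro one_le_power) simp
      then show ?thesis using h eps0 mult_right_mono[of 1 "(1 + h * ?c) ^ Suc j" "h * \<epsilon>"] by simp
    qed
    finally have "wsum 0 n (\<lambda>k. ?S (Suc j) k - coord (x (real j * h + h)) k)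
       \<le> (1 + h * ?c) ^ Suc j * (E + real (Suc j) * h * \<epsilon>)"
      by (simp add: algebra_simps)
    moreover have "real (Suc j) * h = real j * h + h" by (simp add: algebra_simps)
    ultimately show ?case by simp
  qed
  from this[of J] pw[of J] show ?thesis by simp
qed

end

text \<open>So many steps that \<open>h n\<^bsup>2s+6\<^esup>\<close> stays small for the mesh \<open>h\<close>; see \<open>mesh_conditions\<close>.\<close>

definition steps :: "real \<Rightarrow> nat \<Rightarrow> real \<Rightarrow> nat \<Rightarrow> nat" where
  "steps \<nu> s T n = nat \<lceil>T * (72 * (real n + 1) ^ (2 * s + 6) * (1 + 4 * \<nu>))\<rceil> + 1"

definition mesh :: "real \<Rightarrow> nat \<Rightarrow> real \<Rightarrow> nat \<Rightarrow> real" where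
  "mesh \<nu> s T n = T / real (steps \<nu> s T n)"

lemma steps_pos: "steps \<nu> s T n > 0"
  by (simp add: steps_def)

lemma steps_mesh: "real (steps \<nu> s T n) * mesh \<nu> s T n = T"
  using steps_pos[of \<nu> s T n] by (simp add: mesh_def)

lemma mesh_bound:
  assumes "\<nu> > 0" "T > 0"
  shows "0 < mesh \<nu> s T n" "mesh \<nu> s T n \<le> 1 / (72 * (real n + 1) ^ (2 * s + 6) * (1 + 4 * \<nu>))"
proof -
  show "0 < mesh \<nu> s T n" using assms steps_pos by (simp add: mesh_def)
  let ?q = "72 * (real n + 1) ^ (2 * s + 6) * (1 + 4 * \<nu>)"
  have q: "?q > 0" using assms by simp
  have "T * ?q \<le> real (steps \<nu> s T n)"
    unfolding steps_def by linarith
  then have "T / real (steps \<nu> s T n) \<le> T / (T * ?q)"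
    using q assms by (intro divide_left_mono mult_pos_pos) (auto simp: steps_pos)
  then show "mesh \<nu> s T n \<le> 1 / ?q" using assms by (simp add: mesh_def)
qed

lemma mesh_conditions:
  assumes "\<nu> > 0" "T > 0"
  shows "4 * mesh \<nu> s T n * \<nu> * real n ^ 4 \<le> 1" "72 * mesh \<nu> s T n * real n ^ (2 * s + 6) \<le> 1"
    "72 * mesh \<nu> s T n * real n ^ 6 \<le> 1" "mesh \<nu> s T n \<le> 1" "\<nu> * mesh \<nu> s T n \<le> 1"
    "mesh \<nu> s T n * (real n + 1) ^ 6 \<le> 1"
proof -
  let ?h = "mesh \<nu> s T n" and ?N = "real n + 1"
  let ?P = "?N ^ (2 * s + 6)"
  have h0: "?h \<ge> 0" using mesh_bound(1)[OF assms] by (simp add: less_imp_le)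
  have N1: "?N \<ge> 1" by simp
  have P1: "?P \<ge> 1" by (rule one_le_power[OF N1])
  have "?h * (72 * ?P * (1 + 4 * \<nu>)) \<le> 1"
    using mesh_bound(2)[OF assms, of s n] assms by (simp add: le_divide_eq)
  then have key: "72 * (?h * ?P) + 288 * (\<nu> * (?h * ?P)) \<le> 1"
    by (simp add: algebra_simps)
  have nn: "0 \<le> ?h * ?P" "0 \<le> \<nu> * (?h * ?P)" using h0 assms by auto
  have a: "?h * x \<le> ?h * ?P" if "x \<le> ?P" for x using h0 that by (rule mult_left_mono[rotated])
  have pw: "real n ^ j \<le> ?P" "?N ^ j \<le> ?P" if "j \<le> 2 * s + 6" for j
  proof -
    show "?N ^ j \<le> ?P" by (rule power_increasing[OF that N1])
    then show "real n ^ j \<le> ?P" by (rule order_trans[rotated]) (rule power_mono; simp)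
  qed
  have "\<nu> * (?h * real n ^ 4) \<le> \<nu> * (?h * ?P)" using a[OF pw(1)[of 4]] assms by simp
  then show "4 * ?h * \<nu> * real n ^ 4 \<le> 1" using key nn by (simp add: mult_ac)
  show "72 * ?h * real n ^ (2 * s + 6) \<le> 1" using a[OF pw(1)[of "2 * s + 6"]] key nn by simp
  show "72 * ?h * real n ^ 6 \<le> 1" using a[OF pw(1)[of 6]] key nn by simp
  show "?h \<le> 1" using a[OF P1] key nn by simp
  have "\<nu> * (?h * 1) \<le> \<nu> * (?h * ?P)" using assms by (intro mult_left_mono[OF a[OF P1]]) auto
  then show "\<nu> * ?h \<le> 1" using key nn by simp
  show "?h * ?N ^ 6 \<le> 1" using a[OF pw(2)[of 6]] key nn by simp
qed

text \<open>The factor next to the mesh grows like n^5, whereas \<open>mesh_conditions\<close>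
  bounds the mesh times (n + 1)^6.\<close>

lemma mesh_tendsto:
  assumes "\<nu> > 0" "T > 0"
  shows "(\<lambda>n. mesh \<nu> s T n * (2 * real n * (2 * \<nu> * (real n)\<^sup>2 + 12 * real n * (K + 1)\<^sup>2)\<^sup>2)) \<longlonglongrightarrow> 0"
    "(\<lambda>n. mesh \<nu> s T n) \<longlonglongrightarrow> 0"
proof -
  have p5: "2 * x * (c * x\<^sup>2)\<^sup>2 = 2 * c\<^sup>2 * x ^ 5" for x c :: real
    using power_add[of x 1 4] by (simp add: power_mult_distrib flip: power_mult)
  have p6: "h * (L * x ^ 5) = L * (h * x ^ 6) / x" if "x > 0" for x L h :: real
    using that power_add[of x 1 5] by simp
  define L where "L = 2 * (2 * \<nu> + 12 * (K + 1)\<^sup>2)\<^sup>2"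
  have z: "(\<lambda>n. L * (1 / (real n + 1))) \<longlonglongrightarrow> 0"
    using LIMSEQ_inverse_real_of_nat by (intro tendsto_mult_right_zero) (simp add: inverse_eq_divide add.commute)
  show "(\<lambda>n. mesh \<nu> s T n * (2 * real n * (2 * \<nu> * (real n)\<^sup>2 + 12 * real n * (K + 1)\<^sup>2)\<^sup>2)) \<longlonglongrightarrow> 0"
  proof (rule Lim_null_comparison[OF _ z], intro always_eventually allI)
    fix n
    let ?h = "mesh \<nu> s T n" and ?N = "real n + 1"
    have h0: "?h \<ge> 0" using mesh_bound(1)[OF assms] by (simp add: less_imp_le)
    have "2 * \<nu> * (real n)\<^sup>2 + 12 * real n * (K + 1)\<^sup>2 \<le> 2 * \<nu> * ?N\<^sup>2 + 12 * ?N\<^sup>2 * (K + 1)\<^sup>2"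
    proof -
      have nN: "real n \<le> ?N\<^sup>2" by (simp add: power2_eq_square algebra_simps)
      show ?thesis using assms by (intro add_mono mult_left_mono mult_right_mono power_mono nN) auto
    qed
    also have "\<dots> = (2 * \<nu> + 12 * (K + 1)\<^sup>2) * ?N\<^sup>2" by (simp add: algebra_simps)
    finally have "(2 * \<nu> * (real n)\<^sup>2 + 12 * real n * (K + 1)\<^sup>2)\<^sup>2 \<le> ((2 * \<nu> + 12 * (K + 1)\<^sup>2) * ?N\<^sup>2)\<^sup>2"
      using assms by (intro power_mono) auto
    then have "2 * real n * (2 * \<nu> * (real n)\<^sup>2 + 12 * real n * (K + 1)\<^sup>2)\<^sup>2 \<le> 2 * ?N * ((2 * \<nu> + 12 * (K + 1)\<^sup>2) * ?N\<^sup>2)\<^sup>2"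
      by (intro mult_mono) auto
    also have "\<dots> = L * ?N ^ 5" unfolding L_def by (rule p5)
    finally have "?h * (2 * real n * (2 * \<nu> * (real n)\<^sup>2 + 12 * real n * (K + 1)\<^sup>2)\<^sup>2) \<le> ?h * (L * ?N ^ 5)"
      using h0 by (rule mult_left_mono)
    also have "\<dots> = L * (?h * ?N ^ 6) / ?N" by (rule p6) simp
    also have "\<dots> \<le> L * 1 / ?N"
      using mesh_conditions(6)[OF assms, of s n] by (intro divide_right_mono mult_left_mono) (auto simp: L_def)
    finally show "norm (?h * (2 * real n * (2 * \<nu> * (real n)\<^sup>2 + 12 * real n * (K + 1)\<^sup>2)\<^sup>2)) \<le> L * (1 / ?N)"
      using h0 by (simp add: abs_mult)
  qed
  have z1: "(\<lambda>n. 1 / (real n + 1)) \<longlonglongrightarrow> 0"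
    using LIMSEQ_inverse_real_of_nat by (simp add: inverse_eq_divide add.commute)
  show "(\<lambda>n. mesh \<nu> s T n) \<longlonglongrightarrow> 0"
  proof (rule Lim_null_comparison[OF _ z1], intro always_eventually allI)
    fix n
    have h0: "mesh \<nu> s T n \<ge> 0" using mesh_bound(1)[OF assms] by (simp add: less_imp_le)
    have "mesh \<nu> s T n * (real n + 1) ^ 1 \<le> mesh \<nu> s T n * (real n + 1) ^ 6"
      using h0 by (intro mult_left_mono power_increasing) auto
    then have "mesh \<nu> s T n * (real n + 1) \<le> 1" using mesh_conditions(6)[OF assms, of s n] by simp
    then show "norm (mesh \<nu> s T n) \<le> 1 / (real n + 1)" using h0 by (simp add: le_divide_eq)
  qed
qed

section \<open>Convergence of the scheme and continuous dependence\<close>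

definition approx :: "real \<Rightarrow> nat \<Rightarrow> real \<Rightarrow> (real \<Rightarrow> int \<Rightarrow> real) \<Rightarrow> nat \<Rightarrow> (int \<Rightarrow> real) \<Rightarrow> int \<Rightarrow> real" where
  "approx \<nu> s T z n X = scheme \<nu> n (mesh \<nu> s T n)
     (\<lambda>j k. z (real j * mesh \<nu> s T n + mesh \<nu> s T n) k - z (real j * mesh \<nu> s T n) k) X (steps \<nu> s T n)"

text \<open>The initial error \<open>E\<close> serves two purposes: with E = 0 the lemma gives
  convergence of the scheme, with E > 0 it compares a path with the scheme started
  elsewhere.\<close>

lemma approx_stability:
  assumes path: "drift_path \<nu> T z x" and nu: "\<nu> > 0" and T: "T > 0"
    and K: "K \<ge> 1" "\<And>s. s \<in> {0..T} \<Longrightarrow> norm (Lam 1 (x s)) \<le> K"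
    and E: "\<And>n. wsum 0 n (\<lambda>k. X n k - coord (x 0) k) \<le> E" and small: "exp (2 * (6 * K + 1) * T) * E < 1"
    and eta: "\<eta> > 0"
  shows "\<forall>\<^sub>F n in sequentially. wsum 0 n (\<lambda>k. approx \<nu> s T z n (X n) k - coord (x T) k) \<le> exp (2 * (6 * K + 1) * T) * E + \<eta>"
proof -
  define M where "M = exp (2 * (6 * K + 1) * T)"
  have M: "M > 0" by (simp add: M_def)
  \<comment> \<open>Chosen so that M T \<epsilon> is the smaller of \<eta> and 1 - M E: the final
    error then exceeds M E by at most \<eta>, and it never exceeds 1.\<close>
  define \<epsilon> where "\<epsilon> = min \<eta> (1 - M * E) / (M * T)"
  have eps: "\<epsilon> > 0" using eta small M T by (simp add: \<epsilon>_def M_def)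
  have MT: "M * T * \<epsilon> = min \<eta> (1 - M * E)" using M T by (simp add: \<epsilon>_def)
  obtain d where d: "0 < d" "d \<le> 1" "\<nu> * d\<^sup>2 / 2 + 72 * K\<^sup>2 * (d + d)\<^sup>2 \<le> \<epsilon> / 2"
  proof
    \<comment> \<open>The coefficient of d^2 after expanding (d + d)^2, with 288 = 72 * 4.\<close>
    define c where "c = \<nu> / 2 + 288 * K\<^sup>2"
    have c: "c > 0" using nu by (simp add: c_def add_pos_nonneg)
    define d where "d = min 1 (\<epsilon> / (2 * c))"
    show "0 < d" "d \<le> 1" using eps c by (auto simp: d_def)
    have "d\<^sup>2 \<le> d" using \<open>0 < d\<close> \<open>d \<le> 1\<close> by (simp add: power2_eq_square mult_left_le)
    then have "c * d\<^sup>2 \<le> c * (\<epsilon> / (2 * c))" using c by (intro mult_left_mono) (auto simp: d_def)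
    then have "c * d\<^sup>2 \<le> \<epsilon> / 2" using c by simp
    then show "\<nu> * d\<^sup>2 / 2 + 72 * K\<^sup>2 * (d + d)\<^sup>2 \<le> \<epsilon> / 2"
      by (simp add: c_def power2_eq_square algebra_simps)
  qed
  obtain d' where d': "d' > 0" "\<And>s t. s \<in> {0..T} \<Longrightarrow> t \<in> {0..T} \<Longrightarrow> \<bar>s - t\<bar> < d' \<Longrightarrow> norm (Lam 1 (x s - x t)) < d"
    using path_modulus[OF path d(1)] by metis
  obtain N where N: "\<And>n t. n \<ge> N \<Longrightarrow> t \<in> {0..T} \<Longrightarrow> norm (Lam 1 (proj n (x t) - x t)) < d"
    using path_uniform_proj[OF path d(1)] by metis
  have e1: "\<forall>\<^sub>F n in sequentially. mesh \<nu> s T n * (2 * real n * (2 * \<nu> * (real n)\<^sup>2 + 12 * real n * (K + 1)\<^sup>2)\<^sup>2) < \<epsilon> / 2"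
    by (rule order_tendstoD(2)[OF mesh_tendsto(1)[OF nu T]]) (use eps in simp)
  have e2: "\<forall>\<^sub>F n in sequentially. mesh \<nu> s T n < d'"
    by (rule order_tendstoD(2)[OF mesh_tendsto(2)[OF nu T] d'(1)])
  obtain N2 :: nat where N2: "real N2 \<ge> K + 1" using real_arch_simple by blast
  show ?thesis
    using e1 e2 eventually_ge_at_top[of N] eventually_ge_at_top[of N2]
  proof eventually_elim
    case (elim n)
    let ?h = "mesh \<nu> s T n"
    define eps' where "eps' = \<nu> * d\<^sup>2 / 2 + 72 * K\<^sup>2 * (d + d)\<^sup>2 + ?h * (2 * real n * (2 * \<nu> * (real n)\<^sup>2 + 12 * real n * (K + 1)\<^sup>2)\<^sup>2)"
    have le: "eps' \<le> \<epsilon>" using d(3) elim(1) by (simp add: eps'_def)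
    have bd: "M * (E + T * eps') \<le> M * E + min \<eta> (1 - M * E)"
    proof -
      have "M * (T * eps') \<le> M * (T * \<epsilon>)" using M T le by (intro mult_left_mono) auto
      then show ?thesis using MT by (simp add: distrib_left mult.assoc)
    qed
    have "wsum 0 n (\<lambda>k. approx \<nu> s T z n (X n) k - coord (x (real (steps \<nu> s T n) * ?h)) k) \<le> M * (E + T * eps')"
      unfolding approx_def M_def
    proof (rule stability_iterate[OF path nu _ _ K d(2) _ _ _ eps'_def E])
      show "0 < ?h" by (rule mesh_bound(1)[OF nu T])
      show "real (steps \<nu> s T n) * ?h \<le> T" by (simp add: steps_mesh)
      show "norm (Lam 1 (x s - x t)) \<le> d" if "s \<in> {0..T}" "t \<in> {0..T}" "\<bar>s - t\<bar> \<le> ?h" for s t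
        using d'(2)[OF that(1,2)] that(3) elim(2) by simp
      show "norm (Lam 1 (proj n (x t) - x t)) \<le> d" if "t \<in> {0..T}" for t
        using N[OF elim(3) that] by simp
      show "real n \<ge> K + 1" using N2 elim(4) by (meson of_nat_le_iff order_trans)
      show "exp (2 * (6 * K + 1) * T) * (E + T * eps') \<le> 1"
        using bd unfolding M_def by linarith
    qed
    then show ?case using bd unfolding steps_mesh M_def by linarith
  qed
qed

lemma approx_converges:
  assumes path: "drift_path \<nu> T z x" and nu: "\<nu> > 0" and T: "T > 0"
  shows "(\<lambda>n. tp n (approx \<nu> s T z n (coord (x 0)))) \<longlonglongrightarrow> x T"
proof -
  obtain K where K: "K \<ge> 1" "\<And>s. s \<in> {0..T} \<Longrightarrow> norm (Lam 1 (x s)) \<le> K"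
    using path_bound[OF path] by metis
  have xT: "x T \<in> mean_zero" using path_mean_zero[OF path] T by simp
  have "(\<lambda>n. tp n (approx \<nu> s T z n (coord (x 0))) - proj n (x T)) \<longlonglongrightarrow> 0"
  proof (rule LIMSEQ_I)
    fix e :: real assume e: "0 < e"
    have "\<forall>\<^sub>F n in sequentially. wsum 0 n (\<lambda>k. approx \<nu> s T z n (coord (x 0)) k - coord (x T) k) \<le> exp (2 * (6 * K + 1) * T) * 0 + e\<^sup>2 / 2"
      by (rule approx_stability[OF path nu T K]) (use e in \<open>auto simp: wsum_def\<close>)
    then show "\<exists>no. \<forall>n\<ge>no. norm (tp n (approx \<nu> s T z n (coord (x 0))) - proj n (x T) - 0) < e"
      unfolding eventually_sequentially
    proof (elim exE, intro exI allI impI)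
      fix N n assume N: "\<forall>n\<ge>N. wsum 0 n (\<lambda>k. approx \<nu> s T z n (coord (x 0)) k - coord (x T) k) \<le> exp (2 * (6 * K + 1) * T) * 0 + e\<^sup>2 / 2"
        and n: "n \<ge> N"
      have "(norm (tp n (approx \<nu> s T z n (coord (x 0))) - proj n (x T)))\<^sup>2 \<le> e\<^sup>2 / 2"
        using N n by (simp add: norm_tp flip: tp_coord tp_diff)
      also have "\<dots> < e\<^sup>2" using e by simp
      finally show "norm (tp n (approx \<nu> s T z n (coord (x 0))) - proj n (x T) - 0) < e"
        using e by (simp add: power2_less_imp_less)
    qed
  qed
  from tendsto_add[OF this proj_tendsto[OF xT]] show ?thesis by simp
qed

text \<open>The scheme started at \<open>y 0\<close> tends to \<open>y T\<close> by
  \<open>approx_converges\<close> and stays within the stated distance of \<open>x\<close> by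
  \<open>approx_stability\<close>; the continuous estimate is thus inherited from the discrete
  one.\<close>

lemma drift_path_stability:
  assumes x: "drift_path \<nu> T z x" and y: "drift_path \<nu> T z y" and nu: "\<nu> > 0" and T: "T > 0"
    and K: "K \<ge> 1" "\<And>s. s \<in> {0..T} \<Longrightarrow> norm (Lam 1 (x s)) \<le> K"
    and small: "exp (2 * (6 * K + 1) * T) * (norm (y 0 - x 0))\<^sup>2 < 1"
  shows "(norm (y T - x T))\<^sup>2 \<le> exp (2 * (6 * K + 1) * T) * (norm (y 0 - x 0))\<^sup>2"
proof (rule field_le_epsilon)
  fix \<eta> :: real assume eta: "0 < \<eta>"
  let ?M = "exp (2 * (6 * K + 1) * T)"
  let ?X = "\<lambda>n. approx \<nu> 0 T z n (coord (y 0))"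
  have E: "wsum 0 n (\<lambda>k. coord (y 0) k - coord (x 0) k) \<le> (norm (y 0 - x 0))\<^sup>2" for n
    using bessel[of "y 0 - x 0" n] by (simp add: wsum_0 inner_diff_left)
  have xT: "x T \<in> mean_zero" using path_mean_zero[OF x] T by simp
  have "(\<lambda>n. (norm (tp n (?X n) - proj n (x T)))\<^sup>2) \<longlonglongrightarrow> (norm (y T - x T))\<^sup>2"
    by (intro tendsto_intros approx_converges[OF y nu T] proj_tendsto xT)
  moreover have ev: "\<forall>\<^sub>F n in sequentially. wsum 0 n (\<lambda>k. ?X n k - coord (x T) k) \<le> ?M * (norm (y 0 - x 0))\<^sup>2 + \<eta>"
    by (rule approx_stability[OF x nu T K E small eta])
  have "\<forall>\<^sub>F n in sequentially. (norm (tp n (?X n) - proj n (x T)))\<^sup>2 \<le> ?M * (norm (y 0 - x 0))\<^sup>2 + \<eta>"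
    using ev
    by eventually_elim (simp add: norm_tp flip: tp_coord tp_diff)
  ultimately show "(norm (y T - x T))\<^sup>2 \<le> ?M * (norm (y 0 - x 0))\<^sup>2 + \<eta>"
    by (rule tendsto_upperbound) simp
qed

section \<open>Solutions as paths\<close>

lemma abel_summation:
  fixes f g :: "nat \<Rightarrow> real"
  shows "(\<Sum>i<n. g i * (f (Suc i) - f i)) = g n * f n - g 0 * f 0 - (\<Sum>i<n. f (Suc i) * (g (Suc i) - g i))"
  by (induction n) (auto simp: algebra_simps)

text \<open>The integrand is smooth and increasing, so after summation by parts the sums converge
  for every continuous path; this replaces stochastic integration. Summation by parts moves
  \<open>B\<close> to right endpoints, and uniform continuity bounds the total error by e/2 times
  the increment of \<open>g\<close>.\<close>

lemma stieltjes_exp_tendsto: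
  fixes B :: "real \<Rightarrow> real"
  assumes B: "continuous_on {0..t} B" and t: "t > 0" and l: "l \<ge> 0"
  defines "g \<equiv> \<lambda>s. exp (- l * (t - s))"
  shows "(\<lambda>n. \<Sum>i<Suc n. g (real i * (t / real (Suc n))) * (B (real (Suc i) * (t / real (Suc n))) - B (real i * (t / real (Suc n)))))
    \<longlonglongrightarrow> B t - g 0 * B 0 - integral {0..t} (\<lambda>s. l * g s * B s)"
proof (rule LIMSEQ_I)
  fix e :: real assume e: "e > 0"
  have "uniformly_continuous_on {0..t} B"
    by (rule compact_uniformly_continuous[OF B compact_Icc])
  then obtain d where d: "d > 0" "\<And>r s. r \<in> {0..t} \<Longrightarrow> s \<in> {0..t} \<Longrightarrow> dist r s < d \<Longrightarrow> dist (B r) (B s) < e / 2"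
    unfolding uniformly_continuous_on_def using e by (metis half_gt_zero)
  obtain N :: nat where N: "real N > t / d" using reals_Archimedean2 by blast
  have gd: "(g has_vector_derivative l * g s) (at s within A)" for s A
    unfolding g_def by (auto intro!: derivative_eq_intros simp flip: has_real_derivative_iff_has_vector_derivative)
  have gc: "continuous_on A g" for A unfolding g_def by (intro continuous_intros)
  show "\<exists>no. \<forall>n\<ge>no. norm ((\<Sum>i<Suc n. g (real i * (t / real (Suc n))) * (B (real (Suc i) * (t / real (Suc n))) - B (real i * (t / real (Suc n)))))
     - (B t - g 0 * B 0 - integral {0..t} (\<lambda>s. l * g s * B s))) < e"
  proof (intro exI[of _ N] allI impI)
    fix n assume n: "n \<ge> N"
    define h where "h = t / real (Suc n)"
    have h: "h > 0" using t by (simp add: h_def)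
    have hd: "h < d"
    proof -
      have "t / d < real (Suc n)" using N n by linarith
      then show ?thesis using d(1) t by (simp add: h_def field_simps)
    qed
    have hn: "real (Suc n) * h = t" by (simp add: h_def)
    let ?\<tau> = "\<lambda>i. real i * h"
    have \<tau>: "0 \<le> ?\<tau> i" "?\<tau> i \<le> ?\<tau> (Suc i)" "?\<tau> (Suc i) = ?\<tau> i + h" for i using h by (auto simp: algebra_simps)
    have \<tau>t: "?\<tau> (Suc i) \<le> t" if "i < Suc n" for i
      unfolding hn[symmetric] using that h by (intro mult_right_mono) auto
    define \<Phi> where "\<Phi> r = integral {0..r} (\<lambda>s. l * g s * B s)" for r
    have int: "(\<lambda>s. l * g s * B s) integrable_on {a..b}" if "0 \<le> a" "b \<le> t" for a b
      by (intro integrable_continuous_interval continuous_intros gc continuous_on_subset[OF B]) (use that in auto)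
    have pc: "\<bar>(\<Phi> (?\<tau> (Suc i)) - \<Phi> (?\<tau> i)) - B (?\<tau> (Suc i)) * (g (?\<tau> (Suc i)) - g (?\<tau> i))\<bar> \<le> e / 2 * (g (?\<tau> (Suc i)) - g (?\<tau> i))"
      if i: "i < Suc n" for i
    proof -
      let ?I = "{?\<tau> i..?\<tau> (Suc i)}"
      have sub: "?I \<subseteq> {0..t}" using \<tau>(1)[of i] \<tau>t[OF i] by auto
      have 1: "((\<lambda>s. l * g s * B s) has_integral (\<Phi> (?\<tau> (Suc i)) - \<Phi> (?\<tau> i))) ?I"
      proof -
        have "\<Phi> (?\<tau> i) + integral ?I (\<lambda>s. l * g s * B s) = \<Phi> (?\<tau> (Suc i))"
          unfolding \<Phi>_def by (rule Henstock_Kurzweil_Integration.integral_combine)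
            (use \<tau>[of i] int[of 0 "?\<tau> (Suc i)"] \<tau>t[OF i] in auto)
        then have eq: "\<Phi> (?\<tau> (Suc i)) - \<Phi> (?\<tau> i) = integral ?I (\<lambda>s. l * g s * B s)" by linarith
        show ?thesis unfolding eq by (rule integrable_integral[OF int[OF \<tau>(1) \<tau>t[OF i]]])
      qed
      have G: "((\<lambda>s. l * g s) has_integral (g (?\<tau> (Suc i)) - g (?\<tau> i))) ?I"
        by (rule fundamental_theorem_of_calculus[OF \<tau>(2) gd])
      have 2: "((\<lambda>s. l * g s * B s - B (?\<tau> (Suc i)) * (l * g s)) has_integral
          ((\<Phi> (?\<tau> (Suc i)) - \<Phi> (?\<tau> i)) - B (?\<tau> (Suc i)) * (g (?\<tau> (Suc i)) - g (?\<tau> i)))) ?I"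
        by (intro has_integral_diff 1 has_integral_mult_right G)
      have 3: "((\<lambda>s. e / 2 * (l * g s)) has_integral e / 2 * (g (?\<tau> (Suc i)) - g (?\<tau> i))) ?I"
        by (intro has_integral_mult_right G)
      have bd: "norm (l * g s * B s - B (?\<tau> (Suc i)) * (l * g s)) \<le> e / 2 * (l * g s)" if s: "s \<in> ?I" for s
      proof -
        have "dist (B s) (B (?\<tau> (Suc i))) < e / 2"
        proof (rule d(2))
          show "dist s (?\<tau> (Suc i)) < d" using s hd \<tau>(3)[of i] unfolding dist_real_def atLeastAtMost_iff by linarith
        qed (use s sub \<tau>(1)[of "Suc i"] \<tau>t[OF i] in auto)
        then have "(l * g s) * \<bar>B s - B (?\<tau> (Suc i))\<bar> \<le> (l * g s) * (e / 2)"
          using l by (intro mult_left_mono) (auto simp: dist_real_def g_def)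
        moreover have "norm (p * b - c * p) \<le> e / 2 * p" if "0 \<le> p" "p * \<bar>b - c\<bar> \<le> p * (e / 2)" for p b c :: real
        proof -
          have "norm (p * b - c * p) = p * \<bar>b - c\<bar>" 
            using that(1) by (simp add: mult.commute[of c] abs_mult flip: right_diff_distrib)
          then show ?thesis using that(2) by (simp add: mult.commute)
        qed
        moreover have "0 \<le> l * g s" using l by (simp add: g_def)
        ultimately show ?thesis by blast
      qed
      have "norm ((\<Phi> (?\<tau> (Suc i)) - \<Phi> (?\<tau> i)) - B (?\<tau> (Suc i)) * (g (?\<tau> (Suc i)) - g (?\<tau> i))) \<le> e / 2 * (g (?\<tau> (Suc i)) - g (?\<tau> i))"
        using integral_norm_bound_integral[OF has_integral_integrable[OF 2] has_integral_integrable[OF 3] bd]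
        unfolding integral_unique[OF 2] integral_unique[OF 3] .
      then show ?thesis by simp
    qed
    have eq1: "(\<Sum>i<Suc n. g (?\<tau> i) * (B (?\<tau> (Suc i)) - B (?\<tau> i))) - (B t - g 0 * B 0 - \<Phi> t)
       = \<Phi> t - (\<Sum>i<Suc n. B (?\<tau> (Suc i)) * (g (?\<tau> (Suc i)) - g (?\<tau> i)))"
      using abel_summation[of "\<lambda>i. g (?\<tau> i)" "\<lambda>i. B (?\<tau> i)" "Suc n"] hn by (simp add: g_def)
    have eq2: "\<Phi> t = (\<Sum>i<Suc n. \<Phi> (?\<tau> (Suc i)) - \<Phi> (?\<tau> i))"
      using sum_lessThan_telescope[of "\<lambda>i. \<Phi> (?\<tau> i)" "Suc n"] hn by (simp add: \<Phi>_def)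
    have eq3: "\<Phi> t - (\<Sum>i<Suc n. B (?\<tau> (Suc i)) * (g (?\<tau> (Suc i)) - g (?\<tau> i)))
      = (\<Sum>i<Suc n. (\<Phi> (?\<tau> (Suc i)) - \<Phi> (?\<tau> i)) - B (?\<tau> (Suc i)) * (g (?\<tau> (Suc i)) - g (?\<tau> i)))"
      unfolding eq2 by (rule sum_subtractf[symmetric])
    have "\<bar>(\<Sum>i<Suc n. g (?\<tau> i) * (B (?\<tau> (Suc i)) - B (?\<tau> i))) - (B t - g 0 * B 0 - \<Phi> t)\<bar>
       = \<bar>\<Sum>i<Suc n. (\<Phi> (?\<tau> (Suc i)) - \<Phi> (?\<tau> i)) - B (?\<tau> (Suc i)) * (g (?\<tau> (Suc i)) - g (?\<tau> i))\<bar>"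
      unfolding eq1 eq3 ..
    also have "\<dots> \<le> (\<Sum>i<Suc n. e / 2 * (g (?\<tau> (Suc i)) - g (?\<tau> i)))"
      by (rule order_trans[OF sum_abs sum_mono]) (use pc in auto)
    also have "\<dots> = e / 2 * (g t - g 0)"
      by (simp only: sum_distrib_left[symmetric] sum_lessThan_telescope[of "\<lambda>i. g (?\<tau> i)"] hn of_nat_0 mult_zero_left)
    also have "\<dots> \<le> e / 2 * 1" using e by (intro mult_left_mono) (auto simp: g_def)
    also have "\<dots> < e" using e by simp
    finally show "norm ((\<Sum>i<Suc n. g (real i * (t / real (Suc n))) * (B (real (Suc i) * (t / real (Suc n))) - B (real i * (t / real (Suc n)))))
     - (B t - g 0 * B 0 - integral {0..t} (\<lambda>s. l * g s * B s))) < e"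
      unfolding \<Phi>_def h_def real_norm_def .
  qed
qed

text \<open>Variation of constants, read backwards. \<open>x\<close> itself need not be
  differentiable, but \<open>x\<close> minus \<open>c\<close> times \<open>B\<close> is: it is the
  function \<open>r\<close>, and differentiating \<open>r\<close> removes the exponential
  kernel.\<close>

lemma mild_to_strong:
  fixes N B x :: "real \<Rightarrow> real"
  assumes N: "continuous_on {0..T} N" and B: "continuous_on {0..T} B"
    and x: "\<And>t. t \<in> {0..T} \<Longrightarrow> x t = exp (- l * t) * y + integral {0..t} (\<lambda>s. exp (- l * (t - s)) * N s)
      + c * (B t - integral {0..t} (\<lambda>s. l * exp (- l * (t - s)) * B s))"
    and t: "t \<in> {0..T}"
  shows "x t = y + integral {0..t} (\<lambda>s. - l * x s + N s) + c * B t"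
proof -
  define f where "f s = exp (l * s) * (N s - l * c * B s)" for s
  define r where "r s = exp (- l * s) * (y + integral {0..s} f)" for s
  have cf: "continuous_on {0..T} f" unfolding f_def by (intro continuous_intros N B)
  have xr: "x s = r s + c * B s" if s: "s \<in> {0..T}" for s
  proof -
    have sub: "{0..s} \<subseteq> {0..T}" using s by auto
    have i: "(\<lambda>u. exp (- l * (s - u)) * N u) integrable_on {0..s}" "(\<lambda>u. l * exp (- l * (s - u)) * B u) integrable_on {0..s}"
      "(\<lambda>u. c * (l * exp (- l * (s - u)) * B u)) integrable_on {0..s}"
      by (intro integrable_continuous_interval continuous_intros continuous_on_subset[OF N sub] continuous_on_subset[OF B sub])+
    have "exp (- l * s) * integral {0..s} f = integral {0..s} (\<lambda>u. exp (- l * s) * f u)" by simp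
    also have "\<dots> = integral {0..s} (\<lambda>u. exp (- l * (s - u)) * N u - c * (l * exp (- l * (s - u)) * B u))"
      by (intro arg_cong[where f = "integral {0..s}"] ext) (simp add: f_def algebra_simps exp_diff exp_minus field_simps)
    also have "\<dots> = integral {0..s} (\<lambda>u. exp (- l * (s - u)) * N u) - c * integral {0..s} (\<lambda>u. l * exp (- l * (s - u)) * B u)"
      using i by (subst Henstock_Kurzweil_Integration.integral_diff) auto
    finally show ?thesis unfolding x[OF s] r_def by (simp add: algebra_simps)
  qed
  have cx: "continuous_on {0..T} x"
  proof -
    have "continuous_on {0..T} (\<lambda>s. r s + c * B s)"
      unfolding r_def by (intro continuous_intros B indefinite_integral_continuous_1 integrable_continuous_interval cf)
    then show ?thesis by (rule continuous_on_eq) (simp add: xr)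
  qed
  have "((\<lambda>s. - l * x s + N s) has_integral r t - r 0) {0..t}"
  proof (rule fundamental_theorem_of_calculus)
    fix s assume s: "s \<in> {0..t}"
    then have sT: "s \<in> {0..T}" using t by auto
    have "((\<lambda>u. integral {0..u} f) has_real_derivative f s) (at s within {0..T})"
      by (rule integral_has_real_derivative[OF cf sT])
    then have "(r has_real_derivative (- l * exp (- l * s)) * (y + integral {0..s} f) + exp (- l * s) * f s) (at s within {0..T})"
      unfolding r_def by (auto intro!: derivative_eq_intros simp: algebra_simps)
    also have "(- l * exp (- l * s)) * (y + integral {0..s} f) + exp (- l * s) * f s = - l * x s + N s"
      unfolding xr[OF sT] r_def f_def by (simp add: algebra_simps exp_minus field_simps)
    finally show "(r has_vector_derivative (- l * x s + N s)) (at s within {0..t})"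
      unfolding has_real_derivative_iff_has_vector_derivative
      by (rule has_vector_derivative_within_subset) (use t in auto)
  qed (use t in auto)
  then have "integral {0..t} (\<lambda>s. - l * x s + N s) = r t - y" by (simp add: integral_unique r_def)
  then show ?thesis using xr[OF t] by simp
qed

text \<open>Restarting at time \<open>r\<close>: the driver becomes its increments after
  \<open>r\<close>, the form that the Markov property requires.\<close>

lemma drift_path_shift:
  assumes path: "drift_path \<nu> (r + T) z x" and r: "r \<ge> 0" and T: "T \<ge> 0"
  shows "drift_path \<nu> T (\<lambda>t k. z (r + t) k - z r k) (\<lambda>t. x (r + t))"
  unfolding drift_path_def
proof (intro conjI ballI)
  show "x (r + t) \<in> hom_sobolev 1" if "t \<in> {0..T}" for t
    using path_H1[OF path, of "r + t"] that r by simp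
  show "continuous_on {0..T} (\<lambda>t. Lam 1 (x (r + t)))"
    by (rule continuous_on_compose2[OF path_continuous[OF path]]) (use r in \<open>auto intro!: continuous_intros\<close>)
  fix k t assume k: "k \<in> nonzero_ints" and t: "t \<in> {0..T}"
  have "coord (x (r + t)) k - coord (x r) k = integral {r..r+t} (\<lambda>s. vfield \<nu> (x s) k) + (z (r + t) k - z r k)"
    by (rule path_increment[OF path]) (use k t r in auto)
  moreover have "integral {r..r+t} (\<lambda>s. vfield \<nu> (x s) k) = integral {0..t} (\<lambda>s. vfield \<nu> (x (r + s)) k)"
    using integral_shift_Icc_real[of 0 t "\<lambda>s. vfield \<nu> (x s) k" r]
    by (simp add: add.commute o_def)
  ultimately show "coord (x (r + t)) k = coord (x (r + 0)) k + integral {0..t} (\<lambda>s. vfield \<nu> (x (r + s)) k) + (z (r + t) k - z r k)"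
    by simp
qed

section \<open>The noise, coordinate by coordinate\<close>

lemma
  fixes f :: "int \<Rightarrow> real"
  assumes "\<And>k. f k \<ge> 0"
  shows sum_freqs_tendsto_infsum: "(\<lambda>n. ennreal (sum f (freqs n))) \<longlonglongrightarrow> (\<Sum>\<^sub>\<infinity>k\<in>nonzero_ints. ennreal (f k))"
    and sum_freqs_le_infsum: "ennreal (sum f (freqs n)) \<le> (\<Sum>\<^sub>\<infinity>k\<in>nonzero_ints. ennreal (f k))"
proof -
  have "(\<lambda>k. ennreal (f k)) summable_on nonzero_ints"
    by (rule nonneg_summable_on_complete) simp
  from has_sum_imp_tendsto_freqs[OF has_sum_infsum[OF this]]
  show lim: "(\<lambda>n. ennreal (sum f (freqs n))) \<longlonglongrightarrow> (\<Sum>\<^sub>\<infinity>k\<in>nonzero_ints. ennreal (f k))"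
    by (subst (asm) sum_ennreal) (auto simp: assms)
  have "incseq (\<lambda>n. ennreal (sum f (freqs n)))"
    by (intro incseq_SucI ennreal_leI sum_mono2 freqs_mono) (auto simp: assms)
  then show "ennreal (sum f (freqs n)) \<le> (\<Sum>\<^sub>\<infinity>k\<in>nonzero_ints. ennreal (f k))"
    using lim by (rule incseq_le)
qed

lemma noise_strength_bound:
  assumes "noise_strength m b < \<infinity>" "s \<le> m"
  shows "(\<Sum>k\<in>freqs n. \<bar>of_int k\<bar> ^ (2 * s) * (b k)\<^sup>2) \<le> enn2real (noise_strength m b)"
proof -
  have "(\<Sum>k\<in>freqs n. \<bar>of_int k\<bar> ^ (2 * s) * (b k)\<^sup>2) \<le> (\<Sum>k\<in>freqs n. \<bar>of_int k\<bar> ^ (2 * m) * (b k)\<^sup>2)"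
    using assms(2) by (intro sum_mono mult_right_mono power_increasing) (auto dest: freqs_nonzero nonzero_int_ge_1)
  moreover have "ennreal (\<Sum>k\<in>freqs n. \<bar>of_int k\<bar> ^ (2 * m) * (b k)\<^sup>2) \<le> noise_strength m b"
    unfolding noise_strength_def by (rule sum_freqs_le_infsum) simp
  then have "(\<Sum>k\<in>freqs n. \<bar>of_int k\<bar> ^ (2 * m) * (b k)\<^sup>2) \<le> enn2real (noise_strength m b)"
    using enn2real_mono[of "ennreal (\<Sum>k\<in>freqs n. \<bar>of_int k\<bar> ^ (2 * m) * (b k)\<^sup>2)" "noise_strength m b"] assms(1)
    by (simp add: sum_nonneg)
  ultimately show ?thesis by linarith
qed

locale noise_space = prob_space M for M :: "'w measure" +
  fixes F :: "real \<Rightarrow> 'w measure" and \<beta> :: "int \<Rightarrow> real \<Rightarrow> 'w \<Rightarrow> real"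
    and b :: "int \<Rightarrow> real" and \<sigma> :: nat and \<nu> :: real
  assumes filt: "filtered_prob_space M F" and fam: "brownian_family M F \<beta>"
    and strength: "noise_strength \<sigma> b < \<infinity>" and nu: "\<nu> > 0"
begin

definition "Bsum = enn2real (noise_strength \<sigma> b)"

lemma noise_sum_le: "s \<le> \<sigma> \<Longrightarrow> (\<Sum>k\<in>freqs n. \<bar>of_int k\<bar> ^ (2 * s) * (b k)\<^sup>2) \<le> Bsum"
  unfolding Bsum_def by (rule noise_strength_bound[OF strength])

lemma noise_sum_le_0: "(\<Sum>k\<in>freqs n. (b k)\<^sup>2) \<le> Bsum"
  using noise_sum_le[of 0 n] by simp

lemma bm: "k \<noteq> 0 \<Longrightarrow> brownian_motion M (\<beta> k)"
  using fam by (simp add: brownian_family_def)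

lemma bm_measurable: "k \<noteq> 0 \<Longrightarrow> t \<ge> 0 \<Longrightarrow> \<beta> k t \<in> borel_measurable M"
  using bm unfolding brownian_motion_def by blast

lemma bm_adapted: "k \<noteq> 0 \<Longrightarrow> t \<ge> 0 \<Longrightarrow> \<beta> k t \<in> borel_measurable (F t)"
  using fam by (simp add: brownian_family_def)

lemma bm_increment:
  "k \<noteq> 0 \<Longrightarrow> 0 \<le> s \<Longrightarrow> s < t \<Longrightarrow> distributed M lborel (\<lambda>\<omega>. \<beta> k t \<omega> - \<beta> k s \<omega>) (normal_density 0 (sqrt (t - s)))"
  using bm unfolding brownian_motion_def by blast

lemma AE_bm: "AE \<omega> in M. \<forall>k. k \<noteq> 0 \<longrightarrow> \<beta> k 0 \<omega> = 0 \<and> continuous_on {0..} (\<lambda>t. \<beta> k t \<omega>)"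
  unfolding AE_all_countable using bm unfolding brownian_motion_def by auto

lemma bm_second_moment:
  assumes "k \<noteq> 0" "t \<ge> 0"
  shows "(\<integral>\<^sup>+\<omega>. ennreal ((\<beta> k t \<omega>)\<^sup>2) \<partial>M) \<le> ennreal t"
proof (cases "t = 0")
  case True
  have "(\<integral>\<^sup>+\<omega>. ennreal ((\<beta> k t \<omega>)\<^sup>2) \<partial>M) = (\<integral>\<^sup>+\<omega>. 0 \<partial>M)"
    by (rule nn_integral_cong_AE) (use AE_bm in eventually_elim, use assms True in auto)
  then show ?thesis by simp
next
  case False
  then have t: "t > 0" using assms by simp
  have "(\<integral>\<^sup>+\<omega>. ennreal ((\<beta> k t \<omega>)\<^sup>2) \<partial>M) = (\<integral>\<^sup>+\<omega>. ennreal ((\<beta> k t \<omega> - \<beta> k 0 \<omega>)\<^sup>2) \<partial>M)"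
    by (rule nn_integral_cong_AE) (use AE_bm in eventually_elim, use assms in auto)
  also have "\<dots> = (\<integral>\<^sup>+x. ennreal (normal_density 0 (sqrt (t - 0)) x) * ennreal (x\<^sup>2) \<partial>lborel)"
    using distributed_nn_integral[OF bm_increment[OF assms(1) order_refl t], of "\<lambda>x. ennreal (x\<^sup>2)"] by simp
  also have "\<dots> = (\<integral>\<^sup>+x. ennreal (normal_density 0 (sqrt t) x * (x - 0) ^ (2 * 1)) \<partial>lborel)"
    by (intro nn_integral_cong) (simp add: ennreal_mult)
  also have "\<dots> = ennreal (fact (2 * 1) / ((2 / (sqrt t)\<^sup>2) ^ 1 * fact 1))"
    using normal_moment_even[of "sqrt t" 0 1] t
    by (intro nn_integral_eq_integral[THEN trans]) (auto simp: has_bochner_integral_iff)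
  also have "\<dots> = ennreal t" using t by (simp add: fact_numeral)
  finally show ?thesis by simp
qed

text \<open>\<open>noise\<close> is an unordered infinite sum, from which nothing can be read where
  it fails to converge. The expected sum of squares is at most t times \<open>Bsum\<close>, so the
  exceptional samples form a null set.\<close>

lemma AE_l2seq_noise:
  assumes t: "t \<ge> 0"
  shows "AE \<omega> in M. l2seq (\<lambda>k. b k * \<beta> k t \<omega>)"
proof -
  let ?S = "\<lambda>n \<omega>. \<Sum>k\<in>freqs n. (b k * \<beta> k t \<omega>)\<^sup>2"
  have meas: "(\<lambda>\<omega>. ennreal (?S n \<omega>)) \<in> borel_measurable M" for n
    using bm_measurable[OF freqs_nonzero t] by (intro measurable_compose[OF _ measurable_ennreal] borel_measurable_sum) auto
  have bd: "(\<integral>\<^sup>+\<omega>. ennreal (?S n \<omega>) \<partial>M) \<le> ennreal (t * Bsum)" for n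
  proof -
    have "(\<integral>\<^sup>+\<omega>. ennreal (?S n \<omega>) \<partial>M) = (\<integral>\<^sup>+\<omega>. (\<Sum>k\<in>freqs n. ennreal ((b k)\<^sup>2) * ennreal ((\<beta> k t \<omega>)\<^sup>2)) \<partial>M)"
      by (simp add: power_mult_distrib ennreal_mult flip: sum_ennreal)
    also have "\<dots> = (\<Sum>k\<in>freqs n. ennreal ((b k)\<^sup>2) * (\<integral>\<^sup>+\<omega>. ennreal ((\<beta> k t \<omega>)\<^sup>2) \<partial>M))"
      using bm_measurable[OF freqs_nonzero t]
      by (subst nn_integral_sum) (auto simp: nn_integral_cmult)
    also have "\<dots> \<le> (\<Sum>k\<in>freqs n. ennreal ((b k)\<^sup>2) * ennreal t)"
      using bm_second_moment[OF freqs_nonzero t] by (intro sum_mono mult_left_mono) auto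
    also have "\<dots> = ennreal (t * (\<Sum>k\<in>freqs n. (b k)\<^sup>2))"
      using t by (simp add: ennreal_mult'[symmetric] sum_distrib_left mult.commute)
    also have "\<dots> \<le> ennreal (t * Bsum)"
      using t noise_sum_le_0 by (intro ennreal_leI mult_left_mono)
    finally show ?thesis .
  qed
  have "(\<integral>\<^sup>+\<omega>. (SUP n. ennreal (?S n \<omega>)) \<partial>M) = (SUP n. \<integral>\<^sup>+\<omega>. ennreal (?S n \<omega>) \<partial>M)"
  proof (rule nn_integral_monotone_convergence_SUP[OF _ meas])
    show "incseq (\<lambda>n \<omega>. ennreal (?S n \<omega>))"
      by (intro incseq_SucI le_funI ennreal_leI sum_mono2 freqs_mono) auto
  qed
  also have "\<dots> \<le> ennreal (t * Bsum)" by (intro SUP_least bd)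
  finally have "(\<integral>\<^sup>+\<omega>. (SUP n. ennreal (?S n \<omega>)) \<partial>M) \<noteq> \<infinity>" by (auto simp: top_unique)
  then have "AE \<omega> in M. (SUP n. ennreal (?S n \<omega>)) \<noteq> \<infinity>"
    by (rule nn_integral_PInf_AE[rotated]) (intro borel_measurable_SUP meas countableI_type)
  then show ?thesis
  proof eventually_elim
    case (elim \<omega>)
    show ?case
    proof (rule l2seqI)
      fix n
      have "ennreal (?S n \<omega>) \<le> (SUP n. ennreal (?S n \<omega>))" by (rule SUP_upper) simp
      then have "enn2real (ennreal (?S n \<omega>)) \<le> enn2real (SUP n. ennreal (?S n \<omega>))"
        by (rule enn2real_mono) (metis elim infinity_ennreal_def top.not_eq_extremum)
      then show "?S n \<omega> \<le> enn2real (SUP n. ennreal (?S n \<omega>))" by (simp add: sum_nonneg)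
    qed
  qed
qed

lemma AE_coord_noise:
  assumes t: "t \<ge> 0"
  shows "AE \<omega> in M. \<forall>k. k \<noteq> 0 \<longrightarrow> coord (noise b \<beta> t \<omega>) k = b k * \<beta> k t \<omega>"
  using AE_l2seq_noise[OF t]
proof eventually_elim
  case (elim \<omega>)
  have "noise b \<beta> t \<omega> = synth (\<lambda>k. b k * \<beta> k t \<omega>)" by (simp add: noise_def synth_def)
  then show ?case using elim by (simp add: coord_synth)
qed

text \<open>Along uniform partitions the coordinate of the sums converges almost surely by
  \<open>stieltjes_exp_tendsto\<close>, and in mean square to the coordinate of \<open>I\<close> by
  hypothesis; Fatou's lemma identifies the limits.\<close>

lemma wiener_integral_coord:
  assumes I: "has_wiener_integral M (noise b \<beta>) (\<lambda>s. heat (\<nu> * (t - s))) t I"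
    and t: "t > 0" and k: "k \<noteq> 0"
  defines "l \<equiv> \<nu> * (of_int k)\<^sup>2"
  shows "AE \<omega> in M. coord (I \<omega>) k = b k * (\<beta> k t \<omega> - integral {0..t} (\<lambda>s. l * exp (- l * (t - s)) * \<beta> k s \<omega>))"
proof -
  define \<tau> where "\<tau> n i = real i * (t / real (Suc n))" for n i :: nat
  define R where "R n \<omega> = (\<Sum>i<Suc n. exp (- l * (t - \<tau> n i)) * (\<beta> k (\<tau> n (Suc i)) \<omega> - \<beta> k (\<tau> n i) \<omega>))" for n \<omega>
  define S where "S n \<omega> = (\<Sum>i<Suc n. heat (\<nu> * (t - \<tau> n i)) (noise b \<beta> (\<tau> n (Suc i)) \<omega> - noise b \<beta> (\<tau> n i) \<omega>))" for n \<omega>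
  have Im[measurable]: "I \<in> borel_measurable M" using I by (simp add: has_wiener_integral_def)
  have Ik[measurable]: "(\<lambda>\<omega>. coord (I \<omega>) k) \<in> borel_measurable M"
    by (rule borel_measurable_continuous_on[OF _ Im]) (intro continuous_intros)
  have l0: "l \<ge> 0" using nu by (simp add: l_def)
  have \<tau>0: "\<tau> n i \<ge> 0" for n i using t by (simp add: \<tau>_def)
  have \<tau>t: "\<tau> n i \<le> t" if "i \<le> Suc n" for n i
  proof -
    have "real i * (t / real (Suc n)) \<le> real (Suc n) * (t / real (Suc n))"
      using that t by (intro mult_right_mono) auto
    then show ?thesis by (simp add: \<tau>_def)
  qed
  have Rm[measurable]: "R n \<in> borel_measurable M" for n
    unfolding R_def using bm_measurable[OF k \<tau>0] by (intro borel_measurable_sum borel_measurable_times borel_measurable_diff borel_measurable_const) auto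
  have SR: "AE \<omega> in M. coord (S n \<omega>) k = b k * R n \<omega>" for n
  proof -
    have "AE \<omega> in M. \<forall>i\<in>{..Suc n}. \<forall>k. k \<noteq> 0 \<longrightarrow> coord (noise b \<beta> (\<tau> n i) \<omega>) k = b k * \<beta> k (\<tau> n i) \<omega>"
      by (subst AE_ball_countable) (auto intro!: AE_coord_noise \<tau>0)
    then show ?thesis
    proof eventually_elim
      case (elim \<omega>)
      have "coord (S n \<omega>) k = (\<Sum>i<Suc n. exp (- l * (t - \<tau> n i)) * (b k * \<beta> k (\<tau> n (Suc i)) \<omega> - b k * \<beta> k (\<tau> n i) \<omega>))"
        unfolding S_def inner_sum_left
      proof (rule sum.cong[OF refl])
        fix i assume i: "i \<in> {..<Suc n}"
        then have "\<nu> * (t - \<tau> n i) \<ge> 0" using \<tau>t[of i n] nu by simp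
        from coord_heat[OF this k] show "coord (heat (\<nu> * (t - \<tau> n i)) (noise b \<beta> (\<tau> n (Suc i)) \<omega> - noise b \<beta> (\<tau> n i) \<omega>)) k
           = exp (- l * (t - \<tau> n i)) * (b k * \<beta> k (\<tau> n (Suc i)) \<omega> - b k * \<beta> k (\<tau> n i) \<omega>)"
          using elim i k by (simp add: inner_diff_left l_def mult_ac)
      qed
      also have "\<dots> = b k * R n \<omega>" by (simp only: R_def sum_distrib_left) (simp add: algebra_simps)
      finally show ?case .
    qed
  qed
  have lim: "(\<lambda>n. \<integral>\<^sup>+\<omega>. ennreal ((b k * R n \<omega> - coord (I \<omega>) k)\<^sup>2) \<partial>M) \<longlonglongrightarrow> 0"
  proof (rule order_tendstoI)
    fix \<epsilon> :: ennreal assume "0 < \<epsilon>"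
    then obtain c where c: "0 < c" "c < \<epsilon>" using dense by blast
    define e where "e = enn2real c"
    have "c < top" using c(2) top_greatest by (rule order_less_le_trans)
    then have e: "e > 0" "ennreal e < \<epsilon>" using c by (auto simp: e_def enn2real_positive_iff)
    from I e(1) obtain \<delta> where \<delta>: "\<delta> > 0" "\<forall>n (\<tau>::nat \<Rightarrow> real). \<tau> 0 = 0 \<and> \<tau> n = t \<and> (\<forall>i<n. \<tau> i \<le> \<tau> (Suc i) \<and> \<tau> (Suc i) - \<tau> i < \<delta>) \<longrightarrow>
        (\<integral>\<^sup>+\<omega>. ennreal ((norm ((\<Sum>i<n. heat (\<nu> * (t - \<tau> i)) (noise b \<beta> (\<tau> (Suc i)) \<omega> - noise b \<beta> (\<tau> i) \<omega>)) - I \<omega>))\<^sup>2) \<partial>M) < ennreal e"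
      unfolding has_wiener_integral_def by blast
    obtain N :: nat where N: "real N > t / \<delta>" using reals_Archimedean2 by blast
    show "\<forall>\<^sub>F n in sequentially. (\<integral>\<^sup>+\<omega>. ennreal ((b k * R n \<omega> - coord (I \<omega>) k)\<^sup>2) \<partial>M) < \<epsilon>"
      using eventually_ge_at_top[of N]
    proof eventually_elim
      case (elim n)
      have "t / \<delta> < real (Suc n)" using N elim by linarith
      then have h: "t / real (Suc n) < \<delta>" using \<delta>(1) t by (simp add: field_simps)
      have "(\<integral>\<^sup>+\<omega>. ennreal ((b k * R n \<omega> - coord (I \<omega>) k)\<^sup>2) \<partial>M) \<le> (\<integral>\<^sup>+\<omega>. ennreal ((norm (S n \<omega> - I \<omega>))\<^sup>2) \<partial>M)"
      proof (rule nn_integral_mono_AE, use SR[of n] in eventually_elim)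
        case (elim \<omega>)
        have "\<bar>b k * R n \<omega> - coord (I \<omega>) k\<bar> \<le> norm (S n \<omega> - I \<omega>)"
          using coord_le_norm[OF k, of "S n \<omega> - I \<omega>"] elim by (simp add: inner_diff_left)
        then have "(b k * R n \<omega> - coord (I \<omega>) k)\<^sup>2 \<le> (norm (S n \<omega> - I \<omega>))\<^sup>2"
          by (simp add: abs_le_square_iff[symmetric])
        then show ?case by (rule ennreal_leI)
      qed
      also have "\<dots> < ennreal e" unfolding S_def
      proof (rule \<delta>(2)[rule_format], intro conjI allI impI)
        fix i
        have "\<tau> n (Suc i) - \<tau> n i = t / real (Suc n)" by (simp add: \<tau>_def algebra_simps flip: add_divide_distrib)
        moreover have "t / real (Suc n) > 0" using t by simp
        ultimately show "\<tau> n i \<le> \<tau> n (Suc i)" "\<tau> n (Suc i) - \<tau> n i < \<delta>" using h by linarith+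
      qed (simp_all add: \<tau>_def)
      finally show ?case using e(2) by (rule less_trans)
    qed
  qed simp
  have pw: "AE \<omega> in M. (\<lambda>n. R n \<omega>) \<longlonglongrightarrow> \<beta> k t \<omega> - integral {0..t} (\<lambda>s. l * exp (- l * (t - s)) * \<beta> k s \<omega>)"
    using AE_bm
  proof eventually_elim
    case (elim \<omega>)
    then have c: "continuous_on {0..t} (\<lambda>s. \<beta> k s \<omega>)" and z: "\<beta> k 0 \<omega> = 0"
      using k by (auto intro: continuous_on_subset)
    from stieltjes_exp_tendsto[OF c t l0] show ?case unfolding R_def \<tau>_def z by simp
  qed
  have "(\<integral>\<^sup>+\<omega>. liminf (\<lambda>n. ennreal ((b k * R n \<omega> - coord (I \<omega>) k)\<^sup>2)) \<partial>M)
      \<le> liminf (\<lambda>n. \<integral>\<^sup>+\<omega>. ennreal ((b k * R n \<omega> - coord (I \<omega>) k)\<^sup>2) \<partial>M)"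
    by (rule nn_integral_liminf) measurable
  also have "\<dots> = 0" by (rule lim_imp_Liminf[OF sequentially_bot lim])
  finally have "(\<integral>\<^sup>+\<omega>. liminf (\<lambda>n. ennreal ((b k * R n \<omega> - coord (I \<omega>) k)\<^sup>2)) \<partial>M) = 0" by simp
  then have "AE \<omega> in M. liminf (\<lambda>n. ennreal ((b k * R n \<omega> - coord (I \<omega>) k)\<^sup>2)) = 0"
    by (subst (asm) nn_integral_0_iff_AE) measurable
  then show ?thesis using pw
  proof eventually_elim
    case (elim \<omega>)
    let ?W = "\<beta> k t \<omega> - integral {0..t} (\<lambda>s. l * exp (- l * (t - s)) * \<beta> k s \<omega>)"
    have "(\<lambda>n. ennreal ((b k * R n \<omega> - coord (I \<omega>) k)\<^sup>2)) \<longlonglongrightarrow> ennreal ((b k * ?W - coord (I \<omega>) k)\<^sup>2)"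
      by (intro tendsto_intros elim(2))
    from lim_imp_Liminf[OF sequentially_bot this] elim(1)
    have "ennreal ((b k * ?W - coord (I \<omega>) k)\<^sup>2) = 0" by simp
    then show ?case by simp
  qed
qed

end

section \<open>From mild solutions to driven paths\<close>

lemma continuous_on_Lam_mono:
  assumes "\<And>t. t \<in> S \<Longrightarrow> x t \<in> hom_sobolev m" "continuous_on S (\<lambda>t. Lam m (x t))" "j \<le> m"
  shows "continuous_on S (\<lambda>t :: real. Lam j (x t))"
  unfolding continuous_on_def
proof
  fix t assume t: "t \<in> S"
  have "((\<lambda>s. Lam j (x s) - Lam j (x t)) \<longlongrightarrow> 0) (at t within S)"
  proof (rule Lim_null_comparison)
    show "\<forall>\<^sub>F s in at t within S. norm (Lam j (x s) - Lam j (x t)) \<le> norm (Lam m (x s) - Lam m (x t))"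
      unfolding eventually_at_filter
    proof (intro always_eventually allI impI)
      fix s assume s: "s \<in> S"
      show "norm (Lam j (x s) - Lam j (x t)) \<le> norm (Lam m (x s) - Lam m (x t))"
        using norm_Lam_mono[OF hom_sobolev_diff[OF assms(1)[OF s] assms(1)[OF t]] assms(3)]
        by (simp add: Lam_diff[OF assms(1)[OF s] assms(1)[OF t]]
            Lam_diff[OF hom_sobolev_mono[OF assms(1)[OF s] assms(3)] hom_sobolev_mono[OF assms(1)[OF t] assms(3)]])
    qed
    have "((\<lambda>s. Lam m (x s)) \<longlongrightarrow> Lam m (x t)) (at t within S)"
      using assms(2) t unfolding continuous_on_def by blast
    then show "((\<lambda>s. norm (Lam m (x s) - Lam m (x t))) \<longlongrightarrow> 0) (at t within S)"
      by (intro tendsto_norm_zero LIM_zero)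
  qed
  then show "((\<lambda>s. Lam j (x s)) \<longlongrightarrow> Lam j (x t)) (at t within S)" by (rule LIM_zero_cancel)
qed

lemma closure_rational_interval:
  assumes "(0::real) < T" shows "closure ({0<..<T} \<inter> \<rat>) = {0..T}"
proof
  show "closure ({0<..<T} \<inter> \<rat>) \<subseteq> {0..T}" by (rule closure_minimal) auto
  show "{0..T} \<subseteq> closure ({0<..<T} \<inter> \<rat>)"
  proof
    fix t assume t: "t \<in> {0..T}"
    show "t \<in> closure ({0<..<T} \<inter> \<rat>)"
      unfolding closure_approachable
    proof (intro allI impI)
      fix e :: real assume "e > 0"
      then have "max 0 (t - e) < min T (t + e)" using t assms by auto
      then obtain q where "q \<in> \<rat>" "max 0 (t - e) < q" "q < min T (t + e)" using Rats_dense_in_real by blast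
      then show "\<exists>y\<in>{0<..<T} \<inter> \<rat>. dist y t < e" by (intro bexI[of _ q]) (auto simp: dist_real_def)
    qed
  qed
qed

text \<open>The exponential kernel factorises into a function of \<open>t\<close> and a function of
  \<open>s\<close>, so the convolution is a continuous function times an indefinite
  integral.\<close>

lemma continuous_exp_convolution:
  fixes f :: "real \<Rightarrow> real"
  assumes "continuous_on {0..T} f"
  shows "continuous_on {0..T} (\<lambda>t. integral {0..t} (\<lambda>s. c * exp (- l * (t - s)) * f s))"
proof -
  have "continuous_on {0..T} (\<lambda>t. exp (- l * t) * integral {0..t} (\<lambda>s. c * exp (l * s) * f s))"
    by (intro continuous_intros indefinite_integral_continuous_1 integrable_continuous_interval assms)
  moreover have "exp (- l * t) * integral {0..t} (\<lambda>s. c * exp (l * s) * f s) = integral {0..t} (\<lambda>s. c * exp (- l * (t - s)) * f s)" for t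
  proof -
    have "exp (- l * t) * integral {0..t} (\<lambda>s. c * exp (l * s) * f s) = integral {0..t} (\<lambda>s. exp (- l * t) * (c * exp (l * s) * f s))"
      by simp
    also have "\<dots> = integral {0..t} (\<lambda>s. c * exp (- l * (t - s)) * f s)"
      by (intro arg_cong[where f = "integral {0..t}"] ext) (simp add: right_diff_distrib exp_diff exp_minus field_simps)
    finally show ?thesis .
  qed
  ultimately show ?thesis by simp
qed

context noise_space
begin

text \<open>At each single time the stochastic convolution is identified only up to a null set. The
  identities are collected at the rational times and for all indices, countably many in all, and
  extended to every time by continuity of the other terms; so one null set suffices.\<close>

lemma solution_path:
  assumes w: "adapted_global_solution M F (- 2) \<nu> (noise b \<beta>) m y w" and y: "y \<in> hom_sobolev m"
    and m: "m \<ge> 1" and T: "T > 0"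
  shows "AE \<omega> in M. drift_path \<nu> T (\<lambda>t k. b k * \<beta> k t \<omega>) (\<lambda>t. w t \<omega>) \<and> w 0 \<omega> = y \<and>
    (\<forall>t\<in>{0..T}. w t \<omega> \<in> hom_sobolev m) \<and> continuous_on {0..T} (\<lambda>t. w t \<omega>)"
proof -
  have sol: "solution_on M (- 2) \<nu> (noise b \<beta>) m T y w"
    using w T by (simp add: adapted_global_solution_def)
  then obtain Z where Z: "\<And>t. t \<in> {0..T} \<Longrightarrow> has_wiener_integral M (noise b \<beta>) (\<lambda>s. heat (\<nu> * (t - s))) t (Z t)"
    and eq: "AE \<omega> in M. \<forall>t\<in>{0..T}.
           (\<lambda>s. heat (\<nu> * (t - s)) (drift (- 2) (w s \<omega>))) integrable_on {0..t} \<and>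
           w t \<omega> = heat (\<nu> * t) y + integral {0..t} (\<lambda>s. heat (\<nu> * (t - s)) (drift (- 2) (w s \<omega>))) + Z t \<omega>"
    unfolding solution_on_def by blast
  have cont: "AE \<omega> in M. continuous_map (top_of_set {0..T}) (sobolev_topology m) (\<lambda>t. w t \<omega>)"
    using sol by (simp add: solution_on_def)
  let ?D = "({0<..<T} \<inter> \<rat>) \<times> nonzero_ints"
  have cD: "countable ?D" using countable_rat by (intro countable_SIGMA) (auto intro: countable_Int2)
  define conv where "conv z \<omega> \<longleftrightarrow> coord (Z (fst z) \<omega>) (snd z) = b (snd z) * (\<beta> (snd z) (fst z) \<omega>
      - integral {0..fst z} (\<lambda>s. (\<nu> * (of_int (snd z))\<^sup>2) * exp (- (\<nu> * (of_int (snd z))\<^sup>2) * (fst z - s)) * \<beta> (snd z) s \<omega>))" for z \<omega>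
  have "AE \<omega> in M. \<forall>z\<in>?D. conv z \<omega>"
  proof (rule AE_ball_countable'[OF _ cD])
    fix z assume "z \<in> ?D"
    then have z: "fst z \<in> {0<..<T}" "snd z \<noteq> 0" by auto
    show "AE \<omega> in M. conv z \<omega>"
      unfolding conv_def by (rule wiener_integral_coord[OF Z]) (use z in auto)
  qed
  then show ?thesis using eq cont AE_bm
  proof eventually_elim
    case (elim \<omega>)
    let ?x = "\<lambda>t. w t \<omega>"
    have xm: "?x t \<in> hom_sobolev m" if "t \<in> {0..T}" for t
      using continuous_map_sobolev(1)[OF elim(3)] that .
    have cm: "continuous_on {0..T} (\<lambda>t. Lam m (?x t))" using continuous_map_sobolev(2)[OF elim(3)] .
    have x1: "?x t \<in> hom_sobolev 1" if "t \<in> {0..T}" for t using hom_sobolev_mono[OF xm[OF that] m] .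
    have c1: "continuous_on {0..T} (\<lambda>t. Lam 1 (?x t))" by (rule continuous_on_Lam_mono[OF xm cm m])
    have c0: "continuous_on {0..T} ?x"
      by (rule continuous_on_eq[OF continuous_on_Lam_mono[OF xm cm, of 0]])
        (auto simp: Lam_0 hom_sobolev_mean_zero[OF xm])
    \<comment> \<open>The driver is defined as whatever makes the equation true, so that the
      continuity lemmas for paths become available for \<open>?x\<close>.\<close>
    have trivial: "drift_path \<nu> T (\<lambda>t k. coord (?x t) k - coord (?x 0) k - integral {0..t} (\<lambda>s. vfield \<nu> (?x s) k)) ?x"
      unfolding drift_path_def using x1 c1 by simp
    have main: "coord (?x t) k = coord y k + integral {0..t} (\<lambda>s. vfield \<nu> (?x s) k) + b k * \<beta> k t \<omega>"
      if k: "k \<noteq> 0" and t: "t \<in> {0..T}" for k t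
    proof -
      define l where "l = \<nu> * (of_int k)\<^sup>2"
      define N where "N s = coord (Bil (?x s) (?x s)) k" for s
      have cN: "continuous_on {0..T} N"
        unfolding N_def by (intro continuous_intros path_Bil_continuous[OF trivial])
      have cB: "continuous_on {0..T} (\<lambda>t. \<beta> k t \<omega>)" using elim(4) k by (auto intro: continuous_on_subset)
      have mild: "coord (?x t) k = exp (- l * t) * coord y k + integral {0..t} (\<lambda>s. exp (- l * (t - s)) * N s) + coord (Z t \<omega>) k"
        if t: "t \<in> {0..T}" for t
      proof -
        let ?f = "\<lambda>s. heat (\<nu> * (t - s)) (drift (- 2) (w s \<omega>))"
        have E: "?f integrable_on {0..t}" "w t \<omega> = heat (\<nu> * t) y + integral {0..t} ?f + Z t \<omega>"
          using elim(2) t by auto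
        have "coord (integral {0..t} ?f) k = integral {0..t} ((\<lambda>u. coord u k) \<circ> ?f)"
          by (rule integral_linear[OF E(1) bounded_linear_inner_left, symmetric])
        also have "\<dots> = integral {0..t} (\<lambda>s. exp (- l * (t - s)) * N s)"
        proof (rule Henstock_Kurzweil_Integration.integral_cong)
          fix s assume s: "s \<in> {0..t}"
          then have "drift (- 2) (?x s) = Bil (?x s) (?x s)" using t by (intro drift_eq_Bil x1) auto
          then show "((\<lambda>u. coord u k) \<circ> ?f) s = exp (- l * (t - s)) * N s"
            using s nu k by (simp add: coord_heat N_def l_def mult_ac)
        qed
        finally have "coord (integral {0..t} ?f) k = integral {0..t} (\<lambda>s. exp (- l * (t - s)) * N s)" .
        then show ?thesis
          using arg_cong[OF E(2), of "\<lambda>u. coord u k"] t nu k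
          by (simp add: inner_add_left coord_heat l_def mult_ac)
      qed
      \<comment> \<open>The defect of the desired formula: it is continuous and vanishes at the
        rational times of (0, T), hence on all of [0, T].\<close>
      define g where "g t = coord (?x t) k - exp (- l * t) * coord y k - integral {0..t} (\<lambda>s. 1 * exp (- l * (t - s)) * N s)
         - b k * (\<beta> k t \<omega> - integral {0..t} (\<lambda>s. l * exp (- l * (t - s)) * \<beta> k s \<omega>))" for t
      have "g t = 0" if t: "t \<in> {0..T}" for t
      proof (rule continuous_constant_on_closure[where f = g and S = "{0<..<T} \<inter> \<rat>"])
        show "continuous_on (closure ({0<..<T} \<inter> \<rat>)) g"
          unfolding closure_rational_interval[OF T] g_def
          by (intro continuous_intros continuous_exp_convolution cN cB path_coord_continuous[OF trivial] k)
        show "t \<in> closure ({0<..<T} \<inter> \<rat>)" using t by (simp add: closure_rational_interval[OF T])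
        fix q assume q: "q \<in> {0<..<T} \<inter> \<rat>"
        then have qT: "q \<in> {0..T}" by auto
        have "coord (Z q \<omega>) k = b k * (\<beta> k q \<omega> - integral {0..q} (\<lambda>s. l * exp (- l * (q - s)) * \<beta> k s \<omega>))"
          using elim(1)[THEN bspec, of "(q, k)"] q k unfolding l_def conv_def by simp
        then show "g q = 0" unfolding g_def using mild[OF qT] by simp
      qed
      then have xt: "coord (?x t) k = exp (- l * t) * coord y k + integral {0..t} (\<lambda>s. exp (- l * (t - s)) * N s)
         + b k * (\<beta> k t \<omega> - integral {0..t} (\<lambda>s. l * exp (- l * (t - s)) * \<beta> k s \<omega>))" if "t \<in> {0..T}" for t
        using that unfolding g_def by fastforce
      have "coord (?x t) k = coord y k + integral {0..t} (\<lambda>s. - l * coord (?x s) k + N s) + b k * \<beta> k t \<omega>"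
        by (rule mild_to_strong[OF cN cB xt t])
      then show ?thesis unfolding vfield_def l_def N_def by simp
    qed
    have x0: "?x 0 = y"
    proof (rule coord_eqI)
      show "?x 0 \<in> mean_zero" using xm[of 0] T hom_sobolev_mean_zero by auto
      show "y \<in> mean_zero" using y hom_sobolev_mean_zero by auto
      show "coord (?x 0) k = coord y k" if "k \<noteq> 0" for k
        using main[OF that, of 0] T elim(4) that by simp
    qed
    have "drift_path \<nu> T (\<lambda>t k. b k * \<beta> k t \<omega>) ?x"
      unfolding drift_path_def using x1 c1 main x0 by simp
    then show ?case using x0 xm c0 by blast
  qed
qed

end

section \<open>A discrete Lyapunov estimate\<close>

lemma convex_on_nonneg_power: "convex_on {0::real..} (\<lambda>x. x ^ q)"
  using convex_power_odd[of q] convex_on_subset[OF convex_power_even[of q], of "{0..}"]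
  by (cases "even q") auto

lemma power_convex_comb:
  assumes "0 \<le> (a::real)" "a \<le> 1" "0 \<le> x" "0 \<le> y"
  shows "((1 - a) * x + a * y) ^ q \<le> (1 - a) * x ^ q + a * y ^ q"
  using convex_onD[OF convex_on_nonneg_power, of a x y q] assms by simp

text \<open>Jensen's inequality for weights of total mass at most \<open>B\<close>. With the squares
  of the noise coefficients as weights it bounds powers of an increment by the strength of the noise
  and not by the number of modes.\<close>

lemma sum_power_le:
  assumes "finite I" "\<And>i. i \<in> I \<Longrightarrow> 0 \<le> w i" "\<And>i. i \<in> I \<Longrightarrow> 0 \<le> y i" "sum w I \<le> (B::real)" "q \<ge> 1"
  shows "(\<Sum>i\<in>I. w i * y i) ^ q \<le> B ^ (q - 1) * (\<Sum>i\<in>I. w i * y i ^ q)"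
proof (cases "sum w I = 0")
  case True
  then have "w i = 0" if "i \<in> I" for i using assms that by (simp add: sum_nonneg_eq_0_iff)
  then show ?thesis using assms by (simp add: zero_power)
next
  case False
  define S where "S = sum w I"
  have S: "S > 0" using False sum_nonneg[of I w] assms by (simp add: S_def order_less_le)
  have "I \<noteq> {}" using False by auto
  have "(\<Sum>i\<in>I. (w i / S) *\<^sub>R y i) ^ q \<le> (\<Sum>i\<in>I. w i / S * y i ^ q)"
    using S assms by (intro convex_on_sum[OF assms(1) \<open>I \<noteq> {}\<close> convex_on_nonneg_power])
      (auto simp: S_def sum_divide_distrib[symmetric])
  then have "S ^ q * (\<Sum>i\<in>I. (w i / S) * y i) ^ q \<le> S ^ q * (\<Sum>i\<in>I. w i / S * y i ^ q)"
    using S by simp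
  also have "S ^ q * (\<Sum>i\<in>I. (w i / S) * y i) ^ q = (\<Sum>i\<in>I. w i * y i) ^ q"
    using S by (simp add: power_mult_distrib[symmetric] sum_distrib_left)
  also have "S ^ q * (\<Sum>i\<in>I. w i / S * y i ^ q) = S ^ (q - 1) * (\<Sum>i\<in>I. w i * y i ^ q)"
    using S assms(5) by (simp add: sum_distrib_left power_eq_if mult_ac)
  also have "\<dots> \<le> B ^ (q - 1) * (\<Sum>i\<in>I. w i * y i ^ q)"
    using S assms by (intro mult_right_mono power_mono sum_nonneg) (auto simp: S_def)
  finally show ?thesis .
qed

lemma power_le_1_plus: "0 \<le> (r::real) \<Longrightarrow> j \<le> N \<Longrightarrow> r ^ j \<le> 1 + r ^ N"
proof (cases "r \<le> 1")
  case True
  assume "0 \<le> r"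
  then have "r ^ j \<le> 1" using True by (simp add: power_le_one)
  moreover have "0 \<le> r ^ N" using \<open>0 \<le> r\<close> by simp
  ultimately show ?thesis by linarith
next
  case False
  assume "j \<le> N"
  then have "r ^ j \<le> r ^ N" using False by (intro power_increasing) auto
  then show ?thesis by simp
qed

lemma power_between: "0 \<le> (z::real) \<Longrightarrow> 2 \<le> i \<Longrightarrow> i \<le> N \<Longrightarrow> z ^ i \<le> z\<^sup>2 + z ^ N"
proof (cases "z \<le> 1")
  case True
  assume "0 \<le> z" "2 \<le> i"
  then have "z ^ i \<le> z ^ 2" using True by (intro power_decreasing) auto
  moreover have "0 \<le> z ^ N" using \<open>0 \<le> z\<close> by simp
  ultimately show ?thesis by linarith
next
  case False
  assume "i \<le> N" "0 \<le> z"
  then have "z ^ i \<le> z ^ N" using False by (intro power_increasing) auto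
  then show ?thesis by (simp add: add_increasing)
qed

lemma add_power_le: "0 \<le> (a::real) \<Longrightarrow> 0 \<le> b \<Longrightarrow> (a + b) ^ i \<le> 2 ^ i * (a ^ i + b ^ i)"
proof -
  assume ab: "0 \<le> a" "0 \<le> b"
  have "(a + b) ^ i \<le> (2 * max a b) ^ i" using ab by (intro power_mono) auto
  also have "\<dots> = 2 ^ i * max a b ^ i" by (simp add: power_mult_distrib)
  also have "max a b ^ i \<le> a ^ i + b ^ i" using ab by (auto simp: max_def)
  finally show ?thesis by simp
qed

text \<open>
  The remainder is at least quadratic in \<open>z\<close>, hence of mean \<open>O(h)\<close> when \<open>z\<close> is the size of a
  Gaussian increment over a time step \<open>h\<close>.
\<close>

lemma power_expansion:
  fixes r z D :: real
  assumes r: "0 \<le> r" and z: "0 \<le> z" and D: "\<bar>D\<bar> \<le> 2 * r * z + z\<^sup>2" and q: "q \<ge> 2"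
  shows "(r\<^sup>2 + D) ^ q \<le> r ^ (2 * q) + q * r ^ (2 * (q - 1)) * D + 2 * 5 ^ q * ((1 + r ^ (2 * (q - 1))) * (z\<^sup>2 + z ^ (2 * q)))"
proof -
  define E where "E = (1 + r ^ (2 * (q - 1))) * (z\<^sup>2 + z ^ (2 * q))"
  have E0: "E \<ge> 0" using r z by (simp add: E_def)
  \<comment> \<open>Majorants of the binomial terms. Degrees 0 and 1 in \<open>D\<close> are kept
    exactly, because the linear term has to be averaged; the others are bounded by multiples of
    \<open>E\<close> whose coefficients add up to (1 + 4)^q = 5^q.\<close>
  define u where "u i = (if i = 0 then r ^ (2 * q) else 0) + (if i = 1 then q * r ^ (2 * (q - 1)) * D else 0) + (q choose i) * 4 ^ i * (2 * E)" for i
  have "(r\<^sup>2 + D) ^ q = (\<Sum>i\<le>q. real (q choose i) * D ^ i * (r\<^sup>2) ^ (q - i))"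
    using binomial_ring[of D "r\<^sup>2" q] by (simp add: add.commute)
  also have "\<dots> \<le> (\<Sum>i\<le>q. u i)"
  proof (rule sum_mono)
    fix i assume i: "i \<in> {..q}"
    have nn: "0 \<le> (q choose i) * 4 ^ i * (2 * E)" using E0 by simp
    consider "i = 0" | "i = 1" | "i \<ge> 2" by linarith
    then show "real (q choose i) * D ^ i * (r\<^sup>2) ^ (q - i) \<le> u i"
    proof cases
      case 1 then show ?thesis using nn by (simp add: u_def power_mult[symmetric])
    next
      case 2 then show ?thesis using nn by (simp add: u_def power_mult[symmetric] mult_ac choose_one)
    next
      case 3
      have p4: "(4::real) ^ i = 2 ^ i * 2 ^ i" by (simp flip: power_mult_distrib)
      have "\<bar>D\<bar> ^ i \<le> (2 * r * z + z\<^sup>2) ^ i" by (intro power_mono D) simp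
      also have "\<dots> \<le> 2 ^ i * ((2 * r * z) ^ i + (z\<^sup>2) ^ i)" using r z by (intro add_power_le) auto
      finally have "\<bar>D\<bar> ^ i * (r\<^sup>2) ^ (q - i) \<le> 2 ^ i * ((2 * r * z) ^ i + (z\<^sup>2) ^ i) * (r\<^sup>2) ^ (q - i)"
        by (rule mult_right_mono) simp
      also have "\<dots> = 4 ^ i * (r ^ (i + 2 * (q - i)) * z ^ i) + 2 ^ i * (r ^ (2 * (q - i)) * z ^ (2 * i))"
        unfolding p4 by (simp add: power_mult_distrib power_add power_mult[symmetric] algebra_simps)
      also have "\<dots> \<le> 4 ^ i * E + 4 ^ i * E"
      proof (intro add_mono mult_mono)
        have iq: "i + 2 * (q - i) \<le> 2 * (q - 1)" "2 * (q - i) \<le> 2 * (q - 1)" using 3 i by auto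
        show "r ^ (i + 2 * (q - i)) * z ^ i \<le> E" unfolding E_def
          using r z 3 i by (intro mult_mono power_le_1_plus power_between iq) auto
        show "r ^ (2 * (q - i)) * z ^ (2 * i) \<le> E" unfolding E_def
          using r z 3 i by (intro mult_mono power_le_1_plus power_between iq) auto
      qed (use r z E0 in \<open>auto intro: power_mono\<close>)
      finally have "\<bar>D\<bar> ^ i * (r\<^sup>2) ^ (q - i) \<le> 4 ^ i * (2 * E)" by (simp add: mult_ac)
      then have "real (q choose i) * (\<bar>D\<bar> ^ i * (r\<^sup>2) ^ (q - i)) \<le> real (q choose i) * (4 ^ i * (2 * E))"
        by (rule mult_left_mono) simp
      moreover have "real (q choose i) * D ^ i * (r\<^sup>2) ^ (q - i) \<le> real (q choose i) * (\<bar>D\<bar> ^ i * (r\<^sup>2) ^ (q - i))"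
        unfolding mult.assoc by (intro mult_left_mono mult_right_mono) (auto simp flip: power_abs)
      ultimately show ?thesis using 3 by (simp add: u_def mult.assoc)
    qed
  qed
  also have "(\<Sum>i\<le>q. u i) = r ^ (2 * q) + q * r ^ (2 * (q - 1)) * D + (\<Sum>i\<le>q. (q choose i) * 4 ^ i) * (2 * E)"
    using q by (simp add: u_def sum.distrib sum.delta' sum_distrib_right)
  also have "(\<Sum>i\<le>q. (q choose i) * 4 ^ i) = (5::real) ^ q"
    using binomial_ring[of "4::real" 1 q] by simp
  finally show ?thesis by (simp add: E_def mult_ac)
qed

section \<open>Gaussian increments\<close>

definition gauss :: "real \<Rightarrow> real measure" where
  "gauss h = density lborel (normal_density 0 (sqrt h))"

text \<open>The joint law of the Brownian increments of the retained modes over a step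
  \<open>h\<close>, see \<open>distr_incr\<close>; \<open>h\<close> is the variance of each
  component.\<close>

definition gamma :: "nat \<Rightarrow> real \<Rightarrow> (int \<Rightarrow> real) measure" where
  "gamma n h = PiM (freqs n) (\<lambda>_. gauss h)"

lemma sets_gauss [measurable_cong, simp]: "sets (gauss h) = sets borel"
  and space_gauss [simp]: "space (gauss h) = UNIV"
  by (simp_all add: gauss_def)

lemma prob_space_gauss: "h > 0 \<Longrightarrow> prob_space (gauss h)"
  unfolding gauss_def by (rule prob_space_normal_density) simp

lemma prob_space_gamma: "h > 0 \<Longrightarrow> prob_space (gamma n h)"
  unfolding gamma_def by (intro prob_space_PiM prob_space_gauss)

lemma gauss_integral:
  fixes f :: "real \<Rightarrow> real"
  assumes h: "h > 0" and f: "f \<in> borel_measurable borel"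
  shows "integrable (gauss h) f \<longleftrightarrow> integrable lborel (\<lambda>x. normal_density 0 (sqrt h) x * f x)"
    "(\<integral>x. f x \<partial>gauss h) = (\<integral>x. normal_density 0 (sqrt h) x * f x \<partial>lborel)"
  unfolding gauss_def using f by (simp_all add: integrable_density integral_density)

lemma gamma_component:
  fixes f :: "real \<Rightarrow> real"
  assumes h: "h > 0" and k: "k \<in> freqs n" and f: "f \<in> borel_measurable borel"
  shows "integrable (gamma n h) (\<lambda>g. f (g k)) \<longleftrightarrow> integrable (gauss h) f"
    "(\<integral>g. f (g k) \<partial>gamma n h) = (\<integral>x. f x \<partial>gauss h)"
proof -
  have d: "distr (gamma n h) (gauss h) (\<lambda>g. g k) = gauss h"
    unfolding gamma_def by (rule distr_PiM_component) (auto simp: prob_space_gauss h k)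
  have m: "(\<lambda>g. g k) \<in> gamma n h \<rightarrow>\<^sub>M gauss h"
    unfolding gamma_def by (rule measurable_component_singleton[OF k])
  have f': "f \<in> borel_measurable (gauss h)" using f by simp
  show "integrable (gamma n h) (\<lambda>g. f (g k)) \<longleftrightarrow> integrable (gauss h) f"
    using integrable_distr_eq[OF m f'] unfolding d by simp
  show "(\<integral>g. f (g k) \<partial>gamma n h) = (\<integral>x. f x \<partial>gauss h)"
    using integral_distr[OF m f'] unfolding d by simp
qed

lemma gamma_moments:
  assumes h: "h > 0" and k: "k \<in> freqs n"
  shows "integrable (gamma n h) (\<lambda>g. g k ^ j)" "(\<integral>g. g k \<partial>gamma n h) = 0"
    "(\<integral>g. g k ^ (2 * q) \<partial>gamma n h) = fact (2 * q) / (2 ^ q * fact q) * h ^ q" "(\<integral>g. (g k)\<^sup>2 \<partial>gamma n h) = h"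
proof -
  have sh: "sqrt h > 0" using h by simp
  show "integrable (gamma n h) (\<lambda>g. g k ^ j)"
    using gamma_component(1)[OF h k, of "\<lambda>x. x ^ j"] gauss_integral(1)[OF h, of "\<lambda>x. x ^ j"]
      integrable_normal_moment[OF sh, of 0 j] by simp
  show "(\<integral>g. g k \<partial>gamma n h) = 0"
    using gamma_component(2)[OF h k, of "\<lambda>x. x"] gauss_integral(2)[OF h, of "\<lambda>x. x"]
      normal_moment_odd[OF sh, of 0 0] by (simp add: has_bochner_integral_iff)
  have *: "(\<integral>g. g k ^ (2 * q) \<partial>gamma n h) = fact (2 * q) / (2 ^ q * fact q) * h ^ q" for q
    using gamma_component(2)[OF h k, of "\<lambda>x. x ^ (2 * q)"] gauss_integral(2)[OF h, of "\<lambda>x. x ^ (2 * q)"]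
      normal_moment_even[OF sh, of 0 q] h by (simp add: has_bochner_integral_iff power_divide)
  show "(\<integral>g. g k ^ (2 * q) \<partial>gamma n h) = fact (2 * q) / (2 ^ q * fact q) * h ^ q" by (rule *)
  show "(\<integral>g. (g k)\<^sup>2 \<partial>gamma n h) = h" using *[of 1] by (simp add: fact_numeral)
qed

section \<open>The Lyapunov function and its decay in one step\<close>

lemma polynomial_absorb:
  assumes "C \<ge> 0" "\<nu> > (0::real)" "q \<ge> 1"
  obtains C' where "C' \<ge> 0" "\<And>U. U \<ge> 0 \<Longrightarrow> C * (1 + (1 + U) ^ (q - 1)) \<le> \<nu> / 2 * U ^ q + C'"
proof -
  define A where "A = max 1 (4 * C * 2 ^ (q - 1) / \<nu>)"
  have A1: "A \<ge> 1" by (simp add: A_def)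
  show thesis
  proof (rule that[of "C * (1 + (1 + A) ^ (q - 1))"])
    show "0 \<le> C * (1 + (1 + A) ^ (q - 1))" using assms A1 by simp
    fix U :: real assume U: "U \<ge> 0"
    show "C * (1 + (1 + U) ^ (q - 1)) \<le> \<nu> / 2 * U ^ q + C * (1 + (1 + A) ^ (q - 1))"
    proof (cases "U \<le> A")
      case True
      then have "C * (1 + (1 + U) ^ (q - 1)) \<le> C * (1 + (1 + A) ^ (q - 1))"
        using assms U by (intro mult_left_mono add_left_mono power_mono) auto
      moreover have "0 \<le> \<nu> / 2 * U ^ q" using assms U by simp
      ultimately show ?thesis by linarith
    next
      case False
      then have UA: "U \<ge> A" "U \<ge> 1" using A1 by auto
      have "(1 + U) ^ (q - 1) \<le> (2 * U) ^ (q - 1)" using UA by (intro power_mono) auto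
      moreover have "1 \<le> (2 * U) ^ (q - 1)" using UA by (intro one_le_power) auto
      ultimately have "C * (1 + (1 + U) ^ (q - 1)) \<le> C * (2 * (2 * U) ^ (q - 1))"
        using assms by (intro mult_left_mono) auto
      also have "\<dots> = (2 * C * 2 ^ (q - 1)) * U ^ (q - 1)" by (simp add: power_mult_distrib)
      also have "\<dots> \<le> (\<nu> / 2 * U) * U ^ (q - 1)"
      proof (rule mult_right_mono)
        have "4 * C * 2 ^ (q - 1) / \<nu> \<le> U" using UA by (simp add: A_def)
        then show "2 * C * 2 ^ (q - 1) \<le> \<nu> / 2 * U" using assms by (simp add: field_simps)
      qed (use U in simp)
      also have "\<dots> = \<nu> / 2 * U ^ q" using assms(3) by (simp add: power_eq_if)
      also have "\<dots> \<le> \<nu> / 2 * U ^ q + C * (1 + (1 + A) ^ (q - 1))" using assms A1 by simp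
      finally show ?thesis .
    qed
  qed
qed

text \<open>The power s + 2 is the one that \<open>step_sobolev_bound\<close> leaves uncontrolled;
  \<open>lyapunov_step\<close> chooses the weight so that the dissipation of the second part pays
  for it.\<close>

definition lyap :: "nat \<Rightarrow> real \<Rightarrow> nat \<Rightarrow> (int \<Rightarrow> real) \<Rightarrow> real" where
  "lyap s \<kappa> n X = wsum s n X + \<kappa> * wsum 0 n X ^ (s + 2)"

lemma lyap_nonneg: "\<kappa> \<ge> 0 \<Longrightarrow> lyap s \<kappa> n X \<ge> 0"
  by (simp add: lyap_def)

lemma wsum_add_noise:
  "wsum s n (\<lambda>k. Y k + b k * g k) = wsum s n Y + (\<Sum>k\<in>freqs n. (2 * \<bar>of_int k\<bar> ^ (2 * s) * Y k * b k) * g k)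
     + (\<Sum>k\<in>freqs n. (\<bar>of_int k\<bar> ^ (2 * s) * (b k)\<^sup>2) * (g k)\<^sup>2)"
  unfolding wsum_def sum.distrib[symmetric]
  by (intro sum.cong refl) (simp add: power2_eq_square algebra_simps)

text \<open>A discrete counterpart of Ito's formula. The linear term is kept because its Gaussian
  mean is zero; the others have even degree in \<open>g\<close> and means of order h.\<close>

lemma wsum_power_noise:
  assumes q: "q \<ge> 2" and B: "(\<Sum>k\<in>freqs n. (b k)\<^sup>2) \<le> B"
  shows "wsum 0 n (\<lambda>k. Y k + b k * g k) ^ q \<le> wsum 0 n Y ^ q
     + q * wsum 0 n Y ^ (q - 1) * ((\<Sum>k\<in>freqs n. (2 * Y k * b k) * g k) + (\<Sum>k\<in>freqs n. (b k)\<^sup>2 * (g k)\<^sup>2))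
     + 2 * 5 ^ q * (1 + wsum 0 n Y ^ (q - 1)) * ((\<Sum>k\<in>freqs n. (b k)\<^sup>2 * (g k)\<^sup>2) + B ^ (q - 1) * (\<Sum>k\<in>freqs n. (b k)\<^sup>2 * g k ^ (2 * q)))"
proof -
  define r where "r = sqrt (wsum 0 n Y)"
  define z where "z = sqrt (\<Sum>k\<in>freqs n. (b k * g k)\<^sup>2)"
  define D where "D = (\<Sum>k\<in>freqs n. (2 * Y k * b k) * g k) + (\<Sum>k\<in>freqs n. (b k)\<^sup>2 * (g k)\<^sup>2)"
  have r2: "r\<^sup>2 = wsum 0 n Y" by (simp add: r_def)
  have z2: "z\<^sup>2 = (\<Sum>k\<in>freqs n. (b k)\<^sup>2 * (g k)\<^sup>2)" by (simp add: z_def sum_nonneg power_mult_distrib)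
  have rp: "r ^ (2 * j) = wsum 0 n Y ^ j" for j by (simp add: power_mult r2)
  have "\<bar>\<Sum>k\<in>freqs n. (2 * Y k * b k) * g k\<bar> \<le> 2 * (\<Sum>k\<in>freqs n. \<bar>Y k\<bar> * \<bar>b k * g k\<bar>)"
    unfolding sum_distrib_left by (rule order_trans[OF sum_abs]) (simp add: abs_mult mult_ac)
  also have "\<dots> \<le> 2 * (L2_set Y (freqs n) * L2_set (\<lambda>k. b k * g k) (freqs n))"
    by (intro mult_left_mono L2_set_mult_ineq) simp
  also have "\<dots> = 2 * r * z" by (simp add: L2_set_def r_def z_def wsum_0)
  finally have D: "\<bar>D\<bar> \<le> 2 * r * z + z\<^sup>2"
    unfolding D_def z2[symmetric] using zero_le_power2[of z] by linarith
  have "wsum 0 n (\<lambda>k. Y k + b k * g k) = r\<^sup>2 + D"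
    unfolding wsum_add_noise D_def r2 by simp
  then have "wsum 0 n (\<lambda>k. Y k + b k * g k) ^ q \<le> r ^ (2 * q) + q * r ^ (2 * (q - 1)) * D + 2 * 5 ^ q * ((1 + r ^ (2 * (q - 1))) * (z\<^sup>2 + z ^ (2 * q)))"
    using power_expansion[OF _ _ D q] by (simp add: r_def z_def sum_nonneg)
  also have "\<dots> \<le> r ^ (2 * q) + q * r ^ (2 * (q - 1)) * D + 2 * 5 ^ q * ((1 + r ^ (2 * (q - 1))) * (z\<^sup>2 + B ^ (q - 1) * (\<Sum>k\<in>freqs n. (b k)\<^sup>2 * g k ^ (2 * q))))"
  proof (intro add_left_mono mult_left_mono)
    show "z ^ (2 * q) \<le> B ^ (q - 1) * (\<Sum>k\<in>freqs n. (b k)\<^sup>2 * g k ^ (2 * q))"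
      unfolding power_mult z2 using q by (intro sum_power_le B) auto
  qed (auto simp: rp)
  finally show ?thesis unfolding rp D_def z2 by (simp add: mult.assoc)
qed

text \<open>Up to a constant times h, the L^2 power loses the fraction \<nu> h of itself and regains
  at most half of that from the noise. Half of the remaining rate \<nu>/2 pays for the growth
  \<open>C1 * U ^ q\<close> of the H^s part, and \<nu>/4 is left over.\<close>

lemma lyapunov_step:
  assumes nu: "\<nu> > 0" and s: "s \<ge> 1" and B0: "\<And>n. (\<Sum>k\<in>freqs n. (b k)\<^sup>2) \<le> B"
    and Bs: "\<And>n. (\<Sum>k\<in>freqs n. \<bar>of_int k\<bar> ^ (2 * s) * (b k)\<^sup>2) \<le> B"
  obtains \<kappa> C where "\<kappa> \<ge> 0" "C \<ge> 0"
    "\<And>n h X. h > 0 \<Longrightarrow> h \<le> 1 \<Longrightarrow> \<nu> * h \<le> 1 \<Longrightarrow> 4 * h * \<nu> * real n ^ 4 \<le> 1 \<Longrightarrow> 72 * h * real n ^ 6 \<le> 1 \<Longrightarrow>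
      72 * h * real n ^ (2 * s + 6) \<le> 1 \<Longrightarrow>
      (\<integral>\<^sup>+g. ennreal (lyap s \<kappa> n (step \<nu> n h X (\<lambda>k. b k * g k))) \<partial>gamma n h) \<le> ennreal ((1 - \<nu> / 4 * h) * lyap s \<kappa> n X + C * h)"
proof -
  define q where "q = s + 2"
  have q: "q \<ge> 2" "q \<ge> 1" by (auto simp: q_def)
  have Bn: "B \<ge> 0" using B0[of 0] by simp
  obtain C1 where C1: "C1 \<ge> 0" "\<And>n h X. h \<ge> 0 \<Longrightarrow> 4 * h * \<nu> * real n ^ 4 \<le> 1 \<Longrightarrow> 72 * h * real n ^ (2 * s + 6) \<le> 1 \<Longrightarrow>
    wsum s n (\<lambda>k. X k + h * Gn \<nu> n X k) \<le> (1 - \<nu> / 2 * h) * wsum s n X + h * (1 + C1 * wsum 0 n X ^ q)"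
    using step_sobolev_bound[OF s nu] unfolding q_def by blast
  define \<mu> where "\<mu> = (fact (2 * q) / (2 ^ q * fact q) :: real)"
  define C2 where "C2 = q * B + 2 * 5 ^ q * (B + B ^ (q - 1) * B * \<mu>)"
  have mu: "\<mu> \<ge> 0" by (simp add: \<mu>_def)
  have C2: "C2 \<ge> 0" unfolding C2_def using Bn mu by simp
  obtain C3 where C3: "C3 \<ge> 0" "\<And>U. U \<ge> 0 \<Longrightarrow> C2 * (1 + (1 + U) ^ (q - 1)) \<le> \<nu> / 2 * U ^ q + C3"
    using polynomial_absorb[OF C2 nu q(2)] by blast
  \<comment> \<open>Makes \<kappa> \<nu>/4 equal to \<open>C1\<close>, so that the surplus terms in
    \<open>h * U ^ q\<close> cancel exactly.\<close>
  define \<kappa> where "\<kappa> = 4 * C1 / \<nu>"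
  define C where "C = 1 + B + \<kappa> * (\<nu> * (1 / \<nu>) ^ q + C3)"
  have kap: "\<kappa> \<ge> 0" using C1 nu by (simp add: \<kappa>_def)
  show thesis
  proof (rule that[of \<kappa> C])
    show "\<kappa> \<ge> 0" by (rule kap)
    show "C \<ge> 0" unfolding C_def using kap nu C3 Bn by simp
    fix n h X
    assume h: "(0::real) < h" "h \<le> 1" "\<nu> * h \<le> 1" "4 * h * \<nu> * real n ^ 4 \<le> 1" "72 * h * real n ^ 6 \<le> 1"
      "72 * h * real n ^ (2 * s + 6) \<le> 1"
    interpret prob_space "gamma n h" by (rule prob_space_gamma[OF h(1)])
    define Y where "Y k = X k + h * Gn \<nu> n X k" for k
    define U where "U = wsum 0 n X"
    define u where "u = wsum 0 n Y"
    have U0: "U \<ge> 0" and u0: "u \<ge> 0" by (auto simp: U_def u_def)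
    have u: "u \<le> (1 - \<nu> * h) * U + h"
      unfolding u_def U_def Y_def using step_L2_bound[OF nu less_imp_le[OF h(1)] h(4,5)] .
    have uU: "u \<le> 1 + U"
    proof -
      have "0 \<le> \<nu> * h * U" using nu h U0 by simp
      then show ?thesis using u h(2) by (simp add: algebra_simps)
    qed
    have uq: "u ^ q \<le> (1 - \<nu> * h) * U ^ q + (\<nu> * h) * (1 / \<nu>) ^ q"
    proof -
      \<comment> \<open>Writing h as \<nu> h times 1/\<nu> displays a convex combination, to which
        convexity of the power applies.\<close>
      have "u \<le> (1 - \<nu> * h) * U + (\<nu> * h) * (1 / \<nu>)" using u nu by simp
      then have "u ^ q \<le> ((1 - \<nu> * h) * U + (\<nu> * h) * (1 / \<nu>)) ^ q" using u0 by (rule power_mono)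
      also have "\<dots> \<le> (1 - \<nu> * h) * U ^ q + (\<nu> * h) * (1 / \<nu>) ^ q"
        using nu h U0 by (intro power_convex_comb) auto
      finally show ?thesis .
    qed
    \<comment> \<open>A polynomial majorant of the Lyapunov function after the step; its Gaussian
      integral is explicit.\<close>
    define P where "P g = wsum s n Y + (\<Sum>k\<in>freqs n. (2 * \<bar>of_int k\<bar> ^ (2 * s) * Y k * b k) * g k)
        + (\<Sum>k\<in>freqs n. (\<bar>of_int k\<bar> ^ (2 * s) * (b k)\<^sup>2) * (g k)\<^sup>2)
        + \<kappa> * (u ^ q + q * u ^ (q - 1) * ((\<Sum>k\<in>freqs n. (2 * Y k * b k) * g k) + (\<Sum>k\<in>freqs n. (b k)\<^sup>2 * (g k)\<^sup>2))
          + 2 * 5 ^ q * (1 + u ^ (q - 1)) * ((\<Sum>k\<in>freqs n. (b k)\<^sup>2 * (g k)\<^sup>2) + B ^ (q - 1) * (\<Sum>k\<in>freqs n. (b k)\<^sup>2 * g k ^ (2 * q))))" for g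
    note int = gamma_moments(1)[OF h(1), where n = n]
    have int1: "integrable (gamma n h) (\<lambda>g. g k)" if "k \<in> freqs n" for k using int[OF that, of 1] by simp
    have Pint: "integrable (gamma n h) P"
      unfolding P_def by (intro Bochner_Integration.integrable_add Bochner_Integration.integrable_sum integrable_mult_right int int1 integrable_const)
    have m1: "(\<integral>g. (\<Sum>k\<in>freqs n. c k * g k) \<partial>gamma n h) = 0" for c
      using int1 by (simp add: gamma_moments(2)[OF h(1)])
    have m2: "(\<integral>g. (\<Sum>k\<in>freqs n. c k * (g k)\<^sup>2) \<partial>gamma n h) = (\<Sum>k\<in>freqs n. c k) * h" for c
      using int by (simp add: gamma_moments(4)[OF h(1)] sum_distrib_right)
    have mq: "(\<integral>g. (\<Sum>k\<in>freqs n. c k * g k ^ (2 * q)) \<partial>gamma n h) = (\<Sum>k\<in>freqs n. c k) * (\<mu> * h ^ q)" for c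
      using int unfolding \<mu>_def sum_distrib_right by (simp add: gamma_moments(3)[OF h(1)])
    have i1: "integrable (gamma n h) (\<lambda>g. \<Sum>k\<in>freqs n. c k * g k)"
      and i2: "integrable (gamma n h) (\<lambda>g. \<Sum>k\<in>freqs n. c k * (g k)\<^sup>2)"
      and iq: "integrable (gamma n h) (\<lambda>g. \<Sum>k\<in>freqs n. c k * g k ^ (2 * q))" for c
      by (intro Bochner_Integration.integrable_sum integrable_mult_right int int1; assumption)+
    define S0 where "S0 = (\<Sum>k\<in>freqs n. (b k)\<^sup>2)"
    define Ss where "Ss = (\<Sum>k\<in>freqs n. \<bar>of_int k\<bar> ^ (2 * s) * (b k)\<^sup>2)"
    have S0: "0 \<le> S0" "S0 \<le> B" using B0[of n] by (auto simp: S0_def sum_nonneg)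
    have Ss: "Ss \<le> B" using Bs[of n] by (simp add: Ss_def)
    have EP: "(\<integral>g. P g \<partial>gamma n h) = wsum s n Y + Ss * h + \<kappa> * (u ^ q + q * u ^ (q - 1) * (S0 * h)
         + 2 * 5 ^ q * (1 + u ^ (q - 1)) * (S0 * h + B ^ (q - 1) * (S0 * (\<mu> * h ^ q))))"
      unfolding P_def S0_def Ss_def
      by (simp add: i1 i2 iq m1 m2 mq Bochner_Integration.integral_add prob_space)
    have hq: "h ^ q \<le> h" using h q power_decreasing[of 1 q h] by simp
    have EPb: "(\<integral>g. P g \<partial>gamma n h) \<le> (1 - \<nu> / 4 * h) * lyap s \<kappa> n X + C * h"
    proof -
      have a: "wsum s n Y + Ss * h \<le> (1 - \<nu> / 2 * h) * wsum s n X + h * (1 + C1 * U ^ q) + B * h"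
        using C1(2)[OF less_imp_le[OF h(1)] h(4,6), of X] Ss h(1) unfolding Y_def U_def
        by (intro add_mono mult_right_mono) auto
      have "q * u ^ (q - 1) * (S0 * h) \<le> q * u ^ (q - 1) * (B * h)"
        using S0 h u0 by (intro mult_left_mono mult_right_mono) auto
      also have "\<dots> \<le> q * (1 + u ^ (q - 1)) * (B * h)"
        using u0 Bn h by (intro mult_right_mono mult_left_mono) auto
      finally have b1: "q * u ^ (q - 1) * (S0 * h) \<le> q * (1 + u ^ (q - 1)) * (B * h)" .
      have b2: "2 * 5 ^ q * (1 + u ^ (q - 1)) * (S0 * h + B ^ (q - 1) * (S0 * (\<mu> * h ^ q)))
         \<le> 2 * 5 ^ q * (1 + u ^ (q - 1)) * (B * h + B ^ (q - 1) * (B * (\<mu> * h)))"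
        using S0 h u0 Bn mu hq by (intro mult_left_mono add_mono mult_right_mono mult_mono) auto
      have "q * u ^ (q - 1) * (S0 * h) + 2 * 5 ^ q * (1 + u ^ (q - 1)) * (S0 * h + B ^ (q - 1) * (S0 * (\<mu> * h ^ q)))
         \<le> h * (C2 * (1 + u ^ (q - 1)))"
        using b1 b2 by (simp add: C2_def algebra_simps)
      also have "\<dots> \<le> h * (C2 * (1 + (1 + U) ^ (q - 1)))"
        using h C2 u0 uU by (intro mult_left_mono add_left_mono power_mono) auto
      also have "\<dots> \<le> h * (\<nu> / 2 * U ^ q + C3)" using h C3(2)[OF U0] by (intro mult_left_mono) auto
      finally have b: "q * u ^ (q - 1) * (S0 * h) + 2 * 5 ^ q * (1 + u ^ (q - 1)) * (S0 * h + B ^ (q - 1) * (S0 * (\<mu> * h ^ q)))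
         \<le> h * (\<nu> / 2 * U ^ q + C3)" .
      have "\<kappa> * (u ^ q + q * u ^ (q - 1) * (S0 * h)
         + 2 * 5 ^ q * (1 + u ^ (q - 1)) * (S0 * h + B ^ (q - 1) * (S0 * (\<mu> * h ^ q))))
         \<le> \<kappa> * (((1 - \<nu> * h) * U ^ q + (\<nu> * h) * (1 / \<nu>) ^ q) + h * (\<nu> / 2 * U ^ q + C3))"
        using uq b kap by (intro mult_left_mono) linarith+
      with a have "(\<integral>g. P g \<partial>gamma n h) \<le> (1 - \<nu> / 2 * h) * wsum s n X + h * (1 + C1 * U ^ q) + B * h
         + \<kappa> * (((1 - \<nu> * h) * U ^ q + (\<nu> * h) * (1 / \<nu>) ^ q) + h * (\<nu> / 2 * U ^ q + C3))"
        unfolding EP by linarith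
      also have "\<dots> = (1 - \<nu> / 2 * h) * wsum s n X + (1 - \<nu> / 4 * h) * (\<kappa> * U ^ q) + h * (C1 - \<kappa> * \<nu> / 4) * U ^ q + C * h"
        by (simp add: C_def algebra_simps)
      also have "C1 - \<kappa> * \<nu> / 4 = 0" using nu by (simp add: \<kappa>_def)
      also have "(1 - \<nu> / 2 * h) * wsum s n X \<le> (1 - \<nu> / 4 * h) * wsum s n X"
        using nu h by (intro mult_right_mono) auto
      finally show ?thesis by (simp add: lyap_def U_def q_def algebra_simps)
    qed
    have le: "lyap s \<kappa> n (step \<nu> n h X (\<lambda>k. b k * g k)) \<le> P g" for g
    proof -
      have st: "step \<nu> n h X (\<lambda>k. b k * g k) = (\<lambda>k. Y k + b k * g k)"
        by (simp add: step_def Y_def fun_eq_iff)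
      have "\<kappa> * wsum 0 n (\<lambda>k. Y k + b k * g k) ^ q \<le> \<kappa> * (wsum 0 n Y ^ q
     + q * wsum 0 n Y ^ (q - 1) * ((\<Sum>k\<in>freqs n. (2 * Y k * b k) * g k) + (\<Sum>k\<in>freqs n. (b k)\<^sup>2 * (g k)\<^sup>2))
     + 2 * 5 ^ q * (1 + wsum 0 n Y ^ (q - 1)) * ((\<Sum>k\<in>freqs n. (b k)\<^sup>2 * (g k)\<^sup>2) + B ^ (q - 1) * (\<Sum>k\<in>freqs n. (b k)\<^sup>2 * g k ^ (2 * q))))"
        using kap by (intro mult_left_mono wsum_power_noise q B0)
      then show ?thesis unfolding lyap_def st q_def[symmetric] P_def u_def wsum_add_noise[of s] by linarith
    qed
    have "(\<integral>\<^sup>+g. ennreal (lyap s \<kappa> n (step \<nu> n h X (\<lambda>k. b k * g k))) \<partial>gamma n h) \<le> (\<integral>\<^sup>+g. ennreal (P g) \<partial>gamma n h)"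
      by (intro nn_integral_mono ennreal_leI le)
    also have "\<dots> = ennreal (\<integral>g. P g \<partial>gamma n h)"
      by (rule nn_integral_eq_integral[OF Pint]) (use le order_trans[OF lyap_nonneg[OF kap]] in blast)
    also have "\<dots> \<le> ennreal ((1 - \<nu> / 4 * h) * lyap s \<kappa> n X + C * h)" by (rule ennreal_leI[OF EPb])
    finally show "(\<integral>\<^sup>+g. ennreal (lyap s \<kappa> n (step \<nu> n h X (\<lambda>k. b k * g k))) \<partial>gamma n h)
       \<le> ennreal ((1 - \<nu> / 4 * h) * lyap s \<kappa> n X + C * h)" .
  qed
qed

section \<open>The law of the scheme\<close>

abbreviation St :: "nat \<Rightarrow> (int \<Rightarrow> real) measure" where
  "St n \<equiv> PiM (freqs n) (\<lambda>_. borel)"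

lemma continuous_tp: "continuous_on UNIV (tp n)"
  unfolding tp_def by (intro continuous_intros continuous_on_product_coordinates)

lemma tp_cong: "(\<And>k. k \<in> freqs n \<Longrightarrow> X k = Y k) \<Longrightarrow> tp n X = tp n Y"
  unfolding tp_def by (rule sum.cong) auto

lemma wsum_cong: "(\<And>k. k \<in> freqs n \<Longrightarrow> X k = Y k) \<Longrightarrow> wsum s n X = wsum s n Y"
  unfolding wsum_def by (rule sum.cong) auto

lemma Gn_cong: "(\<And>k. k \<in> freqs n \<Longrightarrow> X k = Y k) \<Longrightarrow> l \<in> freqs n \<Longrightarrow> Gn \<nu> n X l = Gn \<nu> n Y l"
  unfolding Gn_def Dn_def using wsum_cong[of n X Y 0] tp_cong[of n X Y] by simp

lemma continuous_fourier_coeff: "continuous_on UNIV (\<lambda>u. fourier_coeff u k)"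
proof -
  have p: "continuous_on UNIV (\<lambda>u. fourier_coeff u k)" if "k \<ge> 1" for k
    unfolding fourier_coeff_pos[OF that] by (intro continuous_intros)
  consider "k \<ge> 1" | "k = 0" | "- k \<ge> 1" by linarith
  then show ?thesis
  proof cases
    case 2
    then show ?thesis
      unfolding 2 fourier_coeff_0 circle_integral_inner by (intro continuous_intros) auto
  next
    case 3
    have "continuous_on UNIV (\<lambda>u. cnj (fourier_coeff u (- k)))" by (intro continuous_intros p 3)
    then show ?thesis by (simp add: fourier_coeff_uminus[symmetric])
  qed (rule p)
qed

text \<open>The operators are given by descriptions, so an explicit formula is needed: by
  \<open>fourier_coeff_Bil\<close> the coefficients of the quadratic term are finite sums of
  products of those of the state.\<close>

lemma continuous_Dn:
  assumes "k \<noteq> 0" shows "continuous_on UNIV (\<lambda>X. Dn n X k)"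
proof -
  have "Bil (tp n X) (tp n X) = Bil (proj n (tp n X)) (tp n X)" for X by simp
  then have c: "continuous_on UNIV (\<lambda>X. fourier_coeff (Bil (tp n X) (tp n X)) l)" for l
    by (simp only: fourier_coeff_Bil[OF mean_zero_tp hom_sobolev_tp])
      (intro continuous_intros continuous_on_compose2[OF continuous_fourier_coeff continuous_tp] subset_UNIV)
  consider "k \<ge> 1" | "- k \<ge> 1" using assms by linarith
  then show ?thesis
  proof cases
    case 1
    have "Dn n X k = 2 * sqrt pi * Re (fourier_coeff (Bil (tp n X) (tp n X)) k)" for X
      by (simp add: Dn_def fourier_coeff_pos[OF 1] real_div_sqrt field_simps)
    then show ?thesis by (simp only:) (intro continuous_intros c)
  next
    case 2
    have "Dn n X k = - 2 * sqrt pi * Im (fourier_coeff (Bil (tp n X) (tp n X)) (- k))" for X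
      by (simp add: Dn_def fourier_coeff_pos[OF 2] real_div_sqrt field_simps)
    then show ?thesis by (simp only:) (intro continuous_intros c)
  qed
qed

lemma continuous_wsum: "continuous_on UNIV (wsum s n)"
  unfolding wsum_def by (intro continuous_intros continuous_on_product_coordinates)

lemma measurable_Gn: "k \<in> freqs n \<Longrightarrow> (\<lambda>X. Gn \<nu> n X k) \<in> borel_measurable borel"
proof -
  assume k: "k \<in> freqs n"
  have [measurable]: "(\<lambda>X. Dn n X k) \<in> borel_measurable borel" "wsum 0 n \<in> borel_measurable borel"
    using continuous_Dn[OF freqs_nonzero[OF k]] continuous_wsum by (auto intro: borel_measurable_continuous_onI)
  show ?thesis unfolding Gn_def by measurable
qed

text \<open>Points of \<open>St n\<close> are \<open>undefined\<close> off \<open>freqs n\<close>.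
  Replacing these values by zero gives a measurable map into the space of all coordinate functions,
  where continuity in the product topology can be used.\<close>

definition trunc :: "nat \<Rightarrow> (int \<Rightarrow> real) \<Rightarrow> int \<Rightarrow> real" where
  "trunc n X k = (if k \<in> freqs n then X k else 0)"

lemma trunc_in [simp]: "k \<in> freqs n \<Longrightarrow> trunc n X k = X k"
  by (simp add: trunc_def)

lemma measurable_trunc [measurable]: "trunc n \<in> borel_measurable (St n)"
proof (rule measurable_coordinatewise_then_product)
  fix k show "(\<lambda>X. trunc n X k) \<in> borel_measurable (St n)"
    by (cases "k \<in> freqs n") (simp_all add: trunc_def)
qed

lemma measurable_St_continuous:
  fixes \<Phi> :: "(int \<Rightarrow> real) \<Rightarrow> 'c::topological_space"
  assumes "continuous_on UNIV \<Phi>" "\<And>X Y. (\<And>k. k \<in> freqs n \<Longrightarrow> X k = Y k) \<Longrightarrow> \<Phi> X = \<Phi> Y"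
  shows "\<Phi> \<in> borel_measurable (St n)"
proof -
  have "(\<lambda>X. \<Phi> (trunc n X)) \<in> borel_measurable (St n)"
    by (rule borel_measurable_continuous_on[OF assms(1) measurable_trunc])
  moreover have "\<Phi> (trunc n X) = \<Phi> X" for X by (rule assms(2)) simp
  ultimately show ?thesis by simp
qed

definition stepr :: "(int \<Rightarrow> real) \<Rightarrow> real \<Rightarrow> nat \<Rightarrow> real \<Rightarrow> (int \<Rightarrow> real) \<Rightarrow> (int \<Rightarrow> real) \<Rightarrow> int \<Rightarrow> real" where
  "stepr b \<nu> n h X g = (\<lambda>k\<in>freqs n. step \<nu> n h X (\<lambda>k. b k * g k) k)"

lemma measurable_stepr [measurable]:
  "(\<lambda>z. stepr b \<nu> n h (fst z) (snd z)) \<in> St n \<Otimes>\<^sub>M St n \<rightarrow>\<^sub>M St n"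
  unfolding stepr_def
proof (rule measurable_restrict)
  fix k assume k: "k \<in> freqs n"
  have "(\<lambda>X. Gn \<nu> n (trunc n X) k) \<in> borel_measurable (St n)"
    by (rule measurable_compose[OF measurable_trunc measurable_Gn[OF k]])
  moreover have "Gn \<nu> n (trunc n X) k = Gn \<nu> n X k" for X by (rule Gn_cong[OF _ k]) simp
  ultimately have G: "(\<lambda>X. Gn \<nu> n X k) \<in> borel_measurable (St n)" by simp
  have c: "(\<lambda>X. X k) \<in> borel_measurable (St n)" using k by simp
  note [measurable] = measurable_compose[OF measurable_fst G] measurable_compose[OF measurable_fst c] measurable_compose[OF measurable_snd c]
  show "(\<lambda>z. step \<nu> n h (fst z) (\<lambda>k. b k * snd z k) k) \<in> borel_measurable (St n \<Otimes>\<^sub>M St n)"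
    unfolding step_def by measurable
qed

lemma sets_gamma [measurable_cong]: "sets (gamma n h) = sets (St n)"
  unfolding gamma_def by (intro sets_PiM_cong) auto

lemma space_gamma: "space (gamma n h) = space (St n)"
  by (rule sets_eq_imp_space_eq[OF sets_gamma])

text \<open>The one-step transition operator of the Euler chain. Acting on nonnegative extended
  functions frees its iterates from integrability conditions.\<close>

definition Qop :: "(int \<Rightarrow> real) \<Rightarrow> real \<Rightarrow> nat \<Rightarrow> real \<Rightarrow> ((int \<Rightarrow> real) \<Rightarrow> ennreal) \<Rightarrow> (int \<Rightarrow> real) \<Rightarrow> ennreal" where
  "Qop b \<nu> n h f X = (\<integral>\<^sup>+g. f (stepr b \<nu> n h X g) \<partial>gamma n h)"

lemma measurable_Qop:
  assumes h: "h > 0" and f[measurable]: "f \<in> borel_measurable (St n)"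
  shows "Qop b \<nu> n h f \<in> borel_measurable (St n)"
proof -
  interpret prob_space "gamma n h" by (rule prob_space_gamma[OF h])
  have "(\<lambda>z. f (stepr b \<nu> n h (fst z) (snd z))) \<in> borel_measurable (St n \<Otimes>\<^sub>M St n)"
    by (rule measurable_compose[OF measurable_stepr f])
  then have "(\<lambda>(X, g). f (stepr b \<nu> n h X g)) \<in> borel_measurable (St n \<Otimes>\<^sub>M gamma n h)"
    by (simp add: split_beta cong: measurable_cong_sets[OF sets_pair_measure_cong[OF refl sets_gamma] refl])
  then show ?thesis unfolding Qop_def by (rule borel_measurable_nn_integral)
qed

lemma measurable_Qop_iterate:
  "h > 0 \<Longrightarrow> f \<in> borel_measurable (St n) \<Longrightarrow> (Qop b \<nu> n h ^^ j) f \<in> borel_measurable (St n)"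
  by (induction j) (auto intro: measurable_Qop)

section \<open>The Euler chain driven by the noise\<close>

context noise_space
begin

definition incr :: "nat \<Rightarrow> real \<Rightarrow> real \<Rightarrow> 'w \<Rightarrow> int \<Rightarrow> real" where
  "incr n h t \<omega> = (\<lambda>k\<in>freqs n. \<beta> k (t + h) \<omega> - \<beta> k t \<omega>)"

lemma measurable_incr: "t \<ge> 0 \<Longrightarrow> h > 0 \<Longrightarrow> incr n h t \<in> M \<rightarrow>\<^sub>M St n"
  unfolding incr_def by (intro measurable_restrict borel_measurable_diff bm_measurable) (auto dest: freqs_nonzero)

lemma distr_incr:
  assumes t: "t \<ge> 0" and h: "h > 0"
  shows "distr M (St n) (incr n h t) = gamma n h"
\<comment> \<open>The criterion for product laws needs a nonempty index set. In the empty case both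
  laws are the unit mass on the single point of \<open>St n\<close>.\<close>
proof (cases "freqs n = {}")
  case True
  have "distr M (St n) (incr n h t) = distr M (St n) (\<lambda>\<omega>. \<lambda>_. undefined)"
    by (rule arg_cong[where f = "distr M (St n)"]) (simp add: incr_def True fun_eq_iff)
  also have "\<dots> = gamma n h"
  proof (rule measure_eqI)
    show "sets (distr M (St n) (\<lambda>\<omega>. \<lambda>_. undefined)) = sets (gamma n h)" by (simp add: sets_gamma)
    interpret g: prob_space "gamma n h" by (rule prob_space_gamma[OF h])
    interpret d: prob_space "distr M (St n) (\<lambda>\<omega>. \<lambda>_. undefined)" by (rule prob_space_distr) (simp add: True space_PiM)
    fix A assume "A \<in> sets (distr M (St n) (\<lambda>\<omega>. \<lambda>_. undefined))"
    then have "A \<subseteq> {\<lambda>_. undefined}" using sets.sets_into_space[of A "St n"] by (simp add: True space_PiM)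
    then consider "A = {}" | "A = space (distr M (St n) (\<lambda>\<omega>. \<lambda>_. undefined))" "A = space (gamma n h)"
      by (auto simp: space_gamma True space_PiM)
    then show "emeasure (distr M (St n) (\<lambda>\<omega>. \<lambda>_. undefined)) A = emeasure (gamma n h) A"
    proof cases
      case 2
      show ?thesis using d.emeasure_space_1 g.emeasure_space_1 by (simp only: 2[symmetric])
    qed simp
  qed
  finally show ?thesis .
next
  case False
  have ind: "indep_vars (\<lambda>_. PiM {0..} (\<lambda>_. borel)) (\<lambda>k \<omega>. \<lambda>t\<in>{0..}. \<beta> k t \<omega>) (freqs n)"
    using fam freqs_subset by (auto simp: brownian_family_def intro: indep_vars_subset)
  have "indep_vars (\<lambda>_. borel) (\<lambda>k \<omega>. (\<lambda>x. x (t + h) - x t) (\<lambda>t\<in>{0..}. \<beta> k t \<omega>)) (freqs n)"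
    by (rule indep_vars_compose2[OF ind], intro borel_measurable_diff measurable_component_singleton)
      (use t h in auto)
  then have ind: "indep_vars (\<lambda>_. borel) (\<lambda>k \<omega>. \<beta> k (t + h) \<omega> - \<beta> k t \<omega>) (freqs n)"
    using t h by simp
  have rv: "random_variable borel (\<lambda>\<omega>. \<beta> k (t + h) \<omega> - \<beta> k t \<omega>)" if "k \<in> freqs n" for k
    using t h that by (intro borel_measurable_diff bm_measurable) (auto dest: freqs_nonzero)
  have "distr M (St n) (incr n h t) = PiM (freqs n) (\<lambda>k. distr M borel (\<lambda>\<omega>. \<beta> k (t + h) \<omega> - \<beta> k t \<omega>))"
    using indep_vars_iff_distr_eq_PiM'[OF False rv] ind unfolding incr_def by simp
  also have "\<dots> = gamma n h"
    unfolding gamma_def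
  proof (rule PiM_cong[OF refl])
    fix k assume "k \<in> freqs n"
    from distributed_distr_eq_density[OF bm_increment[OF freqs_nonzero[OF this] t, of "t + h"]] h
    have "density lborel (normal_density 0 (sqrt h)) = distr M lborel (\<lambda>\<omega>. \<beta> k (t + h) \<omega> - \<beta> k t \<omega>)" by simp
    then show "distr M borel (\<lambda>\<omega>. \<beta> k (t + h) \<omega> - \<beta> k t \<omega>) = gauss h"
      unfolding gauss_def by (simp cong: distr_cong)
  qed
  finally show ?thesis .
qed

lemma subalgebra_F: "t \<ge> 0 \<Longrightarrow> subalgebra M (F t)"
  and subalgebra_F_mono: "0 \<le> s \<Longrightarrow> s \<le> t \<Longrightarrow> subalgebra (F t) (F s)"
  using filt by (auto simp: filtered_prob_space_def)

text \<open>\<open>incr\<close> reads finitely many of the increments after \<open>t\<close>, which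
  are jointly independent of \<open>F t\<close>; so both generated sigma-algebras lie inside
  independent ones.\<close>

lemma indep_incr:
  assumes t: "t \<ge> 0" and h: "h > 0" and X: "X \<in> F t \<rightarrow>\<^sub>M St n"
  shows "indep_var (St n) X (St n) (incr n h t)"
proof -
  let ?I = "nonzero_ints \<times> {t..}"
  let ?P = "\<lambda>\<omega>. \<lambda>(k, u)\<in>?I. \<beta> k u \<omega> - \<beta> k t \<omega>"
  let ?V = "vimage_algebra (space M) ?P (PiM ?I (\<lambda>_. borel))"
  have ind: "indep_set (sets (F t)) (sets ?V)"
    using fam t by (simp add: brownian_family_def)
  have sp: "space (F t) = space M" using subalgebra_F[OF t] by (simp add: subalgebra_def)
  have XM: "X \<in> M \<rightarrow>\<^sub>M St n" by (rule measurable_from_subalg[OF subalgebra_F[OF t] X])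
  have PV: "?P \<in> ?V \<rightarrow>\<^sub>M PiM ?I (\<lambda>_. borel)"
    by (rule measurable_vimage_algebra1) (auto simp: space_PiM split_def)
  have "(\<lambda>\<omega>. \<lambda>k\<in>freqs n. ?P \<omega> (k, t + h)) \<in> ?V \<rightarrow>\<^sub>M St n"
    by (intro measurable_restrict measurable_compose[OF PV] measurable_component_singleton) (use h in \<open>auto dest: freqs_nonzero\<close>)
  moreover have "(\<lambda>\<omega>. \<lambda>k\<in>freqs n. ?P \<omega> (k, t + h)) = incr n h t"
    using h by (auto simp: incr_def fun_eq_iff restrict_def dest: freqs_nonzero)
  ultimately have GV: "incr n h t \<in> ?V \<rightarrow>\<^sub>M St n" by simp
  have "indep_set (sigma_sets (space M) {X -` A \<inter> space M |A. A \<in> sets (St n)})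
     (sigma_sets (space M) {incr n h t -` A \<inter> space M |A. A \<in> sets (St n)})"
    unfolding indep_set_def
  proof (rule indep_sets_mono_sets[OF ind[unfolded indep_set_def]])
    have A: "sigma_sets (space M) {X -` A \<inter> space M |A. A \<in> sets (St n)} \<subseteq> sets (F t)"
      using measurable_sets[OF X] sets.sigma_sets_subset[of "{X -` A \<inter> space M |A. A \<in> sets (St n)}" "F t"] unfolding sp by blast
    have B: "sigma_sets (space M) {incr n h t -` A \<inter> space M |A. A \<in> sets (St n)} \<subseteq> sets ?V"
      using measurable_sets[OF GV] sets.sigma_sets_subset[of "{incr n h t -` A \<inter> space M |A. A \<in> sets (St n)}" ?V]
      unfolding space_vimage_algebra by blast
    show "(case i of True \<Rightarrow> sigma_sets (space M) {X -` A \<inter> space M |A. A \<in> sets (St n)}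
        | False \<Rightarrow> sigma_sets (space M) {incr n h t -` A \<inter> space M |A. A \<in> sets (St n)})
      \<subseteq> (case i of True \<Rightarrow> sets (F t) | False \<Rightarrow> sets ?V)" for i
      by (cases i) (use A B in simp_all)
  qed
  then show ?thesis unfolding indep_var_eq using XM measurable_incr[OF t h] by simp
qed

text \<open>Independence makes the joint law of state and increment a product, and Fubini integrates
  the increment out with the state frozen.\<close>

lemma one_step:
  assumes t: "t \<ge> 0" and h: "h > 0" and X: "X \<in> F t \<rightarrow>\<^sub>M St n" and f: "f \<in> borel_measurable (St n)"
  shows "(\<integral>\<^sup>+\<omega>. f (stepr b \<nu> n h (X \<omega>) (incr n h t \<omega>)) \<partial>M) = (\<integral>\<^sup>+\<omega>. Qop b \<nu> n h f (X \<omega>) \<partial>M)"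
proof -
  interpret g: prob_space "gamma n h" by (rule prob_space_gamma[OF h])
  have XM: "X \<in> M \<rightarrow>\<^sub>M St n" by (rule measurable_from_subalg[OF subalgebra_F[OF t] X])
  have G: "incr n h t \<in> M \<rightarrow>\<^sub>M St n" by (rule measurable_incr[OF t h])
  have P: "(\<lambda>\<omega>. (X \<omega>, incr n h t \<omega>)) \<in> M \<rightarrow>\<^sub>M St n \<Otimes>\<^sub>M St n" by (rule measurable_Pair[OF XM G])
  have fm: "(\<lambda>z. f (stepr b \<nu> n h (fst z) (snd z))) \<in> borel_measurable (St n \<Otimes>\<^sub>M St n)"
    by (rule measurable_compose[OF measurable_stepr f])
  have "(\<integral>\<^sup>+\<omega>. f (stepr b \<nu> n h (X \<omega>) (incr n h t \<omega>)) \<partial>M)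
     = (\<integral>\<^sup>+z. f (stepr b \<nu> n h (fst z) (snd z)) \<partial>distr M (St n \<Otimes>\<^sub>M St n) (\<lambda>\<omega>. (X \<omega>, incr n h t \<omega>)))"
    by (subst nn_integral_distr[OF P]) (use fm in simp_all)
  also have "distr M (St n \<Otimes>\<^sub>M St n) (\<lambda>\<omega>. (X \<omega>, incr n h t \<omega>)) = distr M (St n) X \<Otimes>\<^sub>M gamma n h"
    using indep_incr[OF t h X] unfolding indep_var_distribution_eq distr_incr[OF t h] by simp
  also have "(\<integral>\<^sup>+z. f (stepr b \<nu> n h (fst z) (snd z)) \<partial>(distr M (St n) X \<Otimes>\<^sub>M gamma n h))
     = (\<integral>\<^sup>+x. \<integral>\<^sup>+g. f (stepr b \<nu> n h x g) \<partial>gamma n h \<partial>distr M (St n) X)"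
    by (subst g.nn_integral_fst[symmetric])
      (use fm in \<open>simp_all cong: measurable_cong_sets[OF sets_pair_measure_cong[OF sets_distr sets_gamma] refl]\<close>)
  also have "\<dots> = (\<integral>\<^sup>+\<omega>. Qop b \<nu> n h f (X \<omega>) \<partial>M)"
    unfolding Qop_def[symmetric] by (rule nn_integral_distr[OF XM]) (use measurable_Qop[OF h f] in simp)
  finally show ?thesis .
qed

definition noise_incr :: "real \<Rightarrow> 'w \<Rightarrow> real \<Rightarrow> int \<Rightarrow> real" where
  "noise_incr r \<omega> t k = b k * \<beta> k (r + t) \<omega> - b k * \<beta> k r \<omega>"

text \<open>The scheme restarted at time \<open>r\<close>, driven by the noise after
  \<open>r\<close>. The starting state may be random; in the lemmas below it is known at time
  \<open>r\<close>.\<close>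

definition sch :: "nat \<Rightarrow> real \<Rightarrow> real \<Rightarrow> 'w \<Rightarrow> (int \<Rightarrow> real) \<Rightarrow> nat \<Rightarrow> int \<Rightarrow> real" where
  "sch n h r \<omega> X = scheme \<nu> n h (\<lambda>j k. noise_incr r \<omega> (real j * h + h) k - noise_incr r \<omega> (real j * h) k) X"

lemma sch_Suc:
  "(\<lambda>k\<in>freqs n. sch n h r \<omega> X (Suc j) k) = stepr b \<nu> n h (\<lambda>k\<in>freqs n. sch n h r \<omega> X j k) (incr n h (r + real j * h) \<omega>)"
  unfolding stepr_def
proof (rule restrict_ext)
  fix k assume k: "k \<in> freqs n"
  show "sch n h r \<omega> X (Suc j) k
      = step \<nu> n h (\<lambda>k\<in>freqs n. sch n h r \<omega> X j k) (\<lambda>k. b k * incr n h (r + real j * h) \<omega> k) k"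
    using k Gn_cong[of n "sch n h r \<omega> X j" "\<lambda>k\<in>freqs n. sch n h r \<omega> X j k" k \<nu>]
    by (simp add: sch_def step_def noise_incr_def incr_def algebra_simps)
qed

lemma measurable_sch:
  assumes r: "r \<ge> 0" and h: "h > 0" and X: "(\<lambda>\<omega>. \<lambda>k\<in>freqs n. X \<omega> k) \<in> F r \<rightarrow>\<^sub>M St n"
  shows "(\<lambda>\<omega>. \<lambda>k\<in>freqs n. sch n h r \<omega> (X \<omega>) j k) \<in> F (r + real j * h) \<rightarrow>\<^sub>M St n"
proof (induction j)
  case 0
  then show ?case using X by (simp only: sch_def scheme.simps of_nat_0 mult_zero_left add_0_right)
next
  case (Suc j)
  let ?t = "r + real j * h" and ?t' = "r + real (Suc j) * h"
  have t: "0 \<le> ?t" "?t \<le> ?t'" "0 \<le> ?t'" using r h by (auto simp: mult_right_mono)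
  have "incr n h ?t \<in> F ?t' \<rightarrow>\<^sub>M St n"
    unfolding incr_def
  proof (rule measurable_restrict, rule borel_measurable_diff)
    fix k assume k: "k \<in> freqs n"
    show "\<beta> k (?t + h) \<in> borel_measurable (F ?t')"
      using bm_adapted[OF freqs_nonzero[OF k] t(3)] by (simp add: algebra_simps)
    show "\<beta> k ?t \<in> borel_measurable (F ?t')"
      by (rule measurable_from_subalg[OF subalgebra_F_mono[OF t(1,2)] bm_adapted[OF freqs_nonzero[OF k] t(1)]])
  qed
  then show ?case
    unfolding sch_Suc using measurable_from_subalg[OF subalgebra_F_mono[OF t(1,2)] Suc]
    by (intro measurable_compose[OF measurable_Pair measurable_stepr, simplified])
qed

text \<open>The Markov property of the chain. The induction peels off the last step, so
  \<open>f\<close> has to vary.\<close>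

lemma sch_law:
  assumes r: "r \<ge> 0" and h: "h > 0" and X: "(\<lambda>\<omega>. \<lambda>k\<in>freqs n. X \<omega> k) \<in> F r \<rightarrow>\<^sub>M St n"
    and f: "f \<in> borel_measurable (St n)"
  shows "(\<integral>\<^sup>+\<omega>. f (\<lambda>k\<in>freqs n. sch n h r \<omega> (X \<omega>) j k) \<partial>M) = (\<integral>\<^sup>+\<omega>. (Qop b \<nu> n h ^^ j) f (\<lambda>k\<in>freqs n. X \<omega> k) \<partial>M)"
  using f
proof (induction j arbitrary: f)
  case 0
  then show ?case by (simp only: sch_def scheme.simps funpow_0)
next
  case (Suc j)
  have t: "0 \<le> r + real j * h" using r h by simp
  have "(\<integral>\<^sup>+\<omega>. f (\<lambda>k\<in>freqs n. sch n h r \<omega> (X \<omega>) (Suc j) k) \<partial>M)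
     = (\<integral>\<^sup>+\<omega>. Qop b \<nu> n h f (\<lambda>k\<in>freqs n. sch n h r \<omega> (X \<omega>) j k) \<partial>M)"
    unfolding sch_Suc by (rule one_step[OF t h measurable_sch[OF r h X] Suc.prems])
  also have "\<dots> = (\<integral>\<^sup>+\<omega>. (Qop b \<nu> n h ^^ j) (Qop b \<nu> n h f) (\<lambda>k\<in>freqs n. X \<omega> k) \<partial>M)"
    by (rule Suc.IH[OF measurable_Qop[OF h Suc.prems]])
  finally show ?case unfolding funpow_Suc_right o_apply .
qed

end

section \<open>The transition semigroup\<close>

lemma openin_sobolev:
  "openin (sobolev_topology m) U \<longleftrightarrow> U \<subseteq> hom_sobolev m \<and> (\<forall>u\<in>U. \<exists>r>0. sob.mball m u r \<subseteq> U)"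
  unfolding sobolev_topology_def sob.openin_mtopology by blast

lemma sobolev_open_subset: "{U. openin (sobolev_topology m) U} \<subseteq> Pow (hom_sobolev m)"
  by (auto simp: openin_sobolev)

lemma space_sobolev_borel [simp]: "space (sobolev_borel m) = hom_sobolev m"
  unfolding sobolev_borel_def using sobolev_open_subset by (rule space_measure_of)

lemma sets_sobolev_borel: "sets (sobolev_borel m) = sigma_sets (hom_sobolev m) {U. openin (sobolev_topology m) U}"
  unfolding sobolev_borel_def using sobolev_open_subset by (rule sets_measure_of)

text \<open>The H^m distance dominates the L^2 distance, so relatively L^2-open subsets of H^m are
  open in H^m.\<close>

lemma sobolev_borel_continuous:
  fixes f :: "l2_circle \<Rightarrow> 'c::topological_space"
  assumes "continuous_on (hom_sobolev m) f"
  shows "f \<in> borel_measurable (sobolev_borel m)"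
proof (rule borel_measurableI)
  fix S :: "'c set" assume "open S"
  then obtain V where V: "open V" "V \<inter> hom_sobolev m = f -` S \<inter> hom_sobolev m"
    using assms unfolding continuous_on_open_invariant by blast
  have "openin (sobolev_topology m) (V \<inter> hom_sobolev m)"
    unfolding openin_sobolev
  proof (intro conjI ballI)
    fix u assume u: "u \<in> V \<inter> hom_sobolev m"
    then obtain r where r: "r > 0" "ball u r \<subseteq> V" using V(1) open_contains_ball by blast
    have "sob.mball m u r \<subseteq> V \<inter> hom_sobolev m"
    proof
      fix v assume "v \<in> sob.mball m u r"
      then have v: "v \<in> hom_sobolev m" "sob_dist m u v < r" by auto
      then have "norm (u - v) < r" using norm_diff_le_sob_dist[of u m v] u by (simp add: sob_dist_eq)
      then show "v \<in> V \<inter> hom_sobolev m" using r(2) v(1) by (auto simp: dist_norm)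
    qed
    then show "\<exists>r>0. sob.mball m u r \<subseteq> V \<inter> hom_sobolev m" using r(1) by blast
  qed auto
  then show "f -` S \<inter> space (sobolev_borel m) \<in> sets (sobolev_borel m)"
    by (auto simp: sets_sobolev_borel V(2))
qed

lemma measurable_coord: "(\<lambda>u. coord u k) \<in> borel_measurable (sobolev_borel m)"
  by (intro sobolev_borel_continuous continuous_intros)

lemma sobolev_norm_measurable:
  assumes "\<And>k. k \<noteq> 0 \<Longrightarrow> (\<lambda>\<omega>. coord (Y \<omega>) k) \<in> borel_measurable N"
  shows "(\<lambda>\<omega>. sobolev_norm_sq s (Y \<omega>)) \<in> borel_measurable N"
  unfolding sobolev_eq_SUP hsum_def
  by (intro borel_measurable_SUP measurable_compose[OF _ measurable_ennreal] borel_measurable_sum borel_measurable_times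
    borel_measurable_power borel_measurable_const assms countableI_type) (auto dest: freqs_nonzero)

definition rational_tp :: "l2_circle set" where
  "rational_tp = (\<Union>n. tp n ` PiE (freqs n) (\<lambda>_. \<rat>))"

lemma countable_rational_tp: "countable rational_tp"
  unfolding rational_tp_def using countable_rat by (intro countable_UN countable_image countable_PiE) auto

lemma rational_tp_dense:
  assumes u: "u \<in> hom_sobolev m" and e: "e > 0"
  obtains d where "d \<in> rational_tp" "norm (Lam m d - Lam m u) < e"
proof -
  have "(\<lambda>n. Lam m (proj n u)) \<longlonglongrightarrow> Lam m u"
    unfolding Lam_proj[OF u] by (intro proj_tendsto mean_zero_Lam u)
  then obtain n where n: "norm (Lam m (proj n u) - Lam m u) < e / 2"
    using e LIMSEQ_D[of _ _ "e / 2"] by (meson half_gt_zero le_refl)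
  define c where "c = real (card (freqs n)) * real n ^ (2 * m) + 1"
  have c: "c > 0" by (simp add: c_def add_nonneg_pos)
  define \<delta> where "\<delta> = e / (2 * sqrt c)"
  have d: "\<delta> > 0" using e c by (simp add: \<delta>_def)
  have "\<exists>q\<in>\<rat>. \<bar>q - coord u k\<bar> < \<delta>" for k
    using Rats_dense_in_real[of "coord u k" "coord u k + \<delta>"] d by force
  then obtain q where q: "\<And>k. q k \<in> \<rat>" "\<And>k. \<bar>q k - coord u k\<bar> < \<delta>" by metis
  have sq: "(q k - coord u k)\<^sup>2 \<le> \<delta>\<^sup>2" for k using q(2)[of k] d by (simp add: abs_le_square_iff[symmetric])
  have "(norm (Lam m (tp n q - proj n u)))\<^sup>2 = wsum m n (\<lambda>k. q k - coord u k)"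
    by (simp add: tp_coord[symmetric] tp_diff[symmetric] norm_Lam_tp)
  also have "\<dots> \<le> real n ^ (2 * m) * wsum 0 n (\<lambda>k. q k - coord u k)" by (rule wsum_le_pow)
  also have "\<dots> \<le> real n ^ (2 * m) * (real (card (freqs n)) * \<delta>\<^sup>2)"
    unfolding wsum_0 using sq by (intro mult_left_mono sum_bounded_above) auto
  also have "\<dots> \<le> c * \<delta>\<^sup>2" by (simp add: c_def algebra_simps)
  also have "\<dots> = (e / 2)\<^sup>2" using c by (simp add: \<delta>_def power_divide power_mult_distrib)
  finally have "norm (Lam m (tp n q - proj n u)) \<le> e / 2" by (rule power2_le_imp_le) (use e in simp)
  then have "norm (Lam m (tp n q) - Lam m (proj n u)) \<le> e / 2" by (simp add: Lam_diff hom_sobolev_proj)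
  then have "norm (Lam m (tp n q) - Lam m u) < e"
    using n norm_triangle_ineq[of "Lam m (tp n q) - Lam m (proj n u)" "Lam m (proj n u) - Lam m u"] by simp
  moreover have "tp n q \<in> rational_tp"
    unfolding rational_tp_def using q(1) tp_cong[of n q "restrict q (freqs n)"]
    by (intro UN_I[of n] image_eqI[of _ _ "restrict q (freqs n)"]) auto
  ultimately show thesis by (rule that[rotated])
qed

lemma rational_tp_hom [intro]: "d \<in> rational_tp \<Longrightarrow> d \<in> hom_sobolev m"
  by (auto simp: rational_tp_def)

text \<open>Polynomials with rational coordinates are dense in H^m, so an open set is a countable
  union of balls around them, and a ball is described by a norm that is a supremum of countably many
  functions of the coordinates. Hence coordinates decide measurability.\<close>

lemma measurable_sobolev_borel:
  assumes H: "\<And>\<omega>. \<omega> \<in> space N \<Longrightarrow> Y \<omega> \<in> hom_sobolev m"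
    and Y: "\<And>k. k \<noteq> 0 \<Longrightarrow> (\<lambda>\<omega>. coord (Y \<omega>) k) \<in> borel_measurable N"
  shows "Y \<in> N \<rightarrow>\<^sub>M sobolev_borel m"
proof (rule measurable_sigma_sets[OF sets_sobolev_borel sobolev_open_subset])
  show "Y \<in> space N \<rightarrow> hom_sobolev m" using H by auto
  fix U assume "U \<in> {U. openin (sobolev_topology m) U}"
  then have U: "U \<subseteq> hom_sobolev m" "\<And>u. u \<in> U \<Longrightarrow> \<exists>r>0. sob.mball m u r \<subseteq> U"
    by (auto simp: openin_sobolev)
  define I where "I = {(d, r). d \<in> rational_tp \<and> r \<in> \<rat> \<and> r > 0 \<and> sob.mball m d r \<subseteq> U}"
  have I: "countable I"
    by (rule countable_subset[OF _ countable_SIGMA[of rational_tp "\<lambda>_. \<rat>"]])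
      (auto simp: I_def countable_rational_tp countable_rat)
  have "U = (\<Union>(d, r)\<in>I. sob.mball m d r)"
  proof
    show "U \<subseteq> (\<Union>(d, r)\<in>I. sob.mball m d r)"
    proof
      fix u assume u: "u \<in> U"
      then have uH: "u \<in> hom_sobolev m" using U(1) by auto
      obtain r where r: "r > 0" "sob.mball m u r \<subseteq> U" using U(2)[OF u] by blast
      obtain q where q: "q \<in> \<rat>" "0 < q" "q < r / 2" using Rats_dense_in_real[of 0 "r / 2"] r by auto
      obtain d where d: "d \<in> rational_tp" "norm (Lam m d - Lam m u) < q" by (rule rational_tp_dense[OF uH q(2)])
      have dH: "d \<in> hom_sobolev m" using d by auto
      have du: "sob_dist m d u < q" using d(2) by (simp add: sob_dist_eq dH uH)
      have "sob.mball m d q \<subseteq> sob.mball m u r"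
      proof
        fix v assume "v \<in> sob.mball m d q"
        then have v: "v \<in> hom_sobolev m" "sob_dist m d v < q" by auto
        have "sob_dist m u v \<le> sob_dist m u d + sob_dist m d v" by (rule sob.triangle[OF uH dH v(1)])
        also have "\<dots> < r" using du v(2) q sob.commute[of m u d] by linarith
        finally show "v \<in> sob.mball m u r" using uH v(1) by simp
      qed
      with r(2) have "(d, q) \<in> I" using d q by (auto simp: I_def)
      moreover have "u \<in> sob.mball m d q" using du dH uH by simp
      ultimately show "u \<in> (\<Union>(d, r)\<in>I. sob.mball m d r)" by blast
    qed
  qed (auto simp: I_def)
  then have "Y -` U \<inter> space N = (\<Union>(d, r)\<in>I. Y -` sob.mball m d r \<inter> space N)" by blast
  also have "\<dots> \<in> sets N"
  proof (intro sets.countable_UN' I, clarify)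
    fix d r assume "(d, r) \<in> I"
    then have d: "d \<in> hom_sobolev m" and r: "r > 0" by (auto simp: I_def)
    have ms: "(\<lambda>\<omega>. sobolev_norm_sq m (d - Y \<omega>)) \<in> borel_measurable N"
      by (rule sobolev_norm_measurable) (use Y in \<open>simp add: inner_diff_left\<close>)
    have "sob_dist m d v < r \<longleftrightarrow> sobolev_norm_sq m (d - v) < ennreal (r\<^sup>2)" if v: "v \<in> hom_sobolev m" for v
    proof -
      have "sob_dist m d v < r \<longleftrightarrow> (norm (Lam m d - Lam m v))\<^sup>2 < r\<^sup>2"
        unfolding sob_dist_eq[OF d v] using r power_strict_mono[of "norm (Lam m d - Lam m v)" r 2]
        by (auto intro: power2_less_imp_less)
      then show ?thesis
        by (simp add: sobolev_norm_Lam[OF hom_sobolev_diff[OF d v]] Lam_diff[OF d v] ennreal_less_iff)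
    qed
    then have "Y -` sob.mball m d r \<inter> space N = {\<omega>\<in>space N. sobolev_norm_sq m (d - Y \<omega>) < ennreal (r\<^sup>2)}"
      using H d by auto
    also have "\<dots> \<in> sets N" using ms by simp
    finally show "Y -` sob.mball m d r \<inter> space N \<in> sets N" .
  qed
  finally show "Y -` U \<inter> space N \<in> sets N" .
qed

lemma sobolev_norm_sq_tp: "sobolev_norm_sq s (tp n X) = ennreal (wsum s n X)"
  by (simp add: sobolev_norm_Lam norm_Lam_tp)

text \<open>A supremum of finite sums that are continuous in the coordinates is lower
  semicontinuous.\<close>

lemma sobolev_norm_liminf:
  assumes "\<And>k. k \<noteq> 0 \<Longrightarrow> (\<lambda>n. coord (y n) k) \<longlonglongrightarrow> coord u k"
  shows "sobolev_norm_sq s u \<le> liminf (\<lambda>n. sobolev_norm_sq s (y n))"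
  unfolding sobolev_eq_SUP[of s u]
proof (rule SUP_least)
  fix N
  have "(\<lambda>n. ennreal (hsum s N (y n))) \<longlonglongrightarrow> ennreal (hsum s N u)"
    unfolding hsum_def by (intro tendsto_intros assms) (auto dest: freqs_nonzero)
  then have "ennreal (hsum s N u) = liminf (\<lambda>n. ennreal (hsum s N (y n)))"
    by (rule lim_imp_Liminf[OF sequentially_bot, symmetric])
  also have "\<dots> \<le> liminf (\<lambda>n. sobolev_norm_sq s (y n))"
    by (intro Liminf_mono always_eventually allI hsum_le_sobolev)
  finally show "ennreal (hsum s N u) \<le> liminf (\<lambda>n. sobolev_norm_sq s (y n))" .
qed

lemma sobolev_fatou:
  assumes lim: "AE \<omega> in N. \<forall>k. k \<noteq> 0 \<longrightarrow> (\<lambda>n. coord (Y n \<omega>) k) \<longlonglongrightarrow> coord (Z \<omega>) k"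
    and m: "\<And>n k. k \<noteq> 0 \<Longrightarrow> (\<lambda>\<omega>. coord (Y n \<omega>) k) \<in> borel_measurable N"
    and K: "\<And>n. (\<integral>\<^sup>+\<omega>. sobolev_norm_sq s (Y n \<omega>) \<partial>N) \<le> K"
  shows "(\<integral>\<^sup>+\<omega>. sobolev_norm_sq s (Z \<omega>) \<partial>N) \<le> K"
proof -
  have "(\<integral>\<^sup>+\<omega>. sobolev_norm_sq s (Z \<omega>) \<partial>N) \<le> (\<integral>\<^sup>+\<omega>. liminf (\<lambda>n. sobolev_norm_sq s (Y n \<omega>)) \<partial>N)"
    by (rule nn_integral_mono_AE) (use lim in eventually_elim, auto intro: sobolev_norm_liminf)
  also have "\<dots> \<le> liminf (\<lambda>n. \<integral>\<^sup>+\<omega>. sobolev_norm_sq s (Y n \<omega>) \<partial>N)"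
    by (rule nn_integral_liminf) (rule sobolev_norm_measurable[OF m])
  also have "\<dots> \<le> K"
    by (rule order_trans[OF Liminf_mono[where g = "\<lambda>_. K"]]) (use K in \<open>auto simp: Liminf_const\<close>)
  finally show ?thesis .
qed

text \<open>Continuity refers to the L^2 topology, not to that of H^m: pathwise stability is in L^2,
  and \<open>P_feller\<close> shows that the semigroup preserves the class.\<close>

definition test_fun :: "nat \<Rightarrow> (l2_circle \<Rightarrow> real) \<Rightarrow> bool" where
  "test_fun m f \<longleftrightarrow> continuous_on (hom_sobolev m) f \<and> (\<forall>u\<in>hom_sobolev m. 0 \<le> f u \<and> f u \<le> 1)"

lemma test_fun_measurable: "test_fun m f \<Longrightarrow> f \<in> borel_measurable (sobolev_borel m)"
  by (auto simp: test_fun_def intro: sobolev_borel_continuous)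

lemma test_fun_tendsto:
  assumes "test_fun m f" "u \<in> hom_sobolev m" "\<And>n. y n \<in> hom_sobolev m" "y \<longlonglongrightarrow> u"
  shows "(\<lambda>n. f (y n)) \<longlonglongrightarrow> f u"
  using assms continuous_on_tendsto_compose[of "hom_sobolev m" f y u sequentially] by (simp add: test_fun_def)

section \<open>The semigroup of the given solutions\<close>

locale solution_space = noise_space +
  fixes m :: nat and W :: "l2_circle \<Rightarrow> real \<Rightarrow> 'a \<Rightarrow> l2_circle"
  assumes m1: "m \<ge> 1" and m_less: "m < \<sigma>"
    and sol: "\<And>y. y \<in> hom_sobolev m \<Longrightarrow> adapted_global_solution M F (- 2) \<nu> (noise b \<beta>) m y (W y)"
begin

abbreviation "P \<equiv> transition_semigroup M W"

lemma W_adapted: "y \<in> hom_sobolev m \<Longrightarrow> t \<ge> 0 \<Longrightarrow> W y t \<in> F t \<rightarrow>\<^sub>M sobolev_borel m"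
  using sol by (simp add: adapted_global_solution_def)

lemma W_measurable: "y \<in> hom_sobolev m \<Longrightarrow> t \<ge> 0 \<Longrightarrow> W y t \<in> M \<rightarrow>\<^sub>M sobolev_borel m"
  using measurable_from_subalg[OF subalgebra_F W_adapted] by blast

lemma W_hom: "y \<in> hom_sobolev m \<Longrightarrow> t \<ge> 0 \<Longrightarrow> \<omega> \<in> space M \<Longrightarrow> W y t \<omega> \<in> hom_sobolev m"
  using measurable_space[OF W_measurable] by simp

lemma AE_W0: "y \<in> hom_sobolev m \<Longrightarrow> AE \<omega> in M. W y 0 \<omega> = y"
  using solution_path[OF sol _ m1, of y 1] by auto

lemma P_eq:
  assumes f: "test_fun m f" and y: "y \<in> hom_sobolev m" and t: "t \<ge> 0"
  shows "integrable M (\<lambda>\<omega>. f (W y t \<omega>))" "ennreal (P t f y) = (\<integral>\<^sup>+\<omega>. ennreal (f (W y t \<omega>)) \<partial>M)"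
    "0 \<le> P t f y" "P t f y \<le> 1"
proof -
  have b: "0 \<le> f (W y t \<omega>) \<and> f (W y t \<omega>) \<le> 1" if "\<omega> \<in> space M" for \<omega>
    using f W_hom[OF y t that] by (simp add: test_fun_def)
  have m: "(\<lambda>\<omega>. f (W y t \<omega>)) \<in> borel_measurable M"
    by (rule measurable_compose[OF W_measurable[OF y t] test_fun_measurable[OF f]])
  show i: "integrable M (\<lambda>\<omega>. f (W y t \<omega>))"
    by (rule integrable_const_bound[where B = 1]) (use b m in \<open>auto intro: AE_I2\<close>)
  show "ennreal (P t f y) = (\<integral>\<^sup>+\<omega>. ennreal (f (W y t \<omega>)) \<partial>M)"
    unfolding transition_semigroup_def
    by (rule nn_integral_eq_integral[OF i, symmetric]) (use b in \<open>auto intro: AE_I2\<close>)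
  show "0 \<le> P t f y" unfolding transition_semigroup_def by (rule integral_nonneg_AE) (use b in \<open>auto intro: AE_I2\<close>)
  have "P t f y \<le> (\<integral>\<omega>. 1 \<partial>M)" unfolding transition_semigroup_def
    by (rule integral_mono_AE[OF i]) (use b in \<open>auto intro: AE_I2\<close>)
  then show "P t f y \<le> 1" by (simp add: prob_space)
qed

lemma P_tendsto:
  assumes f: "test_fun m f" and y: "\<And>n. y n \<in> hom_sobolev m" "z \<in> hom_sobolev m"
    and t: "\<And>n. t n \<ge> 0" "r \<ge> 0" and lim: "AE \<omega> in M. (\<lambda>n. W (y n) (t n) \<omega>) \<longlonglongrightarrow> W z r \<omega>"
  shows "(\<lambda>n. P (t n) f (y n)) \<longlonglongrightarrow> P r f z"
  unfolding transition_semigroup_def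
proof (rule integral_dominated_convergence[where w = "\<lambda>_. 1"])
  show "(\<lambda>\<omega>. f (W z r \<omega>)) \<in> borel_measurable M" "(\<lambda>\<omega>. f (W (y n) (t n) \<omega>)) \<in> borel_measurable M" for n
    using f y t by (auto intro!: measurable_compose[OF W_measurable test_fun_measurable])
  show "AE \<omega> in M. (\<lambda>n. f (W (y n) (t n) \<omega>)) \<longlonglongrightarrow> f (W z r \<omega>)"
    using lim AE_space by eventually_elim (use f y t in \<open>auto intro!: test_fun_tendsto W_hom\<close>)
  show "AE \<omega> in M. norm (f (W (y n) (t n) \<omega>)) \<le> 1" for n
    using AE_space by eventually_elim (use f W_hom[OF y(1) t(1)] in \<open>auto simp: test_fun_def\<close>)
qed simp

lemma P_time_continuous:
  assumes f: "test_fun m f" and y: "y \<in> hom_sobolev m" and t: "\<And>n. t n \<ge> 0" "r \<ge> 0" "t \<longlonglongrightarrow> r"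
  shows "(\<lambda>n. P (t n) f y) \<longlonglongrightarrow> P r f y"
proof (rule P_tendsto[OF f y y t(1,2)])
  have "Bseq t" using t(3) by (intro convergent_imp_Bseq) (auto simp: convergent_def)
  then obtain K where K: "K > 0" "\<And>n. \<bar>t n\<bar> \<le> K" unfolding Bseq_def by auto
  have r: "r \<le> K" by (rule LIMSEQ_le_const2[OF t(3)]) (use K abs_le_iff in blast)
  show "AE \<omega> in M. (\<lambda>n. W y (t n) \<omega>) \<longlonglongrightarrow> W y r \<omega>"
    using solution_path[OF sol[OF y] y m1 K(1)]
  proof eventually_elim
    case (elim \<omega>)
    then have c: "continuous_on {0..K} (\<lambda>t. W y t \<omega>)" by simp
    show ?case
      by (rule continuous_on_tendsto_compose[OF c t(3)]) (use t K r in \<open>auto intro!: always_eventually simp: abs_le_iff\<close>)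
  qed
qed

text \<open>Continuity is tested on sequences, so only countably many starting points occur and they
  share one null set. On the other samples \<open>drift_path_stability\<close> applies as soon as
  the starting points are close enough for the bound of the limiting path.\<close>

lemma P_feller:
  assumes f: "test_fun m f" and t: "t \<ge> 0"
  shows "test_fun m (P t f)"
  unfolding test_fun_def continuous_on_sequentially
proof (intro conjI ballI allI impI)
  show "0 \<le> P t f u" "P t f u \<le> 1" if "u \<in> hom_sobolev m" for u using P_eq[OF f that t] by auto
next
  fix y z assume a: "(\<forall>n. y n \<in> hom_sobolev m) \<and> y \<longlonglongrightarrow> z" and z: "z \<in> hom_sobolev m"
  then have y: "\<And>n. y n \<in> hom_sobolev m" "y \<longlonglongrightarrow> z" by auto
  have "(\<lambda>n. P t f (y n)) \<longlonglongrightarrow> P t f z"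
  proof (rule P_tendsto[OF f y(1) z t t])
    show "AE \<omega> in M. (\<lambda>n. W (y n) t \<omega>) \<longlonglongrightarrow> W z t \<omega>"
    \<comment> \<open>\<open>solution_path\<close> and the scheme concern intervals of positive
      length; at time 0 the initial values settle the claim.\<close>
    proof (cases "t = 0")
      case True
      have "AE \<omega> in M. \<forall>n. W (y n) 0 \<omega> = y n" by (subst AE_all_countable) (intro allI AE_W0 y)
      with AE_W0[OF z] show ?thesis unfolding True by eventually_elim (simp add: y)
    next
      case False
      then have t0: "t > 0" using t by simp
      have "AE \<omega> in M. \<forall>n. drift_path \<nu> t (\<lambda>t k. b k * \<beta> k t \<omega>) (\<lambda>t. W (y n) t \<omega>) \<and> W (y n) 0 \<omega> = y n"
        by (subst AE_all_countable) (use solution_path[OF sol[OF y(1)] y(1) m1 t0] in auto)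
      then show ?thesis using solution_path[OF sol[OF z] z m1 t0]
      proof eventually_elim
        case (elim \<omega>)
        have zp: "drift_path \<nu> t (\<lambda>t k. b k * \<beta> k t \<omega>) (\<lambda>t. W z t \<omega>)" and z0: "W z 0 \<omega> = z" using elim by auto
        obtain K where K: "K \<ge> 1" "\<And>s. s \<in> {0..t} \<Longrightarrow> norm (Lam 1 (W z s \<omega>)) \<le> K"
          using path_bound[OF zp] by metis
        let ?c = "exp (2 * (6 * K + 1) * t)"
        have "(\<lambda>n. y n - z) \<longlonglongrightarrow> 0" using y(2) by (rule LIM_zero)
        then have "(\<lambda>n. ?c * (norm (y n - z))\<^sup>2) \<longlonglongrightarrow> ?c * (norm (0::l2_circle))\<^sup>2"
          by (intro tendsto_mult tendsto_const tendsto_power tendsto_norm)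
        then have l: "(\<lambda>n. ?c * (norm (y n - z))\<^sup>2) \<longlonglongrightarrow> 0" by simp
        have "(\<lambda>n. (norm (W (y n) t \<omega> - W z t \<omega>))\<^sup>2) \<longlonglongrightarrow> 0"
        proof (rule Lim_null_comparison[OF _ l])
          show "\<forall>\<^sub>F n in sequentially. norm ((norm (W (y n) t \<omega> - W z t \<omega>))\<^sup>2) \<le> ?c * (norm (y n - z))\<^sup>2"
            using order_tendstoD(2)[OF l zero_less_one]
          proof eventually_elim
            case (elim n)
            have yp: "drift_path \<nu> t (\<lambda>t k. b k * \<beta> k t \<omega>) (\<lambda>t. W (y n) t \<omega>)" and y0: "W (y n) 0 \<omega> = y n"
              using \<open>\<forall>n. _ n\<close> by auto
            from drift_path_stability[OF zp yp nu t0 K] elim show ?case by (simp add: y0 z0)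
          qed
        qed
        then have "(\<lambda>n. sqrt ((norm (W (y n) t \<omega> - W z t \<omega>))\<^sup>2)) \<longlonglongrightarrow> sqrt 0" by (rule tendsto_real_sqrt)
        then show ?case by (simp add: tendsto_norm_zero_iff LIM_zero_iff)
      qed
    qed
  qed
  then show "((P t f) \<circ> y) \<longlonglongrightarrow> P t f z" by (simp add: o_def)
qed

lemma approx_sch: "approx \<nu> s t (noise_incr r \<omega>) n X = sch n (mesh \<nu> s t n) r \<omega> X (steps \<nu> s t n)"
  unfolding approx_def sch_def ..

lemma AE_approx:
  assumes y: "y \<in> hom_sobolev m" and r: "r \<ge> 0" and t: "t > 0"
  shows "AE \<omega> in M. (\<lambda>n. tp n (sch n (mesh \<nu> s t n) r \<omega> (coord (W y r \<omega>)) (steps \<nu> s t n))) \<longlonglongrightarrow> W y (r + t) \<omega>"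
  using solution_path[OF sol[OF y] y m1 add_nonneg_pos[OF r t]]
proof eventually_elim
  case (elim \<omega>)
  then have p: "drift_path \<nu> (r + t) (\<lambda>t k. b k * \<beta> k t \<omega>) (\<lambda>t. W y t \<omega>)" by simp
  have "drift_path \<nu> t (noise_incr r \<omega>) (\<lambda>s. W y (r + s) \<omega>)"
    using drift_path_shift[OF p r less_imp_le[OF t]] unfolding noise_incr_def .
  from approx_converges[OF this nu t, of s] show ?case by (simp add: approx_sch)
qed

lemma measurable_coord_W:
  "y \<in> hom_sobolev m \<Longrightarrow> t \<ge> 0 \<Longrightarrow> (\<lambda>\<omega>. \<lambda>k\<in>freqs n. coord (W y t \<omega>) k) \<in> F t \<rightarrow>\<^sub>M St n"
  by (intro measurable_restrict measurable_compose[OF W_adapted measurable_coord])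

lemma test_fun_St:
  assumes "test_fun m f" shows "(\<lambda>X. ennreal (f (tp n X))) \<in> borel_measurable (St n)"
proof (rule measurable_compose[OF _ measurable_ennreal], rule measurable_St_continuous)
  show "continuous_on UNIV (\<lambda>X. f (tp n X))"
    by (rule continuous_on_compose2[OF _ continuous_tp]) (use assms in \<open>auto simp: test_fun_def\<close>)
qed (metis tp_cong)

text \<open>Convergence of the scheme restarted at \<open>r\<close>, read as a statement about laws
  through \<open>sch_law\<close>. The discrete operators depend on \<open>t\<close> but not on
  \<open>r\<close> or \<open>y\<close>, which is what \<open>markov\<close> exploits.\<close>

lemma law_limit:
  assumes f: "test_fun m f" and y: "y \<in> hom_sobolev m" and r: "r \<ge> 0" and t: "t > 0"
  shows "(\<lambda>n. \<integral>\<^sup>+\<omega>. (Qop b \<nu> n (mesh \<nu> 0 t n) ^^ steps \<nu> 0 t n) (\<lambda>X. ennreal (f (tp n X))) (\<lambda>k\<in>freqs n. coord (W y r \<omega>) k) \<partial>M)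
    \<longlonglongrightarrow> ennreal (P (r + t) f y)"
proof -
  let ?S = "\<lambda>n \<omega>. \<lambda>k\<in>freqs n. sch n (mesh \<nu> 0 t n) r \<omega> (coord (W y r \<omega>)) (steps \<nu> 0 t n) k"
  note h = mesh_bound(1)[OF nu t, of 0]
  note Xm = measurable_coord_W[OF y r]
  have rt: "0 \<le> r + t" using r t by simp
  have Sm: "?S n \<in> M \<rightarrow>\<^sub>M St n" for n
    using measurable_from_subalg[OF subalgebra_F measurable_sch[OF r h Xm]] r h by (simp add: less_imp_le)
  have tpS: "tp n (?S n \<omega>) = tp n (sch n (mesh \<nu> 0 t n) r \<omega> (coord (W y r \<omega>)) (steps \<nu> 0 t n))" for n \<omega>
    by (rule tp_cong) simp
  have "(\<lambda>n. \<integral>\<^sup>+\<omega>. ennreal (f (tp n (?S n \<omega>))) \<partial>M) \<longlonglongrightarrow> (\<integral>\<^sup>+\<omega>. ennreal (f (W y (r + t) \<omega>)) \<partial>M)"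
  proof (rule nn_integral_dominated_convergence[where w = "\<lambda>_. 1"])
    show "(\<lambda>\<omega>. ennreal (f (tp n (?S n \<omega>)))) \<in> borel_measurable M" for n
      by (rule measurable_compose[OF Sm test_fun_St[OF f]])
    show "(\<lambda>\<omega>. ennreal (f (W y (r + t) \<omega>))) \<in> borel_measurable M"
      using test_fun_measurable[OF f] W_measurable[OF y rt] by measurable
    show "AE \<omega> in M. ennreal (f (tp n (?S n \<omega>))) \<le> 1" for n
      using f by (auto simp: test_fun_def)
    show "(\<integral>\<^sup>+\<omega>. 1 \<partial>M) < \<infinity>" by (simp add: emeasure_space_1)
    show "AE \<omega> in M. (\<lambda>n. ennreal (f (tp n (?S n \<omega>)))) \<longlonglongrightarrow> ennreal (f (W y (r + t) \<omega>))"
      using AE_approx[OF y r t, of 0] AE_space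
      by eventually_elim (unfold tpS, intro tendsto_ennrealI test_fun_tendsto[OF f], use W_hom[OF y rt] in auto)
  qed simp
  then show ?thesis
    unfolding sch_law[OF r h Xm test_fun_St[OF f]] P_eq(2)[OF f y rt] .
qed

text \<open>From deterministic states the discrete operators converge pointwise to
  \<open>P t f\<close>. Integrated against the law of the state at time \<open>r\<close>, the same
  operators converge to \<open>P (r + t) f y\<close>. Dominated convergence equates the two
  limits.\<close>

lemma markov:
  assumes f: "test_fun m f" and y: "y \<in> hom_sobolev m" and r: "r \<ge> 0" and t: "t \<ge> 0"
  shows "P (r + t) f y = P r (P t f) y"
proof (cases "t = 0")
  case True
  have "P r (P 0 f) y = P r f y"
    unfolding transition_semigroup_def[of M W r]
  proof (rule integral_cong_AE)
    show "(\<lambda>\<omega>. P 0 f (W y r \<omega>)) \<in> borel_measurable M" "(\<lambda>\<omega>. f (W y r \<omega>)) \<in> borel_measurable M"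
      using f y r P_feller by (auto intro!: measurable_compose[OF W_measurable test_fun_measurable])
    have "P 0 f u = f u" if u: "u \<in> hom_sobolev m" for u
    proof -
      have "P 0 f u = (\<integral>\<omega>. f u \<partial>M)" unfolding transition_semigroup_def
        by (rule integral_cong_AE)
          (use f u AE_W0[OF u] in \<open>auto intro!: measurable_compose[OF W_measurable test_fun_measurable]\<close>)
      then show ?thesis by (simp add: prob_space)
    qed
    then show "AE \<omega> in M. P 0 f (W y r \<omega>) = f (W y r \<omega>)" using W_hom[OF y r] by (auto intro: AE_I2)
  qed
  then show ?thesis by (simp add: True)
next
  case False
  then have t0: "t > 0" using t by simp
  define Q where "Q n = (Qop b \<nu> n (mesh \<nu> 0 t n) ^^ steps \<nu> 0 t n) (\<lambda>X. ennreal (f (tp n X)))" for n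
  have rt: "0 \<le> r + t" using r t by simp
  \<comment> \<open>\<open>law_limit\<close> at r = 0, where the state is almost surely the
    deterministic \<open>u\<close>.\<close>
  have Qlim: "(\<lambda>n. Q n (\<lambda>k\<in>freqs n. coord u k)) \<longlonglongrightarrow> ennreal (P t f u)" if u: "u \<in> hom_sobolev m" for u
  proof -
    have "(\<integral>\<^sup>+\<omega>. Q n (\<lambda>k\<in>freqs n. coord (W u 0 \<omega>) k) \<partial>M) = (\<integral>\<^sup>+\<omega>. Q n (\<lambda>k\<in>freqs n. coord u k) \<partial>M)" for n
      by (rule nn_integral_cong_AE) (use AE_W0[OF u] in eventually_elim, simp)
    then show ?thesis using law_limit[OF f u order_refl t0] by (simp add: Q_def emeasure_space_1)
  qed
  have Q1: "Q n X \<le> 1" if "X \<in> space (St n)" for n X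
  proof -
    have "(Qop b \<nu> n (mesh \<nu> 0 t n) ^^ j) (\<lambda>X. ennreal (f (tp n X))) X \<le> 1" for j X
    proof (induction j arbitrary: X)
      case 0
      then show ?case using f by (simp add: test_fun_def)
    next
      case (Suc j)
      interpret g: prob_space "gamma n (mesh \<nu> 0 t n)" by (rule prob_space_gamma[OF mesh_bound(1)[OF nu t0]])
      have "(Qop b \<nu> n (mesh \<nu> 0 t n) ^^ Suc j) (\<lambda>X. ennreal (f (tp n X))) X \<le> (\<integral>\<^sup>+g. 1 \<partial>gamma n (mesh \<nu> 0 t n))"
        unfolding funpow.simps o_apply Qop_def[of b \<nu> n _ "(Qop b \<nu> n (mesh \<nu> 0 t n) ^^ j) (\<lambda>X. ennreal (f (tp n X)))"]
        by (intro nn_integral_mono Suc.IH)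
      then show ?case by (simp add: g.emeasure_space_1)
    qed
    then show ?thesis unfolding Q_def .
  qed
  have Qm: "Q n \<in> borel_measurable (St n)" for n
    unfolding Q_def by (rule measurable_Qop_iterate[OF mesh_bound(1)[OF nu t0] test_fun_St[OF f]])
  have Xm: "(\<lambda>\<omega>. \<lambda>k\<in>freqs n. coord (W y r \<omega>) k) \<in> M \<rightarrow>\<^sub>M St n" for n
    by (rule measurable_from_subalg[OF subalgebra_F[OF r] measurable_coord_W[OF y r]])
  have Pf: "test_fun m (P t f)" by (rule P_feller[OF f t])
  have "(\<lambda>n. \<integral>\<^sup>+\<omega>. Q n (\<lambda>k\<in>freqs n. coord (W y r \<omega>) k) \<partial>M) \<longlonglongrightarrow> (\<integral>\<^sup>+\<omega>. ennreal (P t f (W y r \<omega>)) \<partial>M)"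
  proof (rule nn_integral_dominated_convergence[where w = "\<lambda>_. 1"])
    show "(\<lambda>\<omega>. Q n (\<lambda>k\<in>freqs n. coord (W y r \<omega>) k)) \<in> borel_measurable M" for n
      by (rule measurable_compose[OF Xm Qm])
    show "(\<lambda>\<omega>. ennreal (P t f (W y r \<omega>))) \<in> borel_measurable M"
      using test_fun_measurable[OF Pf] W_measurable[OF y r] by measurable
    show "AE \<omega> in M. Q n (\<lambda>k\<in>freqs n. coord (W y r \<omega>) k) \<le> 1" for n
      by (intro AE_I2 Q1 measurable_space[OF Xm])
    show "(\<integral>\<^sup>+\<omega>. 1 \<partial>M) < \<infinity>" by (simp add: emeasure_space_1)
    show "AE \<omega> in M. (\<lambda>n. Q n (\<lambda>k\<in>freqs n. coord (W y r \<omega>) k)) \<longlonglongrightarrow> ennreal (P t f (W y r \<omega>))"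
      by (intro AE_I2 Qlim W_hom[OF y r])
  qed simp
  from LIMSEQ_unique[OF law_limit[OF f y r t0, folded Q_def] this]
  have "ennreal (P (r + t) f y) = ennreal (P r (P t f) y)" by (simp add: P_eq(2)[OF Pf y r])
  then show ?thesis using P_eq(3)[OF f y rt] P_eq(3)[OF Pf y r] by simp
qed

text \<open>The Lyapunov function vanishes at 0, and its decay bounds the chain uniformly in mesh,
  truncation and time; lower semicontinuity carries the bound over to the solution.\<close>

lemma moment_bound:
  obtains C where "\<And>t. t \<ge> 0 \<Longrightarrow> (\<integral>\<^sup>+\<omega>. sobolev_norm_sq (m + 1) (W 0 t \<omega>) \<partial>M) \<le> ennreal C"
proof -
  define s where "s = m + 1"
  \<comment> \<open>The estimate in H^(m+1) needs noise of that order; this is where m < \<sigma>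
    enters.\<close>
  have s: "s \<ge> 1" "s \<le> \<sigma>" using m_less by (auto simp: s_def)
  note z = hom_sobolev_zero[of m]
  obtain \<kappa> C where kc: "\<kappa> \<ge> 0" "C \<ge> 0" and
    L: "\<And>n h X. h > 0 \<Longrightarrow> h \<le> 1 \<Longrightarrow> \<nu> * h \<le> 1 \<Longrightarrow> 4 * h * \<nu> * real n ^ 4 \<le> 1 \<Longrightarrow> 72 * h * real n ^ 6 \<le> 1 \<Longrightarrow>
      72 * h * real n ^ (2 * s + 6) \<le> 1 \<Longrightarrow>
      (\<integral>\<^sup>+g. ennreal (lyap s \<kappa> n (step \<nu> n h X (\<lambda>k. b k * g k))) \<partial>gamma n h) \<le> ennreal ((1 - \<nu> / 4 * h) * lyap s \<kappa> n X + C * h)"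
    using lyapunov_step[OF nu s(1) noise_sum_le_0 noise_sum_le[OF s(2)]] by blast
  have lm: "(\<lambda>X. ennreal (lyap s \<kappa> n X)) \<in> borel_measurable (St n)" for n
    unfolding lyap_def
  proof (rule measurable_compose[OF _ measurable_ennreal], rule measurable_St_continuous)
    show "continuous_on UNIV (\<lambda>X. wsum s n X + \<kappa> * wsum 0 n X ^ (s + 2))"
      by (intro continuous_intros continuous_wsum)
  qed (metis wsum_cong)
  have lc: "lyap s \<kappa> n (restrict X (freqs n)) = lyap s \<kappa> n X" for n X
    unfolding lyap_def using wsum_cong[of n "restrict X (freqs n)" X] by simp
  have Q: "Qop b \<nu> n (mesh \<nu> s t n) (\<lambda>X. ennreal (lyap s \<kappa> n X)) X
     \<le> ennreal ((1 - \<nu> / 4 * mesh \<nu> s t n) * lyap s \<kappa> n X + C * mesh \<nu> s t n)" if t: "t > 0" for t n X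
    unfolding Qop_def stepr_def lc
    by (rule L[OF mesh_bound(1)[OF nu t] mesh_conditions(4,5,1,3,2)[OF nu t]])
  \<comment> \<open>4 C/\<nu> is the fixed point of x -> (1 - \<nu> h/4) x + C h for every h, so the
    bound reproduces itself at each step.\<close>
  have main: "(\<integral>\<^sup>+\<omega>. ennreal (lyap s \<kappa> n (sch n (mesh \<nu> s t n) 0 \<omega> (\<lambda>_. 0) j)) \<partial>M) \<le> ennreal (4 * C / \<nu>)"
    if t: "t > 0" for t n j
  proof (induction j)
    case 0
    have "lyap s \<kappa> n (\<lambda>_. 0) = 0" by (simp add: lyap_def wsum_def)
    then show ?case by (simp add: sch_def)
  next
    case (Suc j)
    define h where "h = mesh \<nu> s t n"
    define X where "X \<omega> = (\<lambda>k\<in>freqs n. sch n h 0 \<omega> (\<lambda>_. 0) j k)" for \<omega>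
    have h: "h > 0" "\<nu> * h \<le> 1" unfolding h_def by (rule mesh_bound(1)[OF nu t], rule mesh_conditions(5)[OF nu t])
    have jh: "0 \<le> 0 + real j * h" using h by simp
    have c0: "(\<lambda>\<omega>. \<lambda>k\<in>freqs n. (\<lambda>_. 0) k) \<in> F 0 \<rightarrow>\<^sub>M St n" by (intro measurable_restrict) simp
    have Xm: "X \<in> F (0 + real j * h) \<rightarrow>\<^sub>M St n" unfolding X_def by (rule measurable_sch[OF order_refl h(1) c0])
    have XM: "X \<in> M \<rightarrow>\<^sub>M St n" by (rule measurable_from_subalg[OF subalgebra_F[OF jh] Xm])
    have lXm: "(\<lambda>\<omega>. ennreal (lyap s \<kappa> n (X \<omega>))) \<in> borel_measurable M" by (rule measurable_compose[OF XM lm])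
    have "(\<integral>\<^sup>+\<omega>. ennreal (lyap s \<kappa> n (sch n h 0 \<omega> (\<lambda>_. 0) (Suc j))) \<partial>M)
       = (\<integral>\<^sup>+\<omega>. ennreal (lyap s \<kappa> n (stepr b \<nu> n h (X \<omega>) (incr n h (0 + real j * h) \<omega>))) \<partial>M)"
      unfolding X_def sch_Suc[symmetric] lc ..
    also have "\<dots> = (\<integral>\<^sup>+\<omega>. Qop b \<nu> n h (\<lambda>X. ennreal (lyap s \<kappa> n X)) (X \<omega>) \<partial>M)"
      by (rule one_step[OF jh h(1) Xm lm])
    also have "\<dots> \<le> (\<integral>\<^sup>+\<omega>. ennreal (1 - \<nu> / 4 * h) * ennreal (lyap s \<kappa> n (X \<omega>)) + ennreal (C * h) \<partial>M)"
    proof (rule nn_integral_mono)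
      fix \<omega>
      have "0 \<le> 1 - \<nu> / 4 * h" using h by simp
      then show "Qop b \<nu> n h (\<lambda>X. ennreal (lyap s \<kappa> n X)) (X \<omega>) \<le> ennreal (1 - \<nu> / 4 * h) * ennreal (lyap s \<kappa> n (X \<omega>)) + ennreal (C * h)"
        using Q[OF t, of n "X \<omega>"] kc h lyap_nonneg[OF kc(1), of s n "X \<omega>"]
        by (simp add: h_def[symmetric] ennreal_mult[symmetric])
    qed
    also have "\<dots> = ennreal (1 - \<nu> / 4 * h) * (\<integral>\<^sup>+\<omega>. ennreal (lyap s \<kappa> n (X \<omega>)) \<partial>M) + ennreal (C * h)"
      using lXm by (simp add: nn_integral_add nn_integral_cmult emeasure_space_1)
    also have "\<dots> \<le> ennreal (1 - \<nu> / 4 * h) * ennreal (4 * C / \<nu>) + ennreal (C * h)"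
      using Suc unfolding X_def lc h_def[symmetric] by (intro add_right_mono mult_left_mono) auto
    also have "\<dots> = ennreal ((1 - \<nu> / 4 * h) * (4 * C / \<nu>) + C * h)"
    proof -
      have a: "0 \<le> 1 - \<nu> / 4 * h" and b: "0 \<le> 4 * C / \<nu>" and c: "0 \<le> C * h" using h kc nu by auto
      show ?thesis
        by (simp only: ennreal_mult[OF a b] ennreal_plus[OF mult_nonneg_nonneg[OF a b] c])
    qed
    also have "(1 - \<nu> / 4 * h) * (4 * C / \<nu>) + C * h = 4 * C / \<nu>" using nu by (simp add: field_simps)
    finally show ?case unfolding h_def .
  qed
  show thesis
  proof (rule that)
    fix t :: real assume t0: "t \<ge> 0"
    show "(\<integral>\<^sup>+\<omega>. sobolev_norm_sq (m + 1) (W 0 t \<omega>) \<partial>M) \<le> ennreal (4 * C / \<nu>)"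
    proof (cases "t = 0")
      case True
      have "(\<integral>\<^sup>+\<omega>. sobolev_norm_sq (m + 1) (W 0 t \<omega>) \<partial>M) = (\<integral>\<^sup>+\<omega>. 0 \<partial>M)"
        by (rule nn_integral_cong_AE) (use AE_W0[OF z] in eventually_elim, simp add: True sobolev_eq_SUP hsum_def)
      then show ?thesis by simp
    next
      case False
      then have t: "t > 0" using t0 by simp
      let ?S = "\<lambda>n \<omega>. sch n (mesh \<nu> s t n) 0 \<omega> (\<lambda>_. 0) (steps \<nu> s t n)"
      note h = mesh_bound(1)[OF nu t, of s]
      have c0: "(\<lambda>\<omega>. \<lambda>k\<in>freqs n. (\<lambda>_. 0) k) \<in> F 0 \<rightarrow>\<^sub>M St n" for n by (intro measurable_restrict) simp
      have Sm: "(\<lambda>\<omega>. \<lambda>k\<in>freqs n. ?S n \<omega> k) \<in> M \<rightarrow>\<^sub>M St n" for n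
        using measurable_from_subalg[OF subalgebra_F measurable_sch[OF order_refl h c0]] h by (simp add: less_imp_le)
      show ?thesis unfolding s_def[symmetric]
      proof (rule sobolev_fatou)
        show "AE \<omega> in M. \<forall>k. k \<noteq> 0 \<longrightarrow> (\<lambda>n. coord (tp n (?S n \<omega>)) k) \<longlonglongrightarrow> coord (W 0 t \<omega>) k"
          using AE_approx[OF z order_refl t, of s] AE_W0[OF z]
        proof eventually_elim
          case (elim \<omega>)
          have "coord (W 0 0 \<omega>) = (\<lambda>_. 0)" using elim by (simp add: fun_eq_iff)
          with elim(1) have "(\<lambda>n. tp n (?S n \<omega>)) \<longlonglongrightarrow> W 0 t \<omega>" by simp
          then show ?case by (auto intro!: tendsto_intros)
        qed
        show "(\<lambda>\<omega>. coord (tp n (?S n \<omega>)) k) \<in> borel_measurable M" if k: "k \<noteq> 0" for n k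
        proof (cases "k \<in> freqs n")
          case True
          have "(\<lambda>\<omega>. (\<lambda>k\<in>freqs n. ?S n \<omega> k) k) \<in> borel_measurable M"
            by (rule measurable_compose[OF Sm]) (use True in simp)
          then show ?thesis using True by simp
        qed (simp add: coord_tp k)
        show "(\<integral>\<^sup>+\<omega>. sobolev_norm_sq s (tp n (?S n \<omega>)) \<partial>M) \<le> ennreal (4 * C / \<nu>)" for n
        proof -
          have "(\<integral>\<^sup>+\<omega>. sobolev_norm_sq s (tp n (?S n \<omega>)) \<partial>M) \<le> (\<integral>\<^sup>+\<omega>. ennreal (lyap s \<kappa> n (?S n \<omega>)) \<partial>M)"
            using kc by (intro nn_integral_mono) (auto simp: sobolev_norm_sq_tp lyap_def intro!: ennreal_leI)
          also have "\<dots> \<le> ennreal (4 * C / \<nu>)" by (rule main[OF t])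
          finally show ?thesis .
        qed
      qed
    qed
  qed
qed

end

section \<open>Weak compactness\<close>

text \<open>
  Schoenberg's device: the 2-periodic continuous function \<open>schoen\<close> reads off the ternary digits
  of a point of the Cantor set, so that a sequence of reals is recovered from one real by a map
  which is continuous on the whole line.
\<close>

definition schoen :: "real \<Rightarrow> real" where
  "schoen x = max 0 (min 1 (1 / 2 - cos (x * pi)))"

lemma schoen_bounds: "0 \<le> schoen x" "schoen x \<le> 1"
  by (simp_all add: schoen_def)

lemma continuous_schoen: "continuous_on UNIV schoen"
  unfolding schoen_def by (intro continuous_intros)

lemma schoen_periodic: "schoen (2 * real n + x) = schoen x"
  by (simp add: schoen_def distrib_right cos_add mult.assoc[symmetric])

lemma schoen_eq_0: "0 \<le> x \<Longrightarrow> x \<le> 1 / 3 \<Longrightarrow> schoen x = 0"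
  using cos_monotone_0_pi_le[of "x * pi" "pi / 3"] by (simp add: schoen_def cos_60)

lemma schoen_eq_1: "2 / 3 \<le> x \<Longrightarrow> x \<le> 1 \<Longrightarrow> schoen x = 1"
  using cos_monotone_0_pi_le[of "2 * pi / 3" "x * pi"] by (simp add: schoen_def cos_120)

definition cantor :: "(nat \<Rightarrow> nat) \<Rightarrow> real" where
  "cantor a = (\<Sum>i. 2 * real (a i) / 3 ^ Suc i)"

lemma summable_cantor:
  assumes "\<And>i. a i \<le> 1" shows "summable (\<lambda>i. 2 * real (a i) / 3 ^ Suc i)"
proof (rule summable_comparison_test)
  have "norm (2 * real (a n) / 3 ^ Suc n) \<le> (1 / 3) ^ n" for n
  proof -
    have "real (a n) \<le> 1" using assms[of n] by simp
    then show ?thesis by (simp add: power_divide field_simps)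
  qed
  then show "\<exists>N. \<forall>n\<ge>N. norm (2 * real (a n) / 3 ^ Suc n) \<le> (1 / 3) ^ n" by blast
qed (simp add: summable_geometric)

lemma cantor_bounds:
  assumes "\<And>i. a i \<le> 1" shows "0 \<le> cantor a" "cantor a \<le> 1"
proof -
  show "0 \<le> cantor a" unfolding cantor_def by (rule suminf_nonneg[OF summable_cantor[OF assms]]) simp
  have "cantor a \<le> (\<Sum>i. 2 / 3 * (1 / 3) ^ i)" unfolding cantor_def
  proof (rule suminf_le[OF _ summable_cantor[OF assms]])
    show "2 * real (a n) / 3 ^ Suc n \<le> 2 / 3 * (1 / 3) ^ n" for n
      using assms[of n] by (simp add: power_divide divide_right_mono)
  qed (intro summable_mult summable_geometric, simp)
  also have "\<dots> = 1" by (subst suminf_mult) (auto simp: summable_geometric suminf_geometric)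
  finally show "cantor a \<le> 1" .
qed

lemma cantor_Suc:
  assumes "\<And>i. a i \<le> 1" shows "3 * cantor a = 2 * real (a 0) + cantor (\<lambda>i. a (Suc i))"
proof -
  have "cantor a = (\<Sum>i. 2 * real (a (Suc i)) / 3 ^ Suc (Suc i)) + 2 * real (a 0) / 3"
    unfolding cantor_def using suminf_split_head[OF summable_cantor[of a, OF assms]] by simp
  also have "(\<Sum>i. 2 * real (a (Suc i)) / 3 ^ Suc (Suc i)) = (\<Sum>i. 1 / 3 * (2 * real (a (Suc i)) / 3 ^ Suc i))"
    by (intro arg_cong[where f = suminf] ext) simp
  also have "\<dots> = 1 / 3 * cantor (\<lambda>i. a (Suc i))"
    unfolding cantor_def by (rule suminf_mult[OF summable_cantor]) (rule assms)
  finally show ?thesis by simp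
qed

text \<open>Multiplication by 3 moves the leading ternary digit, 0 or 2, into the integer part, and
  the period 2 of \<open>schoen\<close> forgets this even integer. What remains lies in the first or
  in the last third of the unit interval, according to the next digit.\<close>

lemma schoen_cantor:
  assumes "\<And>i. a i \<le> 1" shows "schoen (3 ^ k * cantor a) = real (a k)"
  using assms
proof (induction k arbitrary: a)
  case 0
  note b = cantor_bounds[of "\<lambda>i. a (Suc i)", OF 0] cantor_Suc[of a, OF 0]
  consider "a 0 = 0" | "a 0 = 1" using 0[of 0] by linarith
  then show ?case
  proof cases
    case 1 then show ?thesis using b by (simp add: schoen_eq_0)
  next
    case 2 then show ?thesis using b by (simp add: schoen_eq_1)
  qed
next
  case (Suc k)
  have "3 ^ Suc k * cantor a = 2 * real (3 ^ k * a 0) + 3 ^ k * cantor (\<lambda>i. a (Suc i))"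
    using arg_cong[OF cantor_Suc[of a, OF Suc.prems], of "(*) (3 ^ k)"] by (simp add: algebra_simps)
  then show ?case
    using Suc.IH[of "\<lambda>i. a (Suc i)"] Suc.prems by (simp only: schoen_periodic)
qed

lemma dyadic_tendsto: "(\<lambda>n. of_int \<lfloor>2 ^ n * x\<rfloor> / 2 ^ n) \<longlonglongrightarrow> (x :: real)"
proof -
  have "(\<lambda>n. of_int \<lfloor>2 ^ n * x\<rfloor> / 2 ^ n - x) \<longlonglongrightarrow> 0"
  proof (rule Lim_null_comparison[OF _ LIMSEQ_realpow_zero], intro always_eventually allI)
    fix n
    have "\<bar>of_int \<lfloor>2 ^ n * x\<rfloor> - 2 ^ n * x\<bar> \<le> 1" by linarith
    then have "\<bar>of_int \<lfloor>2 ^ n * x\<rfloor> - 2 ^ n * x\<bar> / 2 ^ n \<le> 1 / 2 ^ n" by (rule divide_right_mono) simp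
    moreover have "of_int \<lfloor>2 ^ n * x\<rfloor> / 2 ^ n - x = (of_int \<lfloor>2 ^ n * x\<rfloor> - 2 ^ n * x) / 2 ^ n"
      by (simp add: diff_divide_distrib)
    ultimately show "norm (of_int \<lfloor>2 ^ n * x\<rfloor> / 2 ^ n - x) \<le> (1 / 2 :: real) ^ n" by (simp add: power_divide abs_divide)
  qed auto
  then show ?thesis by (rule LIM_zero_cancel)
qed

definition bit2 :: "real \<Rightarrow> nat \<Rightarrow> nat" where
  "bit2 x j = nat (\<lfloor>2 ^ Suc j * x\<rfloor> mod 2)"

lemma bit2_le: "bit2 x j \<le> 1"
  by (simp add: bit2_def)

lemma bit2_sums:
  assumes x: "0 \<le> x" "x < 1" shows "(\<lambda>j. real (bit2 x j) / 2 ^ Suc j) sums x"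
proof -
  have part: "(\<Sum>j<n. real (bit2 x j) / 2 ^ Suc j) = of_int \<lfloor>2 ^ n * x\<rfloor> / 2 ^ n" for n
  proof (induction n)
    case 0
    have "\<lfloor>x\<rfloor> = 0" using x by linarith
    then show ?case by simp
  next
    case (Suc n)
    have "\<lfloor>2 ^ Suc n * x\<rfloor> div 2 = \<lfloor>2 ^ n * x\<rfloor>"
      using floor_divide_real_eq_div[of 2 "2 ^ Suc n * x"] by simp
    then have "2 * \<lfloor>2 ^ n * x\<rfloor> + int (bit2 x n) = \<lfloor>2 ^ Suc n * x\<rfloor>"
      using div_mult_mod_eq[of "\<lfloor>2 ^ Suc n * x\<rfloor>" 2] by (simp add: bit2_def)
    then have "2 * real_of_int \<lfloor>2 ^ n * x\<rfloor> + real (bit2 x n) = real_of_int \<lfloor>2 ^ Suc n * x\<rfloor>"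
      by (metis of_int_add of_int_mult of_int_numeral of_int_of_nat_eq)
    then show ?case using Suc by (simp add: field_simps)
  qed
  then show ?thesis unfolding sums_def using dyadic_tendsto[of x] by simp
qed

definition code_index :: "int \<Rightarrow> nat \<Rightarrow> nat" where
  "code_index k j = prod_encode (int_encode k, j)"

definition coded_digit :: "(int \<Rightarrow> real) \<Rightarrow> nat \<Rightarrow> nat" where
  "coded_digit c i = bit2 (1 / 2 + arctan (c (int_decode (fst (prod_decode i)))) / pi) (snd (prod_decode i))"

text \<open>Each coordinate is squeezed into (0, 1) by arctan and written in binary; the digits of
  all coordinates are interleaved by a pairing function and become ternary digits 0 and 2. The code
  is merely Borel, but its left inverse \<open>dec\<close> is built on the continuous
  \<open>pdec\<close>.\<close>

definition enc :: "(int \<Rightarrow> real) \<Rightarrow> real" where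
  "enc c = cantor (coded_digit c)"

definition pdec :: "int \<Rightarrow> real \<Rightarrow> real" where
  "pdec k v = (\<Sum>j. schoen (3 ^ code_index k j * v) / 2 ^ Suc j)"

definition dec :: "real \<Rightarrow> int \<Rightarrow> real" where
  "dec v k = tan (pi * (pdec k v - 1 / 2))"

lemma continuous_pdec: "continuous_on UNIV (pdec k)"
proof (rule uniform_limit_theorem)
  show "uniform_limit UNIV (\<lambda>n v. \<Sum>j<n. schoen (3 ^ code_index k j * v) / 2 ^ Suc j) (pdec k) sequentially"
    unfolding pdec_def
  proof (rule Weierstrass_m_test)
    show "norm (schoen (3 ^ code_index k j * v) / 2 ^ Suc j) \<le> (1 / 2) ^ Suc j" for j v
      using schoen_bounds[of "3 ^ code_index k j * v"] by (simp add: power_divide divide_right_mono)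
    show "summable (\<lambda>j. (1 / 2 :: real) ^ Suc j)" by (subst summable_Suc_iff) (simp add: summable_geometric)
  qed
  show "\<forall>\<^sub>F n in sequentially. continuous_on UNIV (\<lambda>v. \<Sum>j<n. schoen (3 ^ code_index k j * v) / 2 ^ Suc j)"
    by (intro always_eventually allI continuous_intros continuous_on_compose2[OF continuous_schoen]) auto
qed simp

lemma measurable_pdec [measurable]: "pdec k \<in> borel_measurable borel"
  by (rule borel_measurable_continuous_onI[OF continuous_pdec])

lemma measurable_dec: "(\<lambda>v. dec v k) \<in> borel_measurable borel"
  unfolding dec_def tan_def by measurable

lemma arctan_unit: "0 < 1 / 2 + arctan x / pi" "1 / 2 + arctan x / pi < 1"
  using arctan_bounded[of x] pi_gt_zero by (auto simp: field_simps)

lemma pdec_enc: "pdec k (enc c) = 1 / 2 + arctan (c k) / pi"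
proof -
  have "schoen (3 ^ code_index k j * enc c) = real (bit2 (1 / 2 + arctan (c k) / pi) j)" for j
    unfolding enc_def by (subst schoen_cantor) (auto simp: coded_digit_def bit2_le code_index_def)
  then have "pdec k (enc c) = (\<Sum>j. real (bit2 (1 / 2 + arctan (c k) / pi) j) / 2 ^ Suc j)"
    unfolding pdec_def by simp
  also have "\<dots> = 1 / 2 + arctan (c k) / pi"
    by (rule sums_unique[symmetric, OF bit2_sums]) (use arctan_unit[of "c k"] in auto)
  finally show ?thesis .
qed

lemma dec_enc: "dec (enc c) k = c k"
  by (simp add: dec_def pdec_enc tan_arctan)

lemma enc_bounds: "0 \<le> enc c" "enc c \<le> 1"
  unfolding enc_def by (intro cantor_bounds; simp add: coded_digit_def bit2_le)+

lemma measurable_enc: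
  assumes [measurable]: "\<And>k. (\<lambda>\<omega>. c \<omega> k) \<in> borel_measurable N"
  shows "(\<lambda>\<omega>. enc (c \<omega>)) \<in> borel_measurable N"
proof -
  have [measurable]: "(\<lambda>\<omega>. real (coded_digit (c \<omega>) i)) \<in> borel_measurable N" for i
    unfolding coded_digit_def bit2_def by measurable
  show ?thesis unfolding enc_def cantor_def by measurable
qed

text \<open>\<open>pdec\<close> is continuous, so it converges in any case. The one danger is a
  limit 0 or 1, at the poles of the tangent, where the coordinate escapes to infinity; a bound that
  holds infinitely often excludes it.\<close>

lemma dec_tendsto:
  assumes v: "V \<longlonglongrightarrow> v" and p: "\<And>n. 0 < pdec k (V n)" "\<And>n. pdec k (V n) < 1"
    and R: "\<exists>\<^sub>F n in sequentially. \<bar>dec (V n) k\<bar> \<le> R"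
  shows "(\<lambda>n. dec (V n) k) \<longlonglongrightarrow> dec v k"
proof -
  have lim: "(\<lambda>n. pdec k (V n)) \<longlonglongrightarrow> pdec k v"
    using continuous_pdec v by (intro continuous_on_tendsto_compose[OF continuous_pdec]) auto
  have at: "arctan (dec (V n) k) = pi * (pdec k (V n) - 1 / 2)" for n
    unfolding dec_def using p[of n] by (intro arctan_tan) (auto simp: field_simps)
  let ?lo = "1 / 2 - arctan R / pi" and ?hi = "1 / 2 + arctan R / pi"
  have b: "\<exists>\<^sub>F n in sequentially. ?lo \<le> pdec k (V n) \<and> pdec k (V n) \<le> ?hi"
    using R
  proof (rule frequently_elim1)
    fix n assume "\<bar>dec (V n) k\<bar> \<le> R"
    then have "arctan (dec (V n) k) \<le> arctan R" "arctan (- R) \<le> arctan (dec (V n) k)" by (auto simp: arctan_le_iff)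
    then show "?lo \<le> pdec k (V n) \<and> pdec k (V n) \<le> ?hi" unfolding at arctan_minus by (simp add: field_simps)
  qed
  have "\<not> pdec k v < ?lo"
  proof
    assume "pdec k v < ?lo"
    from order_tendstoD(2)[OF lim this] have "\<forall>\<^sub>F n in sequentially. \<not> (?lo \<le> pdec k (V n) \<and> pdec k (V n) \<le> ?hi)"
      by eventually_elim simp
    with b show False by (simp add: frequently_def)
  qed
  moreover have "\<not> pdec k v > ?hi"
  proof
    assume "pdec k v > ?hi"
    from order_tendstoD(1)[OF lim this] have "\<forall>\<^sub>F n in sequentially. \<not> (?lo \<le> pdec k (V n) \<and> pdec k (V n) \<le> ?hi)"
      by eventually_elim simp
    with b show False by (simp add: frequently_def)
  qed
  ultimately have pv: "0 < pdec k v" "pdec k v < 1" using arctan_unit[of R] arctan_unit[of "- R"] by (auto simp: arctan_minus)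
  have "cos (pi * (pdec k v - 1 / 2)) > 0"
    using pv by (intro cos_gt_zero_pi) (auto simp: field_simps)
  then have c: "cos (pi * (pdec k v - 1 / 2)) \<noteq> 0" by simp
  have "(\<lambda>n. pi * (pdec k (V n) - 1 / 2)) \<longlonglongrightarrow> pi * (pdec k v - 1 / 2)" by (intro tendsto_intros lim)
  then show ?thesis unfolding dec_def by (rule isCont_tendsto_compose[OF isCont_tan[OF c]])
qed

section \<open>Decoding into H^m\<close>

definition cnorm :: "nat \<Rightarrow> (int \<Rightarrow> real) \<Rightarrow> ennreal" where
  "cnorm m c = (SUP n. ennreal (\<Sum>k\<in>freqs n. \<bar>of_int k\<bar> ^ (2 * m) * (c k)\<^sup>2))"

lemma cnorm_coord: "cnorm m (coord u) = sobolev_norm_sq m u"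
  by (simp add: cnorm_def sobolev_eq_SUP hsum_def)

lemma cnorm_cong: "(\<And>k. k \<noteq> 0 \<Longrightarrow> c k = d k) \<Longrightarrow> cnorm m c = cnorm m d"
  unfolding cnorm_def by (intro SUP_cong refl arg_cong[where f = ennreal] sum.cong) (auto dest: freqs_nonzero)

lemma cnorm_mono_s: "m \<le> s \<Longrightarrow> cnorm m c \<le> cnorm s c"
  unfolding cnorm_def
  by (intro SUP_mono' ennreal_leI sum_mono mult_right_mono power_increasing) (auto dest: freqs_nonzero nonzero_int_ge_1)

lemma synth_hom:
  assumes "cnorm m c < top"
  shows "synth c \<in> hom_sobolev m" "k \<noteq> 0 \<Longrightarrow> coord (synth c) k = c k"
proof -
  have l: "l2seq c"
  proof (rule l2seqI)
    fix n
    have "ennreal (\<Sum>k\<in>freqs n. (c k)\<^sup>2) \<le> cnorm 0 c" unfolding cnorm_def by (rule SUP_upper2[of n]) auto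
    also have "\<dots> \<le> cnorm m c" by (rule cnorm_mono_s) simp
    finally have "enn2real (ennreal (\<Sum>k\<in>freqs n. (c k)\<^sup>2)) \<le> enn2real (cnorm m c)"
      using assms by (intro enn2real_mono) auto
    then show "(\<Sum>k\<in>freqs n. (c k)\<^sup>2) \<le> enn2real (cnorm m c)" by (simp add: sum_nonneg)
  qed
  show c: "coord (synth c) k = c k" if "k \<noteq> 0" for k by (rule coord_synth[OF l that])
  have "sobolev_norm_sq m (synth c) = cnorm m c"
    unfolding cnorm_coord[symmetric] by (rule cnorm_cong[OF c])
  then show "synth c \<in> hom_sobolev m" using assms mean_zero_synth[OF l] by (simp add: hom_sobolev_def)
qed

text \<open>A real number need not code an element of H^m; the value 0 there makes
  \<open>decode\<close> a total Borel map into H^m.\<close>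

definition decode :: "nat \<Rightarrow> real \<Rightarrow> l2_circle" where
  "decode m v = (if cnorm m (dec v) < top then synth (dec v) else 0)"

lemma decode_hom: "decode m v \<in> hom_sobolev m"
  by (simp add: decode_def synth_hom(1) hom_sobolev_zero)

lemma coord_decode: "cnorm m (dec v) < top \<Longrightarrow> k \<noteq> 0 \<Longrightarrow> coord (decode m v) k = dec v k"
  by (simp add: decode_def synth_hom(2))

lemma measurable_cnorm_dec [measurable]: "(\<lambda>v. cnorm m (dec v)) \<in> borel_measurable borel"
  unfolding cnorm_def using measurable_dec by measurable

lemma measurable_decode: "decode m \<in> borel \<rightarrow>\<^sub>M sobolev_borel m"
proof (rule measurable_sobolev_borel)
  note [measurable] = measurable_dec
  fix k :: int assume k: "k \<noteq> 0"
  have "(\<lambda>v. if cnorm m (dec v) < top then dec v k else 0) \<in> borel_measurable borel" by measurable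
  also have "(\<lambda>v. if cnorm m (dec v) < top then dec v k else 0) = (\<lambda>v. coord (decode m v) k)"
    by (auto simp: fun_eq_iff coord_decode k) (simp add: decode_def)
  finally show "(\<lambda>v. coord (decode m v) k) \<in> borel_measurable borel" .
qed (rule decode_hom)

lemma cnorm_enc: "cnorm m (dec (enc (coord u))) = sobolev_norm_sq m u"
  by (simp add: cnorm_coord[symmetric] dec_enc cnorm_def)

lemma decode_enc:
  assumes u: "u \<in> hom_sobolev m" shows "decode m (enc (coord u)) = u"
proof (rule coord_eqI)
  have "cnorm m (dec (enc (coord u))) < top" using u by (simp add: cnorm_enc hom_sobolev_def)
  then show "coord (decode m (enc (coord u))) k = coord u k" if "k \<noteq> 0" for k
    using that by (simp add: coord_decode dec_enc)
  show "decode m (enc (coord u)) \<in> mean_zero" by (rule hom_sobolev_mean_zero[OF decode_hom])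
  show "u \<in> mean_zero" by (rule hom_sobolev_mean_zero[OF u])
qed

text \<open>Frequencies above N carry a weight |k|^(2 s) of at least N + 1, so a bound in the
  stronger norm makes the tails of the L^2 norm uniformly small.\<close>

lemma norm_split_high:
  assumes u: "u \<in> mean_zero" and s: "s \<ge> 1"
  shows "ennreal ((norm u)\<^sup>2) \<le> ennreal (hsum 0 N u) + ennreal (1 / (real N + 1)) * sobolev_norm_sq s u"
proof -
  have u0: "u \<in> hom_sobolev 0"
    using u by (auto simp: hom_sobolev_iff l2seq_coord)
  have "hsum 0 n u \<le> hsum 0 N u + 1 / (real N + 1) * hsum s n u" for n
  proof -
    have "(coord u k)\<^sup>2 \<le> (if k \<in> freqs N then (coord u k)\<^sup>2 else 0) + 1 / (real N + 1) * (\<bar>of_int k\<bar> ^ (2 * s) * (coord u k)\<^sup>2)"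
      if k: "k \<in> freqs n" for k
    proof (cases "k \<in> freqs N")
      case False
      then have "\<bar>k\<bar> \<ge> int N + 1" using freqs_nonzero[OF k] by (auto simp: freqs_def)
      then have kN: "real N + 1 \<le> \<bar>of_int k\<bar>" by linarith
      have "\<bar>real_of_int k\<bar> ^ 1 \<le> \<bar>of_int k\<bar> ^ (2 * s)"
        using kN s by (intro power_increasing) auto
      with kN have "1 \<le> 1 / (real N + 1) * \<bar>of_int k\<bar> ^ (2 * s)" by (simp add: field_simps)
      then have "1 * (coord u k)\<^sup>2 \<le> (1 / (real N + 1) * \<bar>of_int k\<bar> ^ (2 * s)) * (coord u k)\<^sup>2"
        by (rule mult_right_mono) simp
      then show ?thesis using False by simp
    qed simp
    then have "hsum 0 n u \<le> (\<Sum>k\<in>freqs n. (if k \<in> freqs N then (coord u k)\<^sup>2 else 0) + 1 / (real N + 1) * (\<bar>of_int k\<bar> ^ (2 * s) * (coord u k)\<^sup>2))"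
      unfolding hsum_def by (intro sum_mono) simp
    also have "\<dots> = (\<Sum>k\<in>freqs n \<inter> freqs N. (coord u k)\<^sup>2) + 1 / (real N + 1) * hsum s n u"
      unfolding sum.distrib hsum_def sum_distrib_left[symmetric] by (simp add: sum.inter_restrict)
    also have "(\<Sum>k\<in>freqs n \<inter> freqs N. (coord u k)\<^sup>2) \<le> hsum 0 N u"
      unfolding hsum_def by (simp, rule sum_mono2) auto
    finally show ?thesis by simp
  qed
  then have "ennreal (hsum 0 n u) \<le> ennreal (hsum 0 N u) + ennreal (1 / (real N + 1)) * ennreal (hsum s n u)" for n
    by (simp add: ennreal_mult'[symmetric] ennreal_plus[symmetric] del: ennreal_plus)
  also have "\<dots> n \<le> ennreal (hsum 0 N u) + ennreal (1 / (real N + 1)) * sobolev_norm_sq s u" for n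
    by (intro add_left_mono mult_left_mono hsum_le_sobolev) simp
  finally have "sobolev_norm_sq 0 u \<le> ennreal (hsum 0 N u) + ennreal (1 / (real N + 1)) * sobolev_norm_sq s u"
    unfolding sobolev_eq_SUP[of 0] by (intro SUP_least)
  then show ?thesis by (simp add: sobolev_norm_Lam[OF u0] Lam_0 u)
qed

lemma sobolev_norm_sq_diff: "sobolev_norm_sq s (u - v) \<le> 2 * sobolev_norm_sq s u + 2 * sobolev_norm_sq s v"
  unfolding sobolev_eq_SUP[of s "u - v"]
proof (rule SUP_least)
  fix n
  have sq: "(x - y)\<^sup>2 \<le> 2 * x\<^sup>2 + 2 * y\<^sup>2" for x y :: real
    using zero_le_power2[of "x + y"] by (simp add: power2_diff power2_sum)
  have "hsum s n (u - v) \<le> 2 * hsum s n u + 2 * hsum s n v"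
    unfolding hsum_def sum_distrib_left sum.distrib[symmetric]
  proof (rule sum_mono)
    fix k assume "k \<in> freqs n"
    have "\<bar>real_of_int k\<bar> ^ (2 * s) * (coord u k - coord v k)\<^sup>2 \<le> \<bar>of_int k\<bar> ^ (2 * s) * (2 * (coord u k)\<^sup>2 + 2 * (coord v k)\<^sup>2)"
      by (intro mult_left_mono sq) simp
    then show "\<bar>real_of_int k\<bar> ^ (2 * s) * (coord (u - v) k)\<^sup>2 \<le> 2 * (\<bar>of_int k\<bar> ^ (2 * s) * (coord u k)\<^sup>2) + 2 * (\<bar>of_int k\<bar> ^ (2 * s) * (coord v k)\<^sup>2)"
      by (simp add: inner_diff_left algebra_simps)
  qed
  then have "ennreal (hsum s n (u - v)) \<le> 2 * ennreal (hsum s n u) + 2 * ennreal (hsum s n v)"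
    by (simp add: ennreal_mult'[symmetric] ennreal_plus[symmetric] ennreal_numeral[symmetric] del: ennreal_plus ennreal_numeral)
  also have "\<dots> \<le> 2 * sobolev_norm_sq s u + 2 * sobolev_norm_sq s v"
    by (intro add_mono mult_left_mono hsum_le_sobolev) auto
  finally show "ennreal (hsum s n (u - v)) \<le> 2 * sobolev_norm_sq s u + 2 * sobolev_norm_sq s v" .
qed

lemma liminf_finite_frequently:
  fixes a :: "nat \<Rightarrow> ennreal"
  assumes "liminf a < top" obtains R where "R \<ge> 0" "\<exists>\<^sub>F n in sequentially. a n \<le> ennreal R"
proof -
  obtain c where c: "liminf a < c" "c < top" using dense[OF assms] by blast
  have "\<exists>\<^sub>F n in sequentially. a n \<le> ennreal (enn2real c)"
  proof (rule ccontr)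
    assume "\<not> ?thesis"
    then have "\<forall>\<^sub>F n in sequentially. c \<le> a n"
      using c(2) by (auto simp: frequently_def elim!: eventually_mono)
    then have "c \<le> liminf a" by (rule Liminf_bounded)
    then show False using c(1) by simp
  qed
  then show thesis by (rule that[rotated]) simp
qed

text \<open>
  Almost sure convergence of the coded laws gives convergence of all coordinates; the uniform
  bound on a stronger norm excludes mass at infinity and upgrades this to convergence in mean square.
\<close>

lemma mean_square_convergence:
  fixes Y :: "nat \<Rightarrow> 'a \<Rightarrow> l2_circle"
  assumes N: "prob_space N" and s: "s \<ge> 1" and C: "\<And>n. (\<integral>\<^sup>+x. sobolev_norm_sq s (Y n x) \<partial>N) \<le> ennreal C"
    and mz: "\<And>n x. Y n x \<in> mean_zero" "\<And>x. Z x \<in> mean_zero"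
    and m: "\<And>n k. k \<noteq> 0 \<Longrightarrow> (\<lambda>x. coord (Y n x) k) \<in> borel_measurable N"
      "\<And>k. k \<noteq> 0 \<Longrightarrow> (\<lambda>x. coord (Z x) k) \<in> borel_measurable N"
    and lim: "AE x in N. \<forall>k. k \<noteq> 0 \<longrightarrow> (\<lambda>n. coord (Y n x) k) \<longlonglongrightarrow> coord (Z x) k"
  obtains r :: "nat \<Rightarrow> nat" where "strict_mono r" "AE x in N. (\<lambda>n. Y (r n) x) \<longlonglongrightarrow> Z x"
proof -
  interpret prob_space N by (rule N)
  have CZ: "(\<integral>\<^sup>+x. sobolev_norm_sq s (Z x) \<partial>N) \<le> ennreal C" by (rule sobolev_fatou[OF lim m(1) C])
  define d where "d n x = Y n x - Z x" for n x
  have dm: "k \<noteq> 0 \<Longrightarrow> (\<lambda>x. coord (d n x) k) \<in> borel_measurable N" for n k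
    unfolding d_def inner_diff_left by (intro borel_measurable_diff m)
  have d0: "d n x \<in> mean_zero" for n x using mz by (simp add: d_def mean_zero_iff)
  have nd: "norm (d n x) = sqrt (enn2real (sobolev_norm_sq 0 (d n x)))" for n x
    using d0[of n x] by (subst sobolev_norm_Lam) (auto simp: hom_sobolev_iff l2seq_coord Lam_0)
  have nm[measurable]: "(\<lambda>x. norm (d n x)) \<in> borel_measurable N" for n
    unfolding nd using sobolev_norm_measurable[of "d n" N 0] dm by measurable
  have hm[measurable]: "(\<lambda>x. hsum 0 K (d n x)) \<in> borel_measurable N" for n K
    unfolding hsum_def by (intro borel_measurable_sum borel_measurable_times borel_measurable_power borel_measurable_const dm) (auto dest: freqs_nonzero)
  have sm: "(\<lambda>x. sobolev_norm_sq s (Y n x)) \<in> borel_measurable N" "(\<lambda>x. sobolev_norm_sq s (Z x)) \<in> borel_measurable N" for n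
    by (intro sobolev_norm_measurable m; assumption)+
  \<comment> \<open>\<open>min 1\<close> keeps the integrands bounded. The tail costs 2/(K + 1)
    times the moments of \<open>Y n\<close> and \<open>Z\<close>, each at most |C|, hence the
    4.\<close>
  have bd: "(\<integral>x. min 1 ((norm (d n x))\<^sup>2) \<partial>N) \<le> (\<integral>x. min 1 (hsum 0 K (d n x)) \<partial>N) + 4 * \<bar>C\<bar> * (1 / (real K + 1))" for n K
  proof -
    have i1: "integrable N (\<lambda>x. min 1 ((norm (d n x))\<^sup>2))" by (rule integrable_const_bound[where B = 1]) auto
    have i2: "integrable N (\<lambda>x. min 1 (hsum 0 K (d n x)))" by (rule integrable_const_bound[where B = 1]) auto
    let ?e = "1 / (real K + 1)"
    have pt: "ennreal (min 1 ((norm (d n x))\<^sup>2)) \<le> ennreal (min 1 (hsum 0 K (d n x)))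
        + ennreal (2 * ?e) * (sobolev_norm_sq s (Y n x) + sobolev_norm_sq s (Z x))" for x
    proof (cases "1 \<le> hsum 0 K (d n x)")
      case True
      then have "ennreal (min 1 ((norm (d n x))\<^sup>2)) \<le> ennreal (min 1 (hsum 0 K (d n x)))" by (intro ennreal_leI) auto
      then show ?thesis by (rule order_trans) simp
    next
      case False
      have "ennreal (min 1 ((norm (d n x))\<^sup>2)) \<le> ennreal ((norm (d n x))\<^sup>2)" by (intro ennreal_leI) auto
      also have "\<dots> \<le> ennreal (hsum 0 K (d n x)) + ennreal ?e * sobolev_norm_sq s (d n x)"
        by (rule norm_split_high[OF d0 s])
      also have "\<dots> \<le> ennreal (hsum 0 K (d n x)) + ennreal ?e * (2 * sobolev_norm_sq s (Y n x) + 2 * sobolev_norm_sq s (Z x))"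
        unfolding d_def by (intro add_left_mono mult_left_mono sobolev_norm_sq_diff) simp
      also have "ennreal ?e * (2 * sobolev_norm_sq s (Y n x) + 2 * sobolev_norm_sq s (Z x))
          = ennreal (2 * ?e) * (sobolev_norm_sq s (Y n x) + sobolev_norm_sq s (Z x))"
        by (subst ennreal_mult) (auto simp: distrib_left mult_ac)
      finally show ?thesis using False by simp
    qed
    have "ennreal (\<integral>x. min 1 ((norm (d n x))\<^sup>2) \<partial>N) = (\<integral>\<^sup>+x. ennreal (min 1 ((norm (d n x))\<^sup>2)) \<partial>N)"
      by (rule nn_integral_eq_integral[OF i1, symmetric]) simp
    also have "\<dots> \<le> (\<integral>\<^sup>+x. ennreal (min 1 (hsum 0 K (d n x))) + ennreal (2 * ?e) * (sobolev_norm_sq s (Y n x) + sobolev_norm_sq s (Z x)) \<partial>N)"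
      by (intro nn_integral_mono pt)
    also have "\<dots> = (\<integral>\<^sup>+x. ennreal (min 1 (hsum 0 K (d n x))) \<partial>N)
        + ennreal (2 * ?e) * ((\<integral>\<^sup>+x. sobolev_norm_sq s (Y n x) \<partial>N) + (\<integral>\<^sup>+x. sobolev_norm_sq s (Z x) \<partial>N))"
      using sm by (simp add: nn_integral_add nn_integral_cmult)
    also have "(\<integral>\<^sup>+x. ennreal (min 1 (hsum 0 K (d n x))) \<partial>N) = ennreal (\<integral>x. min 1 (hsum 0 K (d n x)) \<partial>N)"
      by (rule nn_integral_eq_integral[OF i2]) simp
    also have "ennreal (\<integral>x. min 1 (hsum 0 K (d n x)) \<partial>N)
        + ennreal (2 * ?e) * ((\<integral>\<^sup>+x. sobolev_norm_sq s (Y n x) \<partial>N) + (\<integral>\<^sup>+x. sobolev_norm_sq s (Z x) \<partial>N))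
      \<le> ennreal (\<integral>x. min 1 (hsum 0 K (d n x)) \<partial>N) + ennreal (2 * ?e) * (ennreal \<bar>C\<bar> + ennreal \<bar>C\<bar>)"
      using order_trans[OF C[of n] ennreal_leI[OF abs_ge_self]] order_trans[OF CZ ennreal_leI[OF abs_ge_self]]
      by (intro add_left_mono mult_left_mono add_mono) auto
    also have "\<dots> = ennreal ((\<integral>x. min 1 (hsum 0 K (d n x)) \<partial>N) + 4 * \<bar>C\<bar> * ?e)"
      by (simp add: ennreal_mult'[symmetric] ennreal_plus[symmetric] integral_nonneg_AE del: ennreal_plus)
    finally show ?thesis by (subst (asm) ennreal_le_iff) (auto intro!: add_nonneg_nonneg integral_nonneg_AE)
  qed
  have "(\<lambda>n. \<integral>x. min 1 ((norm (d n x))\<^sup>2) \<partial>N) \<longlonglongrightarrow> 0"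
  proof (rule LIMSEQ_I)
    fix e :: real assume e: "e > 0"
    obtain K :: nat where "8 * \<bar>C\<bar> / e < real K" using reals_Archimedean2 by blast
    then have K: "4 * \<bar>C\<bar> * (1 / (real K + 1)) < e / 2" using e by (simp add: field_simps)
    have "(\<lambda>n. \<integral>x. min 1 (hsum 0 K (d n x)) \<partial>N) \<longlonglongrightarrow> (\<integral>x. 0 \<partial>N)"
    proof (rule integral_dominated_convergence[where w = "\<lambda>_. 1"])
      show "AE x in N. (\<lambda>n. min 1 (hsum 0 K (d n x))) \<longlonglongrightarrow> 0"
        using lim
      proof eventually_elim
        case (elim x)
        have "(\<lambda>n. coord (d n x) k) \<longlonglongrightarrow> 0" if "k \<in> freqs K" for k
          unfolding d_def inner_diff_left using elim that by (intro LIM_zero) (auto dest: freqs_nonzero)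
        then have "(\<lambda>n. hsum 0 K (d n x)) \<longlonglongrightarrow> (\<Sum>k\<in>freqs K. \<bar>of_int k\<bar> ^ (2 * 0) * 0\<^sup>2)"
          unfolding hsum_def by (intro tendsto_intros) auto
        then have "(\<lambda>n. min 1 (hsum 0 K (d n x))) \<longlonglongrightarrow> min 1 0"
          by (intro tendsto_min tendsto_const) simp
        then show ?case by simp
      qed
    qed auto
    then have "\<forall>\<^sub>F n in sequentially. (\<integral>x. min 1 (hsum 0 K (d n x)) \<partial>N) < e / 2"
      using e by (auto dest: order_tendstoD(2)[of _ _ _ "e / 2"])
    then obtain n0 where n0: "\<And>n. n \<ge> n0 \<Longrightarrow> (\<integral>x. min 1 (hsum 0 K (d n x)) \<partial>N) < e / 2"
      unfolding eventually_sequentially by blast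
    have nn: "0 \<le> (\<integral>x. min 1 ((norm (d n x))\<^sup>2) \<partial>N)" for n by (rule integral_nonneg_AE) simp
    have "norm ((\<integral>x. min 1 ((norm (d n x))\<^sup>2) \<partial>N) - 0) < e" if "n \<ge> n0" for n
      using n0[OF that] bd[of n K] K nn[of n] by simp
    then show "\<exists>no. \<forall>n\<ge>no. norm ((\<integral>x. min 1 ((norm (d n x))\<^sup>2) \<partial>N) - 0) < e" by blast
  qed
  then have L1: "(\<lambda>n. \<integral>x. norm (min 1 ((norm (d n x))\<^sup>2)) \<partial>N) \<longlonglongrightarrow> 0" by simp
  have i: "integrable N (\<lambda>x. min 1 ((norm (d n x))\<^sup>2))" for n by (rule integrable_const_bound[where B = 1]) auto
  obtain r :: "nat \<Rightarrow> nat" where r: "strict_mono r" "AE x in N. (\<lambda>n. min 1 ((norm (d (r n) x))\<^sup>2)) \<longlonglongrightarrow> 0"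
    using tendsto_L1_AE_subseq[OF i L1] by blast
  from r(2) have "AE x in N. (\<lambda>n. Y (r n) x) \<longlonglongrightarrow> Z x"
  proof eventually_elim
    case (elim x)
    have "\<forall>\<^sub>F n in sequentially. min 1 ((norm (d (r n) x))\<^sup>2) < 1" by (rule order_tendstoD(2)[OF elim]) simp
    then have "\<forall>\<^sub>F n in sequentially. min 1 ((norm (d (r n) x))\<^sup>2) = (norm (d (r n) x))\<^sup>2" by eventually_elim auto
    then have "(\<lambda>n. (norm (d (r n) x))\<^sup>2) \<longlonglongrightarrow> 0" using elim by (rule Lim_transform_eventually[rotated])
    then have "(\<lambda>n. sqrt ((norm (d (r n) x))\<^sup>2)) \<longlonglongrightarrow> sqrt 0" by (rule tendsto_real_sqrt)
    then show ?case by (simp add: tendsto_norm_zero_iff d_def LIM_zero_iff)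
  qed
  with r(1) show thesis by (rule that)
qed

text \<open>All codes lie in [0, 1], so tightness of their laws is immediate; Helly's theorem gives
  a weak limit and Skorohod's theorem convergent versions on one probability space. Decoding leads
  back to H^m, and the bound in H^s upgrades convergence of coordinates to convergence in L^2 along
  a subsequence.\<close>

lemma weak_compactness:
  fixes Y :: "nat \<Rightarrow> 'a \<Rightarrow> l2_circle" and Q :: "nat \<Rightarrow> 'a measure"
  assumes Q: "\<And>n. prob_space (Q n)" and Y: "\<And>n. Y n \<in> Q n \<rightarrow>\<^sub>M sobolev_borel m" and s: "s \<ge> 1" "m \<le> s"
    and C: "\<And>n. (\<integral>\<^sup>+x. sobolev_norm_sq s (Y n x) \<partial>Q n) \<le> ennreal C"
  obtains N :: "real measure" and Z r where "strict_mono (r :: nat \<Rightarrow> nat)" "prob_space N" "Z \<in> N \<rightarrow>\<^sub>M sobolev_borel m"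
    "(\<integral>\<^sup>+x. sobolev_norm_sq s (Z x) \<partial>N) \<le> ennreal C"
    "\<And>f. test_fun m f \<Longrightarrow> (\<lambda>n. \<integral>x. f (Y (r n) x) \<partial>Q (r n)) \<longlonglongrightarrow> (\<integral>x. f (Z x) \<partial>N)"
proof -
  define U where "U n x = enc (coord (Y n x))" for n x
  have Yk: "(\<lambda>x. coord (Y n x) k) \<in> borel_measurable (Q n)" for n k
    by (rule measurable_compose[OF Y measurable_coord])
  have Um: "U n \<in> borel_measurable (Q n)" for n unfolding U_def by (rule measurable_enc[OF Yk])
  have YH: "Y n x \<in> hom_sobolev m" if "x \<in> space (Q n)" for n x using measurable_space[OF Y that] by simp
  define L where "L n = distr (Q n) borel (U n)" for n
  have L: "real_distribution (L n)" for n
    unfolding L_def real_distribution_def real_distribution_axioms_def using prob_space.prob_space_distr[OF Q Um] by simp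
  have tight: "tight L"
    unfolding tight_def
  proof (intro conjI allI impI L)
    fix e :: real assume "e > 0"
    have "measure (L n) {-1<..2} = 1" for n
    proof -
      interpret q: prob_space "Q n" by (rule Q)
      have U12: "-1 < U n x \<and> U n x \<le> 2" for x
        using enc_bounds[of "coord (Y n x)"] unfolding U_def by linarith
      have "measure (L n) {-1<..2} = measure (Q n) (U n -` {-1<..2} \<inter> space (Q n))"
        unfolding L_def by (rule measure_distr[OF Um]) simp
      also have "U n -` {-1<..2} \<inter> space (Q n) = space (Q n)"
        using U12 by auto
      finally show ?thesis by (simp add: q.prob_space)
    qed
    then show "\<exists>a b. a < b \<and> (\<forall>n. 1 - e < measure (L n) {a<..b})" using \<open>e > 0\<close>
      by (intro exI[of _ "-1"] exI[of _ 2]) auto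
  qed
  obtain r1 Lim where r1: "strict_mono (r1 :: nat \<Rightarrow> nat)" and Lim: "real_distribution Lim" "weak_conv_m (L \<circ> id \<circ> r1) Lim"
    using tight_imp_convergent_subsubsequence[OF tight strict_mono_id] by blast
  have L': "real_distribution ((L \<circ> id \<circ> r1) n)" for n using L by simp
  obtain N :: "real measure" and V v where N: "prob_space N" and V: "\<forall>n. V n \<in> borel_measurable N"
    "\<forall>n. distr N borel (V n) = (L \<circ> id \<circ> r1) n" "v \<in> N \<rightarrow>\<^sub>M lborel" "\<forall>x\<in>space N. (\<lambda>n. V n x) \<longlonglongrightarrow> (v x :: real)"
    using Skorohod[OF L' Lim] by blast
  have Vm: "\<And>n. V n \<in> borel_measurable N" and VL: "\<And>n. distr N borel (V n) = L (r1 n)" and vm: "v \<in> borel_measurable N"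
    and lim: "\<And>x. x \<in> space N \<Longrightarrow> (\<lambda>n. V n x) \<longlonglongrightarrow> (v x :: real)"
    using V by auto
  interpret N: prob_space N by (rule N)
  define Y' where "Y' n x = decode m (V n x)" for n x
  define Z where "Z x = decode m (v x)" for x
  have Y'm: "Y' n \<in> N \<rightarrow>\<^sub>M sobolev_borel m" for n unfolding Y'_def by (rule measurable_compose[OF Vm measurable_decode])
  have Zm: "Z \<in> N \<rightarrow>\<^sub>M sobolev_borel m" unfolding Z_def by (rule measurable_compose[OF vm measurable_decode])
  \<comment> \<open>\<open>decode\<close> undoes the code on H^m, so the decoded versions have the
    laws of the original variables.\<close>
  have law: "(\<integral>\<^sup>+x. g (Y' n x) \<partial>N) = (\<integral>\<^sup>+x. g (Y (r1 n) x) \<partial>Q (r1 n))"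
    if g: "g \<in> borel_measurable (sobolev_borel m)" for g n
  proof -
    have gd: "(\<lambda>w. g (decode m w)) \<in> borel_measurable borel" by (rule measurable_compose[OF measurable_decode g])
    have "(\<integral>\<^sup>+x. g (Y' n x) \<partial>N) = (\<integral>\<^sup>+w. g (decode m w) \<partial>distr N borel (V n))"
      unfolding Y'_def by (rule nn_integral_distr[symmetric, OF Vm]) (use gd in simp)
    also have "\<dots> = (\<integral>\<^sup>+x. g (decode m (U (r1 n) x)) \<partial>Q (r1 n))"
      unfolding VL L_def by (rule nn_integral_distr[OF Um]) (use gd in simp)
    also have "\<dots> = (\<integral>\<^sup>+x. g (Y (r1 n) x) \<partial>Q (r1 n))"
      unfolding U_def by (intro nn_integral_cong) (simp add: decode_enc YH)
    finally show ?thesis .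
  qed
  have law_int: "(\<integral>x. g (Y' n x) \<partial>N) = (\<integral>x. g (Y (r1 n) x) \<partial>Q (r1 n))"
    if g: "g \<in> borel_measurable (sobolev_borel m)" for g :: "l2_circle \<Rightarrow> real" and n
  proof -
    have gd: "(\<lambda>w. g (decode m w)) \<in> borel_measurable borel" by (rule measurable_compose[OF measurable_decode g])
    have "(\<integral>x. g (Y' n x) \<partial>N) = (\<integral>w. g (decode m w) \<partial>distr N borel (V n))"
      unfolding Y'_def by (rule integral_distr[symmetric, OF Vm]) (use gd in simp)
    also have "\<dots> = (\<integral>x. g (decode m (U (r1 n) x)) \<partial>Q (r1 n))"
      unfolding VL L_def by (rule integral_distr[OF Um]) (use gd in simp)
    also have "\<dots> = (\<integral>x. g (Y (r1 n) x) \<partial>Q (r1 n))"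
      unfolding U_def by (intro Bochner_Integration.integral_cong) (simp_all add: decode_enc YH)
    finally show ?thesis .
  qed
  have snm: "sobolev_norm_sq s \<in> borel_measurable (sobolev_borel m)"
    using sobolev_norm_measurable[of "\<lambda>u. u"] measurable_coord by simp
  have C': "(\<integral>\<^sup>+x. sobolev_norm_sq s (Y' n x) \<partial>N) \<le> ennreal C" for n
    unfolding law[OF snm] by (rule C)
  have Y'k: "(\<lambda>x. coord (Y' n x) k) \<in> borel_measurable N" for n k
    by (rule measurable_compose[OF Y'm measurable_coord])
  have Zk: "(\<lambda>x. coord (Z x) k) \<in> borel_measurable N" for k
    by (rule measurable_compose[OF Zm measurable_coord])
  \<comment> \<open>\<open>V n\<close> is known through its law only, so it takes decodable values
    almost surely and not everywhere; \<open>G\<close> collects the Borel conditions needed.\<close>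
  define G where "G = {w. (\<forall>k. 0 < pdec k w \<and> pdec k w < 1) \<and> cnorm m (dec w) < top}"
  have Gm: "G \<in> sets borel" unfolding G_def by measurable
  have VG: "AE x in N. \<forall>n. V n x \<in> G"
    unfolding AE_all_countable
  proof
    fix n
    have "AE w in L (r1 n). w \<in> G"
      unfolding L_def using Gm
    proof (subst AE_distr_iff[OF Um])
      have "U (r1 n) x \<in> G" if "x \<in> space (Q (r1 n))" for x
        using YH[OF that] arctan_unit unfolding G_def U_def by (simp add: pdec_enc cnorm_enc hom_sobolev_def)
      then show "AE x in Q (r1 n). U (r1 n) x \<in> G" by (intro AE_I2)
    qed simp
    then show "AE x in N. V n x \<in> G"
      unfolding VL[symmetric] using Gm by (subst (asm) AE_distr_iff[OF Vm]) simp_all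
  qed
  have "(\<integral>\<^sup>+x. liminf (\<lambda>n. sobolev_norm_sq s (Y' n x)) \<partial>N) \<le> liminf (\<lambda>n. \<integral>\<^sup>+x. sobolev_norm_sq s (Y' n x) \<partial>N)"
    by (rule nn_integral_liminf) (rule measurable_compose[OF Y'm snm])
  also have "\<dots> \<le> ennreal C"
    by (rule order_trans[OF Liminf_mono[where g = "\<lambda>_. ennreal C"]]) (use C' in \<open>auto simp: Liminf_const\<close>)
  finally have "(\<integral>\<^sup>+x. liminf (\<lambda>n. sobolev_norm_sq s (Y' n x)) \<partial>N) \<noteq> \<infinity>" by (auto simp: top_unique)
  \<comment> \<open>A finite lower limit bounds each coordinate infinitely often, as
    \<open>dec_tendsto\<close> demands.\<close>
  then have fin: "AE x in N. liminf (\<lambda>n. sobolev_norm_sq s (Y' n x)) \<noteq> \<infinity>"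
    by (rule nn_integral_PInf_AE[rotated]) (intro borel_measurable_liminf measurable_compose[OF Y'm snm])
  have conv: "AE x in N. \<forall>k. k \<noteq> 0 \<longrightarrow> (\<lambda>n. coord (Y' n x) k) \<longlonglongrightarrow> coord (Z x) k"
    using VG fin AE_space
  proof eventually_elim
    case (elim x)
    have fin: "liminf (\<lambda>n. sobolev_norm_sq s (Y' n x)) < top" using elim(2) by (simp add: less_top)
    have G: "0 < pdec k (V n x)" "pdec k (V n x) < 1" "cnorm m (dec (V n x)) < top" for n k
      using elim(1) by (auto simp: G_def)
    have Yc: "coord (Y' n x) k = dec (V n x) k" if "k \<noteq> 0" for n k
      unfolding Y'_def by (rule coord_decode[OF G(3) that])
    obtain R where R: "R \<ge> 0" "\<exists>\<^sub>F n in sequentially. sobolev_norm_sq s (Y' n x) \<le> ennreal R"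
      by (rule liminf_finite_frequently[OF fin])
    have dl: "(\<lambda>n. dec (V n x) k) \<longlonglongrightarrow> dec (v x) k" if k: "k \<noteq> 0" for k
    proof (rule dec_tendsto[OF lim[OF elim(3)] G(1,2)])
      show "\<exists>\<^sub>F n in sequentially. \<bar>dec (V n x) k\<bar> \<le> sqrt R"
        using R(2)
      proof (rule frequently_elim1)
        fix n assume a: "sobolev_norm_sq s (Y' n x) \<le> ennreal R"
        obtain K where K: "{k} \<subseteq> freqs K" using finite_subset_freqs[of "{k}"] k by auto
        have "(dec (V n x) k)\<^sup>2 \<le> \<bar>of_int k\<bar> ^ (2 * s) * (coord (Y' n x) k)\<^sup>2"
          using mult_right_mono[OF one_le_power[OF nonzero_int_ge_1[OF k], of "2 * s"], of "(dec (V n x) k)\<^sup>2"]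
          by (simp add: Yc k)
        also have "\<dots> \<le> hsum s K (Y' n x)" unfolding hsum_def
          by (rule member_le_sum[of k "freqs K"]) (use K in auto)
        finally have "(dec (V n x) k)\<^sup>2 \<le> hsum s K (Y' n x)" .
        moreover have "ennreal (hsum s K (Y' n x)) \<le> ennreal R" using hsum_le_sobolev a by (rule order_trans)
        ultimately have "(dec (V n x) k)\<^sup>2 \<le> R" using R(1) by simp
        then show "\<bar>dec (V n x) k\<bar> \<le> sqrt R" using real_le_rsqrt[of "\<bar>dec (V n x) k\<bar>" R] by simp
      qed
    qed
    \<comment> \<open>Guarantees that the limit code is decodable, so that \<open>Z\<close> is not
      given its default value here.\<close>
    have "cnorm s (dec (v x)) \<le> liminf (\<lambda>n. sobolev_norm_sq s (Y' n x))"
      unfolding cnorm_def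
    proof (rule SUP_least)
      fix K
      have "(\<lambda>n. ennreal (hsum s K (Y' n x))) \<longlonglongrightarrow> ennreal (\<Sum>k\<in>freqs K. \<bar>of_int k\<bar> ^ (2 * s) * (dec (v x) k)\<^sup>2)"
        unfolding hsum_def by (intro tendsto_intros) (use dl in \<open>auto simp: Yc dest!: freqs_nonzero\<close>)
      then have "ennreal (\<Sum>k\<in>freqs K. \<bar>of_int k\<bar> ^ (2 * s) * (dec (v x) k)\<^sup>2) = liminf (\<lambda>n. ennreal (hsum s K (Y' n x)))"
        by (rule lim_imp_Liminf[OF sequentially_bot, symmetric])
      also have "\<dots> \<le> liminf (\<lambda>n. sobolev_norm_sq s (Y' n x))"
        by (intro Liminf_mono always_eventually allI hsum_le_sobolev)
      finally show "ennreal (\<Sum>k\<in>freqs K. \<bar>of_int k\<bar> ^ (2 * s) * (dec (v x) k)\<^sup>2) \<le> liminf (\<lambda>n. sobolev_norm_sq s (Y' n x))" .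
    qed
    then have "cnorm m (dec (v x)) < top"
      using cnorm_mono_s[OF s(2), of "dec (v x)"] fin by (meson order_le_less_trans)
    then show ?case using dl by (simp add: Yc Z_def coord_decode)
  qed
  have mz: "Y' n x \<in> mean_zero" "Z x \<in> mean_zero" for n x
    unfolding Y'_def Z_def by (rule hom_sobolev_mean_zero[OF decode_hom])+
  obtain r2 where r2: "strict_mono (r2 :: nat \<Rightarrow> nat)" "AE x in N. (\<lambda>n. Y' (r2 n) x) \<longlonglongrightarrow> Z x"
    using mean_square_convergence[OF N s(1) C' mz Y'k Zk conv] by blast
  show thesis
  proof (rule that[of "r1 \<circ> r2" N Z])
    show "strict_mono (r1 \<circ> r2)" using r1 r2(1) by (rule strict_mono_o)
    show "(\<integral>\<^sup>+x. sobolev_norm_sq s (Z x) \<partial>N) \<le> ennreal C" by (rule sobolev_fatou[OF conv Y'k C'])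
    fix f assume f: "test_fun m f"
    have "(\<lambda>n. \<integral>x. f (Y' (r2 n) x) \<partial>N) \<longlonglongrightarrow> (\<integral>x. f (Z x) \<partial>N)"
    proof (rule integral_dominated_convergence[where w = "\<lambda>_. 1"])
      show "(\<lambda>x. f (Z x)) \<in> borel_measurable N" "(\<lambda>x. f (Y' (r2 n) x)) \<in> borel_measurable N" for n
        using Zm Y'm test_fun_measurable[OF f] by (auto intro: measurable_compose)
      show "AE x in N. (\<lambda>n. f (Y' (r2 n) x)) \<longlonglongrightarrow> f (Z x)"
        using r2(2) by eventually_elim (rule test_fun_tendsto[OF f], auto simp: Z_def Y'_def decode_hom)
      show "AE x in N. norm (f (Y' (r2 n) x)) \<le> 1" for n
        using f decode_hom[of m] by (auto simp: test_fun_def Y'_def)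
    qed simp
    then show "(\<lambda>n. \<integral>x. f (Y ((r1 \<circ> r2) n) x) \<partial>Q ((r1 \<circ> r2) n)) \<longlonglongrightarrow> (\<integral>x. f (Z x) \<partial>N)"
      unfolding law_int[OF test_fun_measurable[OF f]] by simp
  qed (rule N Zm)+
qed

section \<open>The invariant measure\<close>

definition cyl :: "nat \<Rightarrow> int set \<Rightarrow> (int \<Rightarrow> real) \<Rightarrow> l2_circle set" where
  "cyl m I c = {u \<in> hom_sobolev m. \<forall>k\<in>I. coord u k \<le> c k}"

definition cyls :: "nat \<Rightarrow> l2_circle set set" where
  "cyls m = {cyl m I c | I c. finite I \<and> 0 \<notin> I}"

lemma cyls_subset: "cyls m \<subseteq> Pow (hom_sobolev m)"
  by (auto simp: cyls_def cyl_def)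

lemma cyl_empty: "cyl m {} c = hom_sobolev m"
  by (simp add: cyl_def)

lemma Int_stable_cyls: "Int_stable (cyls m)"
proof (rule Int_stableI)
  fix A B assume "A \<in> cyls m" "B \<in> cyls m"
  then obtain I c J d where A: "A = cyl m I c" "finite I" "0 \<notin> I" and B: "B = cyl m J d" "finite J" "0 \<notin> J"
    by (auto simp: cyls_def)
  have "A \<inter> B = cyl m (I \<union> J) (\<lambda>k. if k \<in> I \<inter> J then min (c k) (d k) else if k \<in> I then c k else d k)"
    unfolding A B cyl_def by (auto split: if_splits)
  then show "A \<inter> B \<in> cyls m" using A B by (auto simp: cyls_def)
qed

lemma measurable_cyl: "finite I \<Longrightarrow> cyl m I c \<in> sets (sobolev_borel m)"
proof -
  assume I: "finite I"
  have "{u \<in> space (sobolev_borel m). \<forall>k\<in>I. coord u k \<le> c k} \<in> sets (sobolev_borel m)"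
    using measurable_coord[of _ m] by (intro sets.sets_Collect_finite_All I) (simp add: borel_measurable_iff_le)
  then show ?thesis by (simp add: cyl_def)
qed

text \<open>All coordinates are measurable for the sigma-algebra of the cylinders, so
  \<open>measurable_sobolev_borel\<close> makes the identity measurable into H^m; this is the
  substantial inclusion.\<close>

lemma sets_sobolev_borel_cyls: "sets (sobolev_borel m) = sigma_sets (hom_sobolev m) (cyls m)"
proof
  show "sigma_sets (hom_sobolev m) (cyls m) \<subseteq> sets (sobolev_borel m)"
    using sets.sigma_sets_subset[of "cyls m" "sobolev_borel m"] measurable_cyl by (auto simp: cyls_def)
  let ?S = "sigma (hom_sobolev m) (cyls m)"
  have sp: "space ?S = hom_sobolev m" and se: "sets ?S = sigma_sets (hom_sobolev m) (cyls m)"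
    using cyls_subset by (auto simp: space_measure_of sets_measure_of)
  have id: "(\<lambda>u. u) \<in> ?S \<rightarrow>\<^sub>M sobolev_borel m"
  proof (rule measurable_sobolev_borel)
    fix k :: int assume k: "k \<noteq> 0"
    show "(\<lambda>u. coord u k) \<in> borel_measurable ?S"
      unfolding borel_measurable_iff_le sp
    proof
      fix a
      have "{u \<in> hom_sobolev m. coord u k \<le> a} = cyl m {k} (\<lambda>_. a)" by (auto simp: cyl_def)
      also have "\<dots> \<in> cyls m" unfolding cyls_def using k by blast
      finally show "{u \<in> hom_sobolev m. coord u k \<le> a} \<in> sets ?S" unfolding se by (rule sigma_sets.Basic)
    qed
  qed (simp add: sp)
  show "sets (sobolev_borel m) \<subseteq> sigma_sets (hom_sobolev m) (cyls m)"
  proof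
    fix A assume A: "A \<in> sets (sobolev_borel m)"
    then have "A \<inter> hom_sobolev m = A" using sets.sets_into_space[OF A] by auto
    then show "A \<in> sigma_sets (hom_sobolev m) (cyls m)" using measurable_sets[OF id A] by (simp add: sp se)
  qed
qed

text \<open>L^2-continuous functions that tend to the indicator of a cylinder; they link the test
  functions with a generator of the Borel sets.\<close>

definition soft_cyl :: "int set \<Rightarrow> (int \<Rightarrow> real) \<Rightarrow> nat \<Rightarrow> l2_circle \<Rightarrow> real" where
  "soft_cyl I c j u = (\<Prod>k\<in>I. max 0 (1 - real j * max 0 (coord u k - c k)))"

lemma test_fun_soft_cyl: "test_fun m (soft_cyl I c j)"
  unfolding test_fun_def soft_cyl_def
  by (intro conjI ballI prod_nonneg prod_le_1 continuous_intros) auto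

lemma soft_cyl_tendsto:
  assumes "u \<in> hom_sobolev m" "finite I"
  shows "(\<lambda>j. soft_cyl I c j u) \<longlonglongrightarrow> indicat_real (cyl m I c) u"
proof -
  have "(\<lambda>j. max 0 (1 - real j * max 0 (coord u k - c k))) \<longlonglongrightarrow> (if coord u k \<le> c k then 1 else 0)" for k
  proof (cases "coord u k \<le> c k")
    case False
    define \<delta> where "\<delta> = coord u k - c k"
    have d: "\<delta> > 0" using False by (simp add: \<delta>_def)
    obtain N :: nat where N: "1 / \<delta> < real N" using reals_Archimedean2 by blast
    have "\<forall>\<^sub>F j in sequentially. max 0 (1 - real j * max 0 \<delta>) = 0"
      using eventually_ge_at_top[of N]
    proof eventually_elim
      case (elim j)
      then have "1 / \<delta> < real j" using N by linarith
      then show ?case using d by (simp add: field_simps max_def)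
    qed
    then show ?thesis using False by (simp add: \<delta>_def[symmetric] tendsto_eventually)
  qed simp
  then have "(\<lambda>j. soft_cyl I c j u) \<longlonglongrightarrow> (\<Prod>k\<in>I. if coord u k \<le> c k then 1 else 0)"
    unfolding soft_cyl_def by (intro tendsto_prod)
  also have "(\<Prod>k\<in>I. if coord u k \<le> c k then 1 else 0) = indicat_real (cyl m I c) u"
    using assms by (auto simp: cyl_def indicator_def intro: prod.neutral prod_zero)
  finally show ?thesis .
qed

section \<open>Time averages and their limit\<close>

lemma sum_shift_bound:
  fixes a :: "nat \<Rightarrow> real"
  assumes "\<And>j. 0 \<le> a j \<and> a j \<le> 1"
  shows "\<bar>(\<Sum>j<N. a (j + i)) - (\<Sum>j<N. a j)\<bar> \<le> real i"
proof (induction i)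
  case (Suc i)
  have "(\<Sum>j<N. a (j + Suc i)) - (\<Sum>j<N. a (j + i)) = a (N + i) - a i"
    using sum_lessThan_telescope[of "\<lambda>j. a (j + i)" N] by (simp add: sum_subtractf)
  then show ?case using Suc assms[of "N + i"] assms[of i] by linarith
qed simp

context solution_space
begin

text \<open>Krylov--Bogoliubov averages over dyadic times: advancing by a dyadic \<open>t\<close> shifts the index.\<close>

definition "avg n = measure_pmf (pmf_of_set {..<(4::nat) ^ n}) \<Otimes>\<^sub>M M"

definition "avgY n = (\<lambda>(j, \<omega>). W 0 (real j / 2 ^ n) \<omega>)"

lemma prob_space_avg: "prob_space (avg n)"
proof -
  interpret pair_prob_space "measure_pmf (pmf_of_set {..<(4::nat) ^ n})" M ..
  show ?thesis unfolding avg_def by unfold_locales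
qed

text \<open>The time index is countable, so measurability of \<open>W 0 t\<close> at each fixed time
  yields joint measurability.\<close>

lemma measurable_avgY: "avgY n \<in> avg n \<rightarrow>\<^sub>M sobolev_borel m"
proof -
  have "avgY n \<in> count_space UNIV \<Otimes>\<^sub>M M \<rightarrow>\<^sub>M sobolev_borel m"
    by (rule measurable_pair_measure_countable1) (auto simp: avgY_def intro!: W_measurable hom_sobolev_zero)
  moreover have "sets (avg n) = sets (count_space UNIV \<Otimes>\<^sub>M M)"
    unfolding avg_def by (intro sets_pair_measure_cong) auto
  ultimately show ?thesis by (simp cong: measurable_cong_sets)
qed

lemma finite_dyadic: "{..<(4::nat) ^ n} \<noteq> {}" "finite {..<(4::nat) ^ n}"
  by (simp_all add: lessThan_empty_iff)

lemma integral_avg: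
  assumes f: "test_fun m f"
  shows "(\<integral>x. f (avgY n x) \<partial>avg n) = (\<Sum>j<4 ^ n. P (real j / 2 ^ n) f 0) / 4 ^ n"
proof -
  interpret pair_prob_space "measure_pmf (pmf_of_set {..<(4::nat) ^ n})" M ..
  interpret A: prob_space "avg n" by (rule prob_space_avg)
  have "integrable (avg n) (\<lambda>x. f (avgY n x))"
  proof (rule A.integrable_const_bound[where B = 1])
    show "AE x in avg n. norm (f (avgY n x)) \<le> 1"
      using measurable_space[OF measurable_avgY] f by (intro AE_I2) (auto simp: test_fun_def)
  qed (rule measurable_compose[OF measurable_avgY test_fun_measurable[OF f]])
  from integral_fst'[OF this[unfolded avg_def]] show ?thesis
    unfolding avg_def[symmetric]
    by (simp add: avgY_def transition_semigroup_def[symmetric] integral_pmf_of_set[OF finite_dyadic])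
qed

lemma moment_avg:
  assumes "\<And>t. t \<ge> 0 \<Longrightarrow> (\<integral>\<^sup>+\<omega>. sobolev_norm_sq (m + 1) (W 0 t \<omega>) \<partial>M) \<le> ennreal C"
  shows "(\<integral>\<^sup>+x. sobolev_norm_sq (m + 1) (avgY n x) \<partial>avg n) \<le> ennreal C"
proof -
  let ?p = "measure_pmf (pmf_of_set {..<(4::nat) ^ n})"
  have "(\<lambda>x. sobolev_norm_sq (m + 1) (avgY n x)) \<in> borel_measurable (avg n)"
    by (intro sobolev_norm_measurable measurable_compose[OF measurable_avgY measurable_coord])
  then have "(\<integral>\<^sup>+x. sobolev_norm_sq (m + 1) (avgY n x) \<partial>avg n)
     = (\<integral>\<^sup>+j. \<integral>\<^sup>+\<omega>. sobolev_norm_sq (m + 1) (avgY n (j, \<omega>)) \<partial>M \<partial>?p)"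
    unfolding avg_def by (rule nn_integral_fst[symmetric])
  also have "\<dots> \<le> (\<integral>\<^sup>+j. ennreal C \<partial>?p)"
    by (intro nn_integral_mono) (simp add: avgY_def assms)
  finally show ?thesis by simp
qed

text \<open>By the Feller property \<open>P t f\<close> is itself a test function, so both sides
  pass to the weak limit. Invariance comes first for dyadic times and then for all times by
  continuity of \<open>P t f y\<close> in \<open>t\<close>.\<close>

lemma invariant_test:
  obtains N :: "real measure" and Z C where "prob_space N" "Z \<in> N \<rightarrow>\<^sub>M sobolev_borel m"
    "(\<integral>\<^sup>+x. sobolev_norm_sq (m + 1) (Z x) \<partial>N) \<le> ennreal C"
    "\<And>f t. test_fun m f \<Longrightarrow> t \<ge> 0 \<Longrightarrow> (\<integral>x. P t f (Z x) \<partial>N) = (\<integral>x. f (Z x) \<partial>N)"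
proof -
  obtain C where C: "\<And>t. t \<ge> 0 \<Longrightarrow> (\<integral>\<^sup>+\<omega>. sobolev_norm_sq (m + 1) (W 0 t \<omega>) \<partial>M) \<le> ennreal C"
    using moment_bound by blast
  have w: "1 \<le> m + 1" "m \<le> m + 1" by auto
  have C': "(\<integral>\<^sup>+x. sobolev_norm_sq (m + 1) (avgY n x) \<partial>avg n) \<le> ennreal C" for n by (rule moment_avg[OF C])
  obtain N :: "real measure" and Z r where r: "strict_mono (r :: nat \<Rightarrow> nat)" and N: "prob_space N"
    and Z: "Z \<in> N \<rightarrow>\<^sub>M sobolev_borel m" and CZ: "(\<integral>\<^sup>+x. sobolev_norm_sq (m + 1) (Z x) \<partial>N) \<le> ennreal C"
    and lim: "\<And>f. test_fun m f \<Longrightarrow> (\<lambda>n. \<integral>x. f (avgY (r n) x) \<partial>avg (r n)) \<longlonglongrightarrow> (\<integral>x. f (Z x) \<partial>N)"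
    by (rule weak_compactness[where Q = avg and Y = avgY, OF prob_space_avg measurable_avgY w C']) blast
  have ZH: "Z x \<in> hom_sobolev m" if "x \<in> space N" for x using measurable_space[OF Z that] by simp
  note z = hom_sobolev_zero[of m]
  have dyadic: "(\<integral>x. P (real p / 2 ^ q) f (Z x) \<partial>N) = (\<integral>x. f (Z x) \<partial>N)" if f: "test_fun m f" for f p q
  proof -
    define t where "t = real p / 2 ^ q"
    have t: "t \<ge> 0" by (simp add: t_def)
    have b: "\<bar>(\<integral>x. P t f (avgY n x) \<partial>avg n) - (\<integral>x. f (avgY n x) \<partial>avg n)\<bar> \<le> real p * (1 / 2) ^ n" if n: "n \<ge> q" for n
    proof -
      \<comment> \<open>Advancing by p/2^q means \<open>i\<close> grid points of width 2^(-n). Over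
        the 4^n points of the grid this changes the average by at most i/4^n, hence by at most
        p/2^n.\<close>
      define i where "i = p * 2 ^ (n - q)"
      have "(2::real) ^ n = 2 ^ q * 2 ^ (n - q)" using n by (simp flip: power_add)
      then have ti: "t = real i / 2 ^ n" by (simp add: t_def i_def)
      have "P (real j / 2 ^ n) (P t f) 0 = P (real (j + i) / 2 ^ n) f 0" for j
        using markov[OF f z _ t, of "real j / 2 ^ n"] by (simp add: ti add_divide_distrib)
      then have "(\<integral>x. P t f (avgY n x) \<partial>avg n) - (\<integral>x. f (avgY n x) \<partial>avg n)
         = ((\<Sum>j<4 ^ n. P (real (j + i) / 2 ^ n) f 0) - (\<Sum>j<4 ^ n. P (real j / 2 ^ n) f 0)) / 4 ^ n"
        unfolding integral_avg[OF f] integral_avg[OF P_feller[OF f t]] by (simp add: diff_divide_distrib)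
      moreover have "\<bar>(\<Sum>j<4 ^ n. P (real (j + i) / 2 ^ n) f 0) - (\<Sum>j<4 ^ n. P (real j / 2 ^ n) f 0)\<bar> \<le> real i"
        by (rule sum_shift_bound) (use P_eq(3,4)[OF f z] in auto)
      ultimately have "\<bar>(\<integral>x. P t f (avgY n x) \<partial>avg n) - (\<integral>x. f (avgY n x) \<partial>avg n)\<bar> \<le> real i / 4 ^ n"
        by (simp add: abs_divide divide_right_mono)
      also have "\<dots> \<le> real p * 2 ^ n / 4 ^ n"
        unfolding i_def by (intro divide_right_mono) (auto intro!: mult_left_mono power_increasing)
      also have "\<dots> = real p * (2 / 4) ^ n" by (simp only: power_divide times_divide_eq_right)
      also have "(2 / 4 :: real) = 1 / 2" by simp
      finally show ?thesis .
    qed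
    have "(\<lambda>n. (\<integral>x. P t f (avgY (r n) x) \<partial>avg (r n)) - (\<integral>x. f (avgY (r n) x) \<partial>avg (r n))) \<longlonglongrightarrow> 0"
    proof (rule Lim_null_comparison)
      show "\<forall>\<^sub>F n in sequentially. norm ((\<integral>x. P t f (avgY (r n) x) \<partial>avg (r n)) - (\<integral>x. f (avgY (r n) x) \<partial>avg (r n))) \<le> real p * (1 / 2) ^ r n"
        using eventually_ge_at_top[of q]
      proof eventually_elim
        case (elim n)
        then show ?case using b[of "r n"] seq_suble[OF r, of n] by simp
      qed
      have "(\<lambda>n. (1 / 2 :: real) ^ r n) \<longlonglongrightarrow> 0"
        using LIMSEQ_subseq_LIMSEQ[OF LIMSEQ_realpow_zero[of "1 / 2 :: real"] r] by (simp add: o_def)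
      then show "(\<lambda>n. real p * (1 / 2) ^ r n) \<longlonglongrightarrow> 0" by (rule tendsto_mult_right_zero)
    qed
    moreover have "(\<lambda>n. (\<integral>x. P t f (avgY (r n) x) \<partial>avg (r n)) - (\<integral>x. f (avgY (r n) x) \<partial>avg (r n)))
       \<longlonglongrightarrow> (\<integral>x. P t f (Z x) \<partial>N) - (\<integral>x. f (Z x) \<partial>N)"
      by (intro tendsto_diff lim P_feller f t)
    ultimately have "(\<integral>x. P t f (Z x) \<partial>N) - (\<integral>x. f (Z x) \<partial>N) = 0" by (rule LIMSEQ_unique[rotated])
    then show ?thesis unfolding t_def by simp
  qed
  show thesis
  proof (rule that[OF N Z CZ])
    interpret N: prob_space N by (rule N)
    fix f t assume f: "test_fun m f" and t: "(0::real) \<le> t"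
    define \<tau> where "\<tau> n = real (nat \<lfloor>2 ^ n * t\<rfloor>) / 2 ^ n" for n :: nat
    have tau: "\<tau> \<longlonglongrightarrow> t" unfolding \<tau>_def using dyadic_tendsto[of t] t by simp
    have tau0: "\<tau> n \<ge> 0" for n by (simp add: \<tau>_def)
    have "(\<lambda>n. \<integral>x. P (\<tau> n) f (Z x) \<partial>N) \<longlonglongrightarrow> (\<integral>x. P t f (Z x) \<partial>N)"
    proof (rule integral_dominated_convergence[where w = "\<lambda>_. 1"])
      show "(\<lambda>x. P t f (Z x)) \<in> borel_measurable N" "(\<lambda>x. P (\<tau> n) f (Z x)) \<in> borel_measurable N" for n
        by (intro measurable_compose[OF Z test_fun_measurable] P_feller f t tau0)+
      show "AE x in N. (\<lambda>n. P (\<tau> n) f (Z x)) \<longlonglongrightarrow> P t f (Z x)"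
        by (intro AE_I2 P_time_continuous f ZH tau0 t tau)
      show "AE x in N. norm (P (\<tau> n) f (Z x)) \<le> 1" for n
        using P_eq(3,4)[OF f ZH tau0] by (intro AE_I2) simp
    qed simp
    then show "(\<integral>x. P t f (Z x) \<partial>N) = (\<integral>x. f (Z x) \<partial>N)"
      unfolding \<tau>_def dyadic[OF f] by (simp add: LIMSEQ_const_iff)
  qed
qed

text \<open>Invariance passes from test functions to bounded Borel functions through an identity of
  measures: \<open>\<mu>\<close> and its image under the kernel agree on cylinders, which are stable
  under intersection and generate.\<close>

lemma invariant_measure_exists:
  "\<exists>\<mu>. invariant_measure m P \<mu> \<and> (\<integral>\<^sup>+y. sobolev_norm_sq (m + 1) y \<partial>\<mu>) < \<infinity>"
proof -
  let ?S = "sobolev_borel m"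
  obtain N :: "real measure" and Z C where N: "prob_space N" and Z: "Z \<in> N \<rightarrow>\<^sub>M ?S"
    and CZ: "(\<integral>\<^sup>+x. sobolev_norm_sq (m + 1) (Z x) \<partial>N) \<le> ennreal C"
    and inv: "\<And>f t. test_fun m f \<Longrightarrow> t \<ge> 0 \<Longrightarrow> (\<integral>x. P t f (Z x) \<partial>N) = (\<integral>x. f (Z x) \<partial>N)"
    using invariant_test by blast
  interpret N: prob_space N by (rule N)
  define \<mu> where "\<mu> = distr N ?S Z"
  have sets_mu[simp, measurable_cong]: "sets \<mu> = sets ?S" by (simp add: \<mu>_def)
  have space_mu[simp]: "space \<mu> = hom_sobolev m" by (simp add: \<mu>_def)
  interpret mu: prob_space \<mu> unfolding \<mu>_def by (rule N.prob_space_distr[OF Z])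
  have inv: "(\<integral>y. P t f y \<partial>\<mu>) = (\<integral>y. f y \<partial>\<mu>)" if f: "test_fun m f" and t: "t \<ge> 0" for f t
    unfolding \<mu>_def using inv[OF f t] test_fun_measurable[OF f] test_fun_measurable[OF P_feller[OF f t]]
    by (simp add: integral_distr[OF Z])
  have main: "integrable \<mu> (P t f) \<and> (\<integral>y. P t f y \<partial>\<mu>) = (\<integral>y. f y \<partial>\<mu>)"
    if t: "t \<ge> 0" and f: "f \<in> borel_measurable ?S" and bd: "bounded (f ` hom_sobolev m)" for t f
  proof -
    \<comment> \<open>The transition kernel. Its measurability in the starting point is derived from
      cylinder probabilities, which are limits of \<open>P t\<close> applied to soft cylinders and
      hence of continuous functions.\<close>
    define K where "K y = distr M ?S (W y t)" for y
    have Wm: "W y t \<in> M \<rightarrow>\<^sub>M ?S" if "y \<in> hom_sobolev m" for y by (rule W_measurable[OF that t])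
    have Kprob: "prob_space (K y)" if "y \<in> hom_sobolev m" for y
      unfolding K_def by (rule prob_space_distr[OF Wm[OF that]])
    have lim: "(\<lambda>j. P t (soft_cyl I c j) y) \<longlonglongrightarrow> measure (K y) (cyl m I c)"
      if y: "y \<in> hom_sobolev m" and I: "finite I" for I c y
    proof -
      have "(\<lambda>j. \<integral>\<omega>. soft_cyl I c j (W y t \<omega>) \<partial>M) \<longlonglongrightarrow> (\<integral>\<omega>. indicat_real (cyl m I c) (W y t \<omega>) \<partial>M)"
      proof (rule integral_dominated_convergence[where w = "\<lambda>_. 1"])
        show "(\<lambda>\<omega>. indicat_real (cyl m I c) (W y t \<omega>)) \<in> borel_measurable M"
          by (rule measurable_compose[OF Wm[OF y] borel_measurable_indicator[OF measurable_cyl[OF I]]])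
        show "(\<lambda>\<omega>. soft_cyl I c j (W y t \<omega>)) \<in> borel_measurable M" for j
          by (rule measurable_compose[OF Wm[OF y] test_fun_measurable[OF test_fun_soft_cyl]])
        show "AE \<omega> in M. (\<lambda>j. soft_cyl I c j (W y t \<omega>)) \<longlonglongrightarrow> indicat_real (cyl m I c) (W y t \<omega>)"
          by (intro AE_I2 soft_cyl_tendsto W_hom y t I)
        show "AE \<omega> in M. norm (soft_cyl I c j (W y t \<omega>)) \<le> 1" for j
          using test_fun_soft_cyl[of m I c j] W_hom[OF y t] by (intro AE_I2) (auto simp: test_fun_def)
      qed simp
      also have "(\<integral>\<omega>. indicat_real (cyl m I c) (W y t \<omega>) \<partial>M) = (\<integral>u. indicat_real (cyl m I c) u \<partial>K y)"
        unfolding K_def by (rule integral_distr[symmetric, OF Wm[OF y] borel_measurable_indicator[OF measurable_cyl[OF I]]])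
      also have "\<dots> = measure (K y) (cyl m I c)"
        using measurable_cyl[OF I, of m c] sets.sets_into_space[OF measurable_cyl[OF I, of m c]] by (simp add: K_def Int_absorb2)
      finally show ?thesis by (simp add: transition_semigroup_def)
    qed
    have Kbox: "(\<lambda>y. measure (K y) (cyl m I c)) \<in> borel_measurable ?S" if I: "finite I" for I c
      by (rule borel_measurable_LIMSEQ_real[OF lim[OF _ I] test_fun_measurable[OF P_feller[OF test_fun_soft_cyl t]]]) simp
    have Ke: "emeasure (K y) A = ennreal (measure (K y) A)" if "y \<in> hom_sobolev m" for y A
    proof -
      interpret k: prob_space "K y" by (rule Kprob[OF that])
      show ?thesis by (rule k.emeasure_eq_measure)
    qed
    have Km: "K \<in> ?S \<rightarrow>\<^sub>M prob_algebra ?S"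
    proof (rule measurable_prob_algebra_generated[OF sets_sobolev_borel_cyls Int_stable_cyls cyls_subset])
      show "(\<lambda>a. emeasure (K a) A) \<in> borel_measurable ?S" if A: "A \<in> cyls m" for A
      proof -
        have "(\<lambda>a. ennreal (measure (K a) A)) \<in> borel_measurable ?S"
          using A Kbox by (auto simp: cyls_def)
        then show ?thesis by (rule measurable_cong[THEN iffD2, rotated]) (simp add: Ke)
      qed
      show "prob_space (K a)" if "a \<in> space ?S" for a using that by (simp add: Kprob)
    qed (simp add: K_def)
    have Km': "K \<in> \<mu> \<rightarrow>\<^sub>M subprob_algebra ?S"
      using measurable_prob_algebraD[OF Km] by (simp cong: measurable_cong_sets)
    define B where "B = \<mu> \<bind> K"
    have "B = \<mu>"
    proof (rule measure_eqI_generator_eq[OF Int_stable_cyls cyls_subset])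
      show "sets B = sigma_sets (hom_sobolev m) (cyls m)"
        unfolding B_def by (subst sets_bind[where N = ?S]) (auto simp: K_def sets_sobolev_borel_cyls mu.not_empty[simplified])
      show "sets \<mu> = sigma_sets (hom_sobolev m) (cyls m)" by (simp add: sets_sobolev_borel_cyls)
      show "range (\<lambda>i::nat. hom_sobolev m) \<subseteq> cyls m" using cyl_empty[of m] by (auto simp: cyls_def)
      show "emeasure B X = emeasure \<mu> X" if X: "X \<in> cyls m" for X
      proof -
        obtain I c where X: "X = cyl m I c" "finite I" using X by (auto simp: cyls_def)
        have Xs: "X \<in> sets ?S" unfolding X by (rule measurable_cyl[OF X(2)])
        have bdd: "norm (measure (K y) X) \<le> 1" if "y \<in> hom_sobolev m" for y
          using prob_space.prob_le_1[OF Kprob[OF that], of X] by simp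
        have i: "integrable \<mu> (\<lambda>y. measure (K y) X)"
          by (rule mu.integrable_const_bound[where B = 1])
            (use bdd Kbox[OF X(2)] in \<open>auto simp: X(1) cong: measurable_cong_sets\<close>)
        have "(\<lambda>j. \<integral>y. P t (soft_cyl I c j) y \<partial>\<mu>) \<longlonglongrightarrow> (\<integral>y. measure (K y) X \<partial>\<mu>)"
        proof (rule integral_dominated_convergence[where w = "\<lambda>_. 1"])
          show "AE y in \<mu>. (\<lambda>j. P t (soft_cyl I c j) y) \<longlonglongrightarrow> measure (K y) X"
            unfolding X(1) by (intro AE_I2 lim X) simp
          show "AE y in \<mu>. norm (P t (soft_cyl I c j) y) \<le> 1" for j
            using P_eq(3,4)[OF test_fun_soft_cyl _ t] by (intro AE_I2) simp
          show "P t (soft_cyl I c j) \<in> borel_measurable \<mu>" for j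
            using test_fun_measurable[OF P_feller[OF test_fun_soft_cyl t]] by (simp cong: measurable_cong_sets)
        qed (use i in auto)
        moreover have "(\<lambda>j. \<integral>y. soft_cyl I c j y \<partial>\<mu>) \<longlonglongrightarrow> (\<integral>y. indicat_real X y \<partial>\<mu>)"
        proof (rule integral_dominated_convergence[where w = "\<lambda>_. 1"])
          show "AE y in \<mu>. (\<lambda>j. soft_cyl I c j y) \<longlonglongrightarrow> indicat_real X y"
            unfolding X(1) by (intro AE_I2 soft_cyl_tendsto X) simp
          show "AE y in \<mu>. norm (soft_cyl I c j y) \<le> 1" for j
            using test_fun_soft_cyl[of m I c j] by (intro AE_I2) (auto simp: test_fun_def)
          show "soft_cyl I c j \<in> borel_measurable \<mu>" for j
            using test_fun_measurable[OF test_fun_soft_cyl[of m I c j]] by (simp cong: measurable_cong_sets)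
          show "indicat_real X \<in> borel_measurable \<mu>" using Xs by simp
        qed simp
        ultimately have eq: "(\<integral>y. measure (K y) X \<partial>\<mu>) = (\<integral>y. indicat_real X y \<partial>\<mu>)"
          unfolding inv[OF test_fun_soft_cyl t] by (rule LIMSEQ_unique)
        have "emeasure B X = (\<integral>\<^sup>+y. emeasure (K y) X \<partial>\<mu>)"
          unfolding B_def by (rule emeasure_bind[OF _ Km' Xs]) (simp add: mu.not_empty[simplified])
        also have "\<dots> = (\<integral>\<^sup>+y. ennreal (measure (K y) X) \<partial>\<mu>)"
          by (intro nn_integral_cong) (simp add: Ke)
        also have "\<dots> = ennreal (\<integral>y. measure (K y) X \<partial>\<mu>)"
          by (rule nn_integral_eq_integral[OF i]) simp
        also have "\<dots> = emeasure \<mu> X"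
          unfolding eq using Xs sets.sets_into_space[of X \<mu>] by (simp add: mu.emeasure_eq_measure Int_absorb2)
        finally show ?thesis .
      qed
      show "emeasure B (hom_sobolev m) \<noteq> \<infinity>" for i :: nat
      proof -
        have "emeasure B (hom_sobolev m) = (\<integral>\<^sup>+y. emeasure (K y) (hom_sobolev m) \<partial>\<mu>)"
          unfolding B_def using sets.top[of ?S] by (intro emeasure_bind[OF _ Km']) (simp_all add: mu.not_empty[simplified])
        also have "\<dots> \<le> (\<integral>\<^sup>+y. 1 \<partial>\<mu>)"
          using prob_space.measure_le_1[OF Kprob] by (intro nn_integral_mono) simp
        finally show ?thesis by (auto simp: mu.emeasure_space_1[simplified] top_unique)
      qed
    qed simp
    obtain c where c: "\<And>u. u \<in> hom_sobolev m \<Longrightarrow> \<bar>f u\<bar> \<le> c" using bd by (auto simp: bounded_iff)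
    have Pf: "P t f y = (\<integral>u. f u \<partial>K y)" if "y \<in> hom_sobolev m" for y
      unfolding transition_semigroup_def K_def by (rule integral_distr[symmetric, OF Wm[OF that] f])
    have Ki: "integrable (K y) f" if y: "y \<in> hom_sobolev m" for y
    proof -
      interpret k: prob_space "K y" by (rule Kprob[OF y])
      show ?thesis
        by (rule k.integrable_const_bound[where B = c]) (use c f in \<open>auto simp: K_def intro!: AE_I2\<close>)
    qed
    have Pb: "\<bar>P t f y\<bar> \<le> c" if y: "y \<in> hom_sobolev m" for y
    proof -
      interpret k: prob_space "K y" by (rule Kprob[OF y])
      have "\<bar>\<integral>u. f u \<partial>K y\<bar> \<le> (\<integral>u. \<bar>f u\<bar> \<partial>K y)" by (rule integral_abs_bound)
      also have "\<dots> \<le> (\<integral>u. c \<partial>K y)"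
      proof (rule integral_mono)
        show "integrable (K y) (\<lambda>u. \<bar>f u\<bar>)" by (intro integrable_abs Ki y)
        show "\<bar>f u\<bar> \<le> c" if "u \<in> space (K y)" for u using that c by (simp add: K_def)
      qed (rule k.integrable_const)
      also have "\<dots> = c" by (simp add: k.prob_space[simplified])
      finally show ?thesis by (simp add: Pf[OF y])
    qed
    have "(\<lambda>y. \<integral>u. f u \<partial>K y) \<in> borel_measurable ?S"
      by (rule measurable_compose[OF measurable_prob_algebraD[OF Km] integral_measurable_subprob_algebra[OF f]])
    then have "P t f \<in> borel_measurable ?S"
      by (rule measurable_cong[THEN iffD2, rotated]) (simp add: Pf)
    then have Pm: "P t f \<in> borel_measurable \<mu>" by (simp cong: measurable_cong_sets)
    have Pi: "integrable \<mu> (P t f)"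
      by (rule mu.integrable_const_bound[where B = c]) (use Pb Pm in \<open>auto intro!: AE_I2\<close>)
    have fi: "integrable \<mu> f"
      by (rule mu.integrable_const_bound[where B = c]) (use c f in \<open>auto intro!: AE_I2 cong: measurable_cong_sets\<close>)
    have fc: "(\<lambda>u. ennreal (f u + c)) \<in> borel_measurable ?S" using f by measurable
    \<comment> \<open>Adding the bound \<open>c\<close> makes the integrand nonnegative, so that
      \<open>nn_integral_bind\<close> can split the integral against \<open>B\<close>.\<close>
    have "ennreal ((\<integral>y. f y \<partial>\<mu>) + c) = (\<integral>\<^sup>+u. ennreal (f u + c) \<partial>\<mu>)"
      using fi c by (subst nn_integral_eq_integral) (auto simp: mu.prob_space[simplified] abs_le_iff intro!: AE_I2 dest!: c)
    also have "\<dots> = (\<integral>\<^sup>+u. ennreal (f u + c) \<partial>B)" by (simp only: \<open>B = \<mu>\<close>)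
    also have "\<dots> = (\<integral>\<^sup>+y. \<integral>\<^sup>+u. ennreal (f u + c) \<partial>K y \<partial>\<mu>)"
      unfolding B_def by (rule nn_integral_bind[OF fc Km'])
    also have "\<dots> = (\<integral>\<^sup>+y. ennreal (P t f y + c) \<partial>\<mu>)"
    proof (rule nn_integral_cong)
      fix y assume "y \<in> space \<mu>"
      then have y: "y \<in> hom_sobolev m" by simp
      interpret k: prob_space "K y" by (rule Kprob[OF y])
      have "AE u in K y. 0 \<le> f u + c" using c by (intro AE_I2) (force simp: K_def)
      then show "(\<integral>\<^sup>+u. ennreal (f u + c) \<partial>K y) = ennreal (P t f y + c)"
        using Ki[OF y] by (subst nn_integral_eq_integral) (auto simp: Pf[OF y] k.prob_space)
    qed
    also have "\<dots> = ennreal ((\<integral>y. P t f y \<partial>\<mu>) + c)"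
    proof -
      have "AE y in \<mu>. 0 \<le> P t f y + c" using Pb by (intro AE_I2) force
      then show ?thesis using Pi by (subst nn_integral_eq_integral) (auto simp: mu.prob_space[simplified])
    qed
    finally have eq: "ennreal ((\<integral>y. f y \<partial>\<mu>) + c) = ennreal ((\<integral>y. P t f y \<partial>\<mu>) + c)" .
    have "0 \<le> (\<integral>y. f y + c \<partial>\<mu>)" "0 \<le> (\<integral>y. P t f y + c \<partial>\<mu>)"
      using c Pb by (auto intro!: integral_nonneg_AE AE_I2) force+
    then have "(\<integral>y. P t f y \<partial>\<mu>) = (\<integral>y. f y \<partial>\<mu>)"
      using eq fi Pi by (simp add: mu.prob_space[simplified])
    then show ?thesis using Pi by simp
  qed
  have "sobolev_norm_sq (m + 1) \<in> borel_measurable ?S"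
    using sobolev_norm_measurable[of "\<lambda>u. u"] measurable_coord by simp
  then have "(\<integral>\<^sup>+y. sobolev_norm_sq (m + 1) y \<partial>\<mu>) = (\<integral>\<^sup>+x. sobolev_norm_sq (m + 1) (Z x) \<partial>N)"
    unfolding \<mu>_def by (intro nn_integral_distr[OF Z]) simp
  also have "\<dots> < \<infinity>" using CZ by (auto intro: order_le_less_trans)
  finally show ?thesis
    unfolding invariant_measure_def using main mu.prob_space_axioms by (intro exI[of _ \<mu>]) simp
qed

end

theorem theorem3p2:
  fixes m m_star :: nat
    and a \<nu> :: real
    and \<omega>0 :: l2_circle
    and M :: "'w measure"
    and F :: "real \<Rightarrow> 'w measure"
    and \<beta> :: "int \<Rightarrow> real \<Rightarrow> 'w \<Rightarrow> real"
    and b :: "int \<Rightarrow> real"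
    and W :: "l2_circle \<Rightarrow> real \<Rightarrow> 'w \<Rightarrow> l2_circle"
  assumes "m \<ge> 1" and "a = -2" and "\<nu> > 0" and "\<omega>0 \<in> hom_sobolev m"
    and "m_star > m" and "noise_strength m_star b < \<infinity>"
    and "filtered_prob_space M F" and "brownian_family M F \<beta>"
    and "\<forall>y\<in>hom_sobolev m. adapted_global_solution M F a \<nu> (noise b \<beta>) m y (W y)"
  shows "\<exists>\<mu>. invariant_measure m (transition_semigroup M W) \<mu> \<and>
           (\<integral>\<^sup>+y. sobolev_norm_sq (m + 1) y \<partial>\<mu>) < \<infinity>"
proof -
  have "prob_space M" using assms(7) by (simp add: filtered_prob_space_def)
  then interpret prob_space M .
  interpret solution_space M F \<beta> b m_star \<nu> m W
    by unfold_locales (use assms in auto)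
  show ?thesis by (rule invariant_measure_exists)
qed

end
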